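(* Let $X$ be a Banach space with a shrinking unconditional basis $(e_j)$ such that one of the following holds: (i) $X$ is an asymptotic $\ell_p$-space for some $1\le p<\infty$ with $p\neq2$; or (ii) every spreading model of a block basic sequence of $(e_j)$ is isomorphic to $c_0$. Then, up to isomorphism, the only spreading models of the twisted Hilbert space $Z(X)$ are the Hilbert space $\ell_2$ and the Orlicz space $\ell_M$.
   Context: Spaces are infinite-dimensional Banach spaces over $\mathbb C$. $\omega$ is the space of all complex sequences with pointwise convergence. For finitely supported $x,y$, $x<y$ means $\max\operatorname{supp}x<\min\operatorname{supp}y$, and $n<x$ means $n<\min\operatorname{supp}x$. A space $X$ with an unconditional basis $(e_j)$ is regarded as a sequence space in $\omega$ through its basis, and $X^*$ as a sequence space through $x^*\mapsto (x^*(e_j))_j$. Asymptotic $\ell_p$-space: there is $C>0$ such that for every $n\in\mathbb N$ and all normalized blocks $n<u_1<\dots<u_n$ of the basis, $(u_j)_{j=1}^n$ is $C$-equivalent to the unit vector basis of $\ell_p^n$. Spreading model: let $(x_j)$ be a bounded sequence in a Banach space $Y$ without convergent subsequences. By Brunel and Sucheston there is a subsequence $(x'_j)$ such that for all $n$ and scalars $a_1,\dots,a_n$ there is a number $L(a_1,\dots,a_n)$ with: for every $\varepsilon>0$ there is $\nu$ with $\big|\,\|\sum_{j=1}^n a_jx'_{k_j}\|-L(a_1,\dots,a_n)\big|<\varepsilon$ whenever $\nu\le k_1<\dots<k_n$. The completion of $c_{00}$ (finitely supported sequences) under the norm $\|\sum_{j=1}^n a_je_j\|:=L(a_1,\dots,a_n)$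 is a spreading model of $Y$ (generated by $(x_j)$). The space $Z(X)$. Let $\mathbb S=\{z\in\mathbb C:0\le \operatorname{Re}z\le 1\}$. $\mathcal F_\infty(X,X^* )$ is the space of functions $F:\mathbb S\to\omega$, bounded and continuous on $\mathbb S$, analytic in its interior, such that $t\mapsto F(it)\in X$ and $t\mapsto F(1+it)\in X^*$ are bounded and continuous, with norm $\max(\sup_t\|F(it)\|_X,\sup_t\|F(1+it)\|_{X^*})$. The interpolation space $(X,X^* )_{1/2}=\{F(1/2):F\in\mathcal F_\infty(X,X^* )\}$ with the quotient norm equals $\ell_2$ up to an equivalent norm. Fix a homogeneous selection $x\in\ell_2\mapsto B(x)\in\mathcal F_\infty(X,X^* )$ with $B(x)(1/2)=x$ and $\|B(x)\|\le C\|x\|_2$, and put $\Omega(x)=B(x)'(1/2)\in\omega$. Then $Z(X)=\{(x,y)\in\omega\times\omega: y\in\ell_2,\ x-\Omega(y)\in\ell_2\}$ with the quasi-norm $\|(x,y)\|=\|x-\Omega(y)\|_2+\|y\|_2$, which is equivalent to a norm; different selections give equivalent quasi-norms. Kalton-Peck space: $Z_2=\{(x,y):\ y\in\ell_2,\ x-\mathcal K(y)\in\ell_2\}$ with $\|(x,y)\|_{Z_2}=\|x-\mathcal K(y)\|_2+\|y\|_2$, where $\mathcal K(y)=\sum_j y_j\log|y_j|\,e_j$ for $\|y\|_2=1$ (with $0\log 0=0$), extended homogeneously. $\ell_M$ is the closed linear span of $\{(0,e_j)\}_{j=1}^\infty$ in $Z_2$; it is an Orlicz sequence space. *)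

theory Defs
  imports "HOL-Complex_Analysis.Complex_Analysis" "HOL-Library.Function_Algebras"
begin

class complex_vector = ab_group_add +
  fixes scaleC :: "complex \<Rightarrow> 'a \<Rightarrow> 'a" (infixr "*\<^sub>C" 75)
  assumes scaleC_add_right: "c *\<^sub>C (x + y) = c *\<^sub>C x + c *\<^sub>C y"
    and scaleC_add_left: "(c + d) *\<^sub>C x = c *\<^sub>C x + d *\<^sub>C x"
    and scaleC_scaleC: "c *\<^sub>C d *\<^sub>C x = (c * d) *\<^sub>C x"
    and scaleC_one: "1 *\<^sub>C x = x"

global_interpretation complex_vector:
  vector_space "scaleC :: complex \<Rightarrow> 'a \<Rightarrow> 'a::complex_vector"
  by unfold_locales (simp_all add: scaleC_add_right scaleC_add_left scaleC_scaleC scaleC_one)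

class complex_banach = complex_vector + banach +
  assumes scaleR_scaleC: "r *\<^sub>R x = complex_of_real r *\<^sub>C x"
    and norm_scaleC: "norm (c *\<^sub>C x) = cmod c * norm x"

instantiation complex :: complex_banach
begin
definition "c *\<^sub>C (x::complex) = c * x"
instance
  by intro_classes
    (simp_all add: scaleC_complex_def algebra_simps norm_mult scaleR_conv_of_real)
end

instantiation "fun" :: (type, complex_vector) complex_vector
begin
definition "c *\<^sub>C f = (\<lambda>i. c *\<^sub>C f i)"
instance
  by intro_classes
    (simp_all add: scaleC_fun_def fun_eq_iff scaleC_add_right scaleC_add_left
      scaleC_scaleC scaleC_one)
end

instantiation prod :: (complex_vector, complex_vector) complex_vector
begin
definition "c *\<^sub>C z = (c *\<^sub>C fst z, c *\<^sub>C snd z)"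
instance
  by intro_classes
    (simp_all add: scaleC_prod_def prod_eq_iff scaleC_add_right scaleC_add_left
      scaleC_scaleC scaleC_one)
end

text \<open>The library's topology on functions is that of pointwise convergence, so this type
  with its class instances is the space \<open>\<omega>\<close>.\<close>

type_synonym omega = "nat \<Rightarrow> complex"

definition norm_on :: "'v::complex_vector set \<Rightarrow> ('v \<Rightarrow> real) \<Rightarrow> bool" where
  "norm_on V N \<longleftrightarrow> complex_vector.subspace V \<and>
     (\<forall>x\<in>V. 0 \<le> N x \<and> (N x = 0 \<longleftrightarrow> x = 0)) \<and>
     (\<forall>x\<in>V. \<forall>y\<in>V. N (x + y) \<le> N x + N y) \<and>
     (\<forall>c. \<forall>x\<in>V. N (c *\<^sub>C x) = cmod c * N x)"

definition banach_on :: "'v::complex_vector set \<Rightarrow> ('v \<Rightarrow> real) \<Rightarrow> bool" where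
  "banach_on V N \<longleftrightarrow> norm_on V N \<and>
     (\<forall>x::nat \<Rightarrow> 'v. range x \<subseteq> V \<longrightarrow>
        (\<forall>\<epsilon>>0. \<exists>M. \<forall>m\<ge>M. \<forall>n\<ge>M. N (x m - x n) < \<epsilon>) \<longrightarrow>
        (\<exists>l\<in>V. (\<lambda>n. N (x n - l)) \<longlonglongrightarrow> 0))"

definition equivalent_on :: "'v set \<Rightarrow> ('v \<Rightarrow> real) \<Rightarrow> ('v \<Rightarrow> real) \<Rightarrow> bool" where
  "equivalent_on V N M \<longleftrightarrow>
     (\<exists>c C. 0 < c \<and> 0 < C \<and> (\<forall>x\<in>V. c * M x \<le> N x \<and> N x \<le> C * M x))"

definition linear_map_on :: "'v::complex_vector set \<Rightarrow> ('v \<Rightarrow> 'w::complex_vector) \<Rightarrow> bool" where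
  "linear_map_on V T \<longleftrightarrow> (\<forall>x\<in>V. \<forall>y\<in>V. T (x + y) = T x + T y) \<and>
     (\<forall>c. \<forall>x\<in>V. T (c *\<^sub>C x) = c *\<^sub>C T x)"

text \<open>The functions \<open>N\<close> and \<open>M\<close> may be quasi-norms.\<close>

definition isomorphic_spaces ::
  "'v::complex_vector set \<Rightarrow> ('v \<Rightarrow> real) \<Rightarrow> 'w::complex_vector set \<Rightarrow> ('w \<Rightarrow> real) \<Rightarrow> bool" where
  "isomorphic_spaces V N W M \<longleftrightarrow>
     (\<exists>T. linear_map_on V T \<and> bij_betw T V W \<and> equivalent_on V (\<lambda>x. M (T x)) N)"

definition is_completion ::
  "'v::complex_vector set \<Rightarrow> ('v \<Rightarrow> real) \<Rightarrow> 'w::complex_vector set \<Rightarrow> ('w \<Rightarrow> real) \<Rightarrow> bool" where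
  "is_completion V N S M \<longleftrightarrow> banach_on S M \<and>
     (\<exists>\<iota>. linear_map_on V \<iota> \<and> \<iota> ` V \<subseteq> S \<and> (\<forall>x\<in>V. M (\<iota> x) = N x) \<and>
        (\<forall>s\<in>S. \<forall>\<epsilon>>0. \<exists>x\<in>V. M (s - \<iota> x) < \<epsilon>))"

text \<open>The completion is unique up to linear isometry, so ``some completion is isomorphic to
  \<open>W\<close>'' and ``every completion is isomorphic to \<open>W\<close>'' agree. Looking for the completion in
  the ambient type of \<open>W\<close> is no restriction: a norm on a space linearly isomorphic to \<open>W\<close> can be
  carried over to the set \<open>W\<close> itself.\<close>

definition completion_isomorphic_to ::
  "'v::complex_vector set \<Rightarrow> ('v \<Rightarrow> real) \<Rightarrow> 'w::complex_vector set \<Rightarrow> ('w \<Rightarrow> real) \<Rightarrow> bool" where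
  "completion_isomorphic_to V N W M \<longleftrightarrow>
     (\<exists>(S::'w set) K. is_completion V N S K \<and> isomorphic_spaces S K W M)"

definition c00 :: "omega set" where
  "c00 = {a. finite {j. a j \<noteq> 0}}"

definition c0 :: "omega set" where
  "c0 = {a. a \<longlonglongrightarrow> 0}"

definition sup_norm :: "omega \<Rightarrow> real" where
  "sup_norm a = (SUP j. cmod (a j))"

definition ell2 :: "omega set" where
  "ell2 = {a. summable (\<lambda>j. (cmod (a j))\<^sup>2)}"

definition ell2_norm :: "omega \<Rightarrow> real" where
  "ell2_norm a = sqrt (\<Sum>j. (cmod (a j))\<^sup>2)"

definition unit_seq :: "nat \<Rightarrow> omega" where
  "unit_seq j = (\<lambda>i. if i = j then 1 else 0)"

definition schauder_basis :: "(nat \<Rightarrow> 'a::complex_banach) \<Rightarrow> bool" where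
  "schauder_basis e \<longleftrightarrow> (\<forall>x. \<exists>!a::omega. (\<lambda>j. a j *\<^sub>C e j) sums x)"

definition unconditional_basis :: "(nat \<Rightarrow> 'a::complex_banach) \<Rightarrow> bool" where
  "unconditional_basis e \<longleftrightarrow> schauder_basis e \<and>
     (\<forall>a::omega. summable (\<lambda>j. a j *\<^sub>C e j) \<longrightarrow> (\<lambda>j. a j *\<^sub>C e j) summable_on UNIV)"

definition coord :: "(nat \<Rightarrow> 'a::complex_banach) \<Rightarrow> 'a \<Rightarrow> omega" where
  "coord e x = (THE a. (\<lambda>j. a j *\<^sub>C e j) sums x)"

definition dual_space :: "('a::complex_banach \<Rightarrow> complex) set" where
  "dual_space = {f. bounded_linear f \<and> (\<forall>c x. f (c *\<^sub>C x) = c * f x)}"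

text \<open>Shrinking: the closed linear span of the coordinate functionals is the whole dual.\<close>

definition shrinking :: "(nat \<Rightarrow> 'a::complex_banach) \<Rightarrow> bool" where
  "shrinking e \<longleftrightarrow> (\<forall>f\<in>(dual_space :: ('a \<Rightarrow> complex) set). \<forall>\<epsilon>>0. \<exists>n (c::omega).
     onorm (\<lambda>x. f x - (\<Sum>j<n. c j * coord e x j)) < \<epsilon>)"

definition seq_space :: "(nat \<Rightarrow> 'a::complex_banach) \<Rightarrow> omega set" where
  "seq_space e = {a. summable (\<lambda>j. a j *\<^sub>C e j)}"

definition seq_norm :: "(nat \<Rightarrow> 'a::complex_banach) \<Rightarrow> omega \<Rightarrow> real" where
  "seq_norm e a = norm (\<Sum>j. a j *\<^sub>C e j)"

definition dual_seq_space :: "(nat \<Rightarrow> 'a::complex_banach) \<Rightarrow> omega set" where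
  "dual_seq_space e = {(\<lambda>j. f (e j)) | f. f \<in> dual_space}"

definition dual_seq_norm :: "(nat \<Rightarrow> 'a::complex_banach) \<Rightarrow> omega \<Rightarrow> real" where
  "dual_seq_norm e a = onorm (THE f. f \<in> dual_space \<and> (\<forall>j. f (e j) = a j))"

definition basis_supp :: "(nat \<Rightarrow> 'a::complex_banach) \<Rightarrow> 'a \<Rightarrow> nat set" where
  "basis_supp e x = {j. coord e x j \<noteq> 0}"

definition block_family :: "(nat \<Rightarrow> 'a::complex_banach) \<Rightarrow> nat set \<Rightarrow> (nat \<Rightarrow> 'a) \<Rightarrow> bool" where
  "block_family e I u \<longleftrightarrow>
     (\<forall>i\<in>I. u i \<noteq> 0 \<and> finite (basis_supp e (u i))) \<and>
     (\<forall>i\<in>I. \<forall>k\<in>I. i < k \<longrightarrow> Max (basis_supp e (u i)) < Min (basis_supp e (u k)))"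

text \<open>Basis vectors are enumerated \<open>e\<^sub>1, e\<^sub>2, \<dots>\<close> in the usual notation, and \<open>e 0\<close> is the first
  one here; hence \<open>n < min supp u\<close> becomes \<open>n < Suc (min supp u)\<close>. The blocks
  \<open>u\<^sub>1 < \<dots> < u\<^sub>n\<close> are \<open>u 0, \<dots>, u (n - 1)\<close>.\<close>

definition asymptotic_lp :: "(nat \<Rightarrow> 'a::complex_banach) \<Rightarrow> real \<Rightarrow> bool" where
  "asymptotic_lp e p \<longleftrightarrow> (\<exists>C>0. \<forall>n (u :: nat \<Rightarrow> 'a).
     block_family e {..<n} u \<and> (\<forall>i<n. norm (u i) = 1 \<and> n < Suc (Min (basis_supp e (u i)))) \<longrightarrow>
     (\<forall>a::omega.
        (1 / C) * (\<Sum>i<n. cmod (a i) powr p) powr (1 / p) \<le> norm (\<Sum>i<n. a i *\<^sub>C u i) \<and>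
        norm (\<Sum>i<n. a i *\<^sub>C u i) \<le> C * (\<Sum>i<n. cmod (a i) powr p) powr (1 / p)))"

text \<open>The scalars \<open>a\<^sub>1, \<dots>, a\<^sub>n\<close> are identified with an element of \<open>c00\<close> supported in the first \<open>n\<close>
  places. Only the values of \<open>L\<close> on \<open>c00\<close> matter; the spreading model is the completion of
  \<open>c00\<close> under \<open>L\<close>.\<close>

definition generates_spreading_norm ::
  "'v::complex_vector set \<Rightarrow> ('v \<Rightarrow> real) \<Rightarrow> (nat \<Rightarrow> 'v) \<Rightarrow> (omega \<Rightarrow> real) \<Rightarrow> bool" where
  "generates_spreading_norm V N x L \<longleftrightarrow>
     range x \<subseteq> V \<and> (\<exists>B. \<forall>j. N (x j) \<le> B) \<and>
     \<not> (\<exists>r::nat \<Rightarrow> nat. \<exists>l\<in>V. strict_mono r \<and> (\<lambda>j. N (x (r j) - l)) \<longlonglongrightarrow> 0) \<and>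
     (\<exists>r::nat \<Rightarrow> nat. strict_mono r \<and>
        (\<forall>n (a::omega). {j. a j \<noteq> 0} \<subseteq> {..<n} \<longrightarrow>
          (\<forall>\<epsilon>>0. \<exists>\<nu>. \<forall>k::nat \<Rightarrow> nat. strict_mono_on {..<n} k \<and> (\<forall>i<n. \<nu> \<le> k i) \<longrightarrow>
             \<bar>N (\<Sum>i<n. a i *\<^sub>C x (r (k i))) - L a\<bar> < \<epsilon>)))"

definition spreading_norm ::
  "'v::complex_vector set \<Rightarrow> ('v \<Rightarrow> real) \<Rightarrow> (omega \<Rightarrow> real) \<Rightarrow> bool" where
  "spreading_norm V N L \<longleftrightarrow> (\<exists>x. generates_spreading_norm V N x L)"

definition block_spreading_models_c0 :: "(nat \<Rightarrow> 'a::complex_banach) \<Rightarrow> bool" where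
  "block_spreading_models_c0 e \<longleftrightarrow> (\<forall>u L. block_family e UNIV u \<longrightarrow>
     generates_spreading_norm UNIV norm u L \<longrightarrow> completion_isomorphic_to c00 L c0 sup_norm)"

definition strip :: "complex set" where
  "strip = {z. 0 \<le> Re z \<and> Re z \<le> 1}"

definition bounded_curve :: "omega set \<Rightarrow> (omega \<Rightarrow> real) \<Rightarrow> (real \<Rightarrow> omega) \<Rightarrow> bool" where
  "bounded_curve V N g \<longleftrightarrow> range g \<subseteq> V \<and> (\<exists>b. \<forall>t. N (g t) \<le> b) \<and>
     (\<forall>t. \<forall>\<epsilon>>0. \<exists>\<delta>>0. \<forall>s. \<bar>s - t\<bar> < \<delta> \<longrightarrow> N (g s - g t) < \<epsilon>)"

text \<open>Boundedness in \<open>\<omega>\<close> is meant in the sense of topological vector spaces, that is,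
  boundedness of each coordinate.\<close>

definition interp_funs ::
  "omega set \<Rightarrow> (omega \<Rightarrow> real) \<Rightarrow> omega set \<Rightarrow> (omega \<Rightarrow> real) \<Rightarrow> (complex \<Rightarrow> omega) set" where
  "interp_funs V\<^sub>0 N\<^sub>0 V\<^sub>1 N\<^sub>1 = {F.
     (\<forall>j. bounded ((\<lambda>z. F z j) ` strip)) \<and> continuous_on strip F \<and>
     (\<forall>j. (\<lambda>z. F z j) holomorphic_on interior strip) \<and>
     bounded_curve V\<^sub>0 N\<^sub>0 (\<lambda>t. F (\<i> * of_real t)) \<and>
     bounded_curve V\<^sub>1 N\<^sub>1 (\<lambda>t. F (1 + \<i> * of_real t))}"

definition interp_norm ::
  "(omega \<Rightarrow> real) \<Rightarrow> (omega \<Rightarrow> real) \<Rightarrow> (complex \<Rightarrow> omega) \<Rightarrow> real" where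
  "interp_norm N\<^sub>0 N\<^sub>1 F =
     max (SUP t::real. N\<^sub>0 (F (\<i> * of_real t))) (SUP t::real. N\<^sub>1 (F (1 + \<i> * of_real t)))"

definition homogeneous_selection ::
  "(nat \<Rightarrow> 'a::complex_banach) \<Rightarrow> (omega \<Rightarrow> complex \<Rightarrow> omega) \<Rightarrow> bool" where
  "homogeneous_selection e B \<longleftrightarrow>
     (\<forall>x\<in>ell2. B x \<in> interp_funs (seq_space e) (seq_norm e) (dual_seq_space e) (dual_seq_norm e)
        \<and> B x (1 / 2) = x) \<and>
     (\<forall>c. \<forall>x\<in>ell2. \<forall>z\<in>strip. B (c *\<^sub>C x) z = c *\<^sub>C B x z) \<and>
     (\<exists>C. \<forall>x\<in>ell2. interp_norm (seq_norm e) (dual_seq_norm e) (B x) \<le> C * ell2_norm x)"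

definition selection_derivation :: "(omega \<Rightarrow> complex \<Rightarrow> omega) \<Rightarrow> omega \<Rightarrow> omega" where
  "selection_derivation B x = (\<lambda>j. deriv (\<lambda>z. B x z j) (1 / 2))"

definition twisted_space :: "(omega \<Rightarrow> omega) \<Rightarrow> (omega \<times> omega) set" where
  "twisted_space \<Omega> = {(x, y). y \<in> ell2 \<and> x - \<Omega> y \<in> ell2}"

definition twisted_norm :: "(omega \<Rightarrow> omega) \<Rightarrow> omega \<times> omega \<Rightarrow> real" where
  "twisted_norm \<Omega> = (\<lambda>(x, y). ell2_norm (x - \<Omega> y) + ell2_norm y)"

abbreviation Z_space :: "(omega \<Rightarrow> complex \<Rightarrow> omega) \<Rightarrow> (omega \<times> omega) set" where
  "Z_space B \<equiv> twisted_space (selection_derivation B)"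

abbreviation Z_quasinorm :: "(omega \<Rightarrow> complex \<Rightarrow> omega) \<Rightarrow> omega \<times> omega \<Rightarrow> real" where
  "Z_quasinorm B \<equiv> twisted_norm (selection_derivation B)"

text \<open>On the unit sphere of \<open>\<ell>\<^sub>2\<close> the Kalton-Peck map is \<open>y\<^sub>j log \<bar>y\<^sub>j\<bar>\<close>; its homogeneous extension
  divides by the norm inside the logarithm. For \<open>y j = 0\<close> the coordinate is \<open>0\<close>, as required.\<close>

definition kalton_peck :: "omega \<Rightarrow> omega" where
  "kalton_peck y = (\<lambda>j. y j * of_real (ln (cmod (y j) / ell2_norm y)))"

definition ell_M :: "(omega \<times> omega) set" where
  "ell_M = {z \<in> twisted_space kalton_peck. \<forall>\<epsilon>>0.
     \<exists>w \<in> complex_vector.span (range (\<lambda>j. (0, unit_seq j))). twisted_norm kalton_peck (z - w) < \<epsilon>}"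

abbreviation ell_M_norm :: "omega \<times> omega \<Rightarrow> real" where
  "ell_M_norm \<equiv> twisted_norm kalton_peck"

end

theory Submission
  imports Defs "HOL-Real_Asymp.Real_Asymp" "HOL-Library.Ramsey" "HOL-Library.Diagonal_Subsequence"
begin

text \<open>The space \<open>Z(X)\<close> is handled through pairs \<open>(y, d)\<close> of values and derivatives at \<open>1/2\<close>
  of analytic functions: two derivatives belonging to the same value differ by an element of \<open>\<ell>\<^sub>2\<close> of
  controlled norm. This follows from the three lines theorem applied to
  \<open>\<Sum>\<^sub>j F\<^sub>j(z) cnj (F\<^sub>j(1 - cnj z))\<close>, with \<open>F(z) / (z - 1/2)\<close> in place of \<open>F\<close> when \<open>F(1/2) = 0\<close>. For a
  finitely supported \<open>y\<close> a Lozanovskii factorization \<open>|y|\<^sup>2 = f g\<close> gives the function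
  \<open>sgn y f\<^bsup>1 - z\<^esup> g\<^bsup>z\<^esup>\<close>. If blocks of \<open>X\<close> satisfy an upper \<open>p\<close>-estimate and blocks of \<open>X*\<close> the conjugate
  one (\<open>\<alpha> = 1/p\<close>, and \<open>\<alpha> = 0\<close> when the spreading models of blocks are \<open>c\<^sub>0\<close>), the functions of the
  blocks may be combined with the coefficients \<open>|a\<^sub>i|\<^bsup>2\<alpha>(1 - z) + 2(1 - \<alpha>)z\<^esup>\<close>. The derivative of the
  combination contains the Kalton-Peck term \<open>2(1 - 2\<alpha>) \<Sum>\<^sub>i a\<^sub>i log |a\<^sub>i| y\<^sub>i\<close>, whose factor does not vanish
  because \<open>p \<noteq> 2\<close>. Hence blocks \<open>(x\<^sub>i, y\<^sub>i)\<close> span \<open>\<ell>\<^sub>M\<close> asymptotically if \<open>\<parallel>y\<^sub>i\<parallel>\<close> is bounded below and \<open>\<ell>\<^sub>2\<close> if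
  \<open>\<parallel>y\<^sub>i\<parallel>\<close> tends to zero along a subsequence. A nonzero weak limit adds a multiple of \<open>|\<Sum>\<^sub>i a\<^sub>i|\<close> to the norm, which does not change
  the isomorphic type of the completion.\<close>


subsection \<open>Square-summable sequences\<close>

text \<open>The derivation depends on an arbitrary selection and commutes neither with sums nor with
  restrictions. What saves the computation is that any convenient analytic function may stand in for
  the selected one, at a cost linear in the norms of the two functions, and that sums, restrictions
  and bounded multiples of such functions are again such functions. Coefficients are normalized to
  \<open>c\<close> with sum of squares at most 1, because \<open>c powr (2 * \<alpha>)\<close> then
  lies in the unit ball of ell_p and \<open>c powr (2 * (1 - \<alpha>))\<close> in that of its dual;
  the difference of the two exponents is the factor of the logarithmic term. In the c_0 case the
  obstacle is that an isomorphism with c_0 says nothing about the position of the unit vectors, so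
  the boundedness of their sums has to be extracted by a gliding hump and by unconditionality. The
  functional that sums the coefficients costs one dimension, and a sequence space with a shift
  absorbs a one-dimensional summand.\<close>

lemma sum_fun_apply: "(sum f A) x = (\<Sum>i\<in>A. f i x)"
  for f :: "'b \<Rightarrow> 'c \<Rightarrow> 'd::comm_monoid_add"
  by (induction A rule: infinite_finite_induct) auto

lemma scaleC_omega [simp]: "(c *\<^sub>C a) j = c * a j" for a :: omega
  by (simp add: scaleC_fun_def scaleC_complex_def)

lemma scaleC_prod_simps [simp]:
  "fst (c *\<^sub>C z) = c *\<^sub>C fst z" "snd (c *\<^sub>C z) = c *\<^sub>C snd z"
  by (simp_all add: scaleC_prod_def)

lemma scaleC_Pair: "c *\<^sub>C (a, b) = (c *\<^sub>C a, c *\<^sub>C b)"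
  by (simp add: scaleC_prod_def)

abbreviation pnorm :: "nat \<Rightarrow> omega \<Rightarrow> real" where
  "pnorm n a \<equiv> L2_set (\<lambda>j. cmod (a j)) {..<n}"

lemma ell2_norm_nonneg: "a \<in> ell2 \<Longrightarrow> 0 \<le> ell2_norm a"
  unfolding ell2_norm_def ell2_def by (auto intro!: suminf_nonneg)

lemma pnorm_le_ell2_norm: assumes "a \<in> ell2" shows "pnorm n a \<le> ell2_norm a"
  using assms unfolding L2_set_def ell2_norm_def ell2_def
  by (auto intro!: sum_le_suminf)

lemma ell2_boundD:
  assumes "\<And>n. pnorm n a \<le> R"
  shows "a \<in> ell2" "ell2_norm a \<le> R"
proof -
  have R: "0 \<le> R" using assms[of 0] by simp
  have b: "(\<Sum>j<n. (cmod (a j))\<^sup>2) \<le> R\<^sup>2" for n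
    using assms[of n] R unfolding L2_set_def by (simp add: sqrt_le_D)
  show 1: "a \<in> ell2" unfolding ell2_def
    using b by (auto intro!: summableI_nonneg_bounded)
  have "(\<Sum>j. (cmod (a j))\<^sup>2) \<le> R\<^sup>2"
    using 1 b unfolding ell2_def by (auto intro!: suminf_le_const)
  then show "ell2_norm a \<le> R" unfolding ell2_norm_def
    by (metis R real_sqrt_le_iff real_sqrt_abs abs_of_nonneg)
qed

lemma pnorm_triangle: "pnorm n (a + b) \<le> pnorm n a + pnorm n b"
proof -
  have "pnorm n (a + b) \<le> L2_set (\<lambda>j. cmod (a j) + cmod (b j)) {..<n}"
    by (rule L2_set_mono) (auto intro: norm_triangle_ineq)
  also have "\<dots> \<le> pnorm n a + pnorm n b" by (rule L2_set_triangle_ineq)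
  finally show ?thesis .
qed

lemma ell2_dominated:
  assumes "b \<in> ell2" "\<And>j. cmod (a j) \<le> c * cmod (b j)" "0 \<le> c"
  shows "a \<in> ell2" "ell2_norm a \<le> c * ell2_norm b"
proof -
  have "pnorm n a \<le> c * ell2_norm b" for n
  proof -
    have "pnorm n a \<le> L2_set (\<lambda>j. c * cmod (b j)) {..<n}"
      by (rule L2_set_mono) (auto intro: assms)
    also have "\<dots> = c * pnorm n b" using assms(3) by (simp add: L2_set_right_distrib)
    also have "\<dots> \<le> c * ell2_norm b" using assms(3) pnorm_le_ell2_norm[OF assms(1)]
      by (rule_tac mult_left_mono) auto
    finally show ?thesis .
  qed
  then show "a \<in> ell2" "ell2_norm a \<le> c * ell2_norm b" by (rule ell2_boundD)+
qed

lemma ell2_add: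
  assumes "a \<in> ell2" "b \<in> ell2"
  shows "a + b \<in> ell2" "ell2_norm (a + b) \<le> ell2_norm a + ell2_norm b"
proof -
  have "pnorm n (a + b) \<le> ell2_norm a + ell2_norm b" for n
    using pnorm_triangle[of a b n] pnorm_le_ell2_norm[OF assms(1), of n] pnorm_le_ell2_norm[OF assms(2), of n] by simp
  then show "a + b \<in> ell2" "ell2_norm (a + b) \<le> ell2_norm a + ell2_norm b"
    by (rule ell2_boundD)+
qed

lemma ell2_0 [simp]: "0 \<in> ell2" "ell2_norm 0 = 0"
  by (auto simp: ell2_def ell2_norm_def)

lemma ell2_norm_scaleC: "ell2_norm (c *\<^sub>C a) = cmod c * ell2_norm a" if "a \<in> ell2"
proof -
  have "(\<Sum>j. (cmod c)\<^sup>2 * (cmod (a j))\<^sup>2) = (cmod c)\<^sup>2 * (\<Sum>j. (cmod (a j))\<^sup>2)"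
    using that unfolding ell2_def by (auto intro: suminf_mult)
  then show ?thesis
    by (simp add: ell2_norm_def norm_mult power_mult_distrib real_sqrt_mult)
qed

lemma ell2_scaleC: "a \<in> ell2 \<Longrightarrow> c *\<^sub>C a \<in> ell2"
  by (rule ell2_dominated(1)[of a _ "cmod c"]) (auto simp: norm_mult)

lemma ell2_uminus: "- a \<in> ell2 \<longleftrightarrow> a \<in> ell2" "ell2_norm (- a) = ell2_norm a"
  by (auto simp: ell2_def ell2_norm_def)

lemma ell2_diff:
  assumes "a \<in> ell2" "b \<in> ell2"
  shows "a - b \<in> ell2" "ell2_norm (a - b) \<le> ell2_norm a + ell2_norm b"
  using ell2_add[of a "- b"] assms by (auto simp: ell2_uminus)

lemma ell2_norm_minus_commute: "ell2_norm (a - b) = ell2_norm (b - a)"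
  using ell2_uminus(2)[of "a - b"] by simp

lemma norm_component_le_ell2_norm: assumes "a \<in> ell2" shows "cmod (a j) \<le> ell2_norm a"
proof -
  have "cmod (a j) \<le> pnorm (Suc j) a"
    by (rule member_le_L2_set) auto
  also have "\<dots> \<le> ell2_norm a" by (rule pnorm_le_ell2_norm[OF assms])
  finally show ?thesis .
qed

lemma ell2_norm_eq_0: assumes "a \<in> ell2" shows "ell2_norm a = 0 \<longleftrightarrow> a = 0"
proof
  assume "ell2_norm a = 0"
  then have "cmod (a j) \<le> 0" for j using norm_component_le_ell2_norm[OF assms, of j] by simp
  then show "a = 0" by (simp add: fun_eq_iff)
qed (simp only: ell2_0)

lemma pnorm_tendsto:
  assumes "\<And>j. (\<lambda>m. x m j) \<longlonglongrightarrow> l j"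
  shows "(\<lambda>m. pnorm n (x m)) \<longlonglongrightarrow> pnorm n l"
  unfolding L2_set_def by (intro tendsto_intros assms)

text \<open>A Fatou property: each section \<open>pnorm n\<close> passes to the coordinatewise
  limit, and a common bound for all sections is membership in \<open>ell2\<close> with that bound.
  Completeness of \<open>ell2\<close> and of \<open>ellM_seq\<close> both rest on it.\<close>

lemma ell2_lower_semicont:
  assumes "\<And>j. (\<lambda>m. x m j) \<longlonglongrightarrow> l j" "eventually (\<lambda>m. x m \<in> ell2 \<and> ell2_norm (x m) \<le> R) sequentially"
  shows "l \<in> ell2" "ell2_norm l \<le> R"
proof -
  have "pnorm n l \<le> R" for n
  proof (rule tendsto_upperbound[OF pnorm_tendsto[OF assms(1)]])
    show "\<forall>\<^sub>F m in sequentially. pnorm n (x m) \<le> R"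
      using assms(2) by eventually_elim (auto intro: order_trans[OF pnorm_le_ell2_norm])
  qed auto
  then show "l \<in> ell2" "ell2_norm l \<le> R" by (rule ell2_boundD)+
qed

lemma ell2_complete:
  assumes "\<And>n. x n \<in> ell2" "\<And>\<epsilon>. \<epsilon> > 0 \<Longrightarrow> \<exists>M. \<forall>m\<ge>M. \<forall>n\<ge>M. ell2_norm (x m - x n) < \<epsilon>"
  shows "\<exists>l\<in>ell2. (\<lambda>n. ell2_norm (x n - l)) \<longlonglongrightarrow> 0"
proof -
  have "Cauchy (\<lambda>n. x n j)" for j
  proof (rule metric_CauchyI)
    fix \<epsilon> :: real assume "\<epsilon> > 0"
    then obtain M where M: "\<forall>m\<ge>M. \<forall>n\<ge>M. ell2_norm (x m - x n) < \<epsilon>" using assms(2) by blast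
    have "dist (x m j) (x n j) \<le> ell2_norm (x m - x n)" for m n
      using norm_component_le_ell2_norm[OF ell2_diff(1), of "x m" "x n" j] assms(1)
      by (simp add: dist_norm)
    with M show "\<exists>M. \<forall>m\<ge>M. \<forall>n\<ge>M. dist (x m j) (x n j) < \<epsilon>" by (meson le_less_trans)
  qed
  then have "\<exists>l. (\<lambda>n. x n j) \<longlonglongrightarrow> l" for j
    using Cauchy_convergent convergent_def by blast
  then obtain l where l: "\<And>j. (\<lambda>n. x n j) \<longlonglongrightarrow> l j" by metis
  have *: "\<exists>M. \<forall>n\<ge>M. x n - l \<in> ell2 \<and> ell2_norm (x n - l) \<le> \<epsilon>" if "\<epsilon> > 0" for \<epsilon>
  proof -
    obtain M where M: "\<forall>m\<ge>M. \<forall>n\<ge>M. ell2_norm (x m - x n) < \<epsilon>" using assms(2) \<open>\<epsilon> > 0\<close> by blast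
    have "x n - l \<in> ell2 \<and> ell2_norm (x n - l) \<le> \<epsilon>" if "n \<ge> M" for n
    proof -
      have *: "eventually (\<lambda>m. x n - x m \<in> ell2 \<and> ell2_norm (x n - x m) \<le> \<epsilon>) sequentially"
        using eventually_ge_at_top[of M] by eventually_elim
          (use M that assms(1) in \<open>auto intro!: ell2_diff less_imp_le\<close>)
      have "(\<lambda>m. (x n - x m) j) \<longlonglongrightarrow> (x n - l) j" for j
        using l by (auto intro!: tendsto_intros)
      with ell2_lower_semicont[OF this *] show ?thesis by blast
    qed
    then show ?thesis by blast
  qed
  obtain n where "x n - l \<in> ell2" using *[of 1] by auto
  then have "l \<in> ell2" using ell2_diff(1)[of "x n" "x n - l"] assms(1) by simp
  moreover have "(\<lambda>n. ell2_norm (x n - l)) \<longlonglongrightarrow> 0"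
  proof (rule LIMSEQ_I)
    fix r :: real assume "r > 0"
    then obtain M where "\<forall>n\<ge>M. x n - l \<in> ell2 \<and> ell2_norm (x n - l) \<le> r / 2"
      using *[of "r / 2"] by auto
    with \<open>r > 0\<close> show "\<exists>M. \<forall>n\<ge>M. norm (ell2_norm (x n - l) - 0) < r"
      by (intro exI[of _ M]) (auto simp: ell2_norm_nonneg intro: le_less_trans)
  qed
  ultimately show ?thesis by blast
qed

section \<open>Restrictions and finitely supported sequences\<close>

definition restr :: "nat set \<Rightarrow> omega \<Rightarrow> omega" where
  "restr I a = (\<lambda>j. if j \<in> I then a j else 0)"

lemma restr_add: "restr I (a + b) = restr I a + restr I b"
  and restr_diff: "restr I (a - b) = restr I a - restr I b"
  and restr_scaleC: "restr I (c *\<^sub>C a) = c *\<^sub>C restr I a"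
  and restr_0 [simp]: "restr I 0 = 0"
  and restr_restr: "restr I (restr J a) = restr (I \<inter> J) a"
  by (auto simp: restr_def fun_eq_iff)

lemma restr_ell2: assumes "a \<in> ell2" shows "restr I a \<in> ell2" "ell2_norm (restr I a) \<le> ell2_norm a"
  using ell2_dominated[of a "restr I a" 1] assms by (auto simp: restr_def)

lemma ell2_tail_tendsto:
  assumes "a \<in> ell2" shows "(\<lambda>n. ell2_norm (restr {n..} a)) \<longlonglongrightarrow> 0"
proof -
  have s: "summable (\<lambda>j. (cmod (a j))\<^sup>2)" using assms by (simp add: ell2_def)
  have "(\<Sum>j. (cmod (restr {n..} a j))\<^sup>2) = (\<Sum>j. (cmod (a (j + n)))\<^sup>2)" for n
  proof -
    have "summable (\<lambda>j. (cmod (restr {n..} a j))\<^sup>2)"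
      using restr_ell2(1)[OF assms] by (simp add: ell2_def)
    then have "(\<Sum>j. (cmod (restr {n..} a j))\<^sup>2) = (\<Sum>j. (cmod (restr {n..} a (j + n)))\<^sup>2)"
      by (subst suminf_split_initial_segment[of _ n]) (auto simp: restr_def)
    then show ?thesis by (simp add: restr_def)
  qed
  then have "(\<lambda>n. sqrt (\<Sum>j. (cmod (restr {n..} a j))\<^sup>2)) \<longlonglongrightarrow> sqrt 0"
    using suminf_exist_split2[OF s] by (intro tendsto_real_sqrt) simp
  then show ?thesis by (simp add: ell2_norm_def)
qed

lemma c00_ell2: "c00 \<subseteq> ell2"
  by (auto simp: c00_def ell2_def intro!: summable_finite)

lemma c00_bounded: assumes "a \<in> c00" obtains n where "{j. a j \<noteq> 0} \<subseteq> {..<n}"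
  using assms unfolding c00_def by (auto simp: finite_nat_iff_bounded)

lemma supp_c00: "{j. a j \<noteq> 0} \<subseteq> {..<n} \<Longrightarrow> a \<in> c00" for a :: omega
  by (auto simp: c00_def finite_subset)

lemma c00_add: "a \<in> c00 \<Longrightarrow> b \<in> c00 \<Longrightarrow> a + b \<in> c00"
  unfolding c00_def by (auto intro: finite_subset[of _ "{j. a j \<noteq> 0} \<union> {j. b j \<noteq> 0}"])

lemma c00_scaleC: "a \<in> c00 \<Longrightarrow> c *\<^sub>C a \<in> c00"
  unfolding c00_def by (auto intro: finite_subset[of _ "{j. a j \<noteq> 0}"])

lemma c00_0: "0 \<in> c00" by (simp add: c00_def)

lemma c00_diff: "a \<in> c00 \<Longrightarrow> b \<in> c00 \<Longrightarrow> a - b \<in> c00"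
  unfolding c00_def by (auto intro: finite_subset[of _ "{j. a j \<noteq> 0} \<union> {j. b j \<noteq> 0}"])

lemma restr_finite_c00: "finite I \<Longrightarrow> restr I a \<in> c00"
  by (auto simp: c00_def restr_def intro: finite_subset)

lemma unit_seq_c00: "unit_seq j \<in> c00"
  by (auto simp: c00_def unit_seq_def)

lemma ell2_norm_finite:
  assumes "{j. a j \<noteq> 0} \<subseteq> {..<n}" shows "(ell2_norm a)\<^sup>2 = (\<Sum>j<n. (cmod (a j))\<^sup>2)"
proof -
  have "(\<Sum>j. (cmod (a j))\<^sup>2) = (\<Sum>j<n. (cmod (a j))\<^sup>2)"
    using assms by (intro suminf_finite) auto
  then show ?thesis by (simp add: ell2_norm_def sum_nonneg)
qed

lemma ell2_norm_unit_seq [simp]: "ell2_norm (unit_seq j) = 1"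
proof -
  have "(ell2_norm (unit_seq j))\<^sup>2 = (\<Sum>i<Suc j. (cmod (unit_seq j i))\<^sup>2)"
    by (rule ell2_norm_finite) (auto simp: unit_seq_def)
  also have "\<dots> = 1" by (simp add: unit_seq_def)
  finally show ?thesis
    using ell2_norm_nonneg[OF subsetD[OF c00_ell2 unit_seq_c00[of j]]] by (auto simp: power2_eq_1_iff)
qed

lemma ell2_norm_disjoint:
  fixes h :: "nat \<Rightarrow> omega"
  assumes h: "\<And>i. i < n \<Longrightarrow> h i \<in> ell2"
    and disj: "\<And>i i' j. i < n \<Longrightarrow> i' < n \<Longrightarrow> i \<noteq> i' \<Longrightarrow> h i j \<noteq> 0 \<Longrightarrow> h i' j = 0"
  shows "(\<Sum>i<n. h i) \<in> ell2" "(ell2_norm (\<Sum>i<n. h i))\<^sup>2 = (\<Sum>i<n. (ell2_norm (h i))\<^sup>2)"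
proof -
  show e: "(\<Sum>i<n. h i) \<in> ell2"
    using h by (induction n) (auto intro: ell2_add)
  have sq: "(ell2_norm x)\<^sup>2 = (\<Sum>j. (cmod (x j))\<^sup>2)" if "x \<in> ell2" for x
    using that unfolding ell2_norm_def ell2_def by (auto intro!: real_sqrt_pow2 suminf_nonneg)
  have pw: "(cmod ((\<Sum>i<n. h i) j))\<^sup>2 = (\<Sum>i<n. (cmod (h i j))\<^sup>2)" for j
  proof (cases "\<exists>i<n. h i j \<noteq> 0")
    case True
    then obtain i where i: "i < n" "h i j \<noteq> 0" by blast
    have "(\<Sum>i'<n. h i' j) = (\<Sum>i'\<in>{i}. h i' j)"
      using i disj[of i _ j] by (intro sum.mono_neutral_right) auto
    moreover have "(\<Sum>i'<n. (cmod (h i' j))\<^sup>2) = (\<Sum>i'\<in>{i}. (cmod (h i' j))\<^sup>2)"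
      using i disj[of i _ j] by (intro sum.mono_neutral_right) auto
    ultimately show ?thesis by (simp add: sum_fun_apply)
  next
    case False
    then show ?thesis by (simp add: sum_fun_apply)
  qed
  show "(ell2_norm (\<Sum>i<n. h i))\<^sup>2 = (\<Sum>i<n. (ell2_norm (h i))\<^sup>2)"
    unfolding sq[OF e] pw using h by (subst suminf_sum) (auto simp: sq ell2_def)
qed


subsection \<open>The Kalton-Peck map\<close>

text \<open>With \<open>x = s^2\<close> the left side is
  \<open>2 * s * \<bar>s * ln s\<bar>\<close>, and \<open>\<bar>s * ln s\<bar>\<close> is at most 1
  because \<open>ln (1 / s) \<le> 1 / s - 1\<close>. A bound that vanishes at 0, instead of a
  constant, is what makes tails in the Orlicz space tend to zero.\<close>

lemma abs_x_ln_x_le: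
  fixes x :: real assumes "0 \<le> x" "x \<le> 1" shows "\<bar>x * ln x\<bar> \<le> 2 * sqrt x"
proof (cases "x = 0")
  case False
  define s where "s = sqrt x"
  have s: "0 < s" "s \<le> 1" "x = s\<^sup>2" using assms False by (auto simp: s_def)
  have "ln (1 / s) \<le> 1 / s - 1" using s by (intro ln_le_minus_one) auto
  then have "- ln s \<le> 1 / s" using s by (simp add: ln_div)
  then have "s * (- ln s) \<le> s * (1 / s)" using s by (intro mult_left_mono) auto
  then have 1: "\<bar>s * ln s\<bar> \<le> 1" using s by (simp add: abs_mult)
  have "x * ln x = 2 * s * (s * ln s)" using s by (simp add: ln_mult power2_eq_square)
  then have "\<bar>x * ln x\<bar> = 2 * s * \<bar>s * ln s\<bar>" using s by (simp add: abs_mult)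
  also have "\<dots> \<le> 2 * s * 1" using s 1 by (intro mult_left_mono) auto
  finally show ?thesis by (simp add: s_def)
qed simp

lemma abs_x_ln_x_le_2:
  fixes x :: real assumes "0 \<le> x" "x \<le> 1" shows "\<bar>x * ln x\<bar> \<le> 2"
proof -
  have "sqrt x \<le> 1" using assms by simp
  then show ?thesis using abs_x_ln_x_le[OF assms] by linarith
qed

text \<open>Decoupling the normalizing constant from the argument makes the map almost additive in each
  coordinate.\<close>

definition log_map :: "real \<Rightarrow> omega \<Rightarrow> omega" where
  "log_map \<tau> y = (\<lambda>j. y j * of_real (ln (cmod (y j) / \<tau>)))"

text \<open>The two maps differ by the scalar multiple \<open>- ln x\<close> of \<open>y\<close>,
  where \<open>x = ell2_norm y / \<tau>\<close>, so the error has norm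
  \<open>\<tau> * \<bar>x * ln x\<bar>\<close>.\<close>

lemma kalton_peck_approx:
  assumes "y \<in> ell2" "ell2_norm y \<le> \<tau>" "0 < \<tau>"
  shows "kalton_peck y - log_map \<tau> y \<in> ell2"
    "ell2_norm (kalton_peck y - log_map \<tau> y) \<le> 2 * \<tau> * sqrt (ell2_norm y / \<tau>)"
proof -
  let ?s = "ell2_norm y"
  define x where "x = ?s / \<tau>"
  have x: "0 \<le> x" "x \<le> 1" using assms by (auto simp: x_def ell2_norm_nonneg)
  have d: "cmod ((kalton_peck y - log_map \<tau> y) j) \<le> \<bar>ln x\<bar> * cmod (y j)" for j
  proof (cases "y j = 0")
    case False
    then have "0 < cmod (y j)" by simp
    then have "0 < ?s" using norm_component_le_ell2_norm[OF assms(1), of j] by linarith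
    then have "(kalton_peck y - log_map \<tau> y) j = - of_real (ln x) * y j"
      using False assms(3) by (simp add: kalton_peck_def log_map_def x_def ln_div algebra_simps)
    then show ?thesis by (simp add: norm_mult)
  qed (simp add: kalton_peck_def log_map_def)
  note * = ell2_dominated[OF assms(1) d]
  show "kalton_peck y - log_map \<tau> y \<in> ell2" by (rule *(1)) simp
  have "ell2_norm (kalton_peck y - log_map \<tau> y) \<le> \<bar>ln x\<bar> * ?s" by (rule *(2)) simp
  also have "\<dots> = \<tau> * \<bar>x * ln x\<bar>" using x assms ell2_norm_nonneg[OF assms(1)] by (simp add: x_def abs_mult)
  also have "\<dots> \<le> \<tau> * (2 * sqrt x)" using x assms by (intro mult_left_mono abs_x_ln_x_le) auto
  finally show "ell2_norm (kalton_peck y - log_map \<tau> y) \<le> 2 * \<tau> * sqrt (?s / \<tau>)"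
    by (simp add: x_def mult_ac)
qed

lemma kalton_peck_approx':
  assumes "y \<in> ell2" "ell2_norm y \<le> \<tau>" "0 < \<tau>"
  shows "ell2_norm (kalton_peck y - log_map \<tau> y) \<le> 2 * \<tau>"
proof -
  have "sqrt (ell2_norm y / \<tau>) \<le> 1" using assms by simp
  then have "2 * \<tau> * sqrt (ell2_norm y / \<tau>) \<le> 2 * \<tau> * 1" using assms by (intro mult_left_mono) auto
  with kalton_peck_approx(2)[OF assms] show ?thesis by simp
qed

text \<open>Replacing the scale \<open>\<tau>\<close> by \<open>w = cmod (a j) + cmod (b j)\<close>
  changes each of the three terms by a linear function of its argument, and these changes cancel.
  With scale \<open>w\<close> all three arguments have modulus at most \<open>w\<close>, so each
  term is at most \<open>2 * w\<close>.\<close>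

lemma log_map_almost_additive:
  assumes "0 < \<tau>"
  shows "cmod ((log_map \<tau> (a + b) - (log_map \<tau> a + log_map \<tau> b)) j) \<le> 6 * (cmod (a j) + cmod (b j))"
proof (cases "a j = 0 \<and> b j = 0")
  case False
  define w where "w = cmod (a j) + cmod (b j)"
  have w: "0 < w" using False unfolding w_def by (auto intro: add_pos_nonneg add_nonneg_pos)
  define E where "E s = s * of_real (ln (cmod s / w))" for s :: complex
  have E: "s * of_real (ln (cmod s / \<tau>)) = E s + s * of_real (ln (w / \<tau>))" for s
    using w assms by (cases "s = 0") (simp_all add: E_def ln_div algebra_simps)
  have Eb: "cmod (E s) \<le> 2 * w" if "cmod s \<le> w" for s
  proof -
    have "cmod (E s) = w * \<bar>(cmod s / w) * ln (cmod s / w)\<bar>"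
      using w by (simp add: E_def norm_mult abs_mult)
    also have "\<dots> \<le> w * 2" using w that by (intro mult_left_mono abs_x_ln_x_le_2) auto
    finally show ?thesis by simp
  qed
  have "(log_map \<tau> (a + b) - (log_map \<tau> a + log_map \<tau> b)) j = E (a j + b j) - (E (a j) + E (b j))"
    by (simp add: log_map_def E algebra_simps)
  also have "cmod \<dots> \<le> cmod (E (a j + b j)) + (cmod (E (a j)) + cmod (E (b j)))"
    by (rule order_trans[OF norm_triangle_ineq4 add_left_mono[OF norm_triangle_ineq]])
  also have "\<dots> \<le> 2 * w + (2 * w + 2 * w)"
    by (intro add_mono Eb) (auto simp: w_def norm_triangle_ineq)
  finally show ?thesis by (simp add: w_def)
qed (simp add: log_map_def)

lemma kalton_peck_0 [simp]: "kalton_peck 0 = 0"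
  by (simp add: kalton_peck_def fun_eq_iff)

lemma kalton_peck_scaleC:
  assumes "a \<in> ell2" shows "kalton_peck (c *\<^sub>C a) = c *\<^sub>C kalton_peck a"
  by (cases "c = 0") (auto simp: kalton_peck_def fun_eq_iff ell2_norm_scaleC[OF assms] norm_mult)

text \<open>A common scale \<open>\<tau>\<close>, the sum of the two norms, replaces the three
  different normalizations. The constant is three normalization errors of \<open>2 * \<tau>\<close>
  plus the additivity defect \<open>6 * \<tau>\<close>.\<close>

lemma kalton_peck_quasilinear:
  assumes a: "a \<in> ell2" and b: "b \<in> ell2"
  defines "d \<equiv> kalton_peck (a + b) - (kalton_peck a + kalton_peck b)"
  shows "d \<in> ell2" "ell2_norm d \<le> 12 * (ell2_norm a + ell2_norm b)"
proof -
  define \<tau> where "\<tau> = ell2_norm a + ell2_norm b"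
  have nn: "0 \<le> ell2_norm a" "0 \<le> ell2_norm b" using a b by (auto simp: ell2_norm_nonneg)
  have "d \<in> ell2 \<and> ell2_norm d \<le> 12 * \<tau>"
  proof (cases "\<tau> = 0")
    case True
    then have "a = 0" "b = 0" using nn a b by (auto simp: \<tau>_def ell2_norm_eq_0[symmetric])
    then have "d = 0" by (simp add: d_def kalton_peck_def fun_eq_iff)
    then show ?thesis using True by (simp only: ell2_0) simp
  next
    case False
    then have \<tau>: "0 < \<tau>" using nn by (simp add: \<tau>_def)
    define f where "f y = kalton_peck y - log_map \<tau> y" for y
    have f: "f y \<in> ell2 \<and> ell2_norm (f y) \<le> 2 * \<tau>" if "y \<in> ell2" "ell2_norm y \<le> \<tau>" for y
      using kalton_peck_approx(1)[OF that \<tau>] kalton_peck_approx'[OF that \<tau>] by (simp add: f_def)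
    define g where "g = log_map \<tau> (a + b) - (log_map \<tau> a + log_map \<tau> b)"
    have abs: "(\<lambda>j. of_real (cmod (x j))) \<in> ell2 \<and> ell2_norm (\<lambda>j. of_real (cmod (x j))) = ell2_norm x"
      if "x \<in> ell2" for x using that by (simp add: ell2_def ell2_norm_def)
    define h :: omega where "h = (\<lambda>j. of_real (cmod (a j))) + (\<lambda>j. of_real (cmod (b j)))"
    have h: "h \<in> ell2" "ell2_norm h \<le> \<tau>"
      using ell2_add[of "\<lambda>j. of_real (cmod (a j))" "\<lambda>j. of_real (cmod (b j))"] abs[OF a] abs[OF b]
      by (auto simp: h_def \<tau>_def)
    have hn: "cmod (h j) = cmod (a j) + cmod (b j)" for j
    proof -
      have "h j = of_real (cmod (a j) + cmod (b j))" by (simp add: h_def)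
      then show ?thesis by (simp only: norm_of_real) simp
    qed
    have g0: "cmod (g j) \<le> 6 * cmod (h j)" for j
      using log_map_almost_additive[OF \<tau>, of a b j] by (simp add: g_def hn)
    have g: "g \<in> ell2" "ell2_norm g \<le> 6 * \<tau>"
      using ell2_dominated[OF h(1) g0] h(2) by auto
    have fs: "f a \<in> ell2" "f b \<in> ell2" "f (a + b) \<in> ell2"
        "ell2_norm (f a) \<le> 2 * \<tau>" "ell2_norm (f b) \<le> 2 * \<tau>" "ell2_norm (f (a + b)) \<le> 2 * \<tau>"
      using f[OF a] f[OF b] f[OF ell2_add(1)[OF a b]] ell2_add(2)[OF a b] nn by (auto simp: \<tau>_def)
    have d: "d = (f (a + b) + g) - (f a + f b)"
      by (simp add: d_def f_def g_def fun_eq_iff)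
    have 1: "f (a + b) + g \<in> ell2" "ell2_norm (f (a + b) + g) \<le> 8 * \<tau>"
      using ell2_add[OF fs(3) g(1)] fs g by auto
    have 2: "f a + f b \<in> ell2" "ell2_norm (f a + f b) \<le> 4 * \<tau>"
      using ell2_add[OF fs(1,2)] fs by auto
    show ?thesis unfolding d using ell2_diff[OF 1(1) 2(1)] 1(2) 2(2) by auto
  qed
  then show "d \<in> ell2" "ell2_norm d \<le> 12 * (ell2_norm a + ell2_norm b)" by (auto simp: \<tau>_def)
qed

text \<open>The sequences \<open>a\<close> with \<open>(0, a)\<close> in the Kalton-Peck space;
  \<open>ell_M_eq\<close> shows that this is the Orlicz space \<open>ell_M\<close> in
  coordinates.\<close>

definition ellM_seq :: "omega set" where
  "ellM_seq = {a \<in> ell2. kalton_peck a \<in> ell2}"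

definition ellM_seq_norm :: "omega \<Rightarrow> real" where
  "ellM_seq_norm a = ell2_norm (kalton_peck a) + ell2_norm a"

lemma ellM_seq_norm_ge: "a \<in> ellM_seq \<Longrightarrow> ell2_norm a \<le> ellM_seq_norm a"
  by (auto simp: ellM_seq_def ellM_seq_norm_def ell2_norm_nonneg)

lemma ellM_seq_norm_nonneg: "a \<in> ellM_seq \<Longrightarrow> 0 \<le> ellM_seq_norm a"
  by (auto simp: ellM_seq_def ellM_seq_norm_def ell2_norm_nonneg)

text \<open>The quasi-linearity constant 12 plus 1 for the triangle inequality in
  \<open>ell2\<close> gives 13, the modulus of concavity used from here on.\<close>

lemma ellM_seq_add:
  assumes "a \<in> ellM_seq" "b \<in> ellM_seq"
  shows "a + b \<in> ellM_seq"
    "ellM_seq_norm (a + b) \<le> 13 * (ellM_seq_norm a + ellM_seq_norm b)"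
proof -
  have e: "a \<in> ell2" "b \<in> ell2" "kalton_peck a \<in> ell2" "kalton_peck b \<in> ell2"
    using assms by (auto simp: ellM_seq_def)
  note q = kalton_peck_quasilinear[OF e(1,2)] and s = ell2_add[OF e(3,4)]
  have k: "kalton_peck (a + b) = (kalton_peck (a + b) - (kalton_peck a + kalton_peck b)) +
      (kalton_peck a + kalton_peck b)" by simp
  note t = ell2_add[OF q(1) s(1), folded k]
  show "a + b \<in> ellM_seq" using t(1) ell2_add[OF e(1,2)] by (simp add: ellM_seq_def)
  have nn: "0 \<le> ell2_norm a" "0 \<le> ell2_norm b" "0 \<le> ell2_norm (kalton_peck a)"
     "0 \<le> ell2_norm (kalton_peck b)" using e by (auto simp: ell2_norm_nonneg)
  show "ellM_seq_norm (a + b) \<le> 13 * (ellM_seq_norm a + ellM_seq_norm b)"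
    using t(2) q(2) s(2) nn ell2_add(2)[OF e(1,2)] unfolding ellM_seq_norm_def
    by (simp add: algebra_simps)
qed

lemma ellM_seq_scaleC:
  assumes "a \<in> ellM_seq"
  shows "c *\<^sub>C a \<in> ellM_seq" "ellM_seq_norm (c *\<^sub>C a) = cmod c * ellM_seq_norm a"
  using assms by (auto simp: ellM_seq_def ellM_seq_norm_def kalton_peck_scaleC ell2_scaleC
      ell2_norm_scaleC algebra_simps)

lemma ellM_seq_uminus:
  assumes "a \<in> ellM_seq" shows "- a \<in> ellM_seq" "ellM_seq_norm (- a) = ellM_seq_norm a"
proof -
  have "- a = (-1) *\<^sub>C a" by (simp add: fun_eq_iff)
  then show "- a \<in> ellM_seq" "ellM_seq_norm (- a) = ellM_seq_norm a"
    using ellM_seq_scaleC[OF assms, of "-1"] by auto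
qed

lemma ellM_seq_diff: "a \<in> ellM_seq \<Longrightarrow> b \<in> ellM_seq \<Longrightarrow> a - b \<in> ellM_seq"
  using ellM_seq_add(1)[of a "- b"] ellM_seq_uminus(1)[of b] by simp

lemma c00_ellM_seq: "c00 \<subseteq> ellM_seq"
proof
  fix a assume a: "a \<in> c00"
  then have "kalton_peck a \<in> c00"
    unfolding c00_def kalton_peck_def by (auto elim: rev_finite_subset)
  then show "a \<in> ellM_seq" using a c00_ell2 by (auto simp: ellM_seq_def)
qed

lemma isCont_mult_ln_cmod: "isCont (\<lambda>z. z * of_real (ln (cmod z))) z"
proof (cases "z = 0")
  case True
  have "((\<lambda>z. z * of_real (ln (cmod z))) \<longlongrightarrow> 0) (at 0)"
  proof (rule Lim_null_comparison)
    have "\<forall>\<^sub>F z::complex in at 0. cmod z < 1"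
      by (auto simp: eventually_at intro!: exI[of _ 1])
    then show "\<forall>\<^sub>F z in at 0. norm (z * of_real (ln (cmod z))) \<le> 2 * sqrt (cmod z)"
      by eventually_elim (use abs_x_ln_x_le in \<open>auto simp: norm_mult abs_mult\<close>)
    show "((\<lambda>z::complex. 2 * sqrt (cmod z)) \<longlongrightarrow> 0) (at 0)"
      by (rule tendsto_eq_intros | simp)+
  qed
  then show ?thesis using True by (simp add: isCont_def)
qed (auto intro!: continuous_intros)

text \<open>Away from the zero sequence the normalizing norm has a positive limit, and the
  coordinate splits into \<open>z * ln (cmod z)\<close>, continuous even at 0, minus
  \<open>z\<close> times the logarithm of the norm. At the zero sequence the second term has no
  limit to compare with, hence \<open>l \<noteq> 0\<close>.\<close>

lemma kalton_peck_tendsto: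
  assumes "\<And>j. (\<lambda>n. x n j) \<longlonglongrightarrow> l j" "(\<lambda>n. ell2_norm (x n)) \<longlonglongrightarrow> ell2_norm l"
    and "l \<in> ell2" "\<And>n. x n \<in> ell2" "l \<noteq> 0"
  shows "(\<lambda>n. kalton_peck (x n) j) \<longlonglongrightarrow> kalton_peck l j"
proof -
  have pos: "0 < ell2_norm l" using ell2_norm_eq_0[of l] ell2_norm_nonneg[of l] assms(3,5) by auto
  define K where "K \<sigma> z = z * of_real (ln (cmod z)) - z * of_real (ln \<sigma>)" for \<sigma> z
  have K: "kalton_peck y j = K (ell2_norm y) (y j)" if "0 < ell2_norm y" for y
    using that by (cases "y j = 0") (auto simp: kalton_peck_def K_def ln_div algebra_simps)
  have "(\<lambda>n. x n j * of_real (ln (cmod (x n j)))) \<longlonglongrightarrow> l j * of_real (ln (cmod (l j)))"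
    using isCont_tendsto_compose[OF isCont_mult_ln_cmod assms(1)] .
  then have "(\<lambda>n. K (ell2_norm (x n)) (x n j)) \<longlonglongrightarrow> K (ell2_norm l) (l j)"
    unfolding K_def
    by (rule tendsto_diff[OF _ tendsto_mult[OF assms(1) tendsto_of_real[OF tendsto_ln[OF assms(2)]]]])
       (use pos in auto)
  moreover have "\<forall>\<^sub>F n in sequentially. K (ell2_norm (x n)) (x n j) = kalton_peck (x n) j"
    using order_tendstoD(1)[OF assms(2) pos] by eventually_elim (simp add: K)
  ultimately show ?thesis using K[OF pos] by (simp add: tendsto_cong)
qed

lemma ell2_norm_tendsto:
  assumes "(\<lambda>n. ell2_norm (x n - l)) \<longlonglongrightarrow> 0" "l \<in> ell2" "\<And>n. x n \<in> ell2"
  shows "(\<lambda>n. ell2_norm (x n)) \<longlonglongrightarrow> ell2_norm l" "(\<lambda>n. x n j) \<longlonglongrightarrow> l j"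
proof -
  have "\<bar>ell2_norm (x n) - ell2_norm l\<bar> \<le> ell2_norm (x n - l)" for n
    using ell2_add(2)[of "x n - l" l] ell2_add(2)[of "l - x n" "x n"] ell2_diff(1) assms(2,3)
    by (simp add: ell2_norm_minus_commute[of l] abs_le_iff)
  then have "(\<lambda>n. ell2_norm (x n) - ell2_norm l) \<longlonglongrightarrow> 0"
    by (intro Lim_null_comparison[OF _ assms(1)]) auto
  then show "(\<lambda>n. ell2_norm (x n)) \<longlonglongrightarrow> ell2_norm l" by (simp add: LIM_zero_iff)
  have "norm (x n j - l j) \<le> ell2_norm (x n - l)" for n
    using norm_component_le_ell2_norm[of "x n - l" j] ell2_diff(1) assms by simp
  then have "(\<lambda>n. x n j - l j) \<longlonglongrightarrow> 0"
    by (intro Lim_null_comparison[OF _ assms(1)]) auto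
  then show "(\<lambda>n. x n j) \<longlonglongrightarrow> l j" by (simp add: LIM_zero_iff)
qed

text \<open>The \<open>ell2\<close> limit is the candidate. Lower semicontinuity is applied to
  \<open>x m - x n\<close> and to its Kalton-Peck image as \<open>n\<close> grows; indices with
  \<open>x m = l\<close> are treated apart, because coordinatewise continuity is available only at
  nonzero limits.\<close>

lemma ellM_seq_complete:
  assumes x: "\<And>n. x n \<in> ellM_seq"
    and C: "\<And>\<epsilon>. \<epsilon> > 0 \<Longrightarrow> \<exists>M. \<forall>m\<ge>M. \<forall>n\<ge>M. ellM_seq_norm (x m - x n) < \<epsilon>"
  shows "\<exists>l\<in>ellM_seq. (\<lambda>n. ellM_seq_norm (x n - l)) \<longlonglongrightarrow> 0"
proof -
  have x2: "x n \<in> ell2" for n using x by (auto simp: ellM_seq_def)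
  have xd: "x m - x n \<in> ellM_seq" for m n by (intro ellM_seq_diff x)
  have "\<exists>M. \<forall>m\<ge>M. \<forall>n\<ge>M. ell2_norm (x m - x n) < \<epsilon>" if "\<epsilon> > 0" for \<epsilon>
    using C[OF that] ellM_seq_norm_ge[OF xd] by (meson le_less_trans)
  with x2 have "\<exists>l\<in>ell2. (\<lambda>n. ell2_norm (x n - l)) \<longlonglongrightarrow> 0" by (rule ell2_complete)
  then obtain l where
    l: "l \<in> ell2" "(\<lambda>n. ell2_norm (x n - l)) \<longlonglongrightarrow> 0" by (elim bexE)
  have *: "\<exists>M. \<forall>m\<ge>M. x m - l \<in> ellM_seq \<and> ellM_seq_norm (x m - l) \<le> \<epsilon>" if "\<epsilon> > 0" for \<epsilon>
  proof -
    obtain M where M: "\<forall>m\<ge>M. \<forall>n\<ge>M. ellM_seq_norm (x m - x n) < \<epsilon> / 2"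
      using C[of "\<epsilon> / 2"] \<open>\<epsilon> > 0\<close> by auto
    have "x m - l \<in> ellM_seq \<and> ellM_seq_norm (x m - l) \<le> \<epsilon>" if m: "m \<ge> M" for m
    proof (cases "x m - l = 0")
      case True
      moreover have "0 \<in> ellM_seq" "ellM_seq_norm 0 = 0"
        by (simp_all only: ellM_seq_def ellM_seq_norm_def kalton_peck_0 ell2_0 mem_Collect_eq simp_thms)
      ultimately show ?thesis using \<open>\<epsilon> > 0\<close> by simp
    next
      case False
      have d: "(\<lambda>n. ell2_norm ((x m - x n) - (x m - l))) \<longlonglongrightarrow> 0"
        using l(2) by (simp add: ell2_norm_minus_commute)
      have m2: "x m - x n \<in> ell2" "x m - l \<in> ell2" for n using l(1) x2 by (auto intro: ell2_diff)
      note t = ell2_norm_tendsto[OF d m2(2) m2(1)]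
      have k: "(\<lambda>n. kalton_peck (x m - x n) j) \<longlonglongrightarrow> kalton_peck (x m - l) j" for j
        by (rule kalton_peck_tendsto[OF t(2) t(1) m2(2) m2(1) False])
      have b: "kalton_peck (x m - x n) \<in> ell2 \<and> ell2_norm (kalton_peck (x m - x n)) \<le> \<epsilon> / 2 \<and>
          x m - x n \<in> ell2 \<and> ell2_norm (x m - x n) \<le> \<epsilon> / 2" if "n \<ge> M" for n
      proof -
        have "ellM_seq_norm (x m - x n) < \<epsilon> / 2" using M m that by blast
        then show ?thesis using xd[of m n] ell2_norm_nonneg[of "x m - x n"]
            ell2_norm_nonneg[of "kalton_peck (x m - x n)"]
          by (simp add: ellM_seq_def ellM_seq_norm_def)
      qed
      have a: "\<forall>\<^sub>F n in sequentially. kalton_peck (x m - x n) \<in> ell2 \<and> ell2_norm (kalton_peck (x m - x n)) \<le> \<epsilon> / 2"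
        "\<forall>\<^sub>F n in sequentially. x m - x n \<in> ell2 \<and> ell2_norm (x m - x n) \<le> \<epsilon> / 2"
        using b unfolding eventually_sequentially by blast+
      have "(\<lambda>n. (x m - x n) j) \<longlonglongrightarrow> (x m - l) j" for j by (rule t(2))
      from ell2_lower_semicont[OF k a(1)] ell2_lower_semicont[where l = "x m - l", OF this a(2)]
      show ?thesis by (auto simp: ellM_seq_def ellM_seq_norm_def)
    qed
    then show ?thesis by blast
  qed
  obtain n where "x n - l \<in> ellM_seq" using *[of 1] by auto
  then have "l \<in> ellM_seq" using ellM_seq_diff[of "x n" "x n - l"] x by simp
  moreover have "(\<lambda>n. ellM_seq_norm (x n - l)) \<longlonglongrightarrow> 0"
  proof (rule LIMSEQ_I)
    fix r :: real assume "r > 0"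
    then obtain M where "\<forall>n\<ge>M. x n - l \<in> ellM_seq \<and> ellM_seq_norm (x n - l) \<le> r / 2"
      using *[of "r / 2"] by auto
    with \<open>r > 0\<close> show "\<exists>M. \<forall>n\<ge>M. norm (ellM_seq_norm (x n - l) - 0) < r"
      by (intro exI[of _ M]) (auto simp: ellM_seq_norm_nonneg intro: le_less_trans)
  qed
  ultimately show ?thesis by blast
qed

lemma ellM_seq_tail_tendsto:
  assumes "a \<in> ellM_seq" shows "(\<lambda>n. ellM_seq_norm (restr {n..} a)) \<longlonglongrightarrow> 0"
proof (cases "a = 0")
  case True
  have "ellM_seq_norm 0 = 0" by (simp only: ellM_seq_norm_def kalton_peck_0 ell2_0)
  then show ?thesis using True by (simp only: restr_0) simp
next
  case False
  have a: "a \<in> ell2" "kalton_peck a \<in> ell2" using assms by (auto simp: ellM_seq_def)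
  define \<tau> where "\<tau> = ell2_norm a"
  have \<tau>: "0 < \<tau>" unfolding \<tau>_def using a(1) False ell2_norm_eq_0[of a] ell2_norm_nonneg[of a] by auto
  define r where "r n = restr {n..} a" for n
  have r: "r n \<in> ell2" "ell2_norm (r n) \<le> \<tau>" for n unfolding r_def \<tau>_def by (rule restr_ell2[OF a(1)])+
  have r0: "(\<lambda>n. ell2_norm (r n)) \<longlonglongrightarrow> 0" unfolding r_def by (rule ell2_tail_tendsto[OF a(1)])
  have lm: "log_map \<tau> (r n) = restr {n..} (kalton_peck a)" for n
    by (auto simp: log_map_def r_def restr_def kalton_peck_def \<tau>_def fun_eq_iff)
  have le: "ellM_seq_norm (r n) \<le> 2 * \<tau> * sqrt (ell2_norm (r n) / \<tau>) +
      ell2_norm (restr {n..} (kalton_peck a)) + ell2_norm (r n)" for n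
  proof -
    note k = kalton_peck_approx[OF r \<tau>, of n]
    have "log_map \<tau> (r n) \<in> ell2" using restr_ell2[OF a(2)] by (simp add: lm)
    from ell2_add(2)[OF k(1) this] k(2) show ?thesis by (simp add: ellM_seq_norm_def lm)
  qed
  have "(\<lambda>n. 2 * \<tau> * sqrt (ell2_norm (r n) / \<tau>) +
      ell2_norm (restr {n..} (kalton_peck a)) + ell2_norm (r n)) \<longlonglongrightarrow> 2 * \<tau> * sqrt (0 / \<tau>) + 0 + 0"
    using r0 ell2_tail_tendsto[OF a(2)] \<tau> by (intro tendsto_intros) auto
  then have lim: "(\<lambda>n. 2 * \<tau> * sqrt (ell2_norm (r n) / \<tau>) +
      ell2_norm (restr {n..} (kalton_peck a)) + ell2_norm (r n)) \<longlonglongrightarrow> 0" by simp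
  have nn: "0 \<le> ellM_seq_norm (r n)" for n
  proof -
    have "restr {n..} (kalton_peck a) + (kalton_peck (r n) - log_map \<tau> (r n)) \<in> ell2"
      by (intro ell2_add restr_ell2 a kalton_peck_approx r \<tau>)
    then have "kalton_peck (r n) \<in> ell2" by (simp add: lm)
    then show ?thesis using r by (auto simp: ellM_seq_norm_def ell2_norm_nonneg)
  qed
  have "(\<lambda>n. ellM_seq_norm (r n)) \<longlonglongrightarrow> 0"
    using nn le by (intro tendsto_sandwich[OF _ _ tendsto_const lim]) auto
  then show ?thesis by (simp add: r_def)
qed


subsection \<open>Completions\<close>

text \<open>The norm \<open>L\<close> is carried over to \<open>W\<close> by \<open>K w\<close>, the
  limit of \<open>L\<close> along approximations \<open>T a\<close> of \<open>w\<close>. Since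
  \<open>L\<close> is subadditive, \<open>K\<close> is a genuine norm even where \<open>M\<close>
  satisfies only a quasi-triangle inequality with \<open>\<kappa>\<close>; it is equivalent to
  \<open>M\<close> and inherits completeness.\<close>

lemma completion_isomorphic_toI:
  fixes W :: "'w::complex_vector set" and M :: "'w \<Rightarrow> real" and T :: "omega \<Rightarrow> 'w"
  assumes W: "complex_vector.subspace W"
    and M_tri: "\<And>x y. x \<in> W \<Longrightarrow> y \<in> W \<Longrightarrow> M (x + y) \<le> \<kappa> * (M x + M y)"
    and M_scale: "\<And>c x. x \<in> W \<Longrightarrow> M (c *\<^sub>C x) = cmod c * M x"
    and M_pos: "\<And>x. x \<in> W \<Longrightarrow> 0 \<le> M x" "\<And>x. x \<in> W \<Longrightarrow> M x = 0 \<Longrightarrow> x = 0"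
    and M_complete: "\<And>x::nat \<Rightarrow> 'w. (\<And>n. x n \<in> W) \<Longrightarrow>
        (\<And>\<epsilon>. \<epsilon> > 0 \<Longrightarrow> \<exists>k. \<forall>m\<ge>k. \<forall>n\<ge>k. M (x m - x n) < \<epsilon>) \<Longrightarrow>
        \<exists>l\<in>W. (\<lambda>n. M (x n - l)) \<longlonglongrightarrow> 0"
    and T: "linear_map_on c00 T" "\<And>a. a \<in> c00 \<Longrightarrow> T a \<in> W"
    and dense: "\<And>w \<epsilon>. w \<in> W \<Longrightarrow> \<epsilon> > 0 \<Longrightarrow> \<exists>a\<in>c00. M (w - T a) < \<epsilon>"
    and L_tri: "\<And>a b. a \<in> c00 \<Longrightarrow> b \<in> c00 \<Longrightarrow> L (a + b) \<le> L a + L b"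
    and L_scale: "\<And>c a. a \<in> c00 \<Longrightarrow> L (c *\<^sub>C a) = cmod c * L a"
    and L_bds: "0 < c" "0 < C" "0 < \<kappa>" "\<And>a. a \<in> c00 \<Longrightarrow> c * M (T a) \<le> L a"
      "\<And>a. a \<in> c00 \<Longrightarrow> L a \<le> C * M (T a)"
  shows "completion_isomorphic_to c00 L W M"
proof -
  note Wcl = complex_vector.subspace_add[OF W] complex_vector.subspace_diff[OF W]
    complex_vector.subspace_scale[OF W] complex_vector.subspace_0[OF W]
  have T_add: "T (a + b) = T a + T b" if "a \<in> c00" "b \<in> c00" for a b
    using T(1) that by (auto simp: linear_map_on_def)
  have T_scale: "T (d *\<^sub>C a) = d *\<^sub>C T a" if "a \<in> c00" for a d
    using T(1) that by (auto simp: linear_map_on_def)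
  have T_diff: "T (a - b) = T a - T b" if "a \<in> c00" "b \<in> c00" for a b
    using T_add[OF c00_diff[OF that] that(2)] by (simp add: algebra_simps)
  have M_minus: "M (x - y) = M (y - x)" if "x \<in> W" "y \<in> W" for x y
    using M_scale[of "y - x" "-1"] that Wcl by simp
  have M_diff: "M (x - y) \<le> \<kappa> * (M (x - z) + M (z - y))" if "x \<in> W" "y \<in> W" "z \<in> W" for x y z
    using M_tri[of "x - z" "z - y"] that Wcl by simp
  have L_diff: "\<bar>L a - L b\<bar> \<le> L (a - b)" if "a \<in> c00" "b \<in> c00" for a b
  proof -
    have "(-1) *\<^sub>C (a - b) = b - a" by (simp add: fun_eq_iff)
    with L_scale[OF c00_diff[OF that], of "-1"] have "L (b - a) = L (a - b)" by simp
    then show ?thesis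
      using L_tri[OF c00_diff[OF that] that(2)] L_tri[OF c00_diff[OF that(2,1)] that(1)] by simp
  qed
  define X where "X w n = (SOME a. a \<in> c00 \<and> M (w - T a) < inverse (Suc n))" for w n
  have X: "X w n \<in> c00 \<and> M (w - T (X w n)) < inverse (Suc n)" if "w \<in> W" for w n
  proof -
    have "0 < inverse (real (Suc n))" by simp
    from dense[OF that this] have "\<exists>a. a \<in> c00 \<and> M (w - T a) < inverse (Suc n)" by blast
    then show ?thesis unfolding X_def by (rule someI_ex)
  qed
  have X1: "X w n \<in> c00" if "w \<in> W" for w n using X[OF that] by blast
  have X_lim: "(\<lambda>n. M (w - T (X w n))) \<longlonglongrightarrow> 0" if "w \<in> W" for w
  proof (rule tendsto_sandwich[OF _ _ tendsto_const LIMSEQ_inverse_real_of_nat])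
    show "\<forall>\<^sub>F n in sequentially. 0 \<le> M (w - T (X w n))"
      using X[OF that] that by (intro always_eventually allI M_pos(1) Wcl(2) T(2)) auto
    show "\<forall>\<^sub>F n in sequentially. M (w - T (X w n)) \<le> inverse (real (Suc n))"
      using X[OF that] by (intro always_eventually allI less_imp_le) blast
  qed
  define K where "K w = lim (\<lambda>n. L (X w n))" for w
  \<comment> \<open>Subadditivity turns closeness in \<open>M\<close> into closeness of the values
    of \<open>L\<close>. Hence \<open>L\<close> is Cauchy along approximations of \<open>w\<close>,
    and \<open>lim_K\<close> will show that the limit does not depend on their choice.\<close>
  have close: "\<bar>L a - L b\<bar> \<le> C * \<kappa> * (M (w - T a) + M (w - T b))"
    if "a \<in> c00" "b \<in> c00" "w \<in> W" for a b w
  proof -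
    have "\<bar>L a - L b\<bar> \<le> C * M (T a - T b)"
      using L_diff[OF that(1,2)] L_bds(5)[OF c00_diff[OF that(1,2)]] T_diff[OF that(1,2)] by simp
    also have "\<dots> \<le> C * (\<kappa> * (M (T a - w) + M (w - T b)))"
      using M_diff[of "T a" "T b" w] T(2) that L_bds by (intro mult_left_mono) auto
    finally show ?thesis using M_minus[of w "T a"] T(2) that by (simp add: mult_ac)
  qed
  have X_K: "(\<lambda>n. L (X w n)) \<longlonglongrightarrow> K w" if w: "w \<in> W" for w
  proof -
    have "Cauchy (\<lambda>n. L (X w n))"
    proof (rule metric_CauchyI)
      fix \<epsilon> :: real assume "\<epsilon> > 0"
      define \<delta> where "\<delta> = \<epsilon> / (2 * (C * \<kappa>))"
      have "\<delta> > 0" using \<open>\<epsilon> > 0\<close> L_bds by (simp add: \<delta>_def)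
      then obtain k where k: "\<And>n. n \<ge> k \<Longrightarrow> M (w - T (X w n)) < \<delta>"
        using order_tendstoD(2)[OF X_lim[OF w]] by (auto simp: eventually_sequentially)
      have "dist (L (X w m)) (L (X w n)) < \<epsilon>" if "m \<ge> k" "n \<ge> k" for m n
      proof -
        have "dist (L (X w m)) (L (X w n)) \<le> C * \<kappa> * (M (w - T (X w m)) + M (w - T (X w n)))"
          using close[of "X w m" "X w n" w] X w by (simp add: dist_real_def)
        also have "\<dots> < C * \<kappa> * (\<delta> + \<delta>)"
          using k that L_bds by (intro mult_strict_left_mono add_strict_mono) auto
        also have "\<dots> = \<epsilon>" using L_bds by (simp add: \<delta>_def)
        finally show ?thesis .
      qed
      then show "\<exists>k. \<forall>m\<ge>k. \<forall>n\<ge>k. dist (L (X w m)) (L (X w n)) < \<epsilon>" by blast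
    qed
    then show ?thesis unfolding K_def by (simp add: Cauchy_convergent_iff convergent_LIMSEQ_iff)
  qed
  have lim_K: "(\<lambda>n. L (a n)) \<longlonglongrightarrow> K w"
    if w: "w \<in> W" and a: "\<And>n. a n \<in> c00" "(\<lambda>n. M (w - T (a n))) \<longlonglongrightarrow> 0" for w a
  proof -
    have "(\<lambda>n. C * \<kappa> * (M (w - T (a n)) + M (w - T (X w n)))) \<longlonglongrightarrow> C * \<kappa> * (0 + 0)"
      by (intro tendsto_intros a X_lim w)
    then have lim0: "(\<lambda>n. C * \<kappa> * (M (w - T (a n)) + M (w - T (X w n)))) \<longlonglongrightarrow> 0" by simp
    have "norm (L (a n) - L (X w n)) \<le> C * \<kappa> * (M (w - T (a n)) + M (w - T (X w n)))" for n
      unfolding real_norm_def by (rule close[OF a(1) X1[OF w] w])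
    then have "(\<lambda>n. L (a n) - L (X w n)) \<longlonglongrightarrow> 0"
      by (intro Lim_null_comparison[OF always_eventually lim0] allI)
    from tendsto_add[OF this X_K[OF w]] show ?thesis by simp
  qed
  have K_lower: "M w \<le> \<kappa> / c * K w" if w: "w \<in> W" for w
  proof (rule LIMSEQ_le_const)
    have "(\<lambda>n. \<kappa> * (M (w - T (X w n)) + L (X w n) / c)) \<longlonglongrightarrow> \<kappa> * (0 + K w / c)"
      using L_bds by (intro tendsto_intros X_lim X_K w) auto
    then show "(\<lambda>n. \<kappa> * (M (w - T (X w n)) + L (X w n) / c)) \<longlonglongrightarrow> \<kappa> / c * K w" by simp
    have "M w \<le> \<kappa> * (M (w - T (X w n)) + L (X w n) / c)" for n
    proof -
      have "M w \<le> \<kappa> * (M (w - T (X w n)) + M (T (X w n)))"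
        using M_tri[of "w - T (X w n)" "T (X w n)"] X[OF w, of n] T(2) w Wcl by simp
      also have "\<dots> \<le> \<kappa> * (M (w - T (X w n)) + L (X w n) / c)"
        using L_bds(1,3) L_bds(4)[of "X w n"] X[OF w, of n]
        by (intro mult_left_mono add_left_mono) (auto simp: field_simps)
      finally show ?thesis .
    qed
    then show "\<exists>N. \<forall>n\<ge>N. M w \<le> \<kappa> * (M (w - T (X w n)) + L (X w n) / c)" by blast
  qed
  have K_upper: "K w \<le> C * \<kappa> * M w" if w: "w \<in> W" for w
  proof (rule LIMSEQ_le[OF X_K[OF w]])
    have "(\<lambda>n. C * (\<kappa> * (M (w - T (X w n)) + M w))) \<longlonglongrightarrow> C * (\<kappa> * (0 + M w))"
      by (intro tendsto_intros X_lim w)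
    then show "(\<lambda>n. C * (\<kappa> * (M (w - T (X w n)) + M w))) \<longlonglongrightarrow> C * \<kappa> * M w" by (simp add: mult.assoc)
    have "L (X w n) \<le> C * (\<kappa> * (M (w - T (X w n)) + M w))" for n
    proof -
      have "L (X w n) \<le> C * M (T (X w n))" by (rule L_bds(5)[OF X1[OF w]])
      also have "M (T (X w n)) \<le> \<kappa> * (M (T (X w n) - w) + M w)"
        using M_tri[of "T (X w n) - w" w] X[OF w, of n] T(2) w Wcl by simp
      also have "M (T (X w n) - w) = M (w - T (X w n))"
        using M_minus X[OF w, of n] T(2) w by simp
      finally show ?thesis using L_bds by simp
    qed
    then show "\<exists>N. \<forall>n\<ge>N. L (X w n) \<le> C * (\<kappa> * (M (w - T (X w n)) + M w))" by blast
  qed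
  have M0: "M 0 = 0" using M_scale[of 0 0] Wcl by simp
  have K_T: "K (T a) = L a" if "a \<in> c00" for a
    using lim_K[of "T a" "\<lambda>_. a"] that T(2) M0 by (simp add: LIMSEQ_const_iff)
  have K_nonneg: "0 \<le> K w" if "w \<in> W" for w
  proof -
    have "0 \<le> \<kappa> / c * K w" using K_lower[OF that] M_pos(1)[OF that] by linarith
    then have "0 \<le> K w * (\<kappa> / c)" by (simp only: mult.commute)
    moreover have "0 < \<kappa> / c" using L_bds by simp
    ultimately show ?thesis using zero_le_mult_iff by (metis not_less)
  qed
  have K_norm: "norm_on W K"
    unfolding norm_on_def
  proof (intro conjI ballI allI)
    fix x assume x: "x \<in> W"
    show "0 \<le> K x" by (rule K_nonneg[OF x])
    show "(K x = 0) = (x = 0)"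
      using K_lower[OF x] K_upper[OF x] M_pos[OF x] M0 K_nonneg[OF x] by auto
    show "K (d *\<^sub>C x) = cmod d * K x" for d
    proof -
      have "(\<lambda>n. L (d *\<^sub>C X x n)) \<longlonglongrightarrow> K (d *\<^sub>C x)"
      proof (rule lim_K)
        have "M (d *\<^sub>C x - T (d *\<^sub>C X x n)) = cmod d * M (x - T (X x n))" for n
          using X[OF x, of n] T(2) x Wcl
          by (simp add: T_scale complex_vector.scale_right_diff_distrib[symmetric] M_scale)
        then show "(\<lambda>n. M (d *\<^sub>C x - T (d *\<^sub>C X x n))) \<longlonglongrightarrow> 0"
          using tendsto_mult_left[OF X_lim[OF x], of "cmod d"] by simp
      qed (intro x X1 Wcl c00_scaleC)+
      moreover have "(\<lambda>n. cmod d * L (X x n)) \<longlonglongrightarrow> cmod d * K x"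
        by (intro tendsto_intros X_K x)
      ultimately show ?thesis using L_scale[OF X1[OF x]] LIMSEQ_unique by simp
    qed
    fix y assume y: "y \<in> W"
    show "K (x + y) \<le> K x + K y"
    proof (rule LIMSEQ_le)
      show "(\<lambda>n. L (X x n + X y n)) \<longlonglongrightarrow> K (x + y)"
      proof (rule lim_K)
        have "M (x + y - T (X x n + X y n)) \<le> \<kappa> * (M (x - T (X x n)) + M (y - T (X y n)))" for n
          using M_tri[of "x - T (X x n)" "y - T (X y n)"] X[OF x, of n] X[OF y, of n] T(2) x y Wcl
          by (simp add: T_add algebra_simps)
        moreover have "0 \<le> M (x + y - T (X x n + X y n))" for n
          using X[OF x, of n] X[OF y, of n] T(2) x y Wcl by (intro M_pos) (simp add: T_add)
        moreover have "(\<lambda>n. \<kappa> * (M (x - T (X x n)) + M (y - T (X y n)))) \<longlonglongrightarrow> \<kappa> * (0 + 0)"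
          by (intro tendsto_intros X_lim x y)
        ultimately show "(\<lambda>n. M (x + y - T (X x n + X y n))) \<longlonglongrightarrow> 0"
          by (rule_tac Lim_null_comparison[of _ "\<lambda>n. \<kappa> * (M (x - T (X x n)) + M (y - T (X y n)))"]) simp_all
      qed (intro x y X1 Wcl c00_add)+
      show "(\<lambda>n. L (X x n) + L (X y n)) \<longlonglongrightarrow> K x + K y"
        by (intro tendsto_intros X_K x y)
      show "\<exists>N. \<forall>n\<ge>N. L (X x n + X y n) \<le> L (X x n) + L (X y n)"
        using L_tri[OF X1[OF x] X1[OF y]] by blast
    qed
  qed (rule W)
  have K_banach: "banach_on W K"
    unfolding banach_on_def
  proof (intro conjI allI impI K_norm)
    fix x :: "nat \<Rightarrow> 'w"
    assume x: "range x \<subseteq> W" and c: "\<forall>\<epsilon>>0. \<exists>k. \<forall>m\<ge>k. \<forall>n\<ge>k. K (x m - x n) < \<epsilon>"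
    have xW: "x n \<in> W" for n using x by auto
    have "\<exists>l\<in>W. (\<lambda>n. M (x n - l)) \<longlonglongrightarrow> 0"
    proof (rule M_complete[OF xW])
      fix \<epsilon> :: real assume "\<epsilon> > 0"
      then have "\<epsilon> * c / \<kappa> > 0" using L_bds by simp
      then obtain k where k: "\<forall>m\<ge>k. \<forall>n\<ge>k. K (x m - x n) < \<epsilon> * c / \<kappa>" using c by blast
      have "M (x m - x n) < \<epsilon>" if "m \<ge> k" "n \<ge> k" for m n
      proof -
        have "M (x m - x n) \<le> \<kappa> / c * K (x m - x n)" by (rule K_lower[OF Wcl(2)[OF xW xW]])
        also have "\<dots> < \<kappa> / c * (\<epsilon> * c / \<kappa>)" using k that L_bds by (intro mult_strict_left_mono) auto
        finally show ?thesis using L_bds by simp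
      qed
      then show "\<exists>k. \<forall>m\<ge>k. \<forall>n\<ge>k. M (x m - x n) < \<epsilon>" by blast
    qed
    then obtain l where l: "l \<in> W" "(\<lambda>n. M (x n - l)) \<longlonglongrightarrow> 0" by (elim bexE)
    have "(\<lambda>n. K (x n - l)) \<longlonglongrightarrow> 0"
    proof (rule Lim_null_comparison)
      show "\<forall>\<^sub>F n in sequentially. norm (K (x n - l)) \<le> C * \<kappa> * M (x n - l)"
        using K_upper[OF Wcl(2)[OF xW l(1)]] K_nonneg[OF Wcl(2)[OF xW l(1)]] by simp
      show "(\<lambda>n. C * \<kappa> * M (x n - l)) \<longlonglongrightarrow> 0" using tendsto_mult_right_zero[OF l(2)] by simp
    qed
    then show "\<exists>l\<in>W. (\<lambda>n. K (x n - l)) \<longlonglongrightarrow> 0" using l by blast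
  qed
  have "is_completion c00 L W K"
    unfolding is_completion_def
  proof (intro conjI exI[of _ T] K_banach T(1) ballI allI impI)
    show "T ` c00 \<subseteq> W" using T(2) by auto
    show "K (T x) = L x" if "x \<in> c00" for x by (rule K_T[OF that])
    fix s \<epsilon> assume s: "s \<in> W" and \<epsilon>: "(0::real) < \<epsilon>"
    then obtain a where a: "a \<in> c00" "M (s - T a) < \<epsilon> / (C * \<kappa>)"
      using dense[OF s, of "\<epsilon> / (C * \<kappa>)"] L_bds by auto
    have "K (s - T a) \<le> C * \<kappa> * M (s - T a)" by (rule K_upper[OF Wcl(2)[OF s T(2)[OF a(1)]]])
    also have "\<dots> < C * \<kappa> * (\<epsilon> / (C * \<kappa>))" using a L_bds by (intro mult_strict_left_mono) auto
    finally show "\<exists>x\<in>c00. K (s - T x) < \<epsilon>" using a L_bds by auto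
  qed
  moreover have "isomorphic_spaces W K W M"
    unfolding isomorphic_spaces_def
  proof (intro exI[of _ id] conjI)
    show "linear_map_on W (id :: 'w \<Rightarrow> 'w)" by (simp add: linear_map_on_def)
    show "equivalent_on W (\<lambda>x. M (id x)) K"
      unfolding equivalent_on_def
    proof (intro exI conjI ballI)
      show "0 < 1 / (C * \<kappa>)" "0 < \<kappa> / c" using L_bds by auto
      fix x assume "x \<in> W"
      then show "1 / (C * \<kappa>) * K x \<le> M (id x)" "M (id x) \<le> \<kappa> / c * K x"
        using K_upper K_lower L_bds by (auto simp: field_simps)
    qed
  qed auto
  ultimately show ?thesis unfolding completion_isomorphic_to_def by blast
qed

text \<open>The condition on the averages makes the summation functional discontinuous; therefore adding
  its absolute value to the norm enlarges the completion by one dimension.\<close>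

locale quasi_sequence_space =
  fixes S :: "omega set" and G :: "omega \<Rightarrow> real" and \<kappa> :: real
  assumes S_add: "a \<in> S \<Longrightarrow> b \<in> S \<Longrightarrow> a + b \<in> S \<and> G (a + b) \<le> \<kappa> * (G a + G b)"
    and S_scale: "a \<in> S \<Longrightarrow> c *\<^sub>C a \<in> S \<and> G (c *\<^sub>C a) = cmod c * G a"
    and G_ge: "a \<in> S \<Longrightarrow> cmod (a j) \<le> G a"
    and S_complete: "(\<And>n. x n \<in> S) \<Longrightarrow>
        (\<And>\<epsilon>. \<epsilon> > 0 \<Longrightarrow> \<exists>k. \<forall>m\<ge>k. \<forall>n\<ge>k. G (x m - x n) < \<epsilon>) \<Longrightarrow>
        \<exists>l\<in>S. (\<lambda>n. G (x n - l)) \<longlonglongrightarrow> 0"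
    and c00_S: "c00 \<subseteq> S"
    and tail: "a \<in> S \<Longrightarrow> (\<lambda>n. G (restr {n..} a)) \<longlonglongrightarrow> 0"
    and shift: "a \<in> c00 \<Longrightarrow> G (case_nat 0 a) = G a"
    and average: "(\<lambda>m. G (\<lambda>j. if j < m then 1 / of_nat m else 0)) \<longlonglongrightarrow> 0"
begin

lemma \<kappa>_pos: "0 < \<kappa>"
proof (rule ccontr)
  assume "\<not> 0 < \<kappa>"
  have u: "unit_seq 0 \<in> S" using unit_seq_c00 c00_S by blast
  have "1 \<le> G (unit_seq 0)" using G_ge[OF u, of 0] by (simp add: unit_seq_def)
  have "1 \<le> cmod ((unit_seq 0 + unit_seq 0) 0)" by (simp add: unit_seq_def)
  also have "\<dots> \<le> G (unit_seq 0 + unit_seq 0)" using S_add[OF u u] by (intro G_ge) blast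
  also have "\<dots> \<le> \<kappa> * (G (unit_seq 0) + G (unit_seq 0))" using S_add[OF u u] by blast
  also have "\<dots> \<le> 0" using \<open>1 \<le> G (unit_seq 0)\<close> \<open>\<not> 0 < \<kappa>\<close> by (intro mult_nonpos_nonneg) auto
  finally show False by simp
qed

lemma G_nonneg: "a \<in> S \<Longrightarrow> 0 \<le> G a"
  using G_ge[of a 0] norm_ge_zero order_trans by blast

lemma G_eq_0: "a \<in> S \<Longrightarrow> G a = 0 \<Longrightarrow> a = 0"
proof
  fix j assume "a \<in> S" "G a = 0"
  then show "a j = 0 j" using G_ge[of a j] by simp
qed

lemma S_subspace: "complex_vector.subspace S"
  using S_add S_scale c00_S c00_0 by (auto simp: complex_vector.subspace_def)

text \<open>The norm \<open>|\<Sum>\<^sub>j a\<^sub>j| + G a\<close> is equivalent to \<open>G (sum_shift a)\<close>, which identifies its completion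
  with the original space.\<close>

definition sum_shift :: "omega \<Rightarrow> omega" where
  "sum_shift a = case_nat (\<Sum>j. a j) a"

lemma case_nat_c00: assumes "a \<in> c00" shows "case_nat t a \<in> c00"
proof -
  obtain n where "{j. a j \<noteq> 0} \<subseteq> {..<n}" using c00_bounded[OF assms] .
  then have "case_nat t a j \<noteq> 0 \<Longrightarrow> j < Suc n" for j by (cases j) auto
  then have "{j. case_nat t a j \<noteq> 0} \<subseteq> {..<Suc n}" by blast
  then show ?thesis by (rule supp_c00)
qed

lemma c00_summable: "a \<in> c00 \<Longrightarrow> summable a"
  by (auto simp: c00_def intro: summable_finite)

lemma sum_shift_linear: "linear_map_on c00 sum_shift"
  unfolding linear_map_on_def sum_shift_def
proof (intro conjI ballI allI)
  fix a b :: omega assume "a \<in> c00" "b \<in> c00"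
  from suminf_add[OF this[THEN c00_summable]]
  have "suminf (a + b) = suminf a + suminf b" by (simp add: plus_fun_def)
  then show "case_nat (suminf (a + b)) (a + b) = case_nat (suminf a) a + case_nat (suminf b) b"
    by (simp add: fun_eq_iff split: nat.splits)
next
  fix c and a :: omega assume "a \<in> c00"
  from suminf_mult[OF this[THEN c00_summable], of c]
  moreover have "(\<lambda>n. c * a n) = c *\<^sub>C a" by (simp add: fun_eq_iff)
  ultimately have "suminf (c *\<^sub>C a) = c * suminf a" by (simp only:)
  then show "case_nat (suminf (c *\<^sub>C a)) (c *\<^sub>C a) = c *\<^sub>C case_nat (suminf a) a"
    by (simp add: fun_eq_iff split: nat.splits)
qed

lemma case_nat_split: "case_nat t a = t *\<^sub>C unit_seq 0 + case_nat 0 a"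
  by (auto simp: fun_eq_iff unit_seq_def split: nat.splits)

text \<open>A finite section \<open>b\<close> of \<open>w\<close> is matched in all coordinates
  except the zeroth, where \<open>sum_shift\<close> forces the sum of the entries. Adding
  \<open>t\<close> times an average over \<open>m\<close> places repairs the sum and costs
  \<open>cmod t * G (u m)\<close>, which is small for large \<open>m\<close>.\<close>

lemma sum_shift_dense:
  assumes w: "w \<in> S" and \<epsilon>: "\<epsilon> > 0"
  shows "\<exists>a\<in>c00. G (w - sum_shift a) < \<epsilon>"
proof -
  have "\<forall>\<^sub>F n in sequentially. G (restr {n..} w) < \<epsilon> / (2 * \<kappa>)"
    using tail[OF w] \<epsilon> \<kappa>_pos by (intro order_tendstoD) auto
  then obtain n where n: "G (restr {n..} w) < \<epsilon> / (2 * \<kappa>)" by (auto simp: eventually_sequentially)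
  define b where "b = restr {..<n} w"
  have b: "b \<in> c00" "w - b = restr {n..} w"
    by (simp add: b_def restr_finite_c00) (auto simp: b_def restr_def fun_eq_iff)
  define b' where "b' = (\<lambda>j. b (Suc j))"
  have b': "b' \<in> c00" by (rule supp_c00[of _ n]) (auto simp: b'_def b_def restr_def split: if_splits)
  define t where "t = b 0 - (\<Sum>j. b' j)"
  define u :: "nat \<Rightarrow> omega" where "u m = (\<lambda>j. if j < m then 1 / of_nat m else 0)" for m
  have u: "u m \<in> c00" for m by (rule supp_c00[of _ m]) (auto simp: u_def)
  have "\<forall>\<^sub>F m in sequentially. cmod t * G (u m) < \<epsilon> / (2 * \<kappa>)"
    using tendsto_mult_right_zero[OF average, of "cmod t"] \<epsilon> \<kappa>_pos unfolding u_def
    by (intro order_tendstoD(2)) auto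
  then have "\<forall>\<^sub>F m in sequentially. cmod t * G (u m) < \<epsilon> / (2 * \<kappa>) \<and> 0 < m"
    using eventually_gt_at_top[of 0] by eventually_elim auto
  then obtain m where m: "cmod t * G (u m) < \<epsilon> / (2 * \<kappa>)" "0 < m"
    by (auto simp: eventually_sequentially)
  have "(\<Sum>j. u m j) = (\<Sum>j<m. u m j)" by (rule suminf_finite) (auto simp: u_def)
  then have su: "(\<Sum>j. u m j) = 1" using m(2) by (simp add: u_def)
  define a where "a = b' + t *\<^sub>C u m"
  have a: "a \<in> c00" unfolding a_def by (intro c00_add c00_scaleC b' u)
  have "(\<Sum>j. a j) = b 0"
    using su by (simp add: a_def suminf_add[OF c00_summable[OF b'] summable_mult[OF c00_summable[OF u]], symmetric]
        suminf_mult[OF c00_summable[OF u]] t_def)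
  then have d: "b - sum_shift a = (- t) *\<^sub>C case_nat 0 (u m)"
    by (auto simp: sum_shift_def fun_eq_iff a_def b'_def split: nat.splits)
  have c: "case_nat 0 (u m) \<in> S" using case_nat_c00[OF u] c00_S by blast
  have r: "restr {n..} w \<in> S"
    using complex_vector.subspace_diff[OF S_subspace w subsetD[OF c00_S b(1)]] b(2) by simp
  have "w - sum_shift a = restr {n..} w + (- t) *\<^sub>C case_nat 0 (u m)"
    unfolding b(2)[symmetric] d[symmetric] by simp
  then have "G (w - sum_shift a) \<le> \<kappa> * (G (restr {n..} w) + G ((- t) *\<^sub>C case_nat 0 (u m)))"
    using conjunct2[OF S_add[OF r conjunct1[OF S_scale[OF c, of "- t"]]]] by (simp only:)
  also have "\<dots> = \<kappa> * (G (restr {n..} w) + cmod t * G (u m))"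
    using S_scale[OF c, of "- t"] shift[OF u] by simp
  also have "\<dots> < \<kappa> * (\<epsilon> / (2 * \<kappa>) + \<epsilon> / (2 * \<kappa>))"
    using n m \<kappa>_pos by (intro mult_strict_left_mono add_strict_mono) auto
  also have "\<dots> = \<epsilon>" using \<kappa>_pos by simp
  finally show ?thesis using a by blast
qed

lemma tail_dense:
  assumes w: "w \<in> S" and \<epsilon>: "\<epsilon> > 0"
  shows "\<exists>a\<in>c00. G (w - a) < \<epsilon>"
proof -
  have "\<forall>\<^sub>F n in sequentially. G (restr {n..} w) < \<epsilon>"
    using tail[OF w] \<epsilon> by (intro order_tendstoD) auto
  then obtain n where n: "G (restr {n..} w) < \<epsilon>" by (auto simp: eventually_sequentially)
  have "w - restr {..<n} w = restr {n..} w" by (auto simp: restr_def fun_eq_iff)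
  then show ?thesis using n restr_finite_c00[of "{..<n}" w] by (intro bexI[of _ "restr {..<n} w"]) auto
qed

text \<open>\<open>sum_shift a\<close> is the shifted \<open>a\<close> plus its sum times the zeroth
  unit vector. In the other direction the sum is the zeroth coordinate, which \<open>G\<close>
  dominates, and subtracting it leaves the shift.\<close>

lemma sum_shift_norm:
  assumes a: "a \<in> c00"
  shows "G (sum_shift a) \<le> \<kappa> * (1 + G (unit_seq 0)) * (cmod (\<Sum>j. a j) + G a)"
    "cmod (\<Sum>j. a j) + G a \<le> (1 + \<kappa> * (1 + G (unit_seq 0))) * G (sum_shift a)"
proof -
  let ?s = "\<Sum>j. a j" and ?g = "G (unit_seq 0)"
  have u: "unit_seq 0 \<in> S" using unit_seq_c00 c00_S by blast
  have c: "case_nat 0 a \<in> S" using case_nat_c00[OF a] c00_S by blast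
  have aS: "a \<in> S" using a c00_S by blast
  have ss: "sum_shift a \<in> S" unfolding sum_shift_def using case_nat_c00[OF a] c00_S by blast
  have g: "0 \<le> ?g" "0 \<le> G a" "0 \<le> G (sum_shift a)" using u aS ss by (auto intro: G_nonneg)
  have "G (sum_shift a) \<le> \<kappa> * (G (?s *\<^sub>C unit_seq 0) + G (case_nat 0 a))"
    unfolding sum_shift_def using S_add[OF conjunct1[OF S_scale[OF u]] c, of ?s]
    by (subst case_nat_split) simp
  also have "\<dots> = \<kappa> * (cmod ?s * ?g + G a)"
    using S_scale[OF u, of ?s] shift[OF a] by simp
  also have "\<dots> \<le> \<kappa> * ((1 + ?g) * (cmod ?s + G a))"
    using \<kappa>_pos g by (intro mult_left_mono) (auto simp: algebra_simps)
  finally show "G (sum_shift a) \<le> \<kappa> * (1 + ?g) * (cmod ?s + G a)" by (simp add: mult.assoc)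
  have s: "cmod ?s \<le> G (sum_shift a)" using G_ge[OF ss, of 0] by (simp add: sum_shift_def)
  have "case_nat 0 a = sum_shift a + (- ?s) *\<^sub>C unit_seq 0"
    unfolding sum_shift_def by (subst case_nat_split[of ?s]) (simp add: fun_eq_iff)
  then have "G a \<le> \<kappa> * (G (sum_shift a) + G ((- ?s) *\<^sub>C unit_seq 0))"
    using S_add[OF ss conjunct1[OF S_scale[OF u]], of "- ?s"] shift[OF a] by simp
  also have "\<dots> = \<kappa> * (G (sum_shift a) + cmod ?s * ?g)" using S_scale[OF u, of "- ?s"] by simp
  also have "\<dots> \<le> \<kappa> * (G (sum_shift a) + G (sum_shift a) * ?g)"
    using \<kappa>_pos g s by (intro mult_left_mono add_left_mono mult_right_mono) auto
  finally show "cmod ?s + G a \<le> (1 + \<kappa> * (1 + ?g)) * G (sum_shift a)"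
    using s by (simp add: algebra_simps)
qed

text \<open>For weight \<open>s = 0\<close> the identity on \<open>c00\<close> serves as the dense
  embedding, for \<open>s > 0\<close> it is \<open>sum_shift\<close>; both lead to the same space.
  The map \<open>emb\<close> covers \<open>ell2\<close> itself and the copy \<open>Pair 0\<close> of
  the Orlicz space inside pairs of sequences.\<close>

lemma completion_isomorphic_to_embedded:
  fixes emb :: "omega \<Rightarrow> 'w::complex_vector" and M :: "'w \<Rightarrow> real"
  assumes emb: "\<And>a b. emb (a + b) = emb a + emb b" "\<And>c a. emb (c *\<^sub>C a) = c *\<^sub>C emb a"
    and M: "\<And>a. a \<in> S \<Longrightarrow> M (emb a) = G a"
    and L_tri: "\<And>a b. a \<in> c00 \<Longrightarrow> b \<in> c00 \<Longrightarrow> L (a + b) \<le> L a + L b"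
    and L_scale: "\<And>c a. a \<in> c00 \<Longrightarrow> L (c *\<^sub>C a) = cmod c * L a"
    and L_bds: "0 < c" "0 < C" "0 \<le> s"
      "\<And>a. a \<in> c00 \<Longrightarrow> c * (s * cmod (\<Sum>j. a j) + G a) \<le> L a"
      "\<And>a. a \<in> c00 \<Longrightarrow> L a \<le> C * (s * cmod (\<Sum>j. a j) + G a)"
  shows "completion_isomorphic_to c00 L (emb ` S) M"
proof -
  have emb0: "emb 0 = 0" using emb(2)[of 0 0] by simp
  have embd: "emb (a - b) = emb a - emb b" for a b
    using emb(1)[of "a - b" b] by (simp add: algebra_simps)
  have sub: "complex_vector.subspace (emb ` S)"
    unfolding complex_vector.subspace_def
    using S_add S_scale c00_S c00_0 emb emb0 by (auto simp: image_iff) metis+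
  have res: "completion_isomorphic_to c00 L (emb ` S) M"
    if T0: "linear_map_on c00 T0" "\<And>a. a \<in> c00 \<Longrightarrow> T0 a \<in> c00"
      and dn: "\<And>w \<epsilon>. w \<in> S \<Longrightarrow> \<epsilon> > 0 \<Longrightarrow> \<exists>a\<in>c00. G (w - T0 a) < \<epsilon>"
      and b: "0 < c'" "0 < C'" "\<And>a. a \<in> c00 \<Longrightarrow> c' * G (T0 a) \<le> L a"
        "\<And>a. a \<in> c00 \<Longrightarrow> L a \<le> C' * G (T0 a)" for T0 c' C'
  proof (rule completion_isomorphic_toI[of "emb ` S" M \<kappa> "\<lambda>a. emb (T0 a)" L c' C'])
    show "M (x + y) \<le> \<kappa> * (M x + M y)" if xy: "x \<in> emb ` S" "y \<in> emb ` S" for x y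
    proof -
      obtain a b where ab: "x = emb a" "y = emb b" "a \<in> S" "b \<in> S" using xy by blast
      then have "M (x + y) = G (a + b)" using M[of "a + b"] S_add emb(1) by simp
      then show ?thesis using S_add[OF ab(3,4)] M ab by simp
    qed
    show "M (d *\<^sub>C x) = cmod d * M x" if x: "x \<in> emb ` S" for d x
    proof -
      obtain a where a: "x = emb a" "a \<in> S" using x by blast
      then have "M (d *\<^sub>C x) = G (d *\<^sub>C a)" using M[of "d *\<^sub>C a"] S_scale emb(2) by simp
      then show ?thesis using S_scale[OF a(2)] M a by simp
    qed
    show "0 \<le> M x" "M x = 0 \<Longrightarrow> x = 0" if "x \<in> emb ` S" for x
    proof -
      obtain a where a: "x = emb a" "a \<in> S" using \<open>x \<in> emb ` S\<close> by blast
      then show "0 \<le> M x" using M G_nonneg by simp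
      assume "M x = 0"
      then have "a = 0" using G_eq_0[OF a(2)] M[OF a(2)] a(1) by simp
      then show "x = 0" using a(1) emb0 by simp
    qed
    show "\<exists>l\<in>emb ` S. (\<lambda>n. M (x n - l)) \<longlonglongrightarrow> 0"
      if x: "\<And>n. x n \<in> emb ` S" and C: "\<And>\<epsilon>. \<epsilon> > 0 \<Longrightarrow> \<exists>k. \<forall>m\<ge>k. \<forall>n\<ge>k. M (x m - x n) < \<epsilon>" for x
    proof -
      have "\<exists>a. a \<in> S \<and> x n = emb a" for n using x[of n] by blast
      then obtain a where a: "\<And>n. a n \<in> S" "\<And>n. x n = emb (a n)" by metis
      have Sd: "a' - b' \<in> S" if "a' \<in> S" "b' \<in> S" for a' b'
        by (rule complex_vector.subspace_diff[OF S_subspace that])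
      have Md: "M (x n - emb l) = G (a n - l)" if "l \<in> S" for n l
        using M[OF Sd[OF a(1) that]] by (simp add: a(2) embd)
      have "M (x m - x n) = G (a m - a n)" for m n
        using Md[OF a(1), of m n] by (simp add: a(2))
      then have "\<exists>l\<in>S. (\<lambda>n. G (a n - l)) \<longlonglongrightarrow> 0"
        using C by (intro S_complete a(1)) simp
      then obtain l where "l \<in> S" "(\<lambda>n. G (a n - l)) \<longlonglongrightarrow> 0" by (elim bexE)
      then show ?thesis using Md by (intro bexI[of _ "emb l"]) auto
    qed
    show "linear_map_on c00 (\<lambda>a. emb (T0 a))"
      using T0(1) emb by (auto simp: linear_map_on_def)
    show "\<exists>a\<in>c00. M (w - emb (T0 a)) < \<epsilon>" if w: "w \<in> emb ` S" and \<epsilon>: "\<epsilon> > 0" for w \<epsilon>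
    proof -
      obtain v where v: "w = emb v" "v \<in> S" using w by blast
      obtain a where a: "a \<in> c00" "G (v - T0 a) < \<epsilon>" using dn[OF v(2) \<epsilon>] by (elim bexE)
      have "T0 a \<in> S" using T0(2)[OF a(1)] c00_S by blast
      then have "M (w - emb (T0 a)) = G (v - T0 a)"
        using M[OF complex_vector.subspace_diff[OF S_subspace v(2)]] by (simp add: v(1) embd)
      then show ?thesis using a by (intro bexI[of _ a]) (simp_all only:)
    qed
    show "emb (T0 a) \<in> emb ` S" if "a \<in> c00" for a using T0(2)[OF that] c00_S by blast
    have MT: "M (emb (T0 a)) = G (T0 a)" if "a \<in> c00" for a
      using M T0(2)[OF that] c00_S by blast
    show "c' * M (emb (T0 a)) \<le> L a" "L a \<le> C' * M (emb (T0 a))" if "a \<in> c00" for a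
      using b(3,4)[OF that] MT[OF that] by simp_all
  qed (use sub \<kappa>_pos b T0(2) c00_S L_tri L_scale in auto)
  show ?thesis
  proof (cases "s = 0")
    case True
    show ?thesis
    proof (rule res[of "\<lambda>a. a" c C])
      show "\<exists>a\<in>c00. G (w - a) < \<epsilon>" if "w \<in> S" "\<epsilon> > 0" for w \<epsilon> by (rule tail_dense[OF that])
    qed (use L_bds True in \<open>auto simp: linear_map_on_def\<close>)
  next
    case False
    then have s: "0 < s" using L_bds by simp
    define k1 where "k1 = \<kappa> * (1 + G (unit_seq 0))"
    define k2 where "k2 = 1 + \<kappa> * (1 + G (unit_seq 0))"
    have "0 \<le> G (unit_seq 0)" using unit_seq_c00 c00_S by (intro G_nonneg) blast
    then have k: "0 < k1" "0 < k2" unfolding k1_def k2_def using \<kappa>_pos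
      by (auto intro!: mult_pos_pos add_pos_nonneg)
    \<comment> \<open>The weights \<open>s\<close> and 1 of the two summands are compared with equal
      weights, for which \<open>sum_shift_norm\<close> is stated.\<close>
    define lo where "lo = min s 1"
    define hi where "hi = max s 1"
    have lh: "0 < lo" "0 < hi" using s by (auto simp: lo_def hi_def)
    show ?thesis
    proof (rule res[of sum_shift "c * lo / k1" "C * hi * k2", OF sum_shift_linear])
      show "sum_shift a \<in> c00" if "a \<in> c00" for a
        unfolding sum_shift_def by (rule case_nat_c00[OF that])
      show "\<exists>a\<in>c00. G (w - sum_shift a) < \<epsilon>" if "w \<in> S" "\<epsilon> > 0" for w \<epsilon>
        by (rule sum_shift_dense[OF that])
      show "0 < c * lo / k1" "0 < C * hi * k2" using L_bds lh k by auto
      fix a assume a: "a \<in> c00"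
      let ?t = "cmod (\<Sum>j. a j)"
      have G0: "0 \<le> G a" using a c00_S by (intro G_nonneg) blast
      have "c * lo / k1 * G (sum_shift a) \<le> c * lo / k1 * (k1 * (?t + G a))"
        using sum_shift_norm(1)[OF a] L_bds lh k by (intro mult_left_mono) (auto simp: k1_def)
      also have "\<dots> = c * (lo * ?t + lo * G a)" using k by (simp add: field_simps)
      also have "\<dots> \<le> c * (s * ?t + 1 * G a)"
        using L_bds G0 by (intro mult_left_mono add_mono mult_right_mono) (auto simp: lo_def)
      also have "\<dots> \<le> L a" using L_bds(4)[OF a] by simp
      finally show "c * lo / k1 * G (sum_shift a) \<le> L a" .
      have "L a \<le> C * (s * ?t + 1 * G a)" using L_bds(5)[OF a] by simp
      also have "\<dots> \<le> C * (hi * ?t + hi * G a)"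
        using L_bds G0 by (intro mult_left_mono add_mono mult_right_mono) (auto simp: hi_def)
      also have "\<dots> = C * hi * (?t + G a)" by (simp add: algebra_simps)
      also have "\<dots> \<le> C * hi * (k2 * G (sum_shift a))"
        using sum_shift_norm(2)[OF a] L_bds lh by (intro mult_left_mono) (auto simp: k2_def)
      finally show "L a \<le> C * hi * k2 * G (sum_shift a)" by (simp add: mult.assoc)
    qed
  qed
qed

end

section \<open>The Hilbert space and the Orlicz space as instances\<close>

lemma ell2_norm_shift: "a \<in> c00 \<Longrightarrow> ell2_norm (case_nat 0 a) = ell2_norm a"
proof -
  assume "a \<in> c00"
  then obtain n where n: "{j. a j \<noteq> 0} \<subseteq> {..<n}" using c00_bounded by blast
  then have "case_nat 0 a j \<noteq> 0 \<Longrightarrow> j < Suc n" for j by (cases j) auto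
  then have n': "{j. case_nat 0 a j \<noteq> 0} \<subseteq> {..<Suc n}" by blast
  have "(ell2_norm (case_nat 0 a))\<^sup>2 = (ell2_norm a)\<^sup>2"
    unfolding ell2_norm_finite[OF n] ell2_norm_finite[OF n'] by (simp add: sum.lessThan_Suc_shift del: sum.lessThan_Suc)
  moreover have "a \<in> ell2" "case_nat 0 a \<in> ell2" using supp_c00[OF n] supp_c00[OF n'] c00_ell2 by auto
  ultimately show ?thesis using ell2_norm_nonneg by (simp add: power2_eq_iff_nonneg)
qed

lemma ell2_norm_average:
  "ell2_norm (\<lambda>j. if j < m then 1 / of_nat m else 0) = inverse (sqrt m)"
proof -
  let ?u = "\<lambda>j. if j < m then 1 / of_nat m else 0 :: complex"
  have s: "{j. ?u j \<noteq> 0} \<subseteq> {..<m}" by auto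
  have "(ell2_norm ?u)\<^sup>2 = (inverse (sqrt m))\<^sup>2"
    unfolding ell2_norm_finite[OF s]
    by (cases "m = 0") (simp_all add: norm_divide power2_eq_square field_simps)
  moreover have "?u \<in> ell2" using supp_c00[OF s] c00_ell2 by blast
  ultimately show ?thesis using ell2_norm_nonneg by (subst (asm) power2_eq_iff_nonneg) auto
qed

lemma ell2_average_tendsto: "(\<lambda>m. ell2_norm (\<lambda>j. if j < m then 1 / of_nat m else 0)) \<longlonglongrightarrow> 0"
  unfolding ell2_norm_average by real_asymp

interpretation ell2: quasi_sequence_space ell2 ell2_norm 1
proof
  fix x :: "nat \<Rightarrow> omega"
  assume "\<And>n. x n \<in> ell2" "\<And>\<epsilon>. \<epsilon> > 0 \<Longrightarrow> \<exists>k. \<forall>m\<ge>k. \<forall>n\<ge>k. ell2_norm (x m - x n) < \<epsilon>"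
  then show "\<exists>l\<in>ell2. (\<lambda>n. ell2_norm (x n - l)) \<longlonglongrightarrow> 0" by (rule ell2_complete)
qed (auto simp: ell2_add ell2_scaleC ell2_norm_scaleC norm_component_le_ell2_norm c00_ell2[THEN subsetD]
    ell2_tail_tendsto ell2_norm_shift intro: ell2_average_tendsto)

interpretation ellM: quasi_sequence_space ellM_seq ellM_seq_norm 13
proof
  fix a b assume "a \<in> ellM_seq" "b \<in> ellM_seq"
  then show "a + b \<in> ellM_seq \<and> ellM_seq_norm (a + b) \<le> 13 * (ellM_seq_norm a + ellM_seq_norm b)"
    using ellM_seq_add by blast
next
  fix x :: "nat \<Rightarrow> omega"
  assume "\<And>n. x n \<in> ellM_seq" "\<And>\<epsilon>. \<epsilon> > 0 \<Longrightarrow> \<exists>k. \<forall>m\<ge>k. \<forall>n\<ge>k. ellM_seq_norm (x m - x n) < \<epsilon>"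
  then show "\<exists>l\<in>ellM_seq. (\<lambda>n. ellM_seq_norm (x n - l)) \<longlonglongrightarrow> 0" by (rule ellM_seq_complete)
next
  fix a :: omega assume a: "a \<in> c00"
  have k: "kalton_peck (case_nat 0 a) = case_nat 0 (kalton_peck a)"
    using ell2_norm_shift[OF a] by (auto simp: kalton_peck_def fun_eq_iff split: nat.splits)
  have "kalton_peck a \<in> c00"
    using a unfolding c00_def kalton_peck_def by (auto elim: rev_finite_subset)
  then show "ellM_seq_norm (case_nat 0 a) = ellM_seq_norm a"
    using a by (simp add: ellM_seq_norm_def k ell2_norm_shift)
next
  fix a :: omega and j assume a: "a \<in> ellM_seq"
  then have "cmod (a j) \<le> ell2_norm a" by (intro norm_component_le_ell2_norm) (simp add: ellM_seq_def)
  with ellM_seq_norm_ge[OF a] show "cmod (a j) \<le> ellM_seq_norm a" by linarith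
next
  \<comment> \<open>All nonzero entries of the average, divided by its norm, equal
    \<open>1 / sqrt m\<close>, so the Kalton-Peck map multiplies it by \<open>- ln (sqrt m)\<close>.
    The logarithm is too small to compensate the factor \<open>1 / sqrt m\<close>.\<close>
  have "ellM_seq_norm (\<lambda>j. if j < m then 1 / of_nat m else 0) = (ln (sqrt m) + 1) * inverse (sqrt m)"
    if "m > 0" for m
  proof -
    let ?u = "\<lambda>j. if j < m then 1 / of_nat m else 0 :: complex"
    have u: "?u \<in> c00" by (rule supp_c00[of _ m]) auto
    have "1 / (real m * inverse (sqrt (real m))) = inverse (sqrt m)" using that
      by (simp add: field_simps)
    then have "ln (1 / (real m * inverse (sqrt (real m)))) = - ln (sqrt m)"
      using that by (simp only: ln_inverse)
    then have "kalton_peck ?u = of_real (- ln (sqrt m)) *\<^sub>C ?u"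
      by (simp add: kalton_peck_def fun_eq_iff ell2_norm_average norm_divide)
    moreover have "0 \<le> ln (sqrt m)" using that by simp
    ultimately show ?thesis using ell2_norm_scaleC[of ?u "of_real (- ln (sqrt m))"] u c00_ell2
      by (auto simp: ellM_seq_norm_def ell2_norm_average algebra_simps)
  qed
  then have "\<forall>\<^sub>F m in sequentially. ellM_seq_norm (\<lambda>j. if j < m then 1 / of_nat m else 0) =
      (ln (sqrt m) + 1) * inverse (sqrt m)"
    using eventually_gt_at_top[of 0] by (rule_tac eventually_mono) blast+
  moreover have "(\<lambda>m. (ln (sqrt (real m)) + 1) * inverse (sqrt (real m))) \<longlonglongrightarrow> 0" by real_asymp
  ultimately show "(\<lambda>m. ellM_seq_norm (\<lambda>j. if j < m then 1 / of_nat m else 0)) \<longlonglongrightarrow> 0"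
    by (simp add: tendsto_cong)
qed (auto simp: ellM_seq_add ellM_seq_scaleC c00_ellM_seq[THEN subsetD] ellM_seq_tail_tendsto)

section \<open>The closed span of the second unit vectors in the Kalton-Peck space\<close>

lemma twisted_norm_kalton_peck_Pair: "twisted_norm kalton_peck (0, a) = ellM_seq_norm a"
proof -
  have "ell2_norm (0 - kalton_peck a) = ell2_norm (kalton_peck a)"
    using ell2_uminus(2)[of "kalton_peck a"] by (simp only: diff_0)
  then show ?thesis unfolding twisted_norm_def ellM_seq_norm_def by simp
qed

lemma span_unit_seq: "complex_vector.span (range (\<lambda>j. (0, unit_seq j))) = Pair (0::omega) ` c00"
proof
  have "complex_vector.subspace (Pair (0::omega) ` c00)"
    unfolding complex_vector.subspace_def
    using c00_add c00_scaleC c00_0 by (auto simp: image_iff scaleC_Pair zero_prod_def)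
  then show "complex_vector.span (range (\<lambda>j. (0, unit_seq j))) \<subseteq> Pair (0::omega) ` c00"
    using unit_seq_c00 by (intro complex_vector.span_minimal) auto
next
  show "Pair (0::omega) ` c00 \<subseteq> complex_vector.span (range (\<lambda>j. (0, unit_seq j)))"
  proof
    fix z assume "z \<in> Pair (0::omega) ` c00"
    then obtain a where a: "z = (0, a)" "a \<in> c00" by blast
    obtain n where n: "{j. a j \<noteq> 0} \<subseteq> {..<n}" using c00_bounded[OF a(2)] .
    have "(\<Sum>j<n. a j *\<^sub>C unit_seq j) = a"
    proof
      fix i
      have "(\<Sum>j<n. a j * (if i = j then 1 else 0)) = (if i < n then a i else 0)"
        by (simp add: if_distrib cong: if_cong)
      then show "(\<Sum>j<n. a j *\<^sub>C unit_seq j) i = a i"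
        using n by (auto simp: sum_fun_apply unit_seq_def)
    qed
    then have "z = (\<Sum>j<n. a j *\<^sub>C (0, unit_seq j))"
      by (simp add: a(1) scaleC_Pair prod_eq_iff fst_sum snd_sum)
    also have "\<dots> \<in> complex_vector.span (range (\<lambda>j. (0, unit_seq j)))"
      by (intro complex_vector.span_sum complex_vector.span_scale complex_vector.span_base) auto
    finally show "z \<in> complex_vector.span (range (\<lambda>j. (0, unit_seq j)))" .
  qed
qed

text \<open>Each coordinate of the Kalton-Peck map is bounded by the norm although the map is
  unbounded on \<open>ell2\<close>; this makes coordinates of the first component continuous for the
  quasi-norm.\<close>

lemma kalton_peck_component:
  assumes "y \<in> ell2" shows "cmod (kalton_peck y j) \<le> 2 * ell2_norm y"
proof (cases "y j = 0")
  case False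
  define \<tau> where "\<tau> = ell2_norm y"
  have le: "cmod (y j) \<le> \<tau>" unfolding \<tau>_def by (rule norm_component_le_ell2_norm[OF assms])
  have \<tau>: "0 < \<tau>" using le False by (smt (verit) zero_less_norm_iff)
  have "cmod (kalton_peck y j) = \<tau> * \<bar>cmod (y j) / \<tau> * ln (cmod (y j) / \<tau>)\<bar>"
    using \<tau> by (simp add: kalton_peck_def \<tau>_def[symmetric] norm_mult abs_mult)
  also have "\<dots> \<le> \<tau> * 2" using \<tau> le by (intro mult_left_mono abs_x_ln_x_le_2) auto
  finally show ?thesis by (simp add: \<tau>_def)
qed (use ell2_norm_nonneg[OF assms] in \<open>simp add: kalton_peck_def\<close>)

text \<open>Passing to the closure cannot create a first component, because its coordinates are
  dominated by the quasi-norm and vanish on the span. With first component 0, membership in the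
  Kalton-Peck space says exactly that \<open>kalton_peck y\<close> lies in \<open>ell2\<close>. The
  converse is density of finite sections.\<close>

lemma ell_M_eq: "ell_M = Pair 0 ` ellM_seq"
proof
  show "ell_M \<subseteq> Pair 0 ` ellM_seq"
  proof
    fix z assume z: "z \<in> ell_M"
    obtain x y where xy: "z = (x, y)" by (cases z)
    have y: "y \<in> ell2" "x - kalton_peck y \<in> ell2"
      using z by (auto simp: ell_M_def twisted_space_def xy)
    have "x j = 0" for j
    proof (rule ccontr)
      assume "x j \<noteq> 0"
      \<comment> \<open>Below, \<open>cmod (x j)\<close> is bounded by twice the quasi-norm of the
        error; any fraction up to one half would give the contradiction.\<close>
      then have "cmod (x j) / 6 > 0" by simp
      with z have "\<exists>w\<in>Pair 0 ` c00. twisted_norm kalton_peck (z - w) < cmod (x j) / 6"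
        unfolding ell_M_def span_unit_seq by blast
      then obtain a where a: "a \<in> c00" "twisted_norm kalton_peck (z - (0, a)) < cmod (x j) / 6"
        by blast
      have "z - (0, a) = (x - 0, y - a)" by (simp add: xy fun_eq_iff)
      note a = a(1) a(2)[unfolded this]
      have ya: "y - a \<in> ell2" using y a c00_ell2 by (auto intro: ell2_diff)
      have "kalton_peck y - kalton_peck (y - a) = (kalton_peck ((y - a) + a) - (kalton_peck (y - a) + kalton_peck a))
        + kalton_peck a" by simp
      moreover have "kalton_peck a \<in> ell2" using a c00_ellM_seq by (auto simp: ellM_seq_def)
      ultimately have "kalton_peck y - kalton_peck (y - a) \<in> ell2"
        using kalton_peck_quasilinear(1)[OF ya, of a] a c00_ell2 by (metis ell2_add(1) subsetD)
      from ell2_add(1)[OF y(2) this] have m: "x - kalton_peck (y - a) \<in> ell2" by simp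
      have "cmod (x j) \<le> cmod ((x - kalton_peck (y - a)) j) + cmod (kalton_peck (y - a) j)"
        using norm_triangle_ineq[of "(x - kalton_peck (y - a)) j" "kalton_peck (y - a) j"] by simp
      also have "\<dots> \<le> ell2_norm (x - kalton_peck (y - a)) + 2 * ell2_norm (y - a)"
        by (intro add_mono norm_component_le_ell2_norm[OF m] kalton_peck_component[OF ya])
      also have "\<dots> \<le> 2 * twisted_norm kalton_peck (x - 0, y - a)"
        using ell2_norm_nonneg[OF m] by (simp add: twisted_norm_def)
      finally show False using a(2) \<open>cmod (x j) / 6 > 0\<close> by simp
    qed
    then have x: "x = 0" by (simp add: fun_eq_iff)
    then have "kalton_peck y \<in> ell2" using y(2) ell2_uminus(1)[of "kalton_peck y"] by simp
    then show "z \<in> Pair 0 ` ellM_seq" using xy x y by (auto simp: ellM_seq_def)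
  qed
next
  show "Pair 0 ` ellM_seq \<subseteq> ell_M"
  proof
    fix z assume "z \<in> Pair (0::omega) ` ellM_seq"
    then obtain a where a: "z = (0, a)" "a \<in> ellM_seq" by blast
    have "z \<in> twisted_space kalton_peck"
      using a ell2_uminus(1)[of "kalton_peck a"] by (auto simp: twisted_space_def ellM_seq_def)
    moreover have "\<exists>w\<in>Pair 0 ` c00. twisted_norm kalton_peck (z - w) < \<epsilon>" if "\<epsilon> > 0" for \<epsilon>
    proof -
      obtain b where b: "b \<in> c00" "ellM_seq_norm (a - b) < \<epsilon>"
        using ellM.tail_dense[OF a(2) \<open>\<epsilon> > 0\<close>] by (elim bexE)
      have "z - (0, b) = (0, a - b)" by (simp add: a(1))
      then have "twisted_norm kalton_peck (z - (0, b)) < \<epsilon>"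
        using b(2) by (simp only: twisted_norm_kalton_peck_Pair)
      with b(1) show ?thesis by blast
    qed
    ultimately show "z \<in> ell_M" unfolding ell_M_def span_unit_seq by blast
  qed
qed

lemma completion_isomorphic_to_ell2:
  assumes "\<And>a b. a \<in> c00 \<Longrightarrow> b \<in> c00 \<Longrightarrow> L (a + b) \<le> L a + L b"
    and "\<And>c a. a \<in> c00 \<Longrightarrow> L (c *\<^sub>C a) = cmod c * L a"
    and "0 < c" "0 < C" "0 \<le> s"
      "\<And>a. a \<in> c00 \<Longrightarrow> c * (s * cmod (\<Sum>j. a j) + ell2_norm a) \<le> L a"
      "\<And>a. a \<in> c00 \<Longrightarrow> L a \<le> C * (s * cmod (\<Sum>j. a j) + ell2_norm a)"
  shows "completion_isomorphic_to c00 L ell2 ell2_norm"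
  using ell2.completion_isomorphic_to_embedded[of "\<lambda>a. a" ell2_norm L c C s] assms by simp

lemma completion_isomorphic_to_ell_M:
  assumes "\<And>a b. a \<in> c00 \<Longrightarrow> b \<in> c00 \<Longrightarrow> L (a + b) \<le> L a + L b"
    and "\<And>c a. a \<in> c00 \<Longrightarrow> L (c *\<^sub>C a) = cmod c * L a"
    and "0 < c" "0 < C" "0 \<le> s"
      "\<And>a. a \<in> c00 \<Longrightarrow> c * (s * cmod (\<Sum>j. a j) + ellM_seq_norm a) \<le> L a"
      "\<And>a. a \<in> c00 \<Longrightarrow> L a \<le> C * (s * cmod (\<Sum>j. a j) + ellM_seq_norm a)"
  shows "completion_isomorphic_to c00 L ell_M ell_M_norm"
  unfolding ell_M_eq
proof (rule ellM.completion_isomorphic_to_embedded[of "Pair 0" ell_M_norm L c C s])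
  show "(0::omega, a + b) = (0, a) + (0, b)" for a b :: omega by simp
  show "(0::omega, c *\<^sub>C a) = c *\<^sub>C (0, a)" for c and a :: omega
    by (simp add: scaleC_Pair fun_eq_iff)
  show "ell_M_norm (0, a) = ellM_seq_norm a" for a by (rule twisted_norm_kalton_peck_Pair)
qed (fact assms)+


subsection \<open>Unconditional bases\<close>

lemma bounded_linear_scaleC: "bounded_linear (\<lambda>x::'a::complex_banach. c *\<^sub>C x)"
proof (rule bounded_linear_intro)
  show "c *\<^sub>C (x + y) = c *\<^sub>C x + c *\<^sub>C y" for x y :: 'a by (rule scaleC_add_right)
  show "c *\<^sub>C r *\<^sub>R x = r *\<^sub>R c *\<^sub>C x" for r and x :: 'a
    by (simp add: scaleR_scaleC scaleC_scaleC mult.commute)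
  show "norm (c *\<^sub>C x) \<le> norm x * cmod c" for x :: 'a by (simp add: norm_scaleC mult.commute)
qed

lemma bounded_linear_scaleC_left: "bounded_linear (\<lambda>c. c *\<^sub>C (x::'a::complex_banach))"
proof (rule bounded_linear_intro)
  show "(c + d) *\<^sub>C x = c *\<^sub>C x + d *\<^sub>C x" for c d by (rule scaleC_add_left)
  show "(r *\<^sub>R c) *\<^sub>C x = r *\<^sub>R c *\<^sub>C x" for r c
    by (simp only: scaleR_scaleC[where 'a = 'a] scaleC_scaleC scaleR_conv_of_real)
  show "norm (c *\<^sub>C x) \<le> cmod c * norm x" for c by (simp add: norm_scaleC)
qed

lemma tendsto_scaleC_left: "(f \<longlongrightarrow> c) F \<Longrightarrow> ((\<lambda>n. f n *\<^sub>C (x::'a::complex_banach)) \<longlongrightarrow> c *\<^sub>C x) F"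
  by (rule bounded_linear.tendsto[OF bounded_linear_scaleC_left])

text \<open>The closed ball of radius \<open>R\<close> of the lattice renorming of \<open>X\<close> (for sequences all of whose
  initial segments are in that ball), and of the Koethe dual of that renorming.\<close>

definition lat_ball :: "(nat \<Rightarrow> 'a::complex_banach) \<Rightarrow> real \<Rightarrow> omega \<Rightarrow> bool" where
  "lat_ball e R x \<longleftrightarrow>
     (\<forall>n \<theta>. (\<forall>j. cmod (\<theta> j) \<le> 1) \<longrightarrow> norm (\<Sum>j<n. (\<theta> j * x j) *\<^sub>C e j) \<le> R)"

definition dual_ball :: "(nat \<Rightarrow> 'a::complex_banach) \<Rightarrow> real \<Rightarrow> omega \<Rightarrow> bool" where
  "dual_ball e S y \<longleftrightarrow> (\<forall>R x n. lat_ball e R x \<longrightarrow> (\<Sum>j<n. cmod (x j) * cmod (y j)) \<le> R * S)"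

lemma lat_ballD: "lat_ball e R x \<Longrightarrow> (\<And>j. cmod (\<theta> j) \<le> 1) \<Longrightarrow> norm (\<Sum>j<n. (\<theta> j * x j) *\<^sub>C e j) \<le> R"
  by (auto simp: lat_ball_def)

lemma lat_ball_nonneg: "lat_ball e R x \<Longrightarrow> 0 \<le> R"
  using lat_ballD[of e R x "\<lambda>_. 0" 0] by simp

lemma lat_ball_0: "0 \<le> R \<Longrightarrow> lat_ball e R 0"
  by (auto simp: lat_ball_def)

lemma lat_ball_mono: "lat_ball e R x \<Longrightarrow> R \<le> R' \<Longrightarrow> lat_ball e R' x"
  unfolding lat_ball_def by (meson order_trans)

text \<open>Solidity is built into \<open>lat_ball\<close>: the multipliers in its definition absorb
  the quotients \<open>y j / x j\<close>.\<close>

lemma lat_ball_dominated: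
  assumes x: "lat_ball e R x" and le: "\<And>j. cmod (y j) \<le> cmod (x j)"
  shows "lat_ball e R y"
  unfolding lat_ball_def
proof (intro allI impI)
  fix n and \<theta> :: omega assume \<theta>: "\<forall>j. cmod (\<theta> j) \<le> 1"
  define \<theta>' where "\<theta>' j = \<theta> j * (y j / x j)" for j
  have y0: "y j = 0" if "x j = 0" for j using le[of j] that by simp
  have 1: "cmod (\<theta>' j) \<le> 1" for j
  proof (cases "x j = 0")
    case False
    then have "cmod (y j / x j) \<le> 1" using le[of j] by (simp add: norm_divide)
    moreover have "cmod (\<theta> j) \<le> 1" using \<theta> by blast
    ultimately show ?thesis unfolding \<theta>'_def norm_mult by (intro mult_le_one) auto
  qed (simp add: \<theta>'_def)
  have "\<theta>' j * x j = \<theta> j * y j" for j using y0[of j] by (cases "x j = 0") (auto simp: \<theta>'_def)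
  moreover have "norm (\<Sum>j<n. (\<theta>' j * x j) *\<^sub>C e j) \<le> R" by (rule lat_ballD[OF x 1])
  ultimately show "norm (\<Sum>j<n. (\<theta> j * y j) *\<^sub>C e j) \<le> R" by simp
qed

lemma lat_ball_add:
  assumes "lat_ball e R x" "lat_ball e S y" shows "lat_ball e (R + S) (x + y)"
  unfolding lat_ball_def
proof (intro allI impI)
  fix n and \<theta> :: omega assume \<theta>: "\<forall>j. cmod (\<theta> j) \<le> 1"
  have "(\<Sum>j<n. (\<theta> j * (x + y) j) *\<^sub>C e j) = (\<Sum>j<n. (\<theta> j * x j) *\<^sub>C e j) + (\<Sum>j<n. (\<theta> j * y j) *\<^sub>C e j)"
    by (simp add: distrib_left scaleC_add_left sum.distrib)
  also have "norm \<dots> \<le> R + S"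
    using \<theta> lat_ballD[OF assms(1), of \<theta> n] lat_ballD[OF assms(2), of \<theta> n]
    by (intro order_trans[OF norm_triangle_ineq]) (auto intro: add_mono)
  finally show "norm (\<Sum>j<n. (\<theta> j * (x + y) j) *\<^sub>C e j) \<le> R + S" .
qed

lemma lat_ball_scaleC:
  assumes "lat_ball e R x" shows "lat_ball e (cmod c * R) (c *\<^sub>C x)"
  unfolding lat_ball_def
proof (intro allI impI)
  fix n and \<theta> :: omega assume \<theta>: "\<forall>j. cmod (\<theta> j) \<le> 1"
  have "(\<Sum>j<n. (\<theta> j * (c *\<^sub>C x) j) *\<^sub>C e j) = c *\<^sub>C (\<Sum>j<n. (\<theta> j * x j) *\<^sub>C e j)"
    by (simp add: complex_vector.scale_sum_right scaleC_scaleC mult_ac)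
  then show "norm (\<Sum>j<n. (\<theta> j * (c *\<^sub>C x) j) *\<^sub>C e j) \<le> cmod c * R"
    using lat_ballD[OF assms, of \<theta> n] \<theta> by (simp add: norm_scaleC mult_left_mono)
qed

lemma lat_ball_sum:
  assumes "\<And>i. i \<in> A \<Longrightarrow> lat_ball e (R i) (x i)"
  shows "lat_ball e (\<Sum>i\<in>A. R i) (\<Sum>i\<in>A. x i)"
  using assms
proof (induction A rule: infinite_finite_induct)
  case (insert a A)
  then show ?case using lat_ball_add[of e "R a" "x a"] by (simp only: sum.insert insert_iff simp_thms)
qed (simp_all only: sum.empty sum.infinite simp_thms lat_ball_0 order_refl)

lemma lat_ball_lim:
  assumes "\<And>j. (\<lambda>m. x m j) \<longlonglongrightarrow> y j" "\<forall>\<^sub>F m in sequentially. lat_ball e R (x m)"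
  shows "lat_ball e R y"
  unfolding lat_ball_def
proof (intro allI impI)
  fix n and \<theta> :: omega assume \<theta>: "\<forall>j. cmod (\<theta> j) \<le> 1"
  have "(\<lambda>m. norm (\<Sum>j<n. (\<theta> j * x m j) *\<^sub>C e j)) \<longlonglongrightarrow> norm (\<Sum>j<n. (\<theta> j * y j) *\<^sub>C e j)"
    by (intro tendsto_norm tendsto_sum tendsto_scaleC_left tendsto_mult tendsto_const assms(1))
  moreover have "\<forall>\<^sub>F m in sequentially. norm (\<Sum>j<n. (\<theta> j * x m j) *\<^sub>C e j) \<le> R"
    using assms(2) by eventually_elim (use \<theta> in \<open>auto intro: lat_ballD\<close>)
  ultimately show "norm (\<Sum>j<n. (\<theta> j * y j) *\<^sub>C e j) \<le> R"
    by (rule tendsto_upperbound) simp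
qed

lemma lat_ball_norm_le: "lat_ball e R x \<Longrightarrow> norm (\<Sum>j<n. x j *\<^sub>C e j) \<le> R"
  using lat_ballD[of e R x "\<lambda>_. 1" n] by simp

lemma lat_ball_component: assumes "lat_ball e R x" shows "cmod (x j) * norm (e j) \<le> R"
proof -
  have "(\<Sum>i<Suc j. ((if i = j then 1 else 0) * x i) *\<^sub>C e i) =
      (\<Sum>i<Suc j. if i = j then x j *\<^sub>C e j else 0)"
    by (rule sum.cong) auto
  also have "\<dots> = x j *\<^sub>C e j" by simp
  finally show ?thesis
    using lat_ballD[OF assms, of "\<lambda>i. if i = j then 1 else 0" "Suc j"] by (simp add: norm_scaleC)
qed

lemma dual_ballD: "dual_ball e S y \<Longrightarrow> lat_ball e R x \<Longrightarrow> (\<Sum>j<n. cmod (x j) * cmod (y j)) \<le> R * S"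
  unfolding dual_ball_def by blast

lemma dual_ball_dominated:
  assumes y: "dual_ball e S y" and le: "\<And>j. cmod (z j) \<le> cmod (y j)"
  shows "dual_ball e S z"
  unfolding dual_ball_def
proof (intro allI impI)
  fix R x n assume "lat_ball e R x"
  have "(\<Sum>j<n. cmod (x j) * cmod (z j)) \<le> (\<Sum>j<n. cmod (x j) * cmod (y j))"
    by (intro sum_mono mult_left_mono le) auto
  also have "\<dots> \<le> R * S" by (rule dual_ballD[OF y \<open>lat_ball e R x\<close>])
  finally show "(\<Sum>j<n. cmod (x j) * cmod (z j)) \<le> R * S" .
qed

lemma dual_ball_mono: assumes "dual_ball e R x" "R \<le> R'" shows "dual_ball e R' x"
  unfolding dual_ball_def
proof (intro allI impI)
  fix S y n assume l: "lat_ball e S y"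
  have "S * R \<le> S * R'" using lat_ball_nonneg[OF l] assms(2) by (intro mult_left_mono)
  with dual_ballD[OF assms(1) l, of n] show "(\<Sum>j<n. cmod (y j) * cmod (x j)) \<le> S * R'" by linarith
qed

lemma dual_ball_add:
  assumes "dual_ball e R x" "dual_ball e S y" shows "dual_ball e (R + S) (x + y)"
  unfolding dual_ball_def
proof (intro allI impI)
  fix T z n assume l: "lat_ball e T z"
  have "(\<Sum>j<n. cmod (z j) * cmod ((x + y) j)) \<le>
      (\<Sum>j<n. cmod (z j) * cmod (x j) + cmod (z j) * cmod (y j))"
    by (intro sum_mono) (auto simp flip: distrib_left intro: mult_left_mono norm_triangle_ineq)
  also have "\<dots> \<le> T * R + T * S"
    unfolding sum.distrib by (intro add_mono dual_ballD[OF assms(1) l] dual_ballD[OF assms(2) l])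
  finally show "(\<Sum>j<n. cmod (z j) * cmod ((x + y) j)) \<le> T * (R + S)" by (simp add: distrib_left)
qed

lemma dual_ball_scaleC:
  assumes "dual_ball e R x" shows "dual_ball e (cmod c * R) (c *\<^sub>C x)"
  unfolding dual_ball_def
proof (intro allI impI)
  fix T z n assume l: "lat_ball e T z"
  have "(\<Sum>j<n. cmod (z j) * cmod ((c *\<^sub>C x) j)) = cmod c * (\<Sum>j<n. cmod (z j) * cmod (x j))"
    by (simp add: sum_distrib_left norm_mult mult_ac)
  also have "\<dots> \<le> cmod c * (T * R)" by (intro mult_left_mono dual_ballD[OF assms l]) auto
  finally show "(\<Sum>j<n. cmod (z j) * cmod ((c *\<^sub>C x) j)) \<le> T * (cmod c * R)" by (simp add: mult_ac)
qed

lemma dual_ball_0: assumes "0 \<le> R" shows "dual_ball e R 0"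
  unfolding dual_ball_def using assms by (auto dest: lat_ball_nonneg)

lemma dual_ball_sum:
  assumes "\<And>i. i \<in> A \<Longrightarrow> dual_ball e (R i) (x i)"
  shows "dual_ball e (\<Sum>i\<in>A. R i) (\<Sum>i\<in>A. x i)"
  using assms
proof (induction A rule: infinite_finite_induct)
  case (insert a A)
  then show ?case using dual_ball_add[of e "R a" "x a"] by (simp only: sum.insert insert_iff simp_thms)
qed (simp_all only: sum.empty sum.infinite simp_thms dual_ball_0 order_refl)

text \<open>A convex function on a cube is bounded by its values at the vertices. The induction
  handles one coordinate at a time, with \<open>w\<close> collecting the vectors already
  decided.\<close>

lemma convex_combination_bound:
  fixes v :: "'i \<Rightarrow> 'b::real_normed_vector"
  assumes "finite F" "\<And>A. A \<subseteq> F \<Longrightarrow> norm (w + sum v A) \<le> R"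
    and "\<And>j. j \<in> F \<Longrightarrow> 0 \<le> t j \<and> t j \<le> 1"
  shows "norm (w + (\<Sum>j\<in>F. t j *\<^sub>R v j)) \<le> R"
  using assms
proof (induction F arbitrary: w)
  case (insert x F)
  let ?s = "\<Sum>j\<in>F. t j *\<^sub>R v j"
  have t: "0 \<le> t x" "t x \<le> 1" using insert.prems by auto
  have 1: "norm (w + ?s) \<le> R"
    by (rule insert.IH) (use insert.prems in auto)
  have 2: "norm ((w + v x) + ?s) \<le> R"
  proof (rule insert.IH)
    fix A assume A: "A \<subseteq> F"
    then have "sum v (insert x A) = v x + sum v A"
      using insert.hyps by (intro sum.insert) (auto intro: finite_subset)
    then show "norm (w + v x + sum v A) \<le> R"
      using insert.prems(1)[of "insert x A"] A by (auto simp: add.assoc)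
  qed (use insert.prems in auto)
  have "w + (\<Sum>j\<in>insert x F. t j *\<^sub>R v j) = (1 - t x) *\<^sub>R (w + ?s) + t x *\<^sub>R (w + v x + ?s)"
    using insert.hyps by (simp add: algebra_simps)
  also have "norm \<dots> \<le> (1 - t x) * norm (w + ?s) + t x * norm (w + v x + ?s)"
    using t by (intro order_trans[OF norm_triangle_ineq]) simp
  also have "\<dots> \<le> (1 - t x) * R + t x * R" using t 1 2 by (intro add_mono mult_left_mono) auto
  finally show ?case by (simp add: algebra_simps)
qed auto

text \<open>The factor 4 counts the positive and negative parts of the real and imaginary parts of
  the multiplier, each a family of coefficients in the unit interval.\<close>

lemma complex_multiplier_bound:
  fixes v :: "'i \<Rightarrow> 'b::complex_banach"
  assumes F: "finite F" and b: "\<And>A. A \<subseteq> F \<Longrightarrow> norm (sum v A) \<le> R"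
    and \<theta>: "\<And>j. cmod (\<theta> j) \<le> 1"
  shows "norm (\<Sum>j\<in>F. \<theta> j *\<^sub>C v j) \<le> 4 * R"
proof -
  have p: "norm (\<Sum>j\<in>F. t j *\<^sub>R v j) \<le> R" if "\<And>j. 0 \<le> t j \<and> t j \<le> 1" for t
    using convex_combination_bound[OF F, of 0 v R t] b that by simp
  define s where "s t = (\<Sum>j\<in>F. t j *\<^sub>R v j)" for t
  have "\<theta> j *\<^sub>C v j = max 0 (Re (\<theta> j)) *\<^sub>R v j - max 0 (- Re (\<theta> j)) *\<^sub>R v j +
      \<i> *\<^sub>C (max 0 (Im (\<theta> j)) *\<^sub>R v j - max 0 (- Im (\<theta> j)) *\<^sub>R v j)" for j
  proof -
    have "\<theta> j = of_real (max 0 (Re (\<theta> j))) - of_real (max 0 (- Re (\<theta> j))) +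
      \<i> * (of_real (max 0 (Im (\<theta> j))) - of_real (max 0 (- Im (\<theta> j))))"
      by (simp add: complex_eq_iff max_def)
    then have "\<theta> j *\<^sub>C v j = (of_real (max 0 (Re (\<theta> j))) - of_real (max 0 (- Re (\<theta> j))) +
      \<i> * (of_real (max 0 (Im (\<theta> j))) - of_real (max 0 (- Im (\<theta> j))))) *\<^sub>C v j" by (rule arg_cong)
    then show ?thesis
      by (simp only: scaleC_add_left scaleC_scaleC[symmetric] scaleR_scaleC
          complex_vector.scale_left_diff_distrib complex_vector.scale_right_diff_distrib)
  qed
  then have "(\<Sum>j\<in>F. \<theta> j *\<^sub>C v j) = s (\<lambda>j. max 0 (Re (\<theta> j))) - s (\<lambda>j. max 0 (- Re (\<theta> j))) +
      \<i> *\<^sub>C (s (\<lambda>j. max 0 (Im (\<theta> j))) - s (\<lambda>j. max 0 (- Im (\<theta> j))))"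
    unfolding s_def
    by (simp add: sum.distrib sum_subtractf complex_vector.scale_sum_right
        complex_vector.scale_right_diff_distrib)
  also have "norm \<dots> \<le> (R + R) + (R + R)"
  proof -
    have q: "norm (s (\<lambda>j. max 0 (f (\<theta> j)))) \<le> R" if "\<And>z. \<bar>f z\<bar> \<le> cmod z" for f
    proof -
      have "0 \<le> max 0 (f (\<theta> j)) \<and> max 0 (f (\<theta> j)) \<le> 1" for j
        using \<theta>[of j] that[of "\<theta> j"] by auto
      then show ?thesis unfolding s_def by (rule p)
    qed
    have "norm (s (\<lambda>j. max 0 (Re (\<theta> j)))) \<le> R" "norm (s (\<lambda>j. max 0 (- Re (\<theta> j)))) \<le> R"
      "norm (s (\<lambda>j. max 0 (Im (\<theta> j)))) \<le> R" "norm (s (\<lambda>j. max 0 (- Im (\<theta> j)))) \<le> R"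
      by (rule q, simp add: abs_Re_le_cmod abs_Im_le_cmod)+
    then show ?thesis
      by (intro order_trans[OF norm_triangle_ineq] add_mono)
        (auto simp: norm_scaleC intro: order_trans[OF norm_triangle_ineq4] add_mono)
  qed
  finally show ?thesis by simp
qed

text \<open>Finite sets containing a suitable \<open>F0\<close> have sums within distance 1 of
  \<open>s\<close>; completing \<open>A\<close> to such a set changes its sum by at most the sum of
  the norms over \<open>F0\<close>.\<close>

lemma summable_on_partial_sums_bounded:
  fixes v :: "'i \<Rightarrow> 'b::real_normed_vector"
  assumes "v summable_on UNIV"
  shows "\<exists>R. \<forall>A. finite A \<longrightarrow> norm (sum v A) \<le> R"
proof -
  obtain s where "(v has_sum s) UNIV" using assms by (auto simp: summable_on_def)
  then have "(sum v \<longlongrightarrow> s) (finite_subsets_at_top UNIV)" by (simp add: has_sum_def)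
  then have "\<forall>\<^sub>F A in finite_subsets_at_top UNIV. dist (sum v A) s < 1"
    by (rule tendstoD) simp
  then obtain F0 where F0: "finite F0" "\<And>A. finite A \<Longrightarrow> F0 \<subseteq> A \<Longrightarrow> dist (sum v A) s < 1"
    by (auto simp: eventually_finite_subsets_at_top)
  have "norm (sum v A) \<le> norm s + 1 + (\<Sum>i\<in>F0. norm (v i))" if A: "finite A" for A
  proof -
    have "sum v (A \<union> F0) = sum v A + sum v (F0 - A)"
      using A F0(1) by (subst sum.union_disjoint[symmetric]) (auto intro: sum.cong)
    then have "(sum v (A \<union> F0) - s) + s - sum v (F0 - A) = sum v A" by simp
    moreover have "norm ((sum v (A \<union> F0) - s) + s - sum v (F0 - A)) \<le>
        norm (sum v (A \<union> F0) - s) + norm s + norm (sum v (F0 - A))"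
      by (rule order_trans[OF norm_triangle_ineq4 add_right_mono[OF norm_triangle_ineq]])
    ultimately have "norm (sum v A) \<le> norm (sum v (A \<union> F0) - s) + norm s + norm (sum v (F0 - A))"
      by simp
    moreover have "norm (sum v (A \<union> F0) - s) \<le> 1"
      using F0(2)[of "A \<union> F0"] A F0(1) by (auto simp: dist_norm)
    moreover have "norm (sum v (F0 - A)) \<le> (\<Sum>i\<in>F0. norm (v i))"
      using F0(1) by (intro order_trans[OF norm_sum] sum_mono2) auto
    ultimately show ?thesis by linarith
  qed
  then show ?thesis by blast
qed

section \<open>Coordinates and the unconditional constant\<close>

context
  fixes e :: "nat \<Rightarrow> 'a::complex_banach"
  assumes unc: "unconditional_basis e"
begin

lemma coord_sums: "(\<lambda>j. coord e x j *\<^sub>C e j) sums x"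
proof -
  have "\<exists>!a. (\<lambda>j. a j *\<^sub>C e j) sums x"
    by (rule unc[unfolded unconditional_basis_def schauder_basis_def, THEN conjunct1, THEN spec])
  then show ?thesis unfolding coord_def by (rule theI')
qed

lemma coord_unique: "(\<lambda>j. a j *\<^sub>C e j) sums x \<Longrightarrow> coord e x = a"
proof -
  have "\<exists>!a. (\<lambda>j. a j *\<^sub>C e j) sums x"
    by (rule unc[unfolded unconditional_basis_def schauder_basis_def, THEN conjunct1, THEN spec])
  then show "(\<lambda>j. a j *\<^sub>C e j) sums x \<Longrightarrow> coord e x = a"
    unfolding coord_def by (rule the1_equality)
qed

lemma coord_add: "coord e (x + y) = coord e x + coord e y"
  by (rule coord_unique) (use sums_add[OF coord_sums coord_sums] in \<open>simp add: scaleC_add_left\<close>)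

lemma coord_scaleC: "coord e (c *\<^sub>C x) = c *\<^sub>C coord e x"
  by (rule coord_unique)
     (use bounded_linear.sums[OF bounded_linear_scaleC coord_sums] in \<open>simp add: scaleC_scaleC\<close>)

lemma coord_uminus: "coord e (- x) = - coord e x"
proof -
  have "- x = (-1) *\<^sub>C x" by simp
  then have "coord e (- x) = (-1) *\<^sub>C coord e x" by (simp only: coord_scaleC)
  then show ?thesis by (simp add: fun_eq_iff)
qed

lemma coord_diff: "coord e (x - y) = coord e x - coord e y"
  using coord_add[of x "- y"] by (simp add: coord_uminus)

lemma coord_0: "coord e 0 = 0"
  by (rule coord_unique) simp

lemma coord_finite_sum:
  assumes "\<And>j. j \<ge> n \<Longrightarrow> a j = 0" shows "coord e (\<Sum>j<n. a j *\<^sub>C e j) = a"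
  by (rule coord_unique) (rule sums_finite, use assms in \<open>auto simp: not_le[symmetric]\<close>)

lemma coord_basis: "coord e (e j) = unit_seq j"
proof (rule coord_unique)
  have "(\<lambda>i. unit_seq j i *\<^sub>C e i) sums (\<Sum>i\<in>{j}. unit_seq j i *\<^sub>C e i)"
    by (rule sums_finite) (auto simp: unit_seq_def)
  then show "(\<lambda>i. unit_seq j i *\<^sub>C e i) sums e j" by (simp add: unit_seq_def)
qed

lemma basis_nonzero: "e j \<noteq> 0"
proof
  assume "e j = 0"
  then have "unit_seq j = 0" using coord_basis[of j] coord_0 by simp
  then have "unit_seq j j = 0" by simp
  then show False by (simp add: unit_seq_def)
qed

text \<open>Unconditional convergence gives a bound for each vector separately; a bound proportional
  to the norm needs the Baire category argument that follows.\<close>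

lemma lat_ball_coord_exists: "\<exists>R. lat_ball e R (coord e x)"
proof -
  define v where "v j = coord e x j *\<^sub>C e j" for j
  have "summable v" using coord_sums[of x] by (auto simp: v_def[abs_def] summable_def)
  then have "v summable_on UNIV" using unc unfolding unconditional_basis_def v_def[abs_def] by blast
  then obtain R where R: "\<And>A. finite A \<Longrightarrow> norm (sum v A) \<le> R"
    using summable_on_partial_sums_bounded by blast
  have "lat_ball e (4 * R) (coord e x)"
    unfolding lat_ball_def
  proof (intro allI impI)
    fix n and \<theta> :: omega assume "\<forall>j. cmod (\<theta> j) \<le> 1"
    then have "norm (\<Sum>j<n. \<theta> j *\<^sub>C v j) \<le> 4 * R"
      by (intro complex_multiplier_bound R) (auto intro: finite_subset)
    then show "norm (\<Sum>j<n. (\<theta> j * coord e x j) *\<^sub>C e j) \<le> 4 * R"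
      by (simp add: v_def scaleC_scaleC)
  qed
  then show ?thesis by blast
qed

lemma lat_ball_coord_diff:
  "lat_ball e R (coord e x) \<Longrightarrow> lat_ball e S (coord e y) \<Longrightarrow> lat_ball e (R + S) (coord e (x - y))"
  using lat_ball_add[of e R "coord e x" S "- coord e y"] lat_ball_dominated[of e S "coord e y" "- coord e y"]
  by (simp add: coord_diff)

text \<open>The sets \<open>A m\<close> of vectors with lattice bound \<open>m\<close> cover the
  space, so by Baire category the closure of one of them contains a ball; differences of its
  elements approximate small vectors. As in the open mapping theorem, this yields only approximation
  up to half the radius.\<close>

lemma lat_ball_approximation:
  "\<exists>D>0. \<forall>x \<rho>. norm x < \<rho> \<longrightarrow> (\<exists>y. lat_ball e (D * \<rho>) (coord e y) \<and> norm (x - y) < \<rho> / 2)"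
proof -
  define A where "A m = {x. lat_ball e (real m) (coord e x)}" for m :: nat
  have cover: "(\<Union>m. A m) = UNIV"
  proof -
    have "x \<in> (\<Union>m. A m)" for x
    proof -
      obtain R where "lat_ball e R (coord e x)" using lat_ball_coord_exists by blast
      then have "lat_ball e (real (nat \<lceil>R\<rceil>)) (coord e x)"
        by (rule lat_ball_mono) linarith
      then show ?thesis by (auto simp: A_def)
    qed
    then show ?thesis by blast
  qed
  have complete: "Metric_space.mcomplete (UNIV :: 'a set) dist"
    unfolding Met_TC.mcomplete_def
    by (auto simp: Cauchy_convergent_iff convergent_def)
  have "\<exists>m. interior (closure (A m)) \<noteq> {}"
  proof (rule ccontr)
    assume no: "\<nexists>m. interior (closure (A m)) \<noteq> {}"
    have "Met_TC.mtopology interior_of \<Union>(range (\<lambda>m. closure (A m))) = {}"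
    proof (rule Met_TC.metric_Baire_category_alt[OF complete])
      fix T assume "T \<in> range (\<lambda>m. closure (A m))"
      then obtain m where T: "T = closure (A m)" by blast
      have "closedin Met_TC.mtopology T" by (simp add: T)
      moreover have "Met_TC.mtopology interior_of T = interior T"
        by (auto simp: interior_of_def interior_def)
      then have "Met_TC.mtopology interior_of T = {}" using no T by simp
      ultimately show "closedin Met_TC.mtopology T \<and> Met_TC.mtopology interior_of T = {}" ..
    qed auto
    moreover have "\<Union>(range (\<lambda>m. closure (A m))) = UNIV"
      using cover closure_subset by blast
    ultimately show False by simp
  qed
  then obtain m x0 r where r: "0 < r" "ball x0 r \<subseteq> closure (A m)"
    by (metis equals0I mem_interior)
  \<comment> \<open>Differences of elements of \<open>A m\<close> have lattice bound
    \<open>2 * m\<close>, and a vector of norm below \<open>\<rho>\<close> is rescaled to norm below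
    \<open>r / 2\<close>. The added 1 keeps \<open>D\<close> positive for
    \<open>m = 0\<close>.\<close>
  define D where "D = 2 * (real m + 1) / (r / 2)"
  have "\<exists>y. lat_ball e (D * \<rho>) (coord e y) \<and> norm (x - y) < \<rho> / 2" if x: "norm x < \<rho>" for x \<rho>
  proof -
    have \<rho>: "0 < \<rho>" using x norm_ge_zero[of x] by linarith
    define k where "k = (r / 2) / \<rho>"
    have k: "0 < k" using r \<rho> by (simp add: k_def)
    define z where "z = of_real k *\<^sub>C x"
    have "norm z = k * norm x" using k by (simp add: z_def norm_scaleC)
    also have "\<dots> < k * \<rho>" using k x by simp
    also have "\<dots> < r" using r \<rho> by (simp add: k_def)
    finally have "x0 + z \<in> closure (A m)" using r(2) by (auto simp: dist_norm)
    moreover have "x0 \<in> closure (A m)" using r by auto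
    moreover have "0 < k * \<rho> / 4" using k \<rho> by simp
    ultimately obtain a b where ab: "a \<in> A m" "dist a (x0 + z) < k * \<rho> / 4" "b \<in> A m" "dist b x0 < k * \<rho> / 4"
      by (meson closure_approachable)
    have nz: "norm (z - (a - b)) < k * \<rho> / 2"
    proof -
      have "z - (a - b) = (b - x0) - (a - (x0 + z))" by simp
      also have "norm \<dots> \<le> norm (b - x0) + norm (a - (x0 + z))" by (rule norm_triangle_ineq4)
      finally show ?thesis using ab by (simp add: dist_norm)
    qed
    define y where "y = of_real (1 / k) *\<^sub>C (a - b)"
    have "lat_ball e (real m + real m) (coord e (a - b))"
      using ab by (intro lat_ball_coord_diff) (auto simp: A_def)
    from lat_ball_scaleC[OF this, of "of_real (1 / k)"]
    have "lat_ball e (cmod (of_real (1 / k)) * (real m + real m)) (coord e y)"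
      by (simp only: y_def coord_scaleC)
    moreover have "cmod (of_real (1 / k)) * (real m + real m) \<le> D * \<rho>"
      using k r \<rho> by (simp add: D_def k_def norm_divide field_simps)
    ultimately have "lat_ball e (D * \<rho>) (coord e y)" by (rule lat_ball_mono)
    moreover have "norm (x - y) < \<rho> / 2"
    proof -
      have "x - y = of_real (1 / k) *\<^sub>C (z - (a - b))"
        using k by (simp add: z_def y_def complex_vector.scale_right_diff_distrib scaleC_scaleC scaleC_one
            flip: of_real_mult)
      then have "norm (x - y) = 1 / k * norm (z - (a - b))" using k by (simp add: norm_scaleC norm_divide)
      also have "\<dots> < 1 / k * (k * \<rho> / 2)" using nz k by (intro mult_strict_left_mono) auto
      finally show ?thesis using k by simp
    qed
    ultimately show ?thesis by blast
  qed
  moreover have "0 < D" using r by (simp add: D_def)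
  ultimately show ?thesis by blast
qed

text \<open>Iterating the approximation writes \<open>x\<close> as a series of vectors whose lattice
  bounds decrease geometrically. Continuity of \<open>coord\<close> is not at hand, so the summed
  coordinates \<open>b\<close> are shown to represent \<open>x\<close>, and uniqueness of the
  expansion identifies them with \<open>coord e x\<close>.\<close>

lemma unconditional_constant: "\<exists>K>0. \<forall>x. lat_ball e (K * norm x) (coord e x)"
proof -
  obtain D where D: "0 < D"
    "\<And>x \<rho>. norm x < \<rho> \<Longrightarrow> \<exists>y. lat_ball e (D * \<rho>) (coord e y) \<and> norm (x - y) < \<rho> / 2"
    using lat_ball_approximation by blast
  have main: "lat_ball e (2 * D * \<rho>) (coord e x)" if x: "norm x < \<rho>" for x \<rho>
  proof -
    have \<rho>: "0 < \<rho>" using x norm_ge_zero[of x] by linarith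
    have "\<exists>X. X 0 = x \<and> (\<forall>n. norm (X n) < \<rho> / 2 ^ n \<and> lat_ball e (D * (\<rho> / 2 ^ n)) (coord e (X n - X (Suc n))))"
    proof -
      \<comment> \<open>The clause about \<open>n = 0\<close> is carried along to pin the starting
        vector, which dependent choice alone would leave free.\<close>
      have "\<exists>X. \<forall>n. (norm (X n) < \<rho> / 2 ^ n \<and> (n = 0 \<longrightarrow> X n = x)) \<and>
          lat_ball e (D * (\<rho> / 2 ^ n)) (coord e (X n - X (Suc n)))"
      proof (rule dependent_nat_choice)
        show "\<exists>z. norm z < \<rho> / 2 ^ 0 \<and> (0 = 0 \<longrightarrow> z = x)" using x by auto
        fix z n assume "norm z < \<rho> / 2 ^ n \<and> (n = 0 \<longrightarrow> z = x)"
        then obtain y where y: "lat_ball e (D * (\<rho> / 2 ^ n)) (coord e y)" "norm (z - y) < \<rho> / 2 ^ n / 2"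
          using D(2) by blast
        then show "\<exists>w. (norm w < \<rho> / 2 ^ Suc n \<and> (Suc n = 0 \<longrightarrow> w = x)) \<and>
            lat_ball e (D * (\<rho> / 2 ^ n)) (coord e (z - w))"
          by (intro exI[of _ "z - y"]) (auto simp: field_simps)
      qed
      then show ?thesis by blast
    qed
    then obtain X where X: "X 0 = x" "\<And>n. norm (X n) < \<rho> / 2 ^ n"
      "\<And>n. lat_ball e (D * (\<rho> / 2 ^ n)) (coord e (X n - X (Suc n)))" by blast
    define c where "c n = coord e (x - X n)" for n
    have cd: "lat_ball e (2 * D * \<rho> / 2 ^ N) (c M - c N)" if "M \<ge> N" for M N
    proof -
      have "c M - c N = (\<Sum>n=N..<M. c (Suc n) - c n)"
        using that by (simp only: sum_Suc_diff')
      also have "\<dots> = (\<Sum>n=N..<M. coord e (X n - X (Suc n)))"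
        by (rule sum.cong) (auto simp: c_def coord_diff[symmetric] simp del: coord_diff)
      finally have "lat_ball e (\<Sum>n=N..<M. D * (\<rho> / 2 ^ n)) (c M - c N)"
        using lat_ball_sum[of "{N..<M}" e "\<lambda>n. D * (\<rho> / 2 ^ n)", OF X(3)] by (simp only:)
      moreover have "(\<Sum>n=N..<M. D * (\<rho> / 2 ^ n)) \<le> 2 * D * \<rho> / 2 ^ N"
      proof -
        have "(\<Sum>n=N..<M. D * (\<rho> / 2 ^ n)) = 2 * D * \<rho> / 2 ^ N - 2 * D * \<rho> / 2 ^ M"
          using that
        proof (induction M rule: dec_induct)
          case (step n)
          have "D * (\<rho> / 2 ^ n) = 2 * D * \<rho> / 2 ^ n - 2 * D * \<rho> / 2 ^ Suc n" by (simp add: field_simps)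
          then show ?case using step by simp
        qed simp
        then show ?thesis using D(1) \<rho> by simp
      qed
      ultimately show ?thesis by (rule lat_ball_mono)
    qed
    have small: "(\<lambda>N. C / 2 ^ N) \<longlonglongrightarrow> 0" for C :: real
      using tendsto_mult_right_zero[OF LIMSEQ_inverse_realpow_zero[of 2], of C] by (simp add: divide_inverse)
    have "Cauchy (\<lambda>n. c n j)" for j
    proof (rule metric_CauchyI)
      fix \<epsilon> :: real assume "\<epsilon> > 0"
      have ne: "0 < norm (e j)" using basis_nonzero by simp
      then have "\<forall>\<^sub>F N in sequentially. (2 * D * \<rho>) / 2 ^ N < \<epsilon> * norm (e j) / 2"
        using small \<open>\<epsilon> > 0\<close> by (intro order_tendstoD) auto
      then obtain N where N: "(2 * D * \<rho>) / 2 ^ N < \<epsilon> * norm (e j) / 2"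
        by (auto simp: eventually_sequentially)
      have *: "dist (c M j) (c N j) < \<epsilon> / 2" if "M \<ge> N" for M
      proof -
        have "cmod ((c M - c N) j) * norm (e j) < \<epsilon> / 2 * norm (e j)"
          using lat_ball_component[OF cd[OF that], of j] N by simp
        then have "cmod ((c M - c N) j) < \<epsilon> / 2" using ne by (rule mult_right_less_imp_less[OF _ less_imp_le])
        then show ?thesis by (simp add: dist_norm)
      qed
      have "dist (c M j) (c M' j) < \<epsilon>" if "M \<ge> N" "M' \<ge> N" for M M'
        using dist_triangle2[of "c M j" "c M' j" "c N j"] *[OF that(1)] *[OF that(2)] by simp
      then show "\<exists>N. \<forall>m\<ge>N. \<forall>n\<ge>N. dist (c m j) (c n j) < \<epsilon>" by blast
    qed
    then have "\<exists>l. (\<lambda>n. c n j) \<longlonglongrightarrow> l" for j using Cauchy_convergent convergent_def by blast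
    then obtain b where b: "\<And>j. (\<lambda>n. c n j) \<longlonglongrightarrow> b j" by metis
    have bd: "lat_ball e (2 * D * \<rho> / 2 ^ N) (b - c N)" for N
    proof (rule lat_ball_lim)
      show "(\<lambda>M. (c M - c N) j) \<longlonglongrightarrow> (b - c N) j" for j using b by (auto intro!: tendsto_intros)
      show "\<forall>\<^sub>F M in sequentially. lat_ball e (2 * D * \<rho> / 2 ^ N) (c M - c N)"
        by (rule eventually_mono[OF eventually_ge_at_top[of N]]) (rule cd)
    qed
    \<comment> \<open>The error of a partial sum has three parts: \<open>b - c N\<close>, small
      uniformly in the length of the sum; the expansion of \<open>x - X N\<close>, which converges;
      and the remainder \<open>X N\<close>.\<close>
    have "(\<lambda>j. b j *\<^sub>C e j) sums x"
      unfolding sums_def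
    proof (rule LIMSEQ_I)
      fix \<epsilon> :: real assume \<epsilon>: "\<epsilon> > 0"
      have "\<forall>\<^sub>F N in sequentially. (2 * D * \<rho> + \<rho>) / 2 ^ N < \<epsilon> / 2"
        using small \<epsilon> by (intro order_tendstoD) auto
      then obtain N where N: "(2 * D * \<rho> + \<rho>) / 2 ^ N < \<epsilon> / 2"
        by (auto simp: eventually_sequentially)
      have "(\<lambda>J. \<Sum>j<J. c N j *\<^sub>C e j) \<longlonglongrightarrow> x - X N"
        using coord_sums[of "x - X N"] by (simp add: c_def sums_def)
      then obtain J0 where J0: "\<And>J. J \<ge> J0 \<Longrightarrow> norm ((\<Sum>j<J. c N j *\<^sub>C e j) - (x - X N)) < \<epsilon> / 2"
        using LIMSEQ_D[of _ "x - X N" "\<epsilon> / 2"] \<epsilon> by auto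
      have "norm ((\<Sum>j<J. b j *\<^sub>C e j) - x) < \<epsilon>" if "J \<ge> J0" for J
      proof -
        have "(\<Sum>j<J. b j *\<^sub>C e j) - x = (\<Sum>j<J. (b - c N) j *\<^sub>C e j) +
            ((\<Sum>j<J. c N j *\<^sub>C e j) - (x - X N)) - X N"
          by (simp add: complex_vector.scale_left_diff_distrib sum_subtractf)
        also have "norm \<dots> \<le> norm (\<Sum>j<J. (b - c N) j *\<^sub>C e j) +
            norm ((\<Sum>j<J. c N j *\<^sub>C e j) - (x - X N)) + norm (X N)"
          by (intro order_trans[OF norm_triangle_ineq4] add_mono norm_triangle_ineq order_refl)
        also have "\<dots> < 2 * D * \<rho> / 2 ^ N + \<epsilon> / 2 + \<rho> / 2 ^ N"
          using lat_ball_norm_le[OF bd, of N J] J0[OF that] X(2)[of N] by linarith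
        also have "2 * D * \<rho> / 2 ^ N + \<epsilon> / 2 + \<rho> / 2 ^ N = (2 * D * \<rho> + \<rho>) / 2 ^ N + \<epsilon> / 2"
          by (simp add: add_divide_distrib)
        also have "\<dots> < \<epsilon>" using N by linarith
        finally show ?thesis .
      qed
      then show "\<exists>J0. \<forall>J\<ge>J0. norm ((\<Sum>j<J. b j *\<^sub>C e j) - x) < \<epsilon>" by blast
    qed
    then have "coord e x = b" by (rule coord_unique)
    moreover have "c 0 = 0" using X(1) coord_0 by (simp add: c_def)
    ultimately show ?thesis using bd[of 0] by simp
  qed
  \<comment> \<open>\<open>main\<close> needs a strict bound for the norm; the radius
    \<open>2 * norm x\<close> provides it and doubles the constant.\<close>
  have "lat_ball e (4 * D * norm x) (coord e x)" for x
  proof (cases "x = 0")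
    case False
    then show ?thesis using main[of x "2 * norm x"] by (simp add: mult_ac)
  next
    case True
    have "lat_ball e 0 (coord e 0)" unfolding coord_0 by (rule lat_ball_0) simp
    then show ?thesis using True by simp
  qed
  then show ?thesis using D(1) by (intro exI[of _ "4 * D"]) auto
qed

end


subsection \<open>Three lines\<close>

lemma interior_strip: "interior strip = {z. 0 < Re z \<and> Re z < 1}"
proof
  have "open {z. 0 < Re z \<and> Re z < 1}"
    by (intro open_Collect_conj open_Collect_less continuous_intros)
  then show "{z. 0 < Re z \<and> Re z < 1} \<subseteq> interior strip"
    by (intro interior_maximal) (auto simp: strip_def)
  show "interior strip \<subseteq> {z. 0 < Re z \<and> Re z < 1}"
  proof
    fix z assume "z \<in> interior strip"
    then obtain \<epsilon> where \<epsilon>: "\<epsilon> > 0" "ball z \<epsilon> \<subseteq> strip" by (auto simp: mem_interior)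
    have "z + of_real (\<epsilon> / 2) \<in> ball z \<epsilon>" "z - of_real (\<epsilon> / 2) \<in> ball z \<epsilon>"
      using \<epsilon>(1) by (auto simp: dist_norm)
    then have "z + of_real (\<epsilon> / 2) \<in> strip" "z - of_real (\<epsilon> / 2) \<in> strip" using \<epsilon>(2) by blast+
    then show "z \<in> {z. 0 < Re z \<and> Re z < 1}" using \<epsilon>(1) by (auto simp: strip_def)
  qed
qed

lemma half_interior_strip: "1 / 2 \<in> interior strip"
  by (simp add: interior_strip)

lemma three_lines:
  assumes cont: "continuous_on strip \<phi>" and holo: "\<phi> holomorphic_on interior strip"
    and bdd: "\<And>z. z \<in> strip \<Longrightarrow> cmod (\<phi> z) \<le> b"
    and bdry: "\<And>t. cmod (\<phi> (\<i> * of_real t)) \<le> M" "\<And>t. cmod (\<phi> (1 + \<i> * of_real t)) \<le> M"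
  shows "cmod (\<phi> (1 / 2)) \<le> M"
proof -
  have M: "0 \<le> M" using bdry(1)[of 0] norm_ge_zero order_trans by blast
  have "0 \<in> strip" by (simp add: strip_def)
  then have b: "0 \<le> b" by (rule order_trans[OF norm_ge_zero bdd])
  have main: "cmod (\<phi> (1 / 2)) \<le> (M + \<delta>) * exp \<delta>" if \<delta>: "\<delta> > 0" for \<delta>
  proof -
    \<comment> \<open>The height is chosen so that on the horizontal sides the decay of the factor
      pushes the crude bound \<open>b\<close> below \<open>\<delta>\<close>, by the inequality
      \<open>u \<le> exp u\<close>.\<close>
    define T where "T = 1 + sqrt (b / \<delta> / \<delta>)"
    have T: "1 \<le> T" using b \<delta> by (simp add: T_def)
    have bT: "b * exp (- \<delta> * T\<^sup>2) \<le> \<delta>"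
    proof -
      have "b / \<delta> / \<delta> \<le> T\<^sup>2"
        using b \<delta> real_sqrt_pow2[of "b / \<delta> / \<delta>"] power_mono[of "sqrt (b / \<delta> / \<delta>)" T 2] by (simp add: T_def)
      then have "b \<le> \<delta> * (\<delta> * T\<^sup>2)" using \<delta> by (simp add: field_simps)
      also have "\<dots> \<le> \<delta> * exp (\<delta> * T\<^sup>2)"
        using \<delta> exp_ge_add_one_self[of "\<delta> * T\<^sup>2"] by (intro mult_left_mono) linarith+
      finally show ?thesis by (simp add: exp_minus field_simps)
    qed
    define \<psi> where "\<psi> z = \<phi> z * exp (of_real \<delta> * z\<^sup>2)" for z
    have nexp: "cmod (exp (of_real \<delta> * z\<^sup>2)) = exp (\<delta> * ((Re z)\<^sup>2 - (Im z)\<^sup>2))" for z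
      by (simp add: power2_eq_square)
    define Q where "Q = cbox (Complex 0 (- T)) (Complex 1 T)"
    have Q: "z \<in> Q \<longleftrightarrow> 0 \<le> Re z \<and> Re z \<le> 1 \<and> \<bar>Im z\<bar> \<le> T" for z
      by (auto simp: Q_def in_cbox_complex_iff)
    have iQ: "interior Q = box (Complex 0 (- T)) (Complex 1 T)" by (simp add: Q_def interior_cbox)
    have Qs: "Q \<subseteq> strip" by (auto simp: Q strip_def)
    have "cmod (\<psi> (1 / 2)) \<le> (M + \<delta>) * exp \<delta>"
    proof (rule maximum_modulus_frontier[of \<psi> Q])
      show "\<psi> holomorphic_on interior Q"
        unfolding \<psi>_def using holomorphic_on_subset[OF holo interior_mono[OF Qs]]
        by (intro holomorphic_intros)
      show "continuous_on (closure Q) \<psi>"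
        unfolding \<psi>_def using continuous_on_subset[OF cont Qs]
        by (intro continuous_intros) (simp add: Q_def)
      show "bounded Q" by (simp add: Q_def bounded_cbox)
      show "1 / 2 \<in> Q" using T by (simp add: Q)
      fix z assume "z \<in> frontier Q"
      then have z: "z \<in> Q" "z \<notin> box (Complex 0 (- T)) (Complex 1 T)"
        by (auto simp: frontier_def iQ closure_closed Q_def)
      then have "Re z = 0 \<or> Re z = 1 \<or> \<bar>Im z\<bar> = T"
        by (auto simp: Q in_box_complex_iff)
      then consider "Re z = 0" | "Re z = 1" | "\<bar>Im z\<bar> = T" by blast
      then show "cmod (\<psi> z) \<le> (M + \<delta>) * exp \<delta>"
      proof cases
        case 1
        have "z = \<i> * of_real (Im z)" using 1 by (simp add: complex_eq_iff)
        then have "cmod (\<phi> z) \<le> M" using bdry(1)[of "Im z"] by simp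
        moreover have "exp (\<delta> * ((Re z)\<^sup>2 - (Im z)\<^sup>2)) \<le> exp \<delta>" using 1 \<delta>
          by (simp add: mult_nonneg_nonneg) (smt (verit) mult_nonneg_nonneg zero_le_power2)
        ultimately show ?thesis using M \<delta> unfolding \<psi>_def norm_mult nexp by (intro mult_mono) auto
      next
        case 2
        have "z = 1 + \<i> * of_real (Im z)" using 2 by (simp add: complex_eq_iff)
        then have "cmod (\<phi> z) \<le> M" using bdry(2)[of "Im z"] by simp
        moreover have "exp (\<delta> * ((Re z)\<^sup>2 - (Im z)\<^sup>2)) \<le> exp \<delta>" using 2 \<delta> by simp
        ultimately show ?thesis using M \<delta> unfolding \<psi>_def norm_mult nexp by (intro mult_mono) auto
      next
        case 3
        have "cmod (\<phi> z) \<le> b" using z Qs by (intro bdd) auto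
        moreover have "(Re z)\<^sup>2 \<le> 1" using z(1) by (simp add: Q power_le_one)
        moreover have "(Im z)\<^sup>2 = T\<^sup>2" using 3 by (metis power2_abs)
        ultimately have "cmod (\<psi> z) \<le> b * exp (\<delta> * (1 - T\<^sup>2))"
          using b \<delta> unfolding \<psi>_def norm_mult nexp by (intro mult_mono) auto
        also have "\<dots> = (b * exp (- \<delta> * T\<^sup>2)) * exp \<delta>" by (simp add: mult_exp_exp algebra_simps)
        also have "\<dots> \<le> (M + \<delta>) * exp \<delta>" using bT M by (intro mult_right_mono) auto
        finally show ?thesis .
      qed
    qed
    moreover have "cmod (\<phi> (1 / 2)) \<le> cmod (\<psi> (1 / 2))"
    proof -
      have "1 \<le> exp (\<delta> * ((Re (1/2))\<^sup>2 - (Im (1/2))\<^sup>2))" using \<delta> by simp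
      then show ?thesis unfolding \<psi>_def norm_mult nexp
        using mult_left_mono[of 1 _ "cmod (\<phi> (1/2))"] by fastforce
    qed
    ultimately show ?thesis by linarith
  qed
  have "((\<lambda>\<delta>. (M + \<delta>) * exp \<delta>) \<longlongrightarrow> (M + 0) * exp 0) (at_right 0)"
    by (intro tendsto_intros)
  then have "((\<lambda>\<delta>. (M + \<delta>) * exp \<delta>) \<longlongrightarrow> M) (at_right 0)" by simp
  then show ?thesis
    by (rule tendsto_lowerbound) (auto simp: eventually_at_right_less intro: main eventually_mono[OF eventually_at_right_less])
qed

text \<open>A relaxation of the unit ball of the space of analytic functions: only the finite sections of
  the boundary values are controlled. Accordingly, \<open>der_at e R y d\<close> says that some function of
  norm at most \<open>R\<close> has value \<open>y\<close> and derivative \<open>d\<close> at \<open>1/2\<close>.\<close>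

definition admissible :: "(nat \<Rightarrow> 'a::complex_banach) \<Rightarrow> real \<Rightarrow> (complex \<Rightarrow> omega) \<Rightarrow> bool" where
  "admissible e R F \<longleftrightarrow> (\<forall>j. bounded ((\<lambda>z. F z j) ` strip) \<and> continuous_on strip (\<lambda>z. F z j) \<and>
     (\<lambda>z. F z j) holomorphic_on interior strip) \<and>
     (\<forall>t. lat_ball e R (F (\<i> * of_real t))) \<and> (\<forall>t. dual_ball e R (F (1 + \<i> * of_real t)))"

definition der_at :: "(nat \<Rightarrow> 'a::complex_banach) \<Rightarrow> real \<Rightarrow> omega \<Rightarrow> omega \<Rightarrow> bool" where
  "der_at e R y d \<longleftrightarrow> (\<exists>F. admissible e R F \<and> F (1 / 2) = y \<and> (\<lambda>j. deriv (\<lambda>z. F z j) (1 / 2)) = d)"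

section \<open>Norm control of values and derivatives at the midpoint\<close>

lemma strip_reflect: "z \<in> strip \<Longrightarrow> 1 - cnj z \<in> strip"
  by (simp add: strip_def)

text \<open>The reflection \<open>1 - cnj z\<close> exchanges the two boundary lines at equal height
  and fixes 1/2. On either line one factor of each product therefore lies in the lattice ball and
  the other in the dual ball, while at 1/2 the sum is that of the squared moduli.\<close>

lemma admissible_pnorm_le:
  assumes F: "admissible e R F" shows "pnorm n (F (1 / 2)) \<le> R"
proof -
  define \<phi> where "\<phi> z = (\<Sum>j<n. F z j * cnj (F (1 - cnj z) j))" for z
  have F': "bounded ((\<lambda>z. F z j) ` strip)" "continuous_on strip (\<lambda>z. F z j)"
    "(\<lambda>z. F z j) holomorphic_on interior strip"
    "lat_ball e R (F (\<i> * of_real t))" "dual_ball e R (F (1 + \<i> * of_real t))" for j t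
    using F by (auto simp: admissible_def)
  have R: "0 \<le> R" using F'(4)[of 0] by (rule lat_ball_nonneg)
  have "\<exists>b. \<forall>z\<in>strip. cmod (F z j) \<le> b" for j using F'(1)[of j] by (auto simp: bounded_iff)
  then obtain b where b: "\<And>j z. z \<in> strip \<Longrightarrow> cmod (F z j) \<le> b j" by metis
  have "cmod (\<phi> (1 / 2)) \<le> R * R"
  proof (rule three_lines[where b = "\<Sum>j<n. b j * b j"])
    have "continuous_on strip (\<lambda>z. F (1 - cnj z) j)" for j
      by (rule continuous_on_compose2[OF F'(2)]) (auto intro!: continuous_intros strip_reflect)
    then show "continuous_on strip \<phi>" unfolding \<phi>_def by (intro continuous_intros F'(2))
    have "(\<lambda>z. cnj (F (1 - cnj z) j)) holomorphic_on interior strip" for j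
    proof -
      have "(\<lambda>w. F (1 - w) j) holomorphic_on interior strip"
        by (rule holomorphic_on_compose_gen[of "\<lambda>w. 1 - w" _ "\<lambda>z. F z j", unfolded o_def, OF _ F'(3)])
           (auto intro!: holomorphic_intros simp: interior_strip)
      moreover have "cnj ` interior strip = interior strip"
        by (auto simp: interior_strip image_iff intro!: exI[of _ "cnj _"] bexI[of _ "cnj _"])
      ultimately show ?thesis
        using holomorphic_on_compose_cnj_cnj[of "\<lambda>w. F (1 - w) j" "interior strip"] by (simp add: o_def)
    qed
    then show "\<phi> holomorphic_on interior strip" unfolding \<phi>_def by (intro holomorphic_intros F'(3))
    fix z assume z: "z \<in> strip"
    have "0 \<le> b j" for j using b[OF z, of j] norm_ge_zero order_trans by blast
    then show "cmod (\<phi> z) \<le> (\<Sum>j<n. b j * b j)"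
      unfolding \<phi>_def using b[OF z] b[OF strip_reflect[OF z]]
      by (intro sum_norm_le) (auto simp: norm_mult intro!: mult_mono)
  next
    fix t
    have 1: "1 - cnj (\<i> * of_real t) = 1 + \<i> * of_real t" "1 - cnj (1 + \<i> * of_real t) = \<i> * of_real t"
      by (simp_all add: complex_eq_iff)
    have *: "(\<Sum>j<n. cmod (F (\<i> * of_real t) j) * cmod (F (1 + \<i> * of_real t) j)) \<le> R * R"
      by (rule dual_ballD[OF F'(5) F'(4)])
    have "cmod (\<phi> (\<i> * of_real t)) \<le> (\<Sum>j<n. cmod (F (\<i> * of_real t) j) * cmod (F (1 + \<i> * of_real t) j))"
      unfolding \<phi>_def 1 by (intro sum_norm_le) (simp add: norm_mult)
    with * show "cmod (\<phi> (\<i> * of_real t)) \<le> R * R" by linarith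
    have "cmod (\<phi> (1 + \<i> * of_real t)) \<le> (\<Sum>j<n. cmod (F (\<i> * of_real t) j) * cmod (F (1 + \<i> * of_real t) j))"
      unfolding \<phi>_def 1 by (intro sum_norm_le) (simp add: norm_mult)
    with * show "cmod (\<phi> (1 + \<i> * of_real t)) \<le> R * R" by linarith
  qed
  moreover have "\<phi> (1 / 2) = of_real (\<Sum>j<n. (cmod (F (1 / 2) j))\<^sup>2)"
    by (simp add: \<phi>_def complex_norm_square[symmetric] del: of_real_power)
  moreover have "cmod (of_real (\<Sum>j<n. (cmod (F (1 / 2) j))\<^sup>2)) = (\<Sum>j<n. (cmod (F (1 / 2) j))\<^sup>2)"
    by (simp only: norm_of_real) (simp add: sum_nonneg)
  ultimately have "(\<Sum>j<n. (cmod (F (1 / 2) j))\<^sup>2) \<le> R\<^sup>2" by (simp add: power2_eq_square)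
  then have "sqrt (\<Sum>j<n. (cmod (F (1 / 2) j))\<^sup>2) \<le> sqrt (R\<^sup>2)" by (rule real_sqrt_le_mono)
  then show ?thesis using R by (simp add: L2_set_def)
qed

text \<open>Dividing out the zero at 1/2 turns the derivative into a value. The factor 2 appears
  because \<open>z - 1 / 2\<close> has modulus at least 1/2 on both boundary lines.\<close>

lemma admissible_deriv_pnorm_le:
  assumes F: "admissible e R F" and 0: "F (1 / 2) = 0"
  shows "pnorm n (\<lambda>j. deriv (\<lambda>z. F z j) (1 / 2)) \<le> 2 * R"
proof -
  have F': "bounded ((\<lambda>z. F z j) ` strip)" "continuous_on strip (\<lambda>z. F z j)"
    "(\<lambda>z. F z j) holomorphic_on interior strip"
    "lat_ball e R (F (\<i> * of_real t))" "dual_ball e R (F (1 + \<i> * of_real t))" for j t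
    using F by (auto simp: admissible_def)
  define G where "G z = (\<lambda>j. if z = 1 / 2 then deriv (\<lambda>z. F z j) (1 / 2) else F z j / (z - 1 / 2))" for z
  have G: "G z = (1 / (z - 1 / 2)) *\<^sub>C F z" if "z \<noteq> 1 / 2" for z
    using that by (simp add: G_def fun_eq_iff)
  have "admissible e (2 * R) G"
    unfolding admissible_def
  proof (intro conjI allI)
    fix j
    have F0: "F (1 / 2) j = 0" using 0 by simp
    have "(\<lambda>z. if z = 1 / 2 then deriv (\<lambda>z. F z j) (1 / 2) else (F z j - F (1 / 2) j) / (z - 1 / 2))
        holomorphic_on interior strip"
      by (rule pole_lemma[OF F'(3)]) (simp add: half_interior_strip)
    then show h: "(\<lambda>z. G z j) holomorphic_on interior strip" by (simp only: G_def F0 diff_zero)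
    show c: "continuous_on strip (\<lambda>z. G z j)"
      unfolding continuous_on_eq_continuous_within
    proof
      fix z assume z: "z \<in> strip"
      show "continuous (at z within strip) (\<lambda>z. G z j)"
      proof (cases "z = 1 / 2")
        case True
        then have "z \<in> interior strip" using half_interior_strip by (simp only:)
        then have "continuous (at z) (\<lambda>z. G z j)"
          using holomorphic_on_imp_continuous_on[OF h] continuous_on_interior[of "interior strip"] by simp
        then show ?thesis by (rule continuous_at_imp_continuous_within)
      next
        case False
        have "continuous (at z within strip) (\<lambda>z. F z j)"
          using F'(2)[of j] z by (simp add: continuous_on_eq_continuous_within)
        then have "continuous (at z within strip) (\<lambda>z. F z j / (z - 1 / 2))"
          using False by (intro continuous_intros) auto
        then have "((\<lambda>z. F z j / (z - 1 / 2)) \<longlongrightarrow> F z j / (z - 1 / 2)) (at z within strip)"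
          by (simp only: continuous_within)
        moreover have "\<forall>\<^sub>F w in at z within strip. F w j / (w - 1 / 2) = G w j"
          using eventually_at_ball'[of 1 z strip] t1_space_nhds[OF False]
          by (auto simp: G_def eventually_at_filter elim: eventually_mono)
        ultimately have "((\<lambda>z. G z j) \<longlongrightarrow> F z j / (z - 1 / 2)) (at z within strip)"
          by (rule Lim_transform_eventually)
        moreover have "F z j / (z - 1 / 2) = G z j" using False by (simp add: G_def)
        ultimately show ?thesis unfolding continuous_within by (simp only:)
      qed
    qed
    \<comment> \<open>Near the removed zero boundedness comes from compactness of a closed disc,
      elsewhere from the divisor being at least 1/2 in modulus.\<close>
    show "bounded ((\<lambda>z. G z j) ` strip)"
    proof -
      obtain b where b: "\<And>z. z \<in> strip \<Longrightarrow> cmod (F z j) \<le> b" using F'(1)[of j] by (auto simp: bounded_iff)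
      have cb: "cball (1 / 2) (1 / 2) \<subseteq> strip"
      proof
        fix z :: complex assume "z \<in> cball (1 / 2) (1 / 2)"
        then have "cmod (z - 1 / 2) \<le> 1 / 2" by (simp add: dist_norm norm_minus_commute)
        then have "\<bar>Re (z - 1 / 2)\<bar> \<le> 1 / 2" using abs_Re_le_cmod order_trans by blast
        then have "0 \<le> Re z \<and> Re z \<le> 1" unfolding abs_le_iff by simp
        then show "z \<in> strip" by (simp add: strip_def)
      qed
      have "bounded ((\<lambda>z. G z j) ` cball (1 / 2) (1 / 2))"
        by (intro compact_imp_bounded compact_continuous_image continuous_on_subset[OF c cb]) simp
      moreover have "bounded ((\<lambda>z. G z j) ` (strip - cball (1 / 2) (1 / 2)))"
        unfolding bounded_iff
      proof (intro exI ballI)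
        fix w assume "w \<in> (\<lambda>z. G z j) ` (strip - cball (1 / 2) (1 / 2))"
        then obtain z where z: "z \<in> strip" "w = G z j" "1 / 2 < cmod (z - 1 / 2)"
          by (auto simp: dist_norm norm_minus_commute)
        then have "0 < cmod (z - 1 / 2)" by linarith
        then have "z \<noteq> 1 / 2" by (simp only: zero_less_norm_iff right_minus_eq not_False_eq_True)
        then have "cmod w = cmod (F z j) / cmod (z - 1 / 2)" using z by (simp add: G_def norm_divide)
        also have "\<dots> \<le> b / (1 / 2)"
          using z b[OF z(1)] order_trans[OF norm_ge_zero b[OF z(1)]] by (intro frac_le) auto
        finally show "norm w \<le> b / (1 / 2)" .
      qed
      ultimately have "bounded ((\<lambda>z. G z j) ` cball (1 / 2) (1 / 2) \<union> (\<lambda>z. G z j) ` (strip - cball (1 / 2) (1 / 2)))"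
        by simp
      then show ?thesis by (rule bounded_subset) auto
    qed
  next
    fix t :: real
    have c: "cmod (1 / (z - 1 / 2)) * R \<le> 2 * R" "z \<noteq> 1 / 2" if "\<bar>Re z - 1 / 2\<bar> = 1 / 2" for z
    proof -
      have "1 / 2 \<le> cmod (z - 1 / 2)" using abs_Re_le_cmod[of "z - 1 / 2"] that by simp
      then have "1 / cmod (z - 1 / 2) \<le> 1 / (1 / 2)" by (intro frac_le) auto
      then show "cmod (1 / (z - 1 / 2)) * R \<le> 2 * R"
        using lat_ball_nonneg[OF F'(4)[of 0]] by (intro mult_right_mono) (auto simp: norm_divide)
      have "0 < cmod (z - 1 / 2)" using \<open>1 / 2 \<le> cmod (z - 1 / 2)\<close> by linarith
      then show "z \<noteq> 1 / 2" by (simp only: zero_less_norm_iff right_minus_eq not_False_eq_True)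
    qed
    have 1: "\<bar>Re (\<i> * of_real t) - 1 / 2\<bar> = 1 / 2" "\<bar>Re (1 + \<i> * of_real t) - 1 / 2\<bar> = 1 / 2" by simp_all
    show "lat_ball e (2 * R) (G (\<i> * of_real t))"
      unfolding G[OF c(2)[OF 1(1)]] by (rule lat_ball_mono[OF lat_ball_scaleC[OF F'(4)] c(1)[OF 1(1)]])
    show "dual_ball e (2 * R) (G (1 + \<i> * of_real t))"
      unfolding G[OF c(2)[OF 1(2)]] by (rule dual_ball_mono[OF dual_ball_scaleC[OF F'(5)] c(1)[OF 1(2)]])
  qed
  from admissible_pnorm_le[OF this, of n] show ?thesis by (simp add: G_def)
qed

section \<open>Calculus of pairs of value and derivative\<close>

lemma admissible_differentiable:
  "admissible e R F \<Longrightarrow> (\<lambda>z. F z j) field_differentiable at (1 / 2)"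
  unfolding admissible_def using half_interior_strip
  by (auto intro: holomorphic_on_imp_differentiable_at)

lemma der_at_add:
  assumes "der_at e R y d" "der_at e S y' d'" shows "der_at e (R + S) (y + y') (d + d')"
proof -
  obtain F G where F: "admissible e R F" "F (1 / 2) = y" "(\<lambda>j. deriv (\<lambda>z. F z j) (1 / 2)) = d"
    and G: "admissible e S G" "G (1 / 2) = y'" "(\<lambda>j. deriv (\<lambda>z. G z j) (1 / 2)) = d'"
    using assms unfolding der_at_def by blast
  define H where "H z = F z + G z" for z
  have "admissible e (R + S) H"
    using F(1) G(1) unfolding admissible_def H_def
    by (auto intro!: lat_ball_add dual_ball_add bounded_plus_comp continuous_intros holomorphic_intros)
  moreover have "deriv (\<lambda>z. H z j) (1 / 2) = d j + d' j" for j
    using admissible_differentiable[OF F(1)] admissible_differentiable[OF G(1)] F(3) G(3)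
    by (auto simp: H_def)
  ultimately show ?thesis unfolding der_at_def using F(2) G(2)
    by (intro exI[of _ H]) (auto simp: H_def fun_eq_iff)
qed

text \<open>Both balls are solid, so multiplication by a fixed bounded sequence preserves
  admissibility. Unlike the derivation itself, these pairs are thus compatible with scalars and with
  restrictions to sets of coordinates.\<close>

lemma der_at_multiplier:
  assumes "der_at e R y d" and m: "\<And>j. cmod (m j) \<le> c" "0 < c"
  shows "der_at e (c * R) (\<lambda>j. m j * y j) (\<lambda>j. m j * d j)"
proof -
  obtain F where F: "admissible e R F" "F (1 / 2) = y" "(\<lambda>j. deriv (\<lambda>z. F z j) (1 / 2)) = d"
    using assms unfolding der_at_def by blast
  define H where "H z = (\<lambda>j. m j * F z j)" for z
  have le: "cmod (m j * x j) \<le> cmod ((of_real c *\<^sub>C x) j)" for x :: omega and j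
    using m by (auto simp: norm_mult intro: mult_right_mono)
  have "admissible e (c * R) H"
    unfolding admissible_def H_def
  proof (intro conjI allI)
    fix j
    show "bounded ((\<lambda>z. m j * F z j) ` strip)"
    proof -
      obtain b where "\<And>z. z \<in> strip \<Longrightarrow> cmod (F z j) \<le> b"
        using F(1) unfolding admissible_def bounded_iff ball_simps by blast
      then show ?thesis unfolding bounded_iff
        by (intro exI[of _ "cmod (m j) * b"]) (auto simp: norm_mult intro: mult_left_mono)
    qed
    show "continuous_on strip (\<lambda>z. m j * F z j)" "(\<lambda>z. m j * F z j) holomorphic_on interior strip"
      using F(1) unfolding admissible_def by (auto intro!: continuous_intros holomorphic_intros)
    fix t
    have "lat_ball e R (F (\<i> * of_real t))" "dual_ball e R (F (1 + \<i> * of_real t))"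
      using F(1) unfolding admissible_def by blast+
    from lat_ball_scaleC[OF this(1), of "of_real c"] dual_ball_scaleC[OF this(2), of "of_real c"]
    have "lat_ball e (c * R) (of_real c *\<^sub>C F (\<i> * of_real t))"
      "dual_ball e (c * R) (of_real c *\<^sub>C F (1 + \<i> * of_real t))" using m(2) by simp_all
    note l = lat_ball_dominated[OF this(1) le] and d = dual_ball_dominated[OF this(2) le]
    show "lat_ball e (c * R) (\<lambda>j. m j * F (\<i> * of_real t) j)" by (rule l)
    show "dual_ball e (c * R) (\<lambda>j. m j * F (1 + \<i> * of_real t) j)" by (rule d)
  qed
  moreover have "deriv (\<lambda>z. H z j) (1 / 2) = m j * d j" for j
    using admissible_differentiable[OF F(1)] F(3) by (auto simp: H_def)
  ultimately show ?thesis unfolding der_at_def using F(2)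
    by (intro exI[of _ H]) (auto simp: H_def fun_eq_iff)
qed

lemma der_at_nonneg: "der_at e R y d \<Longrightarrow> 0 \<le> R"
  unfolding der_at_def admissible_def using lat_ball_nonneg by blast

lemma der_at_0: "der_at e 0 0 0"
  unfolding der_at_def admissible_def
  by (intro exI[of _ "\<lambda>_. 0"]) (auto simp: lat_ball_0 dual_ball_0 fun_eq_iff bounded_iff intro: exI[of _ 0])

lemma der_at_scaleC:
  assumes "der_at e R y d" shows "der_at e (cmod c * R) (c *\<^sub>C y) (c *\<^sub>C d)"
proof (cases "c = 0")
  case True
  then show ?thesis using der_at_0 by simp
next
  case False
  have "(\<lambda>j. c * x j) = c *\<^sub>C x" for x :: omega by (simp add: fun_eq_iff)
  moreover have "der_at e (cmod c * R) (\<lambda>j. c * y j) (\<lambda>j. c * d j)"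
    by (rule der_at_multiplier[OF assms]) (use False in auto)
  ultimately show ?thesis by (simp only:)
qed

lemma der_at_restr:
  assumes "der_at e R y d" shows "der_at e R (restr I y) (restr I d)"
proof -
  have "(\<lambda>j. (if j \<in> I then 1 else 0) * x j) = restr I x" for x :: omega by (auto simp: restr_def)
  with der_at_multiplier[OF assms, of "\<lambda>j. if j \<in> I then 1 else 0" 1] show ?thesis by simp
qed

lemma der_at_diff:
  assumes "der_at e R y d" "der_at e S y' d'" shows "der_at e (R + S) (y - y') (d - d')"
proof -
  have "y + (-1) *\<^sub>C y' = y - y'" "d + (-1) *\<^sub>C d' = d - d'" "cmod (-1) * S = S"
    by (simp_all add: fun_eq_iff)
  with der_at_add[OF assms(1) der_at_scaleC[OF assms(2), of "-1"]] show ?thesis by (simp only:)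
qed

lemma der_at_sum:
  assumes "\<And>i. i \<in> A \<Longrightarrow> der_at e (R i) (y i) (d i)"
  shows "der_at e (\<Sum>i\<in>A. R i) (\<Sum>i\<in>A. y i) (\<Sum>i\<in>A. d i)"
  using assms
proof (induction A rule: infinite_finite_induct)
  case (insert a A)
  then show ?case using der_at_add[of e "R a" "y a" "d a"] by (simp only: sum.insert insert_iff simp_thms)
qed (simp_all only: sum.empty sum.infinite simp_thms der_at_0)

lemma der_at_ell2: assumes "der_at e R y d" shows "y \<in> ell2" "ell2_norm y \<le> R"
proof -
  have "pnorm n y \<le> R" for n using assms admissible_pnorm_le unfolding der_at_def by blast
  then show "y \<in> ell2" "ell2_norm y \<le> R" by (rule ell2_boundD)+
qed

lemma der_at_zero_ell2: assumes "der_at e R 0 d" shows "d \<in> ell2" "ell2_norm d \<le> 2 * R"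
proof -
  have "pnorm n d \<le> 2 * R" for n using assms admissible_deriv_pnorm_le unfolding der_at_def by blast
  then show "d \<in> ell2" "ell2_norm d \<le> 2 * R" by (rule ell2_boundD)+
qed

text \<open>The difference of the two functions vanishes at 1/2. This is what permits replacing the
  selected derivative by that of an explicit function.\<close>

lemma der_at_unique:
  assumes "der_at e R y d" "der_at e S y d'"
  shows "d - d' \<in> ell2" "ell2_norm (d - d') \<le> 2 * (R + S)"
  using der_at_zero_ell2[of e "R + S" "d - d'"] der_at_diff[OF assms] by simp_all

text \<open>The function is \<open>s j * exp (p j + (q j - p j) * z)\<close>, a geometric
  interpolation between the two boundary vectors; its moduli do not depend on the height. Vanishing
  coordinates are encoded in \<open>s\<close>, since \<open>p\<close> and \<open>q\<close> are
  logarithms of moduli.\<close>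

lemma der_at_exp:
  fixes s :: omega and p q :: "nat \<Rightarrow> real"
  assumes "lat_ball e R (\<lambda>j. s j * of_real (exp (p j)))" "dual_ball e R (\<lambda>j. s j * of_real (exp (q j)))"
  shows "der_at e R (\<lambda>j. s j * of_real (exp ((p j + q j) / 2)))
    (\<lambda>j. s j * of_real (exp ((p j + q j) / 2)) * of_real (q j - p j))"
proof -
  define F where "F z = (\<lambda>j. s j * exp (of_real (p j) + of_real (q j - p j) * z))" for z
  have nF: "cmod (F z j) = cmod (s j) * exp (p j + (q j - p j) * Re z)" for z j
    by (simp add: F_def norm_mult)
  have "admissible e R F"
    unfolding admissible_def
  proof (intro conjI allI)
    fix j
    show "bounded ((\<lambda>z. F z j) ` strip)"
      unfolding bounded_iff
    proof (intro exI ballI)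
      fix w assume "w \<in> (\<lambda>z. F z j) ` strip"
      then obtain z where z: "w = F z j" "0 \<le> Re z" "Re z \<le> 1" by (auto simp: strip_def)
      have "(q j - p j) * Re z \<le> \<bar>q j - p j\<bar> * 1"
        using z(2,3) by (intro mult_mono) auto
      then show "norm w \<le> cmod (s j) * exp (p j + \<bar>q j - p j\<bar>)"
        unfolding z(1) nF by (intro mult_left_mono) auto
    qed
    show "continuous_on strip (\<lambda>z. F z j)" unfolding F_def by (intro continuous_intros)
    show "(\<lambda>z. F z j) holomorphic_on interior strip" unfolding F_def by (intro holomorphic_intros)
  next
    fix t
    show "lat_ball e R (F (\<i> * of_real t))" by (rule lat_ball_dominated[OF assms(1)]) (simp add: nF norm_mult)
    show "dual_ball e R (F (1 + \<i> * of_real t))" by (rule dual_ball_dominated[OF assms(2)]) (simp add: nF norm_mult)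
  qed
  moreover have half: "exp (of_real (p j) + of_real (q j - p j) * (1 / 2)) = (of_real (exp ((p j + q j) / 2)) :: complex)" for j
    by (simp add: exp_of_real[symmetric] field_simps)
  moreover have "deriv (\<lambda>z. F z j) (1 / 2) = s j * of_real (exp ((p j + q j) / 2)) * of_real (q j - p j)" for j
  proof (rule DERIV_imp_deriv)
    have "((\<lambda>z. F z j) has_field_derivative
        s j * (exp (of_real (p j) + of_real (q j - p j) * (1 / 2)) * of_real (q j - p j))) (at (1 / 2))"
      unfolding F_def by (rule derivative_eq_intros refl | simp)+
    then show "((\<lambda>z. F z j) has_field_derivative s j * of_real (exp ((p j + q j) / 2)) * of_real (q j - p j)) (at (1 / 2))"
      unfolding half by (simp only: mult.assoc)
  qed
  ultimately show ?thesis unfolding der_at_def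
    by (intro exI[of _ F]) (auto simp only: F_def half)
qed

text \<open>The functional is evaluated at a vector whose phases make every term positive.
  Functionals are determined by their values on the basis, so the definite description in
  \<open>dual_seq_norm\<close> denotes the functional at hand.\<close>

lemma dual_seq_space_dual_ball:
  assumes unc: "unconditional_basis e" and a: "a \<in> dual_seq_space e"
  shows "dual_ball e (dual_seq_norm e a) a"
proof -
  obtain f where f: "f \<in> dual_space" "a = (\<lambda>j. f (e j))" using a by (auto simp: dual_seq_space_def)
  have lin: "bounded_linear f" "\<And>c x. f (c *\<^sub>C x) = c * f x" if "f \<in> dual_space" for f :: "'a \<Rightarrow> complex"
    using that by (auto simp: dual_space_def)
  have "g = f" if g: "g \<in> dual_space" "\<forall>j. g (e j) = a j" for g
  proof
    fix x
    have "(\<lambda>j. h (coord e x j *\<^sub>C e j)) sums h x" if "h \<in> dual_space" for h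
      using bounded_linear.sums[OF lin(1)[OF that] coord_sums[OF unc]] .
    from this[OF g(1)] this[OF f(1)] show "g x = f x"
      using g f by (simp add: lin(2) sums_unique2)
  qed
  then have "(THE f. f \<in> dual_space \<and> (\<forall>j. f (e j) = a j)) = f"
    using f by (intro the_equality) auto
  then have N: "dual_seq_norm e a = onorm f" by (simp add: dual_seq_norm_def)
  show ?thesis
    unfolding dual_ball_def N
  proof (intro allI impI)
    fix R x n assume x: "lat_ball e R x"
    \<comment> \<open>The conjugate phase of the product; it is 0 where the product vanishes, which
      is still an admissible multiplier.\<close>
    define \<theta> where "\<theta> j = cnj (sgn (x j * a j))" for j
    have \<theta>: "cmod (\<theta> j) \<le> 1" for j by (simp add: \<theta>_def norm_sgn)
    have "f (\<Sum>j<n. (\<theta> j * x j) *\<^sub>C e j) = (\<Sum>j<n. f ((\<theta> j * x j) *\<^sub>C e j))"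
      using linear_sum[OF bounded_linear.linear[OF lin(1)[OF f(1)]]] .
    also have "\<dots> = (\<Sum>j<n. of_real (cmod (x j) * cmod (a j)))"
    proof (rule sum.cong[OF refl])
      fix j
      have "cnj (sgn w) * w = of_real (cmod w)" for w
      proof (cases "w = 0")
        case False
        have "cnj w * w = of_real (cmod w) * of_real (cmod w)"
          using complex_norm_square[of w] by (simp add: power2_eq_square mult.commute)
        then show ?thesis using False by (simp add: sgn_eq)
      qed simp
      from this[of "x j * a j"] show "f ((\<theta> j * x j) *\<^sub>C e j) = of_real (cmod (x j) * cmod (a j))"
        using f by (simp add: lin(2) \<theta>_def norm_mult mult.assoc)
    qed
    finally have "cmod (f (\<Sum>j<n. (\<theta> j * x j) *\<^sub>C e j)) = cmod (of_real (\<Sum>j<n. cmod (x j) * cmod (a j)))"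
      by simp
    then have "(\<Sum>j<n. cmod (x j) * cmod (a j)) = cmod (f (\<Sum>j<n. (\<theta> j * x j) *\<^sub>C e j))"
      by (simp only: norm_of_real) (simp add: sum_nonneg)
    also have "\<dots> \<le> onorm f * norm (\<Sum>j<n. (\<theta> j * x j) *\<^sub>C e j)"
      by (rule onorm[OF lin(1)[OF f(1)]])
    also have "\<dots> \<le> onorm f * R"
      by (intro mult_left_mono lat_ballD[OF x \<theta>] onorm_pos_le[OF lin(1)[OF f(1)]])
    finally show "(\<Sum>j<n. cmod (x j) * cmod (a j)) \<le> R * onorm f" by (simp add: mult.commute)
  qed
qed

text \<open>The unconditional constant turns norm bounds on the line \<open>Re z = 0\<close> into
  lattice bounds; on the line \<open>Re z = 1\<close> the dual bound is direct. From here on the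
  selection enters only through this consequence.\<close>

lemma selection_der_at:
  assumes unc: "unconditional_basis e" and B: "homogeneous_selection e B"
  shows "\<exists>C>0. \<forall>y\<in>ell2. der_at e (C * ell2_norm y) y (selection_derivation B y)"
proof -
  obtain K where K: "0 < K" "\<And>x. lat_ball e (K * norm x) (coord e x)"
    using unconditional_constant[OF unc] by blast
  obtain C where C: "\<And>x. x \<in> ell2 \<Longrightarrow> interp_norm (seq_norm e) (dual_seq_norm e) (B x) \<le> C * ell2_norm x"
    using B unfolding homogeneous_selection_def by blast
  \<comment> \<open>The maximum serves both lines at once, with \<open>K\<close> for the lattice
    side and 1 for the dual side. \<open>\<bar>C\<bar> + 1\<close> is used because \<open>C\<close>
    carries no sign.\<close>
  define D where "D = max 1 K * (\<bar>C\<bar> + 1)"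
  have "der_at e (D * ell2_norm y) y (selection_derivation B y)" if y: "y \<in> ell2" for y
  proof -
    have I: "B y \<in> interp_funs (seq_space e) (seq_norm e) (dual_seq_space e) (dual_seq_norm e)" "B y (1 / 2) = y"
      using B y unfolding homogeneous_selection_def by blast+
    define S where "S = interp_norm (seq_norm e) (dual_seq_norm e) (B y)"
    have c0: "range (\<lambda>t. B y (\<i> * of_real t)) \<subseteq> seq_space e" "\<exists>b. \<forall>t. seq_norm e (B y (\<i> * of_real t)) \<le> b"
      and c1: "range (\<lambda>t. B y (1 + \<i> * of_real t)) \<subseteq> dual_seq_space e"
        "\<exists>b. \<forall>t. dual_seq_norm e (B y (1 + \<i> * of_real t)) \<le> b"
      using I(1) unfolding interp_funs_def bounded_curve_def by blast+
    have S0: "seq_norm e (B y (\<i> * of_real t)) \<le> S" for t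
      using c0(2) unfolding S_def interp_norm_def
      by (intro order_trans[OF cSUP_upper max.cobounded1]) (auto simp: bdd_above_def)
    have S1: "dual_seq_norm e (B y (1 + \<i> * of_real t)) \<le> S" for t
      using c1(2) unfolding S_def interp_norm_def
      by (intro order_trans[OF cSUP_upper max.cobounded2]) (auto simp: bdd_above_def)
    have "C * ell2_norm y \<le> (\<bar>C\<bar> + 1) * ell2_norm y"
      using ell2_norm_nonneg[OF y] by (intro mult_right_mono) auto
    then have SC: "S \<le> (\<bar>C\<bar> + 1) * ell2_norm y" using C[OF y] unfolding S_def by linarith
    have S_nonneg: "0 \<le> S" using S0[of 0] unfolding seq_norm_def by (rule order_trans[rotated]) simp
    have KS: "K * S \<le> D * ell2_norm y" "S \<le> D * ell2_norm y"
    proof -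
      have "max 1 K * S \<le> max 1 K * ((\<bar>C\<bar> + 1) * ell2_norm y)"
        using SC by (intro mult_left_mono) auto
      moreover have "K * S \<le> max 1 K * S" "1 * S \<le> max 1 K * S"
        by (rule mult_right_mono[OF _ S_nonneg]; simp)+
      ultimately show "K * S \<le> D * ell2_norm y" "S \<le> D * ell2_norm y" by (auto simp: D_def mult.assoc)
    qed
    have "admissible e (D * ell2_norm y) (B y)"
      unfolding admissible_def
    proof (intro conjI allI)
      fix j
      show "bounded ((\<lambda>z. B y z j) ` strip)" "(\<lambda>z. B y z j) holomorphic_on interior strip"
        using I(1) unfolding interp_funs_def by blast+
      have "continuous_on strip (B y)" using I(1) unfolding interp_funs_def by blast
      then show "continuous_on strip (\<lambda>z. B y z j)" by (rule continuous_on_product_then_coordinatewise)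
    next
      fix t
      let ?a = "B y (\<i> * of_real t)"
      have "?a \<in> seq_space e" using c0(1) by blast
      then have "(\<lambda>j. ?a j *\<^sub>C e j) sums (\<Sum>j. ?a j *\<^sub>C e j)" by (simp add: seq_space_def summable_sums)
      from coord_unique[OF unc this] K(2)[of "\<Sum>j. ?a j *\<^sub>C e j"]
      have "lat_ball e (K * seq_norm e ?a) ?a" by (simp add: seq_norm_def)
      then show "lat_ball e (D * ell2_norm y) ?a"
        by (rule lat_ball_mono) (rule order_trans[OF mult_left_mono[OF S0] KS(1)], use K in auto)
      have "B y (1 + \<i> * of_real t) \<in> dual_seq_space e" using c1(1) by blast
      from dual_seq_space_dual_ball[OF unc this]
      show "dual_ball e (D * ell2_norm y) (B y (1 + \<i> * of_real t))"
        by (rule dual_ball_mono) (rule order_trans[OF S1 KS(2)])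
    qed
    then show ?thesis unfolding der_at_def selection_derivation_def using I(2) by blast
  qed
  moreover have "0 < D" using K by (simp add: D_def)
  ultimately show ?thesis by blast
qed


subsection \<open>Lozanovskii factorization of finitely supported vectors\<close>

lemma compact_box_functions:
  fixes c :: "nat \<Rightarrow> real" shows "compact {f. \<forall>j. 0 \<le> f j \<and> f j \<le> c j}"
proof -
  have "compactin (product_topology (\<lambda>_. euclidean) UNIV) (PiE UNIV (\<lambda>j. {0..c j}))"
    by (simp add: compactin_PiE)
  then have "compact (PiE UNIV (\<lambda>j. {0..c j}))" by (simp add: euclidean_product_topology)
  moreover have "PiE UNIV (\<lambda>j. {0..c j}) = {f. \<forall>j. 0 \<le> f j \<and> f j \<le> c j}" by (auto simp: PiE_iff)
  ultimately show ?thesis by simp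
qed

text \<open>The weights \<open>w\<close> are split by maximizing \<open>\<Prod>j. f j powr w j\<close> over the unit ball; the first-order
  condition at the maximum says that \<open>w / f\<close> lies in the dual ball.\<close>

lemma lozanovskii:
  fixes e :: "nat \<Rightarrow> 'a::complex_banach" and w :: "nat \<Rightarrow> real"
  assumes unc: "unconditional_basis e" and I: "finite I" "\<And>j. j \<in> I \<Longrightarrow> 0 < w j" "(\<Sum>j\<in>I. w j) = 1"
  shows "\<exists>f g :: nat \<Rightarrow> real. (\<forall>j\<in>I. 0 < f j \<and> 0 < g j \<and> f j * g j = w j) \<and> (\<forall>j. j \<notin> I \<longrightarrow> f j = 0 \<and> g j = 0) \<and>
     lat_ball e 1 (\<lambda>j. of_real (f j)) \<and> dual_ball e 1 (\<lambda>j. of_real (g j))"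
proof -
  have ne: "0 < norm (e j)" for j using basis_nonzero[OF unc] by simp
  have Ine: "I \<noteq> {}" using I(3) by auto
  \<comment> \<open>These are the largest values that single coordinates can take in the unit
    lattice ball; they confine the admissible \<open>f\<close> to a compact product of
    intervals.\<close>
  define c where "c j = (if j \<in> I then 1 / norm (e j) else 0)" for j
  define S where "S = {f. \<forall>j. 0 \<le> f j \<and> f j \<le> c j} \<inter> {f::nat \<Rightarrow> real. lat_ball e 1 (\<lambda>j. of_real (f j))}"
  have "closed {f::nat \<Rightarrow> real. lat_ball e 1 (\<lambda>j. of_real (f j))}"
  proof -
    have eq: "{f::nat \<Rightarrow> real. lat_ball e 1 (\<lambda>j. of_real (f j))} =
        (\<Inter>n. \<Inter>\<theta>\<in>{\<theta>::omega. \<forall>j. cmod (\<theta> j) \<le> 1}. {f. norm (\<Sum>j<n. (\<theta> j * of_real (f j)) *\<^sub>C e j) \<le> 1})"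
      by (auto simp: lat_ball_def)
    have "continuous_on UNIV (\<lambda>f::nat \<Rightarrow> real. norm (\<Sum>j<n. (\<theta> j * of_real (f j)) *\<^sub>C e j))" for n and \<theta> :: omega
      by (intro continuous_on_norm continuous_on_sum bounded_linear.continuous_on[OF bounded_linear_scaleC_left]
          continuous_on_mult continuous_on_const continuous_on_of_real continuous_on_product_coordinates)
    then show ?thesis unfolding eq by (intro closed_INT ballI closed_Collect_le continuous_on_const)
  qed
  then have S: "compact S" unfolding S_def by (intro compact_Int_closed compact_box_functions)
  \<comment> \<open>A point of the ball that is positive on all of \<open>I\<close>, so the maximum
    of the product is positive and a maximizer cannot vanish anywhere on \<open>I\<close>.\<close>
  define f0 where "f0 j = (if j \<in> I then 1 / (card I * norm (e j)) else 0)" for j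
  have cI: "1 \<le> real (card I)" using I(1) Ine by (simp add: Suc_leI card_gt_0_iff)
  have f0: "f0 \<in> S"
  proof -
    have "0 \<le> f0 j \<and> f0 j \<le> c j" for j
      using cI ne[of j] by (auto simp: f0_def c_def field_simps)
    moreover have "lat_ball e 1 (\<lambda>j. of_real (f0 j))"
      unfolding lat_ball_def
    proof (intro allI impI)
      fix n and \<theta> :: omega assume \<theta>: "\<forall>j. cmod (\<theta> j) \<le> 1"
      have "norm (\<Sum>j<n. (\<theta> j * of_real (f0 j)) *\<^sub>C e j) \<le> (\<Sum>j<n. if j \<in> I then 1 / card I else 0)"
      proof (rule sum_norm_le)
        fix j
        have "norm ((\<theta> j * of_real (f0 j)) *\<^sub>C e j) \<le> 1 * \<bar>f0 j\<bar> * norm (e j)"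
          unfolding norm_scaleC norm_mult norm_of_real using \<theta> by (intro mult_right_mono) auto
        also have "\<dots> = (if j \<in> I then 1 / card I else 0)" using ne[of j] by (auto simp: f0_def)
        finally show "norm ((\<theta> j * of_real (f0 j)) *\<^sub>C e j) \<le> (if j \<in> I then 1 / card I else 0)" .
      qed
      also have "\<dots> = card ({..<n} \<inter> I) * (1 / card I)"
        by (simp add: sum.inter_restrict[symmetric])
      also have "\<dots> \<le> card I * (1 / card I)"
        using I(1) by (intro mult_right_mono) (auto intro: card_mono)
      finally show "norm (\<Sum>j<n. (\<theta> j * of_real (f0 j)) *\<^sub>C e j) \<le> 1" using cI by simp
    qed
    ultimately show ?thesis by (simp add: S_def)
  qed
  define \<Phi> where "\<Phi> f = (\<Prod>j\<in>I. f j powr w j)" for f :: "nat \<Rightarrow> real"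
  have "continuous_on S \<Phi>"
    unfolding \<Phi>_def
  proof (intro continuous_on_prod continuous_on_powr' continuous_on_const ballI conjI impI)
    fix j assume j: "j \<in> I"
    show "continuous_on S (\<lambda>f. f j)"
      by (rule continuous_on_subset[OF continuous_on_product_coordinates]) simp
    fix f assume f: "f \<in> S"
    show "0 \<le> f j" using f by (simp add: S_def)
    show "0 < w j" by (rule I(2)[OF j])
  qed
  then obtain f where f: "f \<in> S" "\<And>h. h \<in> S \<Longrightarrow> \<Phi> h \<le> \<Phi> f"
    using continuous_attains_sup[OF S _, of \<Phi>] f0 by blast
  have "0 < \<Phi> f0" unfolding \<Phi>_def using ne cI by (intro prod_pos) (auto simp: f0_def)
  then have \<Phi>f: "0 < \<Phi> f" using f(2)[OF f0] by linarith
  have fpos: "0 < f j" if "j \<in> I" for j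
  proof -
    have "f j \<noteq> 0"
    proof
      assume "f j = 0"
      then have "\<Phi> f = 0" using I(1) that unfolding \<Phi>_def by (auto intro!: prod_zero bexI[of _ j])
      then show False using \<Phi>f by simp
    qed
    moreover have "0 \<le> f j" using f(1) by (simp add: S_def)
    ultimately show ?thesis by simp
  qed
  have f_out: "f j = 0" if "j \<notin> I" for j using f(1) that by (force simp: S_def c_def intro: antisym)
  \<comment> \<open>The first-order condition: along the segment from \<open>f\<close> to
    \<open>h\<close> the derivative at \<open>f\<close> of the logarithm of the product is the sum
    of \<open>w j * (h j / f j - 1)\<close>, and it cannot be positive.\<close>
  have key: "(\<Sum>j\<in>I. w j * (h j / f j)) \<le> 1" if h: "h \<in> S" for h
  proof -
    define r where "r j = h j / f j - 1" for j
    have r1: "- 1 \<le> r j" if "j \<in> I" for j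
      using h fpos[OF that] by (simp add: r_def S_def)
    \<comment> \<open>The inequality \<open>1 - 1 / u \<le> ln u\<close> gives the estimate at each
      \<open>t > 0\<close>, so that only a limit of rational expressions has to be taken and nothing
      is differentiated.\<close>
    have ineq: "(\<Sum>j\<in>I. w j * (r j / (1 + t * r j))) \<le> 0" if t: "0 < t" "t < 1" for t
    proof -
      define ft where "ft j = (1 - t) * f j + t * h j" for j
      have pos: "0 < 1 + t * r j" if "j \<in> I" for j
      proof -
        have "t * (- 1) \<le> t * r j" using t r1[OF that] by (intro mult_left_mono) auto
        then show ?thesis using t by simp
      qed
      have ft: "ft j = f j * (1 + t * r j)" if "j \<in> I" for j
        using fpos[OF that] by (simp add: ft_def r_def algebra_simps)
      have "ft \<in> S"
      proof -
        have "0 \<le> ft j \<and> ft j \<le> c j" for j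
        proof -
          have "0 \<le> f j" "f j \<le> c j" "0 \<le> h j" "h j \<le> c j" using f(1) h by (auto simp: S_def)
          then have "ft j \<le> (1 - t) * c j + t * c j"
            unfolding ft_def using t by (intro add_mono mult_left_mono) auto
          moreover have "0 \<le> ft j" unfolding ft_def using t \<open>0 \<le> f j\<close> \<open>0 \<le> h j\<close> by simp
          ultimately show ?thesis by (simp add: algebra_simps)
        qed
        moreover have "lat_ball e 1 (\<lambda>j. of_real (ft j))"
        proof -
          have "lat_ball e 1 (\<lambda>j. of_real (f j))" "lat_ball e 1 (\<lambda>j. of_real (h j))"
            using f(1) h by (auto simp: S_def)
          from lat_ball_add[OF lat_ball_scaleC[OF this(1), of "of_real (1 - t)"] lat_ball_scaleC[OF this(2), of "of_real t"]]
          have "lat_ball e (cmod (of_real (1 - t)) * 1 + cmod (of_real t) * 1)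
             (of_real (1 - t) *\<^sub>C (\<lambda>j. of_real (f j)) + of_real t *\<^sub>C (\<lambda>j. of_real (h j)))" .
          moreover have "cmod (of_real (1 - t)) * 1 + cmod (of_real t) * 1 = 1"
            unfolding norm_of_real using t by simp
          moreover have "of_real (1 - t) *\<^sub>C (\<lambda>j. of_real (f j)) + of_real t *\<^sub>C (\<lambda>j. of_real (h j)) = (\<lambda>j. of_real (ft j) :: complex)"
            by (simp add: fun_eq_iff ft_def)
          ultimately show ?thesis by (simp only:)
        qed
        ultimately show ?thesis by (simp add: S_def)
      qed
      then have le: "\<Phi> ft \<le> \<Phi> f" by (rule f(2))
      have "\<Phi> ft = (\<Prod>j\<in>I. f j powr w j * (1 + t * r j) powr w j)"
        unfolding \<Phi>_def using ft fpos pos by (intro prod.cong) (auto simp: powr_mult less_imp_le)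
      also have "\<dots> = \<Phi> f * (\<Prod>j\<in>I. (1 + t * r j) powr w j)" by (simp add: \<Phi>_def prod.distrib)
      finally have "(\<Prod>j\<in>I. (1 + t * r j) powr w j) \<le> 1" using le \<Phi>f by simp
      moreover have "(\<Prod>j\<in>I. (1 + t * r j) powr w j) = exp (\<Sum>j\<in>I. w j * ln (1 + t * r j))"
        unfolding exp_sum[OF I(1)] using less_imp_neq[OF pos] by (intro prod.cong refl) (auto simp: powr_def)
      ultimately have l: "(\<Sum>j\<in>I. w j * ln (1 + t * r j)) \<le> 0" by simp
      have "t * (\<Sum>j\<in>I. w j * (r j / (1 + t * r j))) = (\<Sum>j\<in>I. w j * (1 - 1 / (1 + t * r j)))"
        unfolding sum_distrib_left
      proof (rule sum.cong[OF refl])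
        fix j assume "j \<in> I"
        then have "1 + t * r j \<noteq> 0" using pos by force
        then show "t * (w j * (r j / (1 + t * r j))) = w j * (1 - 1 / (1 + t * r j))"
          by (simp add: field_simps)
      qed
      also have "\<dots> \<le> (\<Sum>j\<in>I. w j * ln (1 + t * r j))"
      proof (intro sum_mono mult_left_mono)
        fix j assume j: "j \<in> I"
        show "0 \<le> w j" using I(2)[OF j] by simp
        have "ln (1 / (1 + t * r j)) \<le> 1 / (1 + t * r j) - 1" using pos[OF j] by (intro ln_le_minus_one) simp
        then show "1 - 1 / (1 + t * r j) \<le> ln (1 + t * r j)" using pos[OF j] by (simp add: ln_div)
      qed
      finally have "t * (\<Sum>j\<in>I. w j * (r j / (1 + t * r j))) \<le> 0" using l by linarith
      then show ?thesis using t by (simp add: mult_le_0_iff)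
    qed
    have "((\<lambda>t. \<Sum>j\<in>I. w j * (r j / (1 + t * r j))) \<longlongrightarrow> (\<Sum>j\<in>I. w j * (r j / (1 + 0 * r j)))) (at_right 0)"
      by (intro tendsto_intros) auto
    moreover have "\<forall>\<^sub>F t in at_right 0. (\<Sum>j\<in>I. w j * (r j / (1 + t * r j))) \<le> 0"
    proof (rule eventually_mono)
      show "\<forall>\<^sub>F t in at_right 0. t \<in> {0<..<1::real}" by (rule eventually_at_right_real) simp
    qed (rule ineq, simp_all only: greaterThanLessThan_iff simp_thms)
    ultimately have "(\<Sum>j\<in>I. w j * (r j / (1 + 0 * r j))) \<le> 0"
      by (rule tendsto_upperbound) simp
    then have "(\<Sum>j\<in>I. w j * (h j / f j)) - (\<Sum>j\<in>I. w j) \<le> 0"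
      by (simp add: r_def algebra_simps sum_subtractf)
    then show ?thesis using I(3) by simp
  qed
  define g where "g j = (if j \<in> I then w j / f j else 0)" for j
  have "dual_ball e 1 (\<lambda>j. of_real (g j))"
    unfolding dual_ball_def
  proof (intro allI impI)
    fix R x n assume x: "lat_ball e R x"
    have g0: "0 \<le> g j" for j using I(2) fpos by (auto simp: g_def intro: divide_nonneg_nonneg less_imp_le)
    have "(\<Sum>j<n. cmod (x j) * cmod (of_real (g j))) = (\<Sum>j<n. cmod (x j) * g j)"
      using g0 by simp
    also have "\<dots> \<le> (\<Sum>j\<in>I. cmod (x j) * g j)"
    proof -
      have "(\<Sum>j<n. cmod (x j) * g j) = (\<Sum>j\<in>{..<n} \<inter> I. cmod (x j) * g j)"
        by (intro sum.mono_neutral_right) (auto simp: g_def)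
      also have "\<dots> \<le> (\<Sum>j\<in>I. cmod (x j) * g j)" using I(1) g0 by (intro sum_mono2) auto
      finally show ?thesis .
    qed
    also have "\<dots> \<le> R"
    proof (cases "R = 0")
      case True
      then have "x j = 0" for j using lat_ball_component[OF x, of j] ne[of j]
        by (simp add: mult_le_0_iff)
      then show ?thesis using True by simp
    next
      case False
      then have R: "0 < R" using lat_ball_nonneg[OF x] by simp
      define h where "h j = (if j \<in> I then cmod (x j) / R else 0)" for j
      have "h \<in> S"
      proof -
        have "0 \<le> h j \<and> h j \<le> c j" for j
          using lat_ball_component[OF x, of j] ne[of j] R by (auto simp: h_def c_def field_simps)
        moreover have "lat_ball e 1 (\<lambda>j. of_real (h j))"
        proof (rule lat_ball_dominated)
          show "lat_ball e 1 (of_real (1 / R) *\<^sub>C x)"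
            using lat_ball_scaleC[OF x, of "of_real (1 / R)"] R by (simp add: norm_divide)
          show "cmod (of_real (h j)) \<le> cmod ((of_real (1 / R) *\<^sub>C x) j)" for j
            using R by (auto simp: h_def norm_divide norm_mult)
        qed
        ultimately show ?thesis by (simp add: S_def)
      qed
      from key[OF this] have "R * (\<Sum>j\<in>I. w j * (h j / f j)) \<le> R * 1" using R by (intro mult_left_mono) auto
      moreover have "R * (\<Sum>j\<in>I. w j * (h j / f j)) = (\<Sum>j\<in>I. cmod (x j) * g j)"
        unfolding sum_distrib_left using R by (intro sum.cong) (auto simp: h_def g_def)
      ultimately show ?thesis by simp
    qed
    finally show "(\<Sum>j<n. cmod (x j) * cmod (of_real (g j))) \<le> R * 1" by simp
  qed
  moreover have "\<forall>j\<in>I. 0 < f j \<and> 0 < g j \<and> f j * g j = w j" using fpos I(2) by (force simp: g_def)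
  moreover have "\<forall>j. j \<notin> I \<longrightarrow> f j = 0 \<and> g j = 0" using f_out by (auto simp: g_def)
  moreover have "lat_ball e 1 (\<lambda>j. of_real (f j))" using f(1) by (simp add: S_def)
  ultimately show ?thesis by blast
qed

text \<open>A Lozanovskii factorization of \<open>\<bar>y\<bar>^2\<close> scaled so that both
  factors have bound \<open>ell2_norm y\<close>. Their geometric mean is the modulus of
  \<open>y\<close>, which gives the interpolating function the value \<open>y\<close> at
  1/2.\<close>

definition factorization :: "(nat \<Rightarrow> 'a::complex_banach) \<Rightarrow> omega \<Rightarrow> (nat \<Rightarrow> real) \<Rightarrow> (nat \<Rightarrow> real) \<Rightarrow> bool" where
  "factorization e y f g \<longleftrightarrow>
     (\<forall>j. y j \<noteq> 0 \<longrightarrow> 0 < f j \<and> 0 < g j \<and> f j * g j = (cmod (y j))\<^sup>2) \<and> (\<forall>j. y j = 0 \<longrightarrow> f j = 0 \<and> g j = 0) \<and>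
     lat_ball e (ell2_norm y) (\<lambda>j. of_real (f j)) \<and> dual_ball e (ell2_norm y) (\<lambda>j. of_real (g j))"

text \<open>The weights are the squared moduli divided by the squared norm, so that they sum to 1;
  afterwards both factors are multiplied by the norm. The zero vector has no such weights and takes
  zero factors.\<close>

lemma factorization_exists:
  assumes unc: "unconditional_basis e" and y: "y \<in> c00"
  shows "\<exists>f g. factorization e y f g"
proof (cases "y = 0")
  case True
  have z: "(\<lambda>j. of_real 0) = (0::omega)" by (simp add: fun_eq_iff)
  have "lat_ball e 0 (\<lambda>j. of_real 0)" "dual_ball e 0 (\<lambda>j. of_real 0)"
    unfolding z by (simp_all only: lat_ball_0 dual_ball_0 order_refl)
  moreover have "ell2_norm y = 0" unfolding True by (rule ell2_0(2))
  ultimately have "factorization e y (\<lambda>_. 0) (\<lambda>_. 0)"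
    unfolding factorization_def using True by simp
  then show ?thesis by blast
next
  case False
  have y2: "y \<in> ell2" using y c00_ell2 by blast
  define s where "s = ell2_norm y"
  have s: "0 < s" unfolding s_def using ell2_norm_eq_0[OF y2] ell2_norm_nonneg[OF y2] False by simp
  define I where "I = {j. y j \<noteq> 0}"
  have I: "finite I" using y by (simp add: I_def c00_def)
  obtain n where n: "{j. y j \<noteq> 0} \<subseteq> {..<n}" using c00_bounded[OF y] .
  define w where "w j = (cmod (y j))\<^sup>2 / s\<^sup>2" for j
  have "(\<Sum>j\<in>I. (cmod (y j))\<^sup>2) = (\<Sum>j<n. (cmod (y j))\<^sup>2)"
    using n by (intro sum.mono_neutral_left) (auto simp: I_def)
  also have "\<dots> = s\<^sup>2" using ell2_norm_finite[OF n, folded s_def] by simp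
  finally have "(\<Sum>j\<in>I. w j) = 1" using s by (simp add: w_def sum_divide_distrib[symmetric])
  then obtain f g where fg: "\<And>j. j \<in> I \<Longrightarrow> 0 < f j \<and> 0 < g j \<and> f j * g j = w j"
     "\<And>j. j \<notin> I \<Longrightarrow> f j = 0 \<and> g j = 0" "lat_ball e 1 (\<lambda>j. of_real (f j))" "dual_ball e 1 (\<lambda>j. of_real (g j))"
    using lozanovskii[OF unc I, of w] s by (auto simp: w_def I_def)
  have sc: "of_real s *\<^sub>C (\<lambda>j. of_real (h j)) = (\<lambda>j. of_real (s * h j) :: complex)" for h :: "nat \<Rightarrow> real"
    by (simp add: fun_eq_iff)
  have "lat_ball e s (\<lambda>j. of_real (s * f j))" "dual_ball e s (\<lambda>j. of_real (s * g j))"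
    using lat_ball_scaleC[OF fg(3), of "of_real s"] dual_ball_scaleC[OF fg(4), of "of_real s"] s
    unfolding sc by simp_all
  moreover have "s * f j * (s * g j) = (cmod (y j))\<^sup>2" if "j \<in> I" for j
  proof -
    have "s * f j * (s * g j) = s\<^sup>2 * w j" using fg(1)[OF that] by (simp add: power2_eq_square mult_ac)
    then show ?thesis using s by (simp add: w_def)
  qed
  ultimately have "factorization e y (\<lambda>j. s * f j) (\<lambda>j. s * g j)"
    unfolding factorization_def using fg s by (auto simp: I_def s_def)
  then show ?thesis by blast
qed

text \<open>The derivative at 1/2 of the function with coordinates
  \<open>sgn y * f^(1 - z) * g^z\<close>.\<close>

definition log_derivation :: "(nat \<Rightarrow> real) \<Rightarrow> (nat \<Rightarrow> real) \<Rightarrow> omega \<Rightarrow> omega" where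
  "log_derivation f g y = (\<lambda>j. y j * of_real (ln (g j) - ln (f j)))"

text \<open>The competitor is \<open>F(z) = \<Sum>i. sgn a\<^sub>i s (|a\<^sub>i| / s)\<^bsup>2\<alpha>(1 - z) + 2(1 - \<alpha>)z\<^esup> sgn y\<^sub>i f\<^sub>i\<^bsup>1 - z\<^esup> g\<^sub>i\<^bsup>z\<^esup>\<close>.\<close>

lemma block_combination_der_at:
  fixes y :: "nat \<Rightarrow> omega" and a :: omega
  assumes disj: "\<And>i i' j. i < n \<Longrightarrow> i' < n \<Longrightarrow> i \<noteq> i' \<Longrightarrow> y i j \<noteq> 0 \<Longrightarrow> y i' j = 0"
    and fac: "\<And>i. i < n \<Longrightarrow> factorization e (y i) (f i) (g i)"
    and s: "0 < s"
    and lat: "lat_ball e C (\<lambda>j. of_real (\<Sum>i<n. (cmod (a i) / s) powr (2 * \<alpha>) * f i j))"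
    and dual: "dual_ball e C (\<lambda>j. of_real (\<Sum>i<n. (cmod (a i) / s) powr (2 * (1 - \<alpha>)) * g i j))"
  shows "der_at e (s * C) (\<Sum>i<n. a i *\<^sub>C y i)
    ((\<Sum>i<n. a i *\<^sub>C log_derivation (f i) (g i) (y i)) +
     of_real (2 * (1 - 2 * \<alpha>)) *\<^sub>C (\<Sum>i<n. (a i * of_real (ln (cmod (a i) / s))) *\<^sub>C y i))"
proof -
  \<comment> \<open>By disjointness a coordinate \<open>j\<close> meets at most one block with
    nonzero coefficient. \<open>P j\<close> says that there is one and \<open>k j\<close> is its
    index; \<open>pick\<close> collapses all sums over blocks accordingly.\<close>
  define P where "P j \<longleftrightarrow> (\<exists>i<n. a i \<noteq> 0 \<and> y i j \<noteq> 0)" for j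
  define k where "k j = (SOME i. i < n \<and> a i \<noteq> 0 \<and> y i j \<noteq> 0)" for j
  have k: "k j < n \<and> a (k j) \<noteq> 0 \<and> y (k j) j \<noteq> 0" if "P j" for j
    unfolding k_def by (rule someI_ex) (use that in \<open>simp add: P_def\<close>)
  have pick: "(\<Sum>i<n. h i) = (if P j then h (k j) else 0)"
    if h: "\<And>i. i < n \<Longrightarrow> a i = 0 \<or> y i j = 0 \<Longrightarrow> h i = 0" for h :: "nat \<Rightarrow> 'c::comm_monoid_add" and j
  proof (cases "P j")
    case True
    have "(\<Sum>i<n. h i) = (\<Sum>i\<in>{k j}. h i)"
      using k[OF True] h disj[of "k j" _ j] by (intro sum.mono_neutral_right) auto
    then show ?thesis using True by simp
  next
    case False
    then show ?thesis using h by (auto simp: P_def intro!: sum.neutral)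
  qed
  have fp: "0 < f i j" "0 < g i j" "f i j * g i j = (cmod (y i j))\<^sup>2" if "i < n" "y i j \<noteq> 0" for i j
    using fac[OF that(1)] that(2) by (auto simp: factorization_def)
  have f0: "f i j = 0" "g i j = 0" if "i < n" "y i j = 0" for i j
    using fac[OF that(1)] that(2) by (auto simp: factorization_def)
  define \<sigma> where "\<sigma> j = (if P j then sgn (a (k j) * y (k j) j) else 0)" for j
  \<comment> \<open>\<open>p\<close> and \<open>q\<close> are the logarithms of the moduli of the
    competitor on the lines \<open>Re z = 0\<close> and \<open>Re z = 1\<close>; the prefactor
    \<open>s\<close> restores the size lost in normalizing the coefficients.\<close>
  define p where "p j = ln s + 2 * \<alpha> * ln (cmod (a (k j)) / s) + ln (f (k j) j)" for j
  define q where "q j = ln s + 2 * (1 - \<alpha>) * ln (cmod (a (k j)) / s) + ln (g (k j) j)" for j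
  have ex: "exp (ln s + \<beta> * ln (cmod (a (k j)) / s) + ln v) = s * ((cmod (a (k j)) / s) powr \<beta> * v)"
    if "P j" "0 < v" for \<beta> v j
    using k[OF that(1)] that(2) s by (simp add: exp_add powr_def)
  have ns: "cmod ((of_real s *\<^sub>C (\<lambda>j. of_real (h j))) j) = s * \<bar>h j\<bar>" for h :: "nat \<Rightarrow> real" and j
    using s by (simp add: norm_mult)
  have "lat_ball e (s * C) (\<lambda>j. \<sigma> j * of_real (exp (p j)))"
  proof (rule lat_ball_dominated)
    show "lat_ball e (s * C) (of_real s *\<^sub>C (\<lambda>j. of_real (\<Sum>i<n. (cmod (a i) / s) powr (2 * \<alpha>) * f i j)))"
      using lat_ball_scaleC[OF lat, of "of_real s"] s by simp
    show "cmod (\<sigma> j * of_real (exp (p j))) \<le>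
        cmod ((of_real s *\<^sub>C (\<lambda>j. of_real (\<Sum>i<n. (cmod (a i) / s) powr (2 * \<alpha>) * f i j))) j)" for j
    proof -
      have "(\<Sum>i<n. (cmod (a i) / s) powr (2 * \<alpha>) * f i j) =
          (if P j then (cmod (a (k j)) / s) powr (2 * \<alpha>) * f (k j) j else 0)"
        by (rule pick) (auto simp: f0)
      then show ?thesis unfolding ns using k[of j] fp[of "k j" j] s
        by (auto simp: \<sigma>_def p_def ex norm_mult norm_sgn abs_mult)
    qed
  qed
  moreover have "dual_ball e (s * C) (\<lambda>j. \<sigma> j * of_real (exp (q j)))"
  proof (rule dual_ball_dominated)
    show "dual_ball e (s * C) (of_real s *\<^sub>C (\<lambda>j. of_real (\<Sum>i<n. (cmod (a i) / s) powr (2 * (1 - \<alpha>)) * g i j)))"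
      using dual_ball_scaleC[OF dual, of "of_real s"] s by simp
    show "cmod (\<sigma> j * of_real (exp (q j))) \<le>
        cmod ((of_real s *\<^sub>C (\<lambda>j. of_real (\<Sum>i<n. (cmod (a i) / s) powr (2 * (1 - \<alpha>)) * g i j))) j)" for j
    proof -
      have "(\<Sum>i<n. (cmod (a i) / s) powr (2 * (1 - \<alpha>)) * g i j) =
          (if P j then (cmod (a (k j)) / s) powr (2 * (1 - \<alpha>)) * g (k j) j else 0)"
        by (rule pick) (auto simp: f0)
      then show ?thesis unfolding ns using k[of j] fp[of "k j" j] s
        by (auto simp: \<sigma>_def q_def ex norm_mult norm_sgn abs_mult)
    qed
  qed
  ultimately have D: "der_at e (s * C) (\<lambda>j. \<sigma> j * of_real (exp ((p j + q j) / 2)))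
    (\<lambda>j. \<sigma> j * of_real (exp ((p j + q j) / 2)) * of_real (q j - p j))"
    by (rule der_at_exp)
  \<comment> \<open>At the midpoint the exponents \<open>2 * \<alpha>\<close> and
    \<open>2 * (1 - \<alpha>)\<close> average to 1 and the factors to their geometric mean, so the
    modulus is that of \<open>a (k j) * y (k j) j\<close>.\<close>
  have half: "\<sigma> j * of_real (exp ((p j + q j) / 2)) = (if P j then a (k j) * y (k j) j else 0)" for j
  proof (cases "P j")
    case True
    let ?a = "a (k j)" and ?y = "y (k j) j"
    have nz: "?a \<noteq> 0" "?y \<noteq> 0" "k j < n" using k[OF True] by auto
    note fg = fp[OF nz(3,2)]
    have "ln (f (k j) j) + ln (g (k j) j) = 2 * ln (cmod ?y)"
    proof -
      have "ln (f (k j) j) + ln (g (k j) j) = ln ((cmod ?y)\<^sup>2)"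
        using ln_mult[of "f (k j) j" "g (k j) j"] fg by simp
      then show ?thesis using nz(2) by (simp add: power2_eq_square ln_mult)
    qed
    then have "(p j + q j) / 2 = ln (cmod ?a) + ln (cmod ?y)"
      using s nz by (simp add: p_def q_def ln_div algebra_simps)
    then have "exp ((p j + q j) / 2) = cmod (?a * ?y)"
      using nz by (simp only: exp_add exp_ln zero_less_norm_iff norm_mult not_False_eq_True)
    moreover have "sgn (?a * ?y) * of_real (cmod (?a * ?y)) = ?a * ?y"
      using nz by (simp add: sgn_eq)
    ultimately show ?thesis using True by (simp only: \<sigma>_def if_True)
  qed (simp add: \<sigma>_def)
  have "(\<Sum>i<n. a i *\<^sub>C y i) = (\<lambda>j. \<sigma> j * of_real (exp ((p j + q j) / 2)))"
  proof
    fix j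
    have "(\<Sum>i<n. a i *\<^sub>C y i) j = (\<Sum>i<n. a i * y i j)" by (simp add: sum_fun_apply)
    also have "\<dots> = (if P j then a (k j) * y (k j) j else 0)" by (rule pick) auto
    finally show "(\<Sum>i<n. a i *\<^sub>C y i) j = \<sigma> j * of_real (exp ((p j + q j) / 2))" by (simp only: half)
  qed
  \<comment> \<open>Coordinatewise, \<open>q - p\<close> is the logarithm of the quotient of the
    factors plus \<open>2 * (1 - 2 * \<alpha>)\<close> times that of the normalized coefficient.
    These are the two summands.\<close>
  moreover have "((\<Sum>i<n. a i *\<^sub>C log_derivation (f i) (g i) (y i)) +
     of_real (2 * (1 - 2 * \<alpha>)) *\<^sub>C (\<Sum>i<n. (a i * of_real (ln (cmod (a i) / s))) *\<^sub>C y i)) =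
     (\<lambda>j. \<sigma> j * of_real (exp ((p j + q j) / 2)) * of_real (q j - p j))" (is "?l = ?r")
  proof
    fix j
    have 1: "(\<Sum>i<n. a i * (y i j * of_real (ln (g i j) - ln (f i j)))) =
        (if P j then a (k j) * (y (k j) j * of_real (ln (g (k j) j) - ln (f (k j) j))) else 0)"
      by (rule pick) auto
    have 2: "(\<Sum>i<n. a i * of_real (ln (cmod (a i) / s)) * y i j) =
        (if P j then a (k j) * of_real (ln (cmod (a (k j)) / s)) * y (k j) j else 0)"
      by (rule pick) auto
    have "?l j = (\<Sum>i<n. a i * (y i j * of_real (ln (g i j) - ln (f i j)))) +
        of_real (2 * (1 - 2 * \<alpha>)) * (\<Sum>i<n. a i * of_real (ln (cmod (a i) / s)) * y i j)"
      by (simp add: sum_fun_apply log_derivation_def)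
    also have "\<dots> = ?r j"
      unfolding 1 2 half by (simp add: p_def q_def algebra_simps)
    finally show "?l j = ?r j" .
  qed
  ultimately show ?thesis using D by (simp only:)
qed

text \<open>The case of one block with coefficient 1 and scale 1, where the logarithmic term
  vanishes.\<close>

lemma factorization_der_at:
  assumes "factorization e y f g" shows "der_at e (ell2_norm y) y (log_derivation f g y)"
proof -
  have "der_at e (1 * ell2_norm y) (\<Sum>i<(1::nat). (\<lambda>_. 1) i *\<^sub>C y)
    ((\<Sum>i<(1::nat). (\<lambda>_. 1) i *\<^sub>C log_derivation f g y) +
     of_real (2 * (1 - 2 * (1/2))) *\<^sub>C (\<Sum>i<(1::nat). ((\<lambda>_. 1) i * of_real (ln (cmod ((\<lambda>_. 1) i) / 1))) *\<^sub>C y))"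
    by (rule block_combination_der_at[where f = "\<lambda>_. f" and g = "\<lambda>_. g"])
       (use assms in \<open>auto simp: factorization_def\<close>)
  then show ?thesis by (simp add: scaleC_one)
qed


subsection \<open>Spreading models\<close>

locale normed_subspace =
  fixes V :: "'v::complex_vector set" and N :: "'v \<Rightarrow> real"
  assumes norm_on: "norm_on V N"
begin

lemma V_subspace: "complex_vector.subspace V" using norm_on by (simp add: norm_on_def)

lemmas V_add = complex_vector.subspace_add[OF V_subspace]
  and V_diff = complex_vector.subspace_diff[OF V_subspace]
  and V_scale = complex_vector.subspace_scale[OF V_subspace]
  and V_0 = complex_vector.subspace_0[OF V_subspace]

lemma V_sum: "(\<And>i. i \<in> A \<Longrightarrow> v i \<in> V) \<Longrightarrow> sum v A \<in> V"
  by (rule complex_vector.subspace_sum[OF V_subspace])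

lemma N_nonneg: "x \<in> V \<Longrightarrow> 0 \<le> N x" using norm_on by (simp add: norm_on_def)
lemma N_eq_0: "x \<in> V \<Longrightarrow> N x = 0 \<longleftrightarrow> x = 0" using norm_on by (simp add: norm_on_def)
lemma N_add: "x \<in> V \<Longrightarrow> y \<in> V \<Longrightarrow> N (x + y) \<le> N x + N y" using norm_on by (simp add: norm_on_def)
lemma N_scale: "x \<in> V \<Longrightarrow> N (c *\<^sub>C x) = cmod c * N x" using norm_on by (simp add: norm_on_def)
lemma N_0 [simp]: "N 0 = 0" using N_eq_0[OF V_0] by simp

lemma N_minus_commute: "x \<in> V \<Longrightarrow> y \<in> V \<Longrightarrow> N (x - y) = N (y - x)"
  using N_scale[of "y - x" "-1"] V_diff[of y x] by simp

lemma N_diff_le: "x \<in> V \<Longrightarrow> y \<in> V \<Longrightarrow> N (x - y) \<le> N x + N y"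
  using N_add[of x "(-1) *\<^sub>C y"] N_scale[of y "-1"] V_scale[of y "-1"] by simp

lemma N_abs_diff: "x \<in> V \<Longrightarrow> y \<in> V \<Longrightarrow> \<bar>N x - N y\<bar> \<le> N (x - y)"
  using N_add[of "x - y" y] N_add[of "y - x" x] N_minus_commute[of x y] V_diff by (simp add: abs_le_iff)

lemma N_sum: "(\<And>i. i \<in> A \<Longrightarrow> v i \<in> V) \<Longrightarrow> N (sum v A) \<le> (\<Sum>i\<in>A. N (v i))"
proof (induction A rule: infinite_finite_induct)
  case (insert a A)
  then show ?case using N_add[of "v a" "sum v A"] V_sum[of A v] by fastforce
qed auto

lemma N_combination: "(\<And>i. i \<in> A \<Longrightarrow> v i \<in> V) \<Longrightarrow> N (\<Sum>i\<in>A. a i *\<^sub>C v i) \<le> (\<Sum>i\<in>A. cmod (a i) * N (v i))"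
  using N_sum[of A "\<lambda>i. a i *\<^sub>C v i"] by (simp add: V_scale N_scale)

end

lemma norm_on_UNIV: "norm_on (UNIV :: 'a::complex_banach set) norm"
  by (simp add: norm_on_def norm_triangle_ineq norm_scaleC complex_vector.subspace_UNIV)

text \<open>The convergence clause of \<open>generates_spreading_norm\<close> for a sequence whose
  good subsequence has already been extracted.\<close>

definition spreading_limit :: "('v::complex_vector \<Rightarrow> real) \<Rightarrow> (nat \<Rightarrow> 'v) \<Rightarrow> (omega \<Rightarrow> real) \<Rightarrow> bool" where
  "spreading_limit N x L \<longleftrightarrow> (\<forall>n (a::omega). {j. a j \<noteq> 0} \<subseteq> {..<n} \<longrightarrow>
     (\<forall>\<epsilon>>0. \<exists>\<nu>. \<forall>k::nat \<Rightarrow> nat. strict_mono_on {..<n} k \<and> (\<forall>i<n. \<nu> \<le> k i) \<longrightarrow>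
        \<bar>N (\<Sum>i<n. a i *\<^sub>C x (k i)) - L a\<bar> < \<epsilon>))"

lemma spreading_limitD:
  assumes "spreading_limit N x L" "{j. a j \<noteq> 0} \<subseteq> {..<n}" "0 < \<epsilon>"
  shows "\<exists>\<nu>. \<forall>k::nat \<Rightarrow> nat. strict_mono_on {..<n} k \<and> (\<forall>i<n. \<nu> \<le> k i) \<longrightarrow>
        \<bar>N (\<Sum>i<n. a i *\<^sub>C x (k i)) - L a\<bar> < \<epsilon>"
  by (rule assms(1)[unfolded spreading_limit_def, rule_format, OF assms(2,3)])

lemma spreading_limit_subseq:
  assumes "spreading_limit N x L" "strict_mono s"
  shows "spreading_limit N (\<lambda>j. x (s j)) L"
  unfolding spreading_limit_def
proof (intro allI impI)
  fix n and a :: omega and \<epsilon> :: real assume "{j. a j \<noteq> 0} \<subseteq> {..<n}" "0 < \<epsilon>"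
  from spreading_limitD[OF assms(1) this] obtain \<nu> where \<nu>: "\<And>k::nat \<Rightarrow> nat. strict_mono_on {..<n} k \<Longrightarrow> (\<forall>i<n. \<nu> \<le> k i) \<Longrightarrow>
        \<bar>N (\<Sum>i<n. a i *\<^sub>C x (k i)) - L a\<bar> < \<epsilon>"
    by blast
  have "\<bar>N (\<Sum>i<n. a i *\<^sub>C x (s (k i))) - L a\<bar> < \<epsilon>"
    if k: "strict_mono_on {..<n} k" "\<forall>i<n. \<nu> \<le> k i" for k
  proof (rule \<nu>[of "\<lambda>i. s (k i)"])
    show "strict_mono_on {..<n} (\<lambda>i. s (k i))"
      using k(1) assms(2) by (auto simp: strict_mono_on_def strict_mono_def)
    show "\<forall>i<n. \<nu> \<le> s (k i)"
      using k(2) seq_suble[OF assms(2)] order_trans by blast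
  qed
  then show "\<exists>\<nu>. \<forall>k. strict_mono_on {..<n} k \<and> (\<forall>i<n. \<nu> \<le> k i) \<longrightarrow>
        \<bar>N (\<Sum>i<n. a i *\<^sub>C x (s (k i))) - L a\<bar> < \<epsilon>" by blast
qed

text \<open>The prescribed lower bound \<open>\<nu>\<close> lets thresholds be chosen one above the
  other, so that a single index sequence satisfies several approximations at once.\<close>

lemma spreading_limit_approx:
  assumes "spreading_limit N x L" "{j. a j \<noteq> 0} \<subseteq> {..<n}" "0 < \<epsilon>"
  obtains m where "\<nu> \<le> m" "\<And>k::nat \<Rightarrow> nat. strict_mono_on {..<n} k \<Longrightarrow> (\<And>i. i < n \<Longrightarrow> m \<le> k i) \<Longrightarrow>
        \<bar>N (\<Sum>i<n. a i *\<^sub>C x (k i)) - L a\<bar> < \<epsilon>"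
proof -
  obtain \<mu> where \<mu>: "\<And>k::nat \<Rightarrow> nat. strict_mono_on {..<n} k \<Longrightarrow> (\<forall>i<n. \<mu> \<le> k i) \<Longrightarrow>
        \<bar>N (\<Sum>i<n. a i *\<^sub>C x (k i)) - L a\<bar> < \<epsilon>"
    using spreading_limitD[OF assms] by blast
  show thesis
  proof (rule that[of "max \<mu> \<nu>"])
    fix k :: "nat \<Rightarrow> nat" assume "strict_mono_on {..<n} k" "\<And>i. i < n \<Longrightarrow> max \<mu> \<nu> \<le> k i"
    then show "\<bar>N (\<Sum>i<n. a i *\<^sub>C x (k i)) - L a\<bar> < \<epsilon>" by (intro \<mu>) auto
  qed simp
qed

lemma strict_mono_on_shift: "strict_mono_on A (\<lambda>i. m + i :: nat)"
  by (simp add: strict_mono_on_def)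

lemma spreading_limit_le:
  assumes "spreading_limit N x L" "{j. a j \<noteq> 0} \<subseteq> {..<n}"
    and "\<And>k::nat \<Rightarrow> nat. strict_mono_on {..<n} k \<Longrightarrow> (\<And>i. i < n \<Longrightarrow> \<nu> \<le> k i) \<Longrightarrow> N (\<Sum>i<n. a i *\<^sub>C x (k i)) \<le> C"
  shows "L a \<le> C"
proof (rule field_le_epsilon)
  fix \<epsilon> :: real assume "0 < \<epsilon>"
  obtain m where m: "\<nu> \<le> m" "\<And>k::nat \<Rightarrow> nat. strict_mono_on {..<n} k \<Longrightarrow> (\<And>i. i < n \<Longrightarrow> m \<le> k i) \<Longrightarrow>
        \<bar>N (\<Sum>i<n. a i *\<^sub>C x (k i)) - L a\<bar> < \<epsilon>"
    using spreading_limit_approx[OF assms(1,2) \<open>0 < \<epsilon>\<close>, of \<nu>] by blast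
  from m(2)[OF strict_mono_on_shift[of _ m]] assms(3)[OF strict_mono_on_shift[of _ m]] m(1)
  show "L a \<le> C + \<epsilon>" by fastforce
qed

lemma spreading_limit_ge:
  assumes "spreading_limit N x L" "{j. a j \<noteq> 0} \<subseteq> {..<n}"
    and "\<And>k::nat \<Rightarrow> nat. strict_mono_on {..<n} k \<Longrightarrow> (\<And>i. i < n \<Longrightarrow> \<nu> \<le> k i) \<Longrightarrow> C \<le> N (\<Sum>i<n. a i *\<^sub>C x (k i))"
  shows "C \<le> L a"
proof (rule field_le_epsilon)
  fix \<epsilon> :: real assume "0 < \<epsilon>"
  obtain m where m: "\<nu> \<le> m" "\<And>k::nat \<Rightarrow> nat. strict_mono_on {..<n} k \<Longrightarrow> (\<And>i. i < n \<Longrightarrow> m \<le> k i) \<Longrightarrow>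
        \<bar>N (\<Sum>i<n. a i *\<^sub>C x (k i)) - L a\<bar> < \<epsilon>"
    using spreading_limit_approx[OF assms(1,2) \<open>0 < \<epsilon>\<close>, of \<nu>] by blast
  from m(2)[OF strict_mono_on_shift[of _ m]] assms(3)[OF strict_mono_on_shift[of _ m]] m(1)
  show "C \<le> L a + \<epsilon>" by fastforce
qed

lemma sum_support_eq:
  fixes v :: "nat \<Rightarrow> 'v::complex_vector"
  assumes "{j. a j \<noteq> 0} \<subseteq> {..<n}" "{j. a j \<noteq> 0} \<subseteq> {..<m}"
  shows "(\<Sum>i<n. a i *\<^sub>C v i) = (\<Sum>i<m. a i *\<^sub>C v i)"
proof -
  have "(\<Sum>i<l. a i *\<^sub>C v i) = (\<Sum>i\<in>{j. a j \<noteq> 0}. a i *\<^sub>C v i)" if "{j. a j \<noteq> 0} \<subseteq> {..<l}" for l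
    using that by (intro sum.mono_neutral_right) auto
  then show ?thesis using assms by simp
qed

section \<open>Properties of the limit and the Brunel-Sucheston theorem\<close>

context normed_subspace
begin

lemma spreading_limit_triangle:
  assumes L: "spreading_limit N x L" and x: "range x \<subseteq> V" and ab: "a \<in> c00" "b \<in> c00"
  shows "L (a + b) \<le> L a + L b"
proof (rule field_le_epsilon)
  fix \<epsilon> :: real assume \<epsilon>: "0 < \<epsilon>"
  obtain n1 n2 where "{j. a j \<noteq> 0} \<subseteq> {..<n1}" "{j. b j \<noteq> 0} \<subseteq> {..<n2}"
    using c00_bounded[OF ab(1)] c00_bounded[OF ab(2)] by metis
  then obtain n where n: "{j. a j \<noteq> 0} \<subseteq> {..<n}" "{j. b j \<noteq> 0} \<subseteq> {..<n}"
    by (metis lessThan_subset_iff max.cobounded1 max.cobounded2 order_trans)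
  have "{j. (a + b) j \<noteq> 0} \<subseteq> {j. a j \<noteq> 0} \<union> {j. b j \<noteq> 0}" by auto
  with n have n': "{j. (a + b) j \<noteq> 0} \<subseteq> {..<n}" by blast
  have \<epsilon>3: "0 < \<epsilon> / 3" using \<epsilon> by simp
  obtain m1 where m1: "0 \<le> m1" "\<And>k::nat \<Rightarrow> nat. strict_mono_on {..<n} k \<Longrightarrow> (\<And>i. i < n \<Longrightarrow> m1 \<le> k i) \<Longrightarrow>
        \<bar>N (\<Sum>i<n. a i *\<^sub>C x (k i)) - L a\<bar> < \<epsilon> / 3"
    using spreading_limit_approx[OF L n(1) \<epsilon>3, of 0] by blast
  obtain m2 where m2: "m1 \<le> m2" "\<And>k::nat \<Rightarrow> nat. strict_mono_on {..<n} k \<Longrightarrow> (\<And>i. i < n \<Longrightarrow> m2 \<le> k i) \<Longrightarrow>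
        \<bar>N (\<Sum>i<n. b i *\<^sub>C x (k i)) - L b\<bar> < \<epsilon> / 3"
    using spreading_limit_approx[OF L n(2) \<epsilon>3, of m1] by blast
  obtain m where m: "m2 \<le> m" "\<And>k::nat \<Rightarrow> nat. strict_mono_on {..<n} k \<Longrightarrow> (\<And>i. i < n \<Longrightarrow> m \<le> k i) \<Longrightarrow>
        \<bar>N (\<Sum>i<n. (a + b) i *\<^sub>C x (k i)) - L (a + b)\<bar> < \<epsilon> / 3"
    using spreading_limit_approx[OF L n' \<epsilon>3, of m2] by blast
  let ?S = "\<lambda>a. \<Sum>i<n. a i *\<^sub>C x (m + i)"
  have "?S (a + b) = ?S a + ?S b" by (simp add: scaleC_add_left sum.distrib)
  moreover have "?S a \<in> V" "?S b \<in> V" using x by (auto intro!: V_sum V_scale)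
  ultimately have "N (?S (a + b)) \<le> N (?S a) + N (?S b)" using N_add by simp
  moreover have "\<bar>N (?S a) - L a\<bar> < \<epsilon> / 3"
    by (rule m1(2)[OF strict_mono_on_shift]) (use m1(1) m2(1) m(1) in linarith)
  moreover have "\<bar>N (?S b) - L b\<bar> < \<epsilon> / 3"
    by (rule m2(2)[OF strict_mono_on_shift]) (use m1(1) m2(1) m(1) in linarith)
  moreover have "\<bar>N (?S (a + b)) - L (a + b)\<bar> < \<epsilon> / 3"
    by (rule m(2)[OF strict_mono_on_shift]) simp
  ultimately show "L (a + b) \<le> L a + L b + \<epsilon>" by linarith
qed

lemma spreading_limit_scale:
  assumes L: "spreading_limit N x L" and x: "range x \<subseteq> V" and a: "a \<in> c00"
  shows "L (c *\<^sub>C a) = cmod c * L a"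
proof -
  obtain n where n: "{j. a j \<noteq> 0} \<subseteq> {..<n}" using c00_bounded[OF a] .
  then have n': "{j. (c *\<^sub>C a) j \<noteq> 0} \<subseteq> {..<n}" by auto
  have "\<bar>L (c *\<^sub>C a) - cmod c * L a\<bar> \<le> 0 + \<epsilon>" if \<epsilon>: "0 < \<epsilon>" for \<epsilon>
  proof -
    define \<delta> where "\<delta> = \<epsilon> / (cmod c + 1)"
    have cp: "0 < cmod c + 1" by (simp add: add_nonneg_pos)
    have \<delta>: "0 < \<delta>" using \<epsilon> cp by (simp add: \<delta>_def)
    obtain m1 where m1: "0 \<le> m1" "\<And>k::nat \<Rightarrow> nat. strict_mono_on {..<n} k \<Longrightarrow> (\<And>i. i < n \<Longrightarrow> m1 \<le> k i) \<Longrightarrow>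
        \<bar>N (\<Sum>i<n. a i *\<^sub>C x (k i)) - L a\<bar> < \<delta>"
      using spreading_limit_approx[OF L n \<delta>, of 0] by blast
    obtain m where m: "m1 \<le> m" "\<And>k::nat \<Rightarrow> nat. strict_mono_on {..<n} k \<Longrightarrow> (\<And>i. i < n \<Longrightarrow> m \<le> k i) \<Longrightarrow>
        \<bar>N (\<Sum>i<n. (c *\<^sub>C a) i *\<^sub>C x (k i)) - L (c *\<^sub>C a)\<bar> < \<delta>"
      using spreading_limit_approx[OF L n' \<delta>, of m1] by blast
    let ?S = "\<lambda>a. \<Sum>i<n. a i *\<^sub>C x (m + i)"
    have "?S (c *\<^sub>C a) = c *\<^sub>C ?S a" by (simp add: complex_vector.scale_sum_right scaleC_scaleC)
    moreover have "?S a \<in> V" using x by (auto intro!: V_sum V_scale)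
    ultimately have eq: "N (?S (c *\<^sub>C a)) = cmod c * N (?S a)" using N_scale by simp
    have 1: "\<bar>N (?S a) - L a\<bar> < \<delta>"
      by (rule m1(2)[OF strict_mono_on_shift]) (use m(1) in linarith)
    have 2: "\<bar>N (?S (c *\<^sub>C a)) - L (c *\<^sub>C a)\<bar> < \<delta>"
      by (rule m(2)[OF strict_mono_on_shift]) simp
    have "\<bar>cmod c * N (?S a) - cmod c * L a\<bar> = cmod c * \<bar>N (?S a) - L a\<bar>"
      by (simp add: abs_mult right_diff_distrib[symmetric])
    also have "\<dots> \<le> cmod c * \<delta>" using 1 by (intro mult_left_mono) auto
    finally have "\<bar>L (c *\<^sub>C a) - cmod c * L a\<bar> \<le> cmod c * \<delta> + \<delta>" using 2 eq by linarith
    also have "\<dots> = (cmod c + 1) * \<delta>" by (simp add: algebra_simps)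
    also have "\<dots> = \<epsilon>" using cp by (simp add: \<delta>_def)
    finally show ?thesis by simp
  qed
  from field_le_epsilon[OF this] show ?thesis by simp
qed

text \<open>The sets of \<open>n\<close> indices are coloured by the norm of the combination in
  units of \<open>\<delta>\<close>; boundedness leaves finitely many colours. On a homogeneous set
  all values lie in one interval of length \<open>\<delta>\<close>. Listing a set increasingly
  matches it with a strictly increasing choice of indices.\<close>

lemma Ramsey_stabilization:
  fixes a :: omega
  assumes x: "range x \<subseteq> V" "\<And>j. N (x j) \<le> b" and \<delta>: "0 < \<delta>"
  shows "\<exists>r c. strict_mono (r :: nat \<Rightarrow> nat) \<and>
    (\<forall>k. strict_mono_on {..<n} k \<longrightarrow> \<bar>N (\<Sum>i<n. a i *\<^sub>C x (r (k i))) - c\<bar> \<le> \<delta>)"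
proof -
  define h where "h X = N (\<Sum>i<n. a i *\<^sub>C x (sorted_list_of_set X ! i))" for X :: "nat set"
  define M where "M = (\<Sum>i<n. cmod (a i) * b)"
  have xV: "x j \<in> V" for j using x by auto
  have h: "0 \<le> h X" "h X \<le> M" for X
  proof -
    show "0 \<le> h X" unfolding h_def by (intro N_nonneg V_sum V_scale xV)
    have "h X \<le> (\<Sum>i<n. cmod (a i) * N (x (sorted_list_of_set X ! i)))"
      unfolding h_def by (intro N_combination xV)
    also have "\<dots> \<le> M" unfolding M_def by (intro sum_mono mult_left_mono x) auto
    finally show "h X \<le> M" .
  qed
  define f where "f X = nat \<lfloor>h X / \<delta>\<rfloor>" for X
  have "f X < Suc (nat \<lfloor>M / \<delta>\<rfloor>)" for X
    using h[of X] \<delta> unfolding f_def less_Suc_eq_le by (intro nat_mono floor_mono divide_right_mono) auto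
  then obtain Y t where Y: "infinite Y" "\<And>X. X \<subseteq> Y \<Longrightarrow> finite X \<Longrightarrow> card X = n \<Longrightarrow> f X = t"
    using Ramsey[of "UNIV :: nat set" n f "Suc (nat \<lfloor>M / \<delta>\<rfloor>)"] by auto
  define r where "r = enumerate Y"
  have r: "strict_mono r" "\<And>i. r i \<in> Y"
    using strict_mono_enumerate[OF Y(1)] enumerate_in_set[OF Y(1)] by (auto simp: r_def)
  have "\<bar>N (\<Sum>i<n. a i *\<^sub>C x (r (k i))) - real t * \<delta>\<bar> \<le> \<delta>" if k: "strict_mono_on {..<n} k" for k
  proof -
    define X where "X = (\<lambda>i. r (k i)) ` {..<n}"
    have sm: "r (k i) < r (k j)" if "i < j" "j < n" for i j
      using k r(1) that by (auto simp: strict_mono_on_def strict_mono_def)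
    have inj: "inj_on (\<lambda>i. r (k i)) {..<n}"
      by (rule inj_onI) (metis sm lessThan_iff linorder_neqE_nat less_irrefl)
    have X: "X \<subseteq> Y" "finite X" "card X = n" using r(2) inj by (auto simp: X_def card_image)
    have "sorted_list_of_set X = map (\<lambda>i. r (k i)) [0..<n]"
      by (rule sorted_list_of_set_unique[THEN iffD1])
        (use X sm in \<open>auto simp: X_def sorted_wrt_iff_nth_less atLeast0LessThan\<close>)
    then have "h X = N (\<Sum>i<n. a i *\<^sub>C x (r (k i)))" unfolding h_def by (simp cong: sum.cong_simp)
    moreover have "f X = t" by (rule Y(2)[OF X])
    moreover have "0 \<le> h X / \<delta>" using h(1)[of X] \<delta> by simp
    ultimately have hX: "h X = N (\<Sum>i<n. a i *\<^sub>C x (r (k i)))" and "real t \<le> h X / \<delta>" "h X / \<delta> < real t + 1"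
      unfolding f_def by linarith+
    then have "real t * \<delta> \<le> h X" "h X \<le> real t * \<delta> + \<delta>" using \<delta> by (simp_all add: field_simps)
    then show ?thesis unfolding hX[symmetric] abs_le_iff by linarith
  qed
  then show ?thesis using r(1) by blast
qed

text \<open>Ramsey's theorem treats one coefficient vector and one accuracy. Only countably many are
  needed, with rational real and imaginary parts, and a diagonal subsequence serves them all; other
  coefficients follow by approximation.\<close>

lemma brunel_sucheston:
  assumes x: "range x \<subseteq> V" "\<And>j. N (x j) \<le> b"
  shows "\<exists>r L. strict_mono (r :: nat \<Rightarrow> nat) \<and> spreading_limit N (\<lambda>j. x (r j)) L"
proof -
  have xV: "x j \<in> V" for j using x by auto
  have b: "0 \<le> b" using N_nonneg[OF xV] x(2) order_trans by blast
  \<comment> \<open>A finite list of rational pairs encodes a coefficient vector. Paired with a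
    natural number for the accuracy it ranges over a countable type, so \<open>from_nat\<close>
    enumerates all requirements.\<close>
  define coef :: "(rat \<times> rat) list \<Rightarrow> omega" where
    "coef l i = (if i < length l then Complex (of_rat (fst (l ! i))) (of_rat (snd (l ! i))) else 0)" for l i
  define dec :: "nat \<Rightarrow> (rat \<times> rat) list \<times> nat" where "dec = from_nat"
  define P where "P q s \<longleftrightarrow> (\<exists>c. \<forall>k::nat \<Rightarrow> nat. strict_mono_on {..<length (fst (dec q))} k \<longrightarrow>
     \<bar>N (\<Sum>i<length (fst (dec q)). coef (fst (dec q)) i *\<^sub>C x (s (k i))) - c\<bar> \<le> 1 / Suc (snd (dec q)))"
    for q and s :: "nat \<Rightarrow> nat"
  interpret subseqs P
  proof
    fix q and s :: "nat \<Rightarrow> nat" assume "strict_mono s"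
    show "\<exists>r'. strict_mono r' \<and> P q (s \<circ> r')"
      unfolding P_def o_def
      using Ramsey_stabilization[of "\<lambda>j. x (s j)" b "1 / Suc (snd (dec q))" "length (fst (dec q))" "coef (fst (dec q))"]
        x(2) xV by auto
  qed
  define r where "r = diagseq"
  have r: "strict_mono r" unfolding r_def by (rule subseq_diagseq)
  \<comment> \<open>\<open>P\<close> passes to subsequences, and beyond place \<open>q\<close> the
    diagonal sequence is a subsequence of the one chosen for requirement \<open>q\<close>.\<close>
  have hold: "P q (r \<circ> ((+) (Suc q)))" for q
    unfolding r_def
  proof (rule diagseq_holds)
    fix r' s :: "nat \<Rightarrow> nat" and n assume r': "strict_mono r'" and "P n s"
    then obtain c where c: "\<forall>k::nat \<Rightarrow> nat. strict_mono_on {..<length (fst (dec n))} k \<longrightarrow>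
     \<bar>N (\<Sum>i<length (fst (dec n)). coef (fst (dec n)) i *\<^sub>C x (s (k i))) - c\<bar> \<le> 1 / Suc (snd (dec n))"
      unfolding P_def by blast
    have "strict_mono_on A (\<lambda>i. r' (k i))" if "strict_mono_on A k" for A and k :: "nat \<Rightarrow> nat"
      using that r' by (auto simp: strict_mono_on_def strict_mono_def)
    with c show "P n (s \<circ> r')" unfolding P_def o_def by blast
  qed
  define S where "S n a k = N (\<Sum>i<n. a i *\<^sub>C x (r (k i)))" for n and a :: omega and k :: "nat \<Rightarrow> nat"
  have osc: "\<exists>\<nu>. \<forall>k k'. strict_mono_on {..<n} k \<and> (\<forall>i<n. \<nu> \<le> k i) \<and> strict_mono_on {..<n} k' \<and> (\<forall>i<n. \<nu> \<le> k' i)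
      \<longrightarrow> \<bar>S n a k - S n a k'\<bar> < \<epsilon>" if \<epsilon>: "0 < \<epsilon>" for n a \<epsilon>
  proof -
    \<comment> \<open>With error \<open>2 * \<delta>\<close> per coefficient and vectors of norm at
      most \<open>b\<close>, the combination changes by at most \<open>\<epsilon> / 4\<close>. The
      increments by 1 avoid zero denominators.\<close>
    define \<delta> where "\<delta> = \<epsilon> / (8 * (real n + 1) * (b + 1))"
    have \<delta>: "0 < \<delta>" using \<epsilon> b by (simp add: \<delta>_def)
    have "\<exists>u v :: rat. \<bar>Re (a i) - of_rat u\<bar> < \<delta> \<and> \<bar>Im (a i) - of_rat v\<bar> < \<delta>" for i
    proof -
      have "\<exists>q::rat. \<bar>t - of_rat q\<bar> < \<delta>" for t :: real
        using of_rat_dense[of "t - \<delta>" "t + \<delta>"] \<delta> by (auto simp: abs_less_iff) (smt (verit))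
      then show ?thesis by blast
    qed
    then obtain u v :: "nat \<Rightarrow> rat" where uv: "\<And>i. \<bar>Re (a i) - of_rat (u i)\<bar> < \<delta>" "\<And>i. \<bar>Im (a i) - of_rat (v i)\<bar> < \<delta>"
      by metis
    define l where "l = map (\<lambda>i. (u i, v i)) [0..<n]"
    have len: "length l = n" by (simp add: l_def)
    have cl: "cmod (a i - coef l i) \<le> 2 * \<delta>" if "i < n" for i
    proof -
      have "cmod (a i - coef l i) \<le> \<bar>Re (a i - coef l i)\<bar> + \<bar>Im (a i - coef l i)\<bar>" by (rule cmod_le)
      then show ?thesis using uv[of i] that by (simp add: coef_def len) (simp add: l_def)
    qed
    obtain m :: nat where m: "1 / Suc m < \<epsilon> / 8"
      using reals_Archimedean[of "\<epsilon> / 8"] \<epsilon> by (auto simp: inverse_eq_divide)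
    define q where "q = to_nat (l, m)"
    have dq: "dec q = (l, m)" by (simp add: dec_def q_def)
    obtain c where c: "\<And>k::nat \<Rightarrow> nat. strict_mono_on {..<n} k \<Longrightarrow>
       \<bar>N (\<Sum>i<n. coef l i *\<^sub>C x (r (Suc q + k i))) - c\<bar> \<le> 1 / Suc m"
      using hold[of q] unfolding P_def dq fst_conv snd_conv len o_def by blast
    have near: "\<bar>S n a k - c\<bar> < \<epsilon> / 2" if k: "strict_mono_on {..<n} k" "\<forall>i<n. Suc q \<le> k i" for k
    proof -
      have "strict_mono_on {..<n} (\<lambda>i. k i - Suc q)"
        using k by (auto simp: strict_mono_on_def intro!: diff_less_mono)
      note sm = this
      have 1: "\<bar>N (\<Sum>i<n. coef l i *\<^sub>C x (r (k i))) - c\<bar> \<le> 1 / Suc m"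
      proof -
        have "(\<Sum>i<n. coef l i *\<^sub>C x (r (Suc q + (k i - Suc q)))) = (\<Sum>i<n. coef l i *\<^sub>C x (r (k i)))"
          using k(2) by (intro sum.cong) (auto simp del: add_Suc)
        then show ?thesis using c[OF sm] by (simp only:)
      qed
      have "\<bar>S n a k - N (\<Sum>i<n. coef l i *\<^sub>C x (r (k i)))\<bar>
          \<le> N ((\<Sum>i<n. a i *\<^sub>C x (r (k i))) - (\<Sum>i<n. coef l i *\<^sub>C x (r (k i))))"
        unfolding S_def by (intro N_abs_diff V_sum V_scale xV)
      also have "\<dots> = N (\<Sum>i<n. (a i - coef l i) *\<^sub>C x (r (k i)))"
        by (simp add: complex_vector.scale_left_diff_distrib sum_subtractf)
      also have "\<dots> \<le> (\<Sum>i<n. cmod (a i - coef l i) * N (x (r (k i))))"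
        by (rule N_combination) (rule xV)
      also have "\<dots> \<le> (\<Sum>i<n. 2 * \<delta> * b)"
        using \<delta> cl x(2) by (intro sum_mono mult_mono) (auto intro: N_nonneg xV)
      also have "\<dots> = real n * (2 * \<delta> * b)" by simp
      also have "\<dots> \<le> (real n + 1) * (2 * \<delta> * (b + 1))"
        using \<delta> b by (intro mult_mono) auto
      also have "\<dots> = (\<delta> * (8 * (real n + 1) * (b + 1))) / 4" by simp
      also have "\<delta> * (8 * (real n + 1) * (b + 1)) = \<epsilon>"
      proof -
        have "8 * (real n + 1) * (b + 1) \<noteq> 0" using b by simp
        then show ?thesis unfolding \<delta>_def by (rule nonzero_eq_divide_eq[THEN iffD1, OF _ refl])
      qed
      finally show ?thesis using 1 m \<epsilon> by linarith
    qed
    have "\<bar>S n a k - S n a k'\<bar> < \<epsilon>" if "strict_mono_on {..<n} k" "\<forall>i<n. Suc q \<le> k i"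
      "strict_mono_on {..<n} k'" "\<forall>i<n. Suc q \<le> k' i" for k k'
      using near[OF that(1,2)] near[OF that(3,4)] by linarith
    then show ?thesis by blast
  qed
  \<comment> \<open>Taking the least admissible length makes \<open>L\<close> a function of the
    sequence alone; longer presentations only add zero terms.\<close>
  define n0 where "n0 a = (LEAST n. {j. a j \<noteq> 0} \<subseteq> {..<n})" for a :: omega
  define L where "L a = lim (\<lambda>m. S (n0 a) a (\<lambda>i. m + i))" for a
  have L: "(\<lambda>m. S (n0 a) a (\<lambda>i. m + i)) \<longlonglongrightarrow> L a" for a
  proof -
    have "Cauchy (\<lambda>m. S (n0 a) a (\<lambda>i. m + i))"
    proof (rule metric_CauchyI)
      fix \<epsilon> :: real assume "0 < \<epsilon>"
      then obtain \<nu> where \<nu>: "\<And>k k'. strict_mono_on {..<n0 a} k \<and> (\<forall>i<n0 a. \<nu> \<le> k i) \<and>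
          strict_mono_on {..<n0 a} k' \<and> (\<forall>i<n0 a. \<nu> \<le> k' i) \<Longrightarrow> \<bar>S (n0 a) a k - S (n0 a) a k'\<bar> < \<epsilon>"
        using osc[of \<epsilon> "n0 a" a] by blast
      have "dist (S (n0 a) a (\<lambda>i. m + i)) (S (n0 a) a (\<lambda>i. m' + i)) < \<epsilon>" if "m \<ge> \<nu>" "m' \<ge> \<nu>" for m m'
        unfolding dist_real_def using that by (intro \<nu>) (auto simp: strict_mono_on_shift)
      then show "\<exists>M. \<forall>m\<ge>M. \<forall>n\<ge>M. dist (S (n0 a) a (\<lambda>i. m + i)) (S (n0 a) a (\<lambda>i. n + i)) < \<epsilon>" by blast
    qed
    then show ?thesis unfolding L_def by (simp add: Cauchy_convergent_iff convergent_LIMSEQ_iff)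
  qed
  have "spreading_limit N (\<lambda>j. x (r j)) L"
    unfolding spreading_limit_def
  proof (intro allI impI)
    fix n and a :: omega and \<epsilon> :: real assume n: "{j. a j \<noteq> 0} \<subseteq> {..<n}" and \<epsilon>: "0 < \<epsilon>"
    have n0: "{j. a j \<noteq> 0} \<subseteq> {..<n0 a}" "n0 a \<le> n"
      unfolding n0_def using n by (auto intro: LeastI2 Least_le)
    obtain \<nu> where \<nu>: "\<And>k k'. strict_mono_on {..<n0 a} k \<and> (\<forall>i<n0 a. \<nu> \<le> k i) \<and>
          strict_mono_on {..<n0 a} k' \<and> (\<forall>i<n0 a. \<nu> \<le> k' i) \<Longrightarrow> \<bar>S (n0 a) a k - S (n0 a) a k'\<bar> < \<epsilon> / 2"
      using osc[of "\<epsilon> / 2" "n0 a" a] \<epsilon> by auto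
    have "\<bar>N (\<Sum>i<n. a i *\<^sub>C x (r (k i))) - L a\<bar> < \<epsilon>"
      if k: "strict_mono_on {..<n} k" "\<forall>i<n. \<nu> \<le> k i" for k
    proof -
      have "(\<lambda>m. \<bar>S (n0 a) a k - S (n0 a) a (\<lambda>i. m + i)\<bar>) \<longlonglongrightarrow> \<bar>S (n0 a) a k - L a\<bar>"
        by (intro tendsto_intros L)
      moreover have "\<forall>m\<ge>\<nu>. \<bar>S (n0 a) a k - S (n0 a) a (\<lambda>i. m + i)\<bar> \<le> \<epsilon> / 2"
      proof (intro allI impI less_imp_le[OF \<nu>])
        have "strict_mono_on {..<n0 a} k" using k(1) n0(2) by (auto simp: strict_mono_on_def)
        moreover have "\<forall>i<n0 a. \<nu> \<le> k i" using k(2) n0(2) by auto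
        moreover fix m assume "\<nu> \<le> m"
        ultimately show "strict_mono_on {..<n0 a} k \<and> (\<forall>i<n0 a. \<nu> \<le> k i) \<and>
            strict_mono_on {..<n0 a} (\<lambda>i. m + i) \<and> (\<forall>i<n0 a. \<nu> \<le> m + i)"
          by (simp add: strict_mono_on_shift)
      qed
      ultimately have "\<bar>S (n0 a) a k - L a\<bar> \<le> \<epsilon> / 2" by (rule LIMSEQ_le_const2[OF _ exI])
      moreover have "S (n0 a) a k = N (\<Sum>i<n. a i *\<^sub>C x (r (k i)))"
        unfolding S_def using sum_support_eq[OF n n0(1), of "\<lambda>i. x (r (k i))"] by simp
      ultimately show ?thesis using \<epsilon> by simp
    qed
    then show "\<exists>\<nu>. \<forall>k. strict_mono_on {..<n} k \<and> (\<forall>i<n. \<nu> \<le> k i) \<longrightarrow>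
        \<bar>N (\<Sum>i<n. a i *\<^sub>C x (r (k i))) - L a\<bar> < \<epsilon>" by blast
  qed
  with r show ?thesis by blast
qed

end


subsection \<open>Upper estimates for blocks\<close>

text \<open>Bolzano-Weierstrass in each coordinate, joined by a diagonal subsequence; the bound may
  depend on the coordinate.\<close>

lemma coordinatewise_convergent_subseq:
  fixes x :: "nat \<Rightarrow> omega"
  assumes "\<And>j i. cmod (x j i) \<le> c i"
  obtains r l where "strict_mono (r :: nat \<Rightarrow> nat)" "\<And>i. (\<lambda>j. x (r j) i) \<longlonglongrightarrow> l i"
proof -
  interpret subseqs "\<lambda>i s. convergent (\<lambda>j. x (s j) i)"
  proof
    fix i and s :: "nat \<Rightarrow> nat" assume "strict_mono s"
    have "bounded (range (\<lambda>j. x (s j) i))" using assms by (auto simp: bounded_iff)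
    then obtain l r' where "strict_mono r'" "((\<lambda>j. x (s j) i) \<circ> r') \<longlonglongrightarrow> l"
      using bounded_imp_convergent_subsequence by blast
    then show "\<exists>r'. strict_mono r' \<and> convergent (\<lambda>j. x ((s \<circ> r') j) i)"
      by (auto simp: o_def convergent_def)
  qed
  have "convergent (\<lambda>j. x ((diagseq \<circ> (+) (Suc i)) j) i)" for i
  proof (rule diagseq_holds)
    fix r s :: "nat \<Rightarrow> nat" and n assume "strict_mono r" "convergent (\<lambda>j. x (s j) n)"
    then show "convergent (\<lambda>j. x ((s \<circ> r) j) n)"
      using convergent_subseq_convergent[of "\<lambda>j. x (s j) n" r] by (simp add: o_def)
  qed
  then have "convergent (\<lambda>j. x (diagseq (j + Suc i)) i)" for i
    by (subst add.commute) (simp only: o_def)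
  then have "convergent (\<lambda>j. x (diagseq j) i)" for i
    using convergent_ignore_initial_segment[of "\<lambda>j. x (diagseq j) i" "Suc i"] by blast
  then have "\<forall>i. \<exists>l. (\<lambda>j. x (diagseq j) i) \<longlonglongrightarrow> l" unfolding convergent_def by (rule allI)
  then obtain l where "\<forall>i. (\<lambda>j. x (diagseq j) i) \<longlonglongrightarrow> l i" by (rule choice[elim_format]) (erule exE)
  then show thesis by (intro that[OF subseq_diagseq]) (rule spec)
qed

section \<open>Bounded sums in a norm whose completion is isomorphic to c_0\<close>

definition indic :: "nat set \<Rightarrow> omega" where
  "indic A = (\<lambda>j. if j \<in> A then 1 else 0)"

lemma indic_c00: "finite A \<Longrightarrow> indic A \<in> c00"
  by (auto simp: indic_def c00_def)

lemma c0_sup_norm: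
  assumes "a \<in> c0" shows "cmod (a i) \<le> sup_norm a"
proof -
  have "Bseq a" using assms convergent_imp_Bseq by (auto simp: c0_def convergent_def)
  then have "bdd_above (range (\<lambda>j. cmod (a j)))" by (auto simp: Bseq_def bdd_above_def)
  then show ?thesis unfolding sup_norm_def by (rule cSUP_upper2[of _ _ i]) auto
qed

text \<open>Gliding hump in \<open>c\<^sub>0\<close>: a vector whose support is essentially finite is followed by a difference
  of two far-out images that is small on that finite set.\<close>

lemma c0_model_differences:
  assumes iso: "completion_isomorphic_to c00 L c0 sup_norm" and D: "\<And>j. L (unit_seq j) \<le> D"
  shows "\<exists>C. \<forall>n. \<exists>A B. finite A \<and> finite B \<and> A \<inter> B = {} \<and> card A = n \<and> L (indic A - indic B) \<le> C"
proof -
  obtain S :: "omega set" and K where "is_completion c00 L S K" and i: "isomorphic_spaces S K c0 sup_norm"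
    using iso unfolding completion_isomorphic_to_def by blast
  then obtain \<iota> where \<iota>: "linear_map_on c00 \<iota>" "\<iota> ` c00 \<subseteq> S" "\<And>a. a \<in> c00 \<Longrightarrow> K (\<iota> a) = L a"
    unfolding is_completion_def by blast
  obtain T where T: "linear_map_on S T" "bij_betw T S c0" "equivalent_on S (\<lambda>x. sup_norm (T x)) K"
    using i unfolding isomorphic_spaces_def by blast
  obtain c C where cC: "0 < c" "0 < C" "\<And>x. x \<in> S \<Longrightarrow> c * K x \<le> sup_norm (T x) \<and> sup_norm (T x) \<le> C * K x"
    using T(3) unfolding equivalent_on_def by blast
  define U where "U a = T (\<iota> a)" for a
  have \<iota>S: "\<iota> a \<in> S" if "a \<in> c00" for a using \<iota>(2) that by blast
  have U: "U a \<in> c0" "c * L a \<le> sup_norm (U a)" "sup_norm (U a) \<le> C * L a" if "a \<in> c00" for a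
    using bij_betwE[OF T(2)] cC(3)[OF \<iota>S[OF that]] \<iota>(3)[OF that] \<iota>S[OF that] by (auto simp: U_def)
  have U_add: "U (a + b) = U a + U b" if "a \<in> c00" "b \<in> c00" for a b
    using \<iota>(1) T(1) \<iota>S that by (simp add: U_def linear_map_on_def)
  have U_scale: "U (d *\<^sub>C a) = d *\<^sub>C U a" if "a \<in> c00" for a d
    using \<iota>(1) T(1) \<iota>S that by (simp add: U_def linear_map_on_def)
  have U_diff: "U (a - b) = U a - U b" if "a \<in> c00" "b \<in> c00" for a b
    using U_add[OF c00_diff[OF that] that(2)] by (simp add: algebra_simps)
  define M where "M = C * \<bar>D\<bar>"
  have M: "cmod (U (unit_seq j) i) \<le> M" for i j
  proof -
    have "cmod (U (unit_seq j) i) \<le> C * L (unit_seq j)"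
      using c0_sup_norm[OF U(1)[OF unit_seq_c00]] U(3)[OF unit_seq_c00] order_trans by blast
    also have "\<dots> \<le> C * \<bar>D\<bar>" using D[of j] cC(2) by (intro mult_left_mono) auto
    finally show ?thesis by (simp add: M_def)
  qed
  \<comment> \<open>The coordinatewise limit of the images need not be 0, nor need it lie in
    \<open>c0\<close>. This is why differences of two unit vectors are added rather than single
    ones.\<close>
  obtain r l where r: "strict_mono (r :: nat \<Rightarrow> nat)" "\<And>i. (\<lambda>j. U (unit_seq (r j)) i) \<longlonglongrightarrow> l i"
    using coordinatewise_convergent_subseq[of "\<lambda>j. U (unit_seq j)" "\<lambda>_. M"] M by metis
  \<comment> \<open>At coordinates below \<open>I\<close> the new difference adds at most
    \<open>\<epsilon>\<close>, since both images are close to the same limit; at the others the old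
    vector is below \<open>\<epsilon>\<close> and the new difference is at most
    \<open>2 * M\<close>. So the bound grows by \<open>\<epsilon>\<close> per step.\<close>
  have step: "\<exists>A B. finite A \<and> finite B \<and> A \<inter> B = {} \<and> card A = n \<and>
      (\<forall>i. cmod (U (indic A - indic B) i) \<le> 2 * M + real n * \<epsilon>)" if \<epsilon>: "0 < \<epsilon>" for n \<epsilon>
  proof (induction n)
    case 0
    have "indic {} - indic {} = (0 *\<^sub>C 0 :: omega)" by simp
    then have "U (indic {} - indic {}) = 0 *\<^sub>C U 0" using U_scale[OF c00_0, of 0] by (simp only:)
    then have z: "cmod (U (indic {} - indic {}) i) = 0" for i by (simp only:) simp
    have "0 \<le> M" using M[of 0 0] norm_ge_zero order_trans by blast
    then have "cmod (U (indic {} - indic {}) i) \<le> 2 * M + real 0 * \<epsilon>" for i unfolding z by simp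
    then show ?case by (intro exI[of _ "{}"] conjI allI finite.emptyI Int_empty_left card.empty)
  next
    case (Suc n)
    then obtain A B where AB: "finite A" "finite B" "A \<inter> B = {}" "card A = n"
      "\<And>i. cmod (U (indic A - indic B) i) \<le> 2 * M + real n * \<epsilon>" by blast
    define s where "s = U (indic A - indic B)"
    have abc: "indic A - indic B \<in> c00" by (intro c00_diff indic_c00 AB)
    have "s \<longlonglongrightarrow> 0" using U(1)[OF abc] by (simp add: s_def c0_def)
    then obtain I where I: "\<And>i. i \<ge> I \<Longrightarrow> cmod (s i) < \<epsilon>"
      using LIMSEQ_D[of s 0 \<epsilon>] \<epsilon> by auto
    have "\<exists>J. \<forall>j\<ge>J. cmod (U (unit_seq (r j)) i - l i) < \<epsilon> / 2" for i
      using LIMSEQ_D[OF r(2), of "\<epsilon> / 2"] \<epsilon> by simp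
    then obtain J where J: "\<And>i j. j \<ge> J i \<Longrightarrow> cmod (U (unit_seq (r j)) i - l i) < \<epsilon> / 2" by metis
    obtain b where b: "A \<union> B \<subseteq> {..<b}" using AB finite_nat_iff_bounded by blast
    define q where "q = b + (\<Sum>i<I. J i)"
    have qJ: "J i \<le> q" if "i < I" for i
      unfolding q_def using that member_le_sum[of i "{..<I}" J] by simp
    define k where "k = r q"
    define k' where "k' = r (Suc q)"
    have kk: "k < k'" "b \<le> k"
      using r(1) seq_suble[OF r(1), of q] by (auto simp: k_def k'_def strict_mono_def q_def)
    have notin: "k' \<notin> A" "k \<notin> B" "k \<notin> A" "k' \<notin> B" using b kk by auto
    have "indic (insert k' A) - indic (insert k B) = (indic A - indic B) + (unit_seq k' - unit_seq k)"
      using notin by (auto simp: indic_def unit_seq_def fun_eq_iff)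
    then have Ueq: "U (indic (insert k' A) - indic (insert k B)) = s + (U (unit_seq k') - U (unit_seq k))"
      unfolding s_def by (simp only: U_add[OF abc c00_diff[OF unit_seq_c00 unit_seq_c00]] U_diff[OF unit_seq_c00 unit_seq_c00])
    have "cmod (U (indic (insert k' A) - indic (insert k B)) i) \<le> 2 * M + real (Suc n) * \<epsilon>" for i
    proof (cases "i < I")
      case True
      have "cmod (U (unit_seq k') i - U (unit_seq k) i) \<le>
          cmod (U (unit_seq k') i - l i) + cmod (U (unit_seq k) i - l i)"
        using norm_triangle_ineq4[of "U (unit_seq k') i - l i" "U (unit_seq k) i - l i"] by simp
      also have "\<dots> \<le> \<epsilon>"
        using J[of i q] J[of i "Suc q"] qJ[OF True] by (simp add: k_def k'_def)
      finally show ?thesis unfolding Ueq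
        using norm_triangle_ineq[of "s i" "U (unit_seq k') i - U (unit_seq k) i"] AB(5)[of i]
        by (simp add: s_def algebra_simps)
    next
      case False
      have "cmod (U (unit_seq k') i - U (unit_seq k) i) \<le> M + M"
        using M by (intro order_trans[OF norm_triangle_ineq4] add_mono)
      moreover have "\<epsilon> \<le> real (Suc n) * \<epsilon>" using \<epsilon> by simp
      ultimately show ?thesis unfolding Ueq
        using norm_triangle_ineq[of "s i" "U (unit_seq k') i - U (unit_seq k) i"] I[of i] False
        by simp
    qed
    moreover have "insert k' A \<inter> insert k B = {}" using AB(3) notin kk by auto
    moreover have "card (insert k' A) = Suc n" using AB notin by simp
    ultimately show ?case using AB(1,2)
      by (intro exI[of _ "insert k' A"] exI[of _ "insert k B"] conjI allI finite.insertI)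
  qed
  show ?thesis
  proof (rule exI, rule allI)
    fix n
    obtain A B where AB: "finite A" "finite B" "A \<inter> B = {}" "card A = n"
      "\<And>i. cmod (U (indic A - indic B) i) \<le> 2 * M + real n * (1 / real (Suc n))"
      \<comment> \<open>The step size depends on \<open>n\<close> and keeps the accumulated error
        below 1, so the final bound is independent of \<open>n\<close>.\<close>
      using step[of "1 / real (Suc n)" n] by auto
    have abc: "indic A - indic B \<in> c00" by (intro c00_diff indic_c00 AB)
    have "sup_norm (U (indic A - indic B)) \<le> 2 * M + 1"
      unfolding sup_norm_def
    proof (rule cSUP_least)
      fix i
      have "real n * (1 / real (Suc n)) \<le> 1" by simp
      then show "cmod (U (indic A - indic B) i) \<le> 2 * M + 1" using AB(5)[of i] by linarith
    qed simp
    then have "c * L (indic A - indic B) \<le> 2 * M + 1" using U(2)[OF abc] by linarith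
    then have "L (indic A - indic B) \<le> (2 * M + 1) / c" using cC(1) by (simp add: field_simps)
    then show "\<exists>A B. finite A \<and> finite B \<and> A \<inter> B = {} \<and> card A = n \<and> L (indic A - indic B) \<le> (2 * M + 1) / c"
      using AB by blast
  qed
qed

section \<open>The asymptotic ell_p case\<close>

lemma coord_restricted_sum:
  assumes unc: "unconditional_basis e" and I: "finite I"
  shows "coord e (\<Sum>j\<in>I. x j *\<^sub>C e j) = restr I x"
proof (rule coord_unique[OF unc])
  have "(\<lambda>j. restr I x j *\<^sub>C e j) sums (\<Sum>j\<in>I. restr I x j *\<^sub>C e j)"
    by (rule sums_finite) (auto simp: I restr_def)
  then show "(\<lambda>j. restr I x j *\<^sub>C e j) sums (\<Sum>j\<in>I. x j *\<^sub>C e j)"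
    by (simp add: restr_def cong: sum.cong_simp)
qed

text \<open>The defining inequality concerns normalized blocks; here vectors of any norm, including
  0, are allowed. The condition \<open>n \<le> j\<close> is its support condition with coordinates
  counted from 0.\<close>

lemma asymptotic_lp_blocks:
  fixes e :: "nat \<Rightarrow> 'a::complex_banach" and x :: "nat \<Rightarrow> omega"
  assumes unc: "unconditional_basis e" and p: "1 \<le> p"
    and C: "\<And>n (u :: nat \<Rightarrow> 'a) (a::omega).
     block_family e {..<n} u \<and> (\<forall>i<n. norm (u i) = 1 \<and> n < Suc (Min (basis_supp e (u i)))) \<Longrightarrow>
        (1 / C) * (\<Sum>i<n. cmod (a i) powr p) powr (1 / p) \<le> norm (\<Sum>i<n. a i *\<^sub>C u i) \<and>
        norm (\<Sum>i<n. a i *\<^sub>C u i) \<le> C * (\<Sum>i<n. cmod (a i) powr p) powr (1 / p)"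
    and I: "\<And>i. i < n \<Longrightarrow> finite (I i) \<and> I i \<noteq> {}" "\<And>i j. i < n \<Longrightarrow> j \<in> I i \<Longrightarrow> n \<le> j"
      "\<And>i i' j j'. i < i' \<Longrightarrow> i' < n \<Longrightarrow> j \<in> I i \<Longrightarrow> j' \<in> I i' \<Longrightarrow> j < j'"
  defines "v \<equiv> \<lambda>i. \<Sum>j\<in>I i. x i j *\<^sub>C e j"
  shows "(1 / C) * (\<Sum>i<n. norm (v i) powr p) powr (1 / p) \<le> norm (\<Sum>i<n. v i)"
    "norm (\<Sum>i<n. v i) \<le> C * (\<Sum>i<n. norm (v i) powr p) powr (1 / p)"
proof -
  \<comment> \<open>A zero vector is replaced by the first basis vector of its interval, which then
    enters with coefficient 0.\<close>
  define w where "w i = (if v i = 0 then \<Sum>j\<in>I i. unit_seq (Min (I i)) j *\<^sub>C e j else v i)" for i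
  define u where "u i = of_real (1 / norm (w i)) *\<^sub>C w i" for i
  have cw: "coord e (w i) = restr (I i) (if v i = 0 then unit_seq (Min (I i)) else x i)" if "i < n" for i
    using I(1)[OF that] by (simp add: w_def v_def coord_restricted_sum[OF unc])
  have w0: "w i \<noteq> 0" if "i < n" for i
  proof
    assume "w i = 0"
    then have v: "v i = 0" by (auto simp: w_def split: if_splits)
    have "Min (I i) \<in> I i" using I(1)[OF that] by simp
    then have "coord e (w i) (Min (I i)) = 1" using cw[OF that] v by (simp add: restr_def unit_seq_def)
    then show False using \<open>w i = 0\<close> by (simp add: coord_0[OF unc])
  qed
  have nu: "norm (u i) = 1" if "i < n" for i using w0[OF that] by (simp add: u_def norm_scaleC norm_divide)
  have su: "basis_supp e (u i) = basis_supp e (w i)" if "i < n" for i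
    using w0[OF that] by (simp add: basis_supp_def u_def coord_scaleC[OF unc])
  have sub: "basis_supp e (u i) \<subseteq> I i" if "i < n" for i
    unfolding su[OF that] by (auto simp: basis_supp_def cw[OF that] restr_def split: if_splits)
  have fin: "finite (basis_supp e (u i))" "basis_supp e (u i) \<noteq> {}" if "i < n" for i
  proof -
    show "finite (basis_supp e (u i))" using sub[OF that] I(1)[OF that] finite_subset by blast
    show "basis_supp e (u i) \<noteq> {}"
    proof
      assume "basis_supp e (u i) = {}"
      then have "coord e (u i) = 0" by (auto simp: basis_supp_def fun_eq_iff)
      with coord_sums[OF unc, of "u i"] have "(\<lambda>j. 0) sums u i" by simp
      then have "u i = 0" using sums_unique2 sums_zero by blast
      then show False using nu[OF that] by simp
    qed
  qed
  have "block_family e {..<n} u"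
    unfolding block_family_def
  proof (intro conjI ballI impI)
    fix i assume "i \<in> {..<n}"
    then show "u i \<noteq> 0" "finite (basis_supp e (u i))" using nu[of i] fin(1)[of i] by auto
  next
    fix i k assume ik: "i \<in> {..<n}" "k \<in> {..<n}" "i < k"
    then have ik': "i < n" "k < n" by auto
    have "Max (basis_supp e (u i)) \<in> I i" "Min (basis_supp e (u k)) \<in> I k"
      by (rule subsetD[OF sub[OF ik'(1)] Max_in[OF fin[OF ik'(1)]]],
          rule subsetD[OF sub[OF ik'(2)] Min_in[OF fin[OF ik'(2)]]])
    then show "Max (basis_supp e (u i)) < Min (basis_supp e (u k))" by (rule I(3)[OF ik(3) ik'(2)])
  qed
  moreover have "n < Suc (Min (basis_supp e (u i)))" if "i < n" for i
    using I(2)[OF that subsetD[OF sub[OF that] Min_in[OF fin[OF that]]]] by simp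
  ultimately have P: "block_family e {..<n} u \<and> (\<forall>i<n. norm (u i) = 1 \<and> n < Suc (Min (basis_supp e (u i))))"
    by (intro conjI allI impI nu)
  define a :: omega where "a i = of_real (norm (v i))" for i
  have au: "a i *\<^sub>C u i = v i" if "i < n" for i
    using w0[OF that] by (cases "v i = 0") (auto simp: a_def u_def w_def scaleC_scaleC scaleC_one)
  have "(\<Sum>i<n. a i *\<^sub>C u i) = (\<Sum>i<n. v i)" using au by simp
  with C[OF P, of a] show "(1 / C) * (\<Sum>i<n. norm (v i) powr p) powr (1 / p) \<le> norm (\<Sum>i<n. v i)"
    "norm (\<Sum>i<n. v i) \<le> C * (\<Sum>i<n. norm (v i) powr p) powr (1 / p)"
    by (simp_all add: a_def)
qed

text \<open>Hoelder's inequality for \<open>p\<close> and its conjugate exponent: the weights lie in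
  the unit ball of the conjugate space because the squares of \<open>c\<close> sum to at most 1. It
  is derived from Young's inequality term by term, which includes \<open>p = 1\<close>.\<close>

lemma weighted_Holder:
  fixes c \<tau> :: "nat \<Rightarrow> real"
  assumes p: "1 \<le> p" and c: "\<And>i. i < n \<Longrightarrow> 0 \<le> c i" "(\<Sum>i<n. (c i)\<^sup>2) \<le> 1" and \<tau>: "\<And>i. i < n \<Longrightarrow> 0 \<le> \<tau> i"
  shows "(\<Sum>i<n. c i powr (2 * (1 - 1 / p)) * \<tau> i) \<le> (\<Sum>i<n. \<tau> i powr p) powr (1 / p)"
proof -
  define T where "T = (\<Sum>i<n. \<tau> i powr p) powr (1 / p)"
  have sn: "0 \<le> (\<Sum>i<n. \<tau> i powr p)" by (intro sum_nonneg) auto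
  have Tp: "T powr p = (\<Sum>i<n. \<tau> i powr p)" using p sn by (simp add: T_def powr_powr)
  show ?thesis
  proof (cases "T = 0")
    case True
    then have "(\<Sum>i<n. \<tau> i powr p) = 0" by (simp add: T_def)
    then have "\<tau> i powr p = 0" if "i < n" for i using that by (simp add: sum_nonneg_eq_0_iff)
    then have "\<tau> i = 0" if "i < n" for i using that by simp
    then show ?thesis using True by (simp add: T_def)
  next
    case False
    then have T: "0 < T" by (simp add: T_def)
    have le: "c i powr (2 * (1 - 1 / p)) * (\<tau> i / T) \<le> (1 - 1 / p) * (c i)\<^sup>2 + 1 / p * (\<tau> i / T) powr p"
      if i: "i < n" for i
    \<comment> \<open>Zero terms are separated because \<open>0 powr x\<close> is 0 for every
      exponent, also for the exponent 0 that occurs when \<open>p = 1\<close>.\<close>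
    proof (cases "c i = 0 \<or> \<tau> i = 0")
      case True
      then have "c i powr (2 * (1 - 1 / p)) * (\<tau> i / T) = 0" by auto
      moreover have "0 \<le> (1 - 1 / p) * (c i)\<^sup>2 + 1 / p * (\<tau> i / T) powr p" using p by simp
      ultimately show ?thesis by linarith
    next
      case False
      then have pos: "0 < c i" "0 < \<tau> i / T" using c(1)[OF i] \<tau>[OF i] T by auto
      have "((c i)\<^sup>2) powr (1 - 1 / p) * ((\<tau> i / T) powr p) powr (1 / p) \<le>
          (1 - 1 / p) * (c i)\<^sup>2 + 1 / p * (\<tau> i / T) powr p"
        using p pos by (intro Youngs_inequality_0) auto
      moreover have "((c i)\<^sup>2) powr (1 - 1 / p) = c i powr (2 * (1 - 1 / p))"
      proof -
        have c2: "(c i)\<^sup>2 = c i powr 2" using pos by simp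
        show ?thesis unfolding c2 by (rule powr_powr)
      qed
      moreover have "((\<tau> i / T) powr p) powr (1 / p) = \<tau> i / T" using pos p \<tau>[OF i] T by (simp add: powr_powr)
      ultimately show ?thesis by simp
    qed
    have "(\<Sum>i<n. c i powr (2 * (1 - 1 / p)) * (\<tau> i / T)) \<le>
        (\<Sum>i<n. (1 - 1 / p) * (c i)\<^sup>2 + 1 / p * (\<tau> i / T) powr p)"
      using le by (intro sum_mono) auto
    also have "\<dots> = (1 - 1 / p) * (\<Sum>i<n. (c i)\<^sup>2) + 1 / p * (\<Sum>i<n. (\<tau> i / T) powr p)"
      by (simp only: sum.distrib sum_distrib_left)
    also have "(\<Sum>i<n. (\<tau> i / T) powr p) = (\<Sum>i<n. \<tau> i powr p / T powr p)"
      using \<tau> T by (intro sum.cong) (auto simp: powr_divide)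
    also have "\<dots> = 1" using T Tp by (simp add: sum_divide_distrib[symmetric] Tp[symmetric])
    also have "(1 - 1 / p) * (\<Sum>i<n. (c i)\<^sup>2) + 1 / p * 1 \<le> (1 - 1 / p) * 1 + 1 / p * 1"
      using p c(2) by (intro add_mono mult_left_mono) auto
    finally have "(\<Sum>i<n. c i powr (2 * (1 - 1 / p)) * \<tau> i) / T \<le> 1"
      by (simp add: sum_divide_distrib)
    then show ?thesis using T by (simp add: T_def[symmetric])
  qed
qed

text \<open>For \<open>\<alpha> = 1 / p\<close> and \<open>c\<close> in the unit ball of ell_2, the
  coefficients run through the positive unit balls of ell_p and of its dual: an upper p-estimate for
  the \<open>f i\<close> and the conjugate one for the \<open>g i\<close>. The value
  \<open>\<alpha> = 0\<close> stands for c_0 and ell_1.\<close>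

definition upper_estimates ::
  "(nat \<Rightarrow> 'a::complex_banach) \<Rightarrow> real \<Rightarrow> real \<Rightarrow> nat \<Rightarrow> (nat \<Rightarrow> nat \<Rightarrow> real) \<Rightarrow> (nat \<Rightarrow> nat \<Rightarrow> real) \<Rightarrow> bool" where
  "upper_estimates e \<alpha> C n f g \<longleftrightarrow> (\<forall>c::nat \<Rightarrow> real. (\<forall>i. 0 \<le> c i) \<and> (\<Sum>i<n. (c i)\<^sup>2) \<le> 1 \<longrightarrow>
     lat_ball e C (\<lambda>j. of_real (\<Sum>i<n. c i powr (2 * \<alpha>) * f i j)) \<and>
     dual_ball e C (\<lambda>j. of_real (\<Sum>i<n. c i powr (2 * (1 - \<alpha>)) * g i j)))"

lemma factorization_support:
  assumes "factorization e y f g" "{j. y j \<noteq> 0} \<subseteq> I" "j \<notin> I" shows "f j = 0" "g j = 0"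
  using assms by (auto simp: factorization_def)

lemma factorization_nonneg: "factorization e y f g \<Longrightarrow> 0 \<le> f j" "factorization e y f g \<Longrightarrow> 0 \<le> g j"
  by (cases "y j = 0"; force simp: factorization_def)+

text \<open>The lattice half is the upper ell_p estimate. The dual half comes from the lower one: a
  vector of the lattice ball is cut into pieces along the \<open>I i\<close>, the ell_p sum of the
  norms of the pieces is bounded, and Hoelder's inequality combines their pairings with the
  \<open>g i\<close>.\<close>

lemma asymptotic_lp_upper_estimates:
  fixes e :: "nat \<Rightarrow> 'a::complex_banach"
  assumes unc: "unconditional_basis e" and p: "1 \<le> p" and as: "asymptotic_lp e p" and \<sigma>: "0 < \<sigma>"
  obtains C where "\<And>n y f g (I :: nat \<Rightarrow> nat set). (\<And>i. i < n \<Longrightarrow> finite (I i) \<and> I i \<noteq> {}) \<Longrightarrow>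
      (\<And>i. i < n \<Longrightarrow> {j. y i j \<noteq> 0} \<subseteq> I i) \<Longrightarrow> (\<And>i j. i < n \<Longrightarrow> j \<in> I i \<Longrightarrow> n \<le> j) \<Longrightarrow>
      (\<And>i. i < n \<Longrightarrow> factorization e (y i) (f i) (g i)) \<Longrightarrow> (\<And>i. i < n \<Longrightarrow> ell2_norm (y i) \<le> \<sigma>) \<Longrightarrow>
      (\<And>i i' j j'. i < i' \<Longrightarrow> i' < n \<Longrightarrow> j \<in> I i \<Longrightarrow> j' \<in> I i' \<Longrightarrow> j < j') \<Longrightarrow>
      upper_estimates e (1 / p) C n f g"
proof -
  obtain C where C0: "0 < C" and C: "\<And>n (u :: nat \<Rightarrow> 'a) (a::omega).
     block_family e {..<n} u \<and> (\<forall>i<n. norm (u i) = 1 \<and> n < Suc (Min (basis_supp e (u i)))) \<Longrightarrow>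
        (1 / C) * (\<Sum>i<n. cmod (a i) powr p) powr (1 / p) \<le> norm (\<Sum>i<n. a i *\<^sub>C u i) \<and>
        norm (\<Sum>i<n. a i *\<^sub>C u i) \<le> C * (\<Sum>i<n. cmod (a i) powr p) powr (1 / p)"
  proof -
    obtain C where C0: "0 < C" and C: "\<forall>n (u :: nat \<Rightarrow> 'a).
     block_family e {..<n} u \<and> (\<forall>i<n. norm (u i) = 1 \<and> n < Suc (Min (basis_supp e (u i)))) \<longrightarrow>
     (\<forall>a::omega. (1 / C) * (\<Sum>i<n. cmod (a i) powr p) powr (1 / p) \<le> norm (\<Sum>i<n. a i *\<^sub>C u i) \<and>
        norm (\<Sum>i<n. a i *\<^sub>C u i) \<le> C * (\<Sum>i<n. cmod (a i) powr p) powr (1 / p))"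
      by (rule exE[OF as[unfolded asymptotic_lp_def]]) (elim conjE)
    show thesis by (rule that[OF C0]) (rule C[rule_format])
  qed
  show thesis
  proof (rule that[of "2 * \<sigma> * C"])
    fix n and y :: "nat \<Rightarrow> omega" and f g and I :: "nat \<Rightarrow> nat set"
    assume H: "\<And>i. i < n \<Longrightarrow> finite (I i) \<and> I i \<noteq> {}" "\<And>i. i < n \<Longrightarrow> {j. y i j \<noteq> 0} \<subseteq> I i"
      "\<And>i j. i < n \<Longrightarrow> j \<in> I i \<Longrightarrow> n \<le> j" "\<And>i. i < n \<Longrightarrow> factorization e (y i) (f i) (g i)"
      "\<And>i. i < n \<Longrightarrow> ell2_norm (y i) \<le> \<sigma>"
      "\<And>i i' j j'. i < i' \<Longrightarrow> i' < n \<Longrightarrow> j \<in> I i \<Longrightarrow> j' \<in> I i' \<Longrightarrow> j < j'"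
    show "upper_estimates e (1 / p) (2 * \<sigma> * C) n f g"
    unfolding upper_estimates_def
  proof (intro allI impI conjI)
    fix c :: "nat \<Rightarrow> real" assume "(\<forall>i. 0 \<le> c i) \<and> (\<Sum>i<n. (c i)\<^sup>2) \<le> 1"
    then have c: "\<And>i. 0 \<le> c i" "(\<Sum>i<n. (c i)\<^sup>2) \<le> 1" by auto
    have f0: "f i j = 0" "g i j = 0" if "i < n" "j \<notin> I i" for i j
      using factorization_support[OF H(4)[OF that(1)] H(2)[OF that(1)] that(2)] by auto
    have lb: "lat_ball e \<sigma> (\<lambda>j. of_real (f i j))" and db: "dual_ball e \<sigma> (\<lambda>j. of_real (g i j))"
      if "i < n" for i
      using H(4,5)[OF that] by (auto simp: factorization_def intro: lat_ball_mono dual_ball_mono)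
    show "lat_ball e (2 * \<sigma> * C) (\<lambda>j. of_real (\<Sum>i<n. c i powr (2 * (1 / p)) * f i j))"
      unfolding lat_ball_def
    proof (intro allI impI)
      fix m and \<theta> :: omega assume \<theta>: "\<forall>j. cmod (\<theta> j) \<le> 1"
      define x where "x i = (\<lambda>j. if j < m then of_real (c i powr (2 * (1 / p))) * (\<theta> j * of_real (f i j)) else 0)" for i
      define v where "v i = (\<Sum>j\<in>I i. x i j *\<^sub>C e j)" for i
      have v: "v i = of_real (c i powr (2 * (1 / p))) *\<^sub>C (\<Sum>j<m. (\<theta> j * of_real (f i j)) *\<^sub>C e j)" if i: "i < n" for i
      proof -
        have "v i = (\<Sum>j\<in>I i \<inter> {..<m}. x i j *\<^sub>C e j)"
          unfolding v_def using H(1)[OF i] by (intro sum.mono_neutral_right) (auto simp: x_def)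
        also have "\<dots> = (\<Sum>j\<in>I i \<inter> {..<m}. (of_real (c i powr (2 * (1 / p))) * (\<theta> j * of_real (f i j))) *\<^sub>C e j)"
          by (intro sum.cong) (auto simp: x_def)
        also have "\<dots> = (\<Sum>j<m. (of_real (c i powr (2 * (1 / p))) * (\<theta> j * of_real (f i j))) *\<^sub>C e j)"
          using f0[OF i] by (intro sum.mono_neutral_left) auto
        finally show ?thesis by (simp add: complex_vector.scale_sum_right scaleC_scaleC)
      qed
      have nv: "norm (v i) \<le> c i powr (2 * (1 / p)) * \<sigma>" if i: "i < n" for i
        unfolding v[OF i] norm_scaleC using lat_ballD[OF lb[OF i], of \<theta> m] \<theta>
        by (simp add: mult_left_mono)
      have "(\<Sum>j<m. (\<theta> j * of_real (\<Sum>i<n. c i powr (2 * (1 / p)) * f i j)) *\<^sub>C e j) =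
          (\<Sum>j<m. \<Sum>i<n. (of_real (c i powr (2 * (1 / p))) * (\<theta> j * of_real (f i j))) *\<^sub>C e j)"
        by (intro sum.cong refl) (simp add: sum_distrib_left complex_vector.scale_sum_left mult_ac)
      also have "\<dots> = (\<Sum>i<n. v i)"
        by (subst sum.swap) (simp add: v complex_vector.scale_sum_right scaleC_scaleC)
      finally have "norm (\<Sum>j<m. (\<theta> j * of_real (\<Sum>i<n. c i powr (2 * (1 / p)) * f i j)) *\<^sub>C e j) = norm (\<Sum>i<n. v i)"
        by (simp only:)
      also have "\<dots> \<le> C * (\<Sum>i<n. norm (v i) powr p) powr (1 / p)"
        unfolding v_def by (rule asymptotic_lp_blocks(2)[OF unc p C H(1,3,6)])
      also have "\<dots> \<le> C * (\<sigma> powr p) powr (1 / p)"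
      proof (intro mult_left_mono powr_mono2)
        have "(\<Sum>i<n. norm (v i) powr p) \<le> (\<Sum>i<n. (c i powr (2 * (1 / p)) * \<sigma>) powr p)"
          using nv p by (intro sum_mono powr_mono2) auto
        also have "\<dots> = (\<Sum>i<n. (c i)\<^sup>2 * \<sigma> powr p)"
        proof (rule sum.cong[OF refl])
          fix i
          show "(c i powr (2 * (1 / p)) * \<sigma>) powr p = (c i)\<^sup>2 * \<sigma> powr p"
            using c(1)[of i] \<sigma> p by (cases "c i = 0") (auto simp: powr_mult powr_powr)
        qed
        also have "\<dots> = (\<Sum>i<n. (c i)\<^sup>2) * \<sigma> powr p" by (simp add: sum_distrib_right)
        also have "\<dots> \<le> 1 * \<sigma> powr p" using c(2) by (intro mult_right_mono) auto
        finally show "(\<Sum>i<n. norm (v i) powr p) \<le> \<sigma> powr p" by simp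
      qed (use C0 p in \<open>auto intro: sum_nonneg\<close>)
      also have "\<dots> \<le> 2 * \<sigma> * C" using p \<sigma> C0 by (simp add: powr_powr)
      finally show "norm (\<Sum>j<m. (\<theta> j * of_real (\<Sum>i<n. c i powr (2 * (1 / p)) * f i j)) *\<^sub>C e j) \<le> 2 * \<sigma> * C" .
    qed
    show "dual_ball e (2 * \<sigma> * C) (\<lambda>j. of_real (\<Sum>i<n. c i powr (2 * (1 - 1 / p)) * g i j))"
      unfolding dual_ball_def
    proof (intro allI impI)
      fix R x m assume x: "lat_ball e R x"
      define S where "S i = (\<Sum>j<m. cmod (x j) * g i j)" for i
      have gn: "0 \<le> g i j" if "i < n" for i j using factorization_nonneg(2)[OF H(4)[OF that]] .
      \<comment> \<open>Multipliers that attain the lattice norm of the piece up to a factor 2. If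
        none existed, the piece would lie in the ball of radius \<open>S i / (2 * \<sigma>)\<close>,
        and pairing with \<open>g i\<close> would give \<open>S i \<le> S i / 2\<close>; the
        multiplier 0 shows \<open>S i > 0\<close>.\<close>
      have "\<exists>\<theta>::omega. (\<forall>j. cmod (\<theta> j) \<le> 1) \<and> S i \<le> 2 * \<sigma> * norm (\<Sum>j\<in>I i. (\<theta> j * x j) *\<^sub>C e j)" if i: "i < n" for i
      proof (rule ccontr)
        assume no0: "\<not> ?thesis"
        have no: "2 * \<sigma> * norm (\<Sum>j\<in>I i. (\<theta> j * x j) *\<^sub>C e j) < S i" if "\<forall>j. cmod (\<theta> j) \<le> 1" for \<theta> :: omega
          using no0 that not_less by blast
        have "lat_ball e (S i / (2 * \<sigma>)) (restr (I i) x)"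
          unfolding lat_ball_def
        proof (intro allI impI)
          fix l and \<theta> :: omega assume \<theta>: "\<forall>j. cmod (\<theta> j) \<le> 1"
          define \<theta>' where "\<theta>' j = (if j < l then \<theta> j else 0)" for j
          have "(\<Sum>j<l. (\<theta> j * restr (I i) x j) *\<^sub>C e j) = (\<Sum>j\<in>I i \<inter> {..<l}. (\<theta>' j * x j) *\<^sub>C e j)"
            using H(1)[OF i] by (intro sum.mono_neutral_cong_right) (auto simp: restr_def \<theta>'_def)
          also have "\<dots> = (\<Sum>j\<in>I i. (\<theta>' j * x j) *\<^sub>C e j)"
            using H(1)[OF i] by (intro sum.mono_neutral_left) (auto simp: \<theta>'_def)
          finally have eq: "(\<Sum>j<l. (\<theta> j * restr (I i) x j) *\<^sub>C e j) = (\<Sum>j\<in>I i. (\<theta>' j * x j) *\<^sub>C e j)" .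
          have "cmod (\<theta>' j) \<le> 1" for j using \<theta> by (simp add: \<theta>'_def)
          then have "2 * \<sigma> * norm (\<Sum>j\<in>I i. (\<theta>' j * x j) *\<^sub>C e j) < S i" by (intro no allI)
          then show "norm (\<Sum>j<l. (\<theta> j * restr (I i) x j) *\<^sub>C e j) \<le> S i / (2 * \<sigma>)"
            unfolding eq using \<sigma> by (simp add: field_simps)
        qed
        from dual_ballD[OF db[OF i] this, of m]
        have "(\<Sum>j<m. cmod (restr (I i) x j) * cmod (of_real (g i j))) \<le> S i / 2" using \<sigma> by simp
        moreover have "(\<Sum>j<m. cmod (restr (I i) x j) * cmod (of_real (g i j))) = S i"
          unfolding S_def using f0[OF i] gn[OF i] by (intro sum.cong) (auto simp: restr_def)
        ultimately have "S i \<le> 0" by simp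
        then show False using no[of "\<lambda>_. 0"] by simp
      qed
      then obtain \<theta> :: "nat \<Rightarrow> omega" where \<theta>: "\<And>i j. i < n \<Longrightarrow> cmod (\<theta> i j) \<le> 1"
        "\<And>i. i < n \<Longrightarrow> S i \<le> 2 * \<sigma> * norm (\<Sum>j\<in>I i. (\<theta> i j * x j) *\<^sub>C e j)" by metis
      define v where "v i = (\<Sum>j\<in>I i. (\<theta> i j * x j) *\<^sub>C e j)" for i
      \<comment> \<open>Since the \<open>I i\<close> are disjoint, the multipliers of the pieces
        glue to a single one; the sum of the pieces is then a multiple of \<open>x\<close> and has
        norm at most \<open>R\<close>.\<close>
      define \<Theta> where "\<Theta> j = (\<Sum>i<n. if j \<in> I i then \<theta> i j else 0)" for j
      have dis: "i = i'" if "i < n" "i' < n" "j \<in> I i" "j \<in> I i'" for i i' j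
        using H(6)[of i i' j j] H(6)[of i' i j j] that by (metis linorder_neqE_nat less_irrefl)
      have \<Theta>: "\<Theta> j = \<theta> i j" if "i < n" "j \<in> I i" for i j
      proof -
        have "\<Theta> j = (\<Sum>i'\<in>{i}. if j \<in> I i' then \<theta> i' j else 0)"
          unfolding \<Theta>_def using dis that by (intro sum.mono_neutral_right) auto
        then show ?thesis using that by simp
      qed
      have \<Theta>1: "cmod (\<Theta> j) \<le> 1" for j
      proof (cases "\<exists>i<n. j \<in> I i")
        case True then show ?thesis using \<Theta> \<theta>(1) by auto
      next
        case False then have "\<Theta> j = 0" unfolding \<Theta>_def by (intro sum.neutral) auto
        then show ?thesis by simp
      qed
      have fU: "finite (\<Union>i<n. I i)" using H(1) by auto
      then obtain l where l: "(\<Union>i<n. I i) \<subseteq> {..<l}" using finite_nat_iff_bounded by blast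
      have "(\<Sum>i<n. v i) = (\<Sum>i<n. \<Sum>j\<in>I i. (\<Theta> j * x j) *\<^sub>C e j)"
        unfolding v_def using \<Theta> by (intro sum.cong refl) auto
      also have "\<dots> = (\<Sum>j\<in>(\<Union>i<n. I i). (\<Theta> j * x j) *\<^sub>C e j)"
        using H(1) dis by (subst sum.UNION_disjoint) auto
      also have "\<dots> = (\<Sum>j<l. (\<Theta> j * x j) *\<^sub>C e j)"
      proof (rule sum.mono_neutral_left)
        show "\<forall>j\<in>{..<l} - (\<Union>i<n. I i). (\<Theta> j * x j) *\<^sub>C e j = 0"
        proof
          fix j assume "j \<in> {..<l} - (\<Union>i<n. I i)"
          then have "\<Theta> j = 0" unfolding \<Theta>_def by (intro sum.neutral) auto
          then show "(\<Theta> j * x j) *\<^sub>C e j = 0" by simp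
        qed
      qed (use l in auto)
      finally have nR: "norm (\<Sum>i<n. v i) \<le> R" using lat_ballD[OF x \<Theta>1] by simp
      have low: "(1 / C) * (\<Sum>i<n. norm (v i) powr p) powr (1 / p) \<le> norm (\<Sum>i<n. v i)"
        unfolding v_def by (rule asymptotic_lp_blocks(1)[OF unc p C H(1,3,6)])
      have "(\<Sum>j<m. cmod (x j) * cmod (of_real (\<Sum>i<n. c i powr (2 * (1 - 1 / p)) * g i j))) =
          (\<Sum>j<m. \<Sum>i<n. c i powr (2 * (1 - 1 / p)) * (cmod (x j) * g i j))"
      proof (rule sum.cong[OF refl])
        fix j
        have "0 \<le> (\<Sum>i<n. c i powr (2 * (1 - 1 / p)) * g i j)" using gn by (intro sum_nonneg) auto
        then have "cmod (of_real (\<Sum>i<n. c i powr (2 * (1 - 1 / p)) * g i j)) = (\<Sum>i<n. c i powr (2 * (1 - 1 / p)) * g i j)"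
          by (simp only: norm_of_real abs_of_nonneg)
        then show "cmod (x j) * cmod (of_real (\<Sum>i<n. c i powr (2 * (1 - 1 / p)) * g i j)) =
            (\<Sum>i<n. c i powr (2 * (1 - 1 / p)) * (cmod (x j) * g i j))"
          by (simp only: sum_distrib_left mult_ac)
      qed
      also have "\<dots> = (\<Sum>i<n. c i powr (2 * (1 - 1 / p)) * S i)"
        by (subst sum.swap) (simp add: S_def sum_distrib_left)
      also have "\<dots> \<le> (\<Sum>i<n. c i powr (2 * (1 - 1 / p)) * (2 * \<sigma> * norm (v i)))"
        using \<theta>(2) by (intro sum_mono mult_left_mono) (auto simp: v_def)
      also have "\<dots> = 2 * \<sigma> * (\<Sum>i<n. c i powr (2 * (1 - 1 / p)) * norm (v i))"
        by (simp add: sum_distrib_left mult_ac)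
      also have "\<dots> \<le> 2 * \<sigma> * (\<Sum>i<n. norm (v i) powr p) powr (1 / p)"
        using \<sigma> c by (intro mult_left_mono weighted_Holder[OF p]) auto
      also have "\<dots> \<le> 2 * \<sigma> * (C * R)"
      proof (rule mult_left_mono)
        have "(1 / C) * (\<Sum>i<n. norm (v i) powr p) powr (1 / p) \<le> R" using low nR by linarith
        then show "(\<Sum>i<n. norm (v i) powr p) powr (1 / p) \<le> C * R" using C0 by (simp add: field_simps)
      qed (use \<sigma> in simp)
      finally show "(\<Sum>j<m. cmod (x j) * cmod (of_real (\<Sum>i<n. c i powr (2 * (1 - 1 / p)) * g i j))) \<le> R * (2 * \<sigma> * C)"
        by (simp add: mult_ac)
    qed
  qed
  qed
qed


section \<open>The c_0 case\<close>

lemma coord_sum: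
  assumes unc: "unconditional_basis e" shows "coord e (\<Sum>i\<in>A. a i *\<^sub>C x i) = (\<Sum>i\<in>A. a i *\<^sub>C coord e (x i))"
  by (induction A rule: infinite_finite_induct)
     (simp_all only: sum.infinite sum.empty sum.insert coord_0[OF unc] coord_add[OF unc] coord_scaleC[OF unc] simp_thms)

lemma lat_ball_coord_norm_le:
  assumes unc: "unconditional_basis e" and "lat_ball e R (coord e x)" shows "norm x \<le> R"
proof (rule LIMSEQ_le_const2)
  show "(\<lambda>n. norm (\<Sum>j<n. coord e x j *\<^sub>C e j)) \<longlonglongrightarrow> norm x"
    using coord_sums[OF unc, of x] by (intro tendsto_norm) (simp add: sums_def)
  show "\<exists>N. \<forall>n\<ge>N. norm (\<Sum>j<n. coord e x j *\<^sub>C e j) \<le> R"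
    using lat_ball_norm_le[OF assms(2)] by blast
qed

text \<open>At each coordinate at most one vector contributes, so domination of the coefficients is
  domination of coordinates, and the lattice bound applies.\<close>

lemma disjoint_domination:
  fixes n :: nat
  assumes unc: "unconditional_basis e" and K: "\<And>x. lat_ball e (K * norm x) (coord e x)"
    and disj: "\<And>i i' t. i < n \<Longrightarrow> i' < n \<Longrightarrow> i \<noteq> i' \<Longrightarrow> coord e (x i) t \<noteq> 0 \<Longrightarrow> coord e (x i') t = 0"
    and le: "\<And>i. i < n \<Longrightarrow> cmod (a i) \<le> cmod (b i)"
  shows "norm (\<Sum>i<n. a i *\<^sub>C x i) \<le> K * norm (\<Sum>i<n. b i *\<^sub>C x i)"
proof (rule lat_ball_coord_norm_le[OF unc lat_ball_dominated[OF K]])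
  fix t
  have ev: "coord e (\<Sum>i<n. c i *\<^sub>C x i) t = (\<Sum>i<n. c i * coord e (x i) t)" for c
    by (simp add: coord_sum[OF unc] sum_fun_apply)
  show "cmod (coord e (\<Sum>i<n. a i *\<^sub>C x i) t) \<le> cmod (coord e (\<Sum>i<n. b i *\<^sub>C x i) t)"
  proof (cases "\<exists>i<n. coord e (x i) t \<noteq> 0")
    case True
    then obtain i where i: "i < n" "coord e (x i) t \<noteq> 0" by blast
    have "(\<Sum>i'<n. c i' * coord e (x i') t) = (\<Sum>i'\<in>{i}. c i' * coord e (x i') t)" for c
      using disj[OF i(1) _ _ i(2)] i(1) by (intro sum.mono_neutral_right) auto
    then show ?thesis unfolding ev using le[OF i(1)] by (simp add: norm_mult mult_right_mono)
  next
    case False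
    then show ?thesis unfolding ev by simp
  qed
qed

text \<open>The vectors \<open>F j\<close> with coordinates \<open>f j\<close> form blocks of norm
  bounded above and below, so the hypothesis applies to them. Their sums are bounded: the hump gives
  bounded signed sums of any length, unconditionality deletes the negative part, and spreading makes
  the positions of the rest irrelevant.\<close>

lemma c0_upper_estimates:
  fixes e :: "nat \<Rightarrow> 'a::complex_banach" and y :: "nat \<Rightarrow> omega"
  assumes unc: "unconditional_basis e" and bs: "block_spreading_models_c0 e"
    and m: "strict_mono m" "\<And>j. {i. y j i \<noteq> 0} \<subseteq> {m j..<m (Suc j)}"
    and \<delta>: "0 < \<delta>" "\<And>j. \<delta> \<le> ell2_norm (y j)" "\<And>j. ell2_norm (y j) \<le> \<sigma>"
    and fac: "\<And>j. factorization e (y j) (f j) (g j)"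
  obtains r C where "strict_mono (r :: nat \<Rightarrow> nat)"
    "\<And>n. \<exists>\<nu>. \<forall>k. strict_mono_on {..<n} k \<and> (\<forall>i<n. \<nu> \<le> k i) \<longrightarrow>
       upper_estimates e 0 C n (\<lambda>i. f (r (k i))) (\<lambda>i. g (r (k i)))"
proof -
  obtain K where K: "0 < K" "\<And>x. lat_ball e (K * norm x) (coord e x)"
    using unconditional_constant[OF unc] by blast
  have f0: "f j i = 0" "g j i = 0" if "i \<notin> {m j..<m (Suc j)}" for i j
    using factorization_support[OF fac m(2) that] by auto
  have fn: "0 \<le> f j i" "0 \<le> g j i" for i j by (rule factorization_nonneg[OF fac])+
  have fy: "f j i \<noteq> 0 \<longleftrightarrow> y j i \<noteq> 0" for i j using fac[of j] unfolding factorization_def by (metis less_irrefl)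
  define F where "F j = (\<Sum>i<m (Suc j). of_real (f j i) *\<^sub>C e i)" for j
  have cF: "coord e (F j) = (\<lambda>i. of_real (f j i))" for j
    unfolding F_def by (rule coord_finite_sum[OF unc]) (simp add: f0)
  have c00y: "y j \<in> c00" for j using m(2)[of j] by (auto simp: c00_def intro: finite_subset)
  have mmono: "m (Suc j) \<le> m k" if "j < k" for j k
    using m(1) that by (simp add: strict_mono_less_eq Suc_leI)
  have disjF: "coord e (F k) t = 0" if "j \<noteq> k" "coord e (F j) t \<noteq> 0" for j k t
  proof -
    have "t \<in> {m j..<m (Suc j)}" using that(2) f0 unfolding cF by auto
    then have "t \<notin> {m k..<m (Suc k)}" using mmono[of j k] mmono[of k j] that(1) by (cases "j < k") auto
    then show ?thesis unfolding cF by (simp add: f0)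
  qed
  have bF: "norm (F j) \<le> \<sigma>" for j
  proof (rule lat_ball_coord_norm_le[OF unc])
    have "lat_ball e (ell2_norm (y j)) (coord e (F j))" using fac[of j] by (simp add: cF factorization_def)
    then show "lat_ball e \<sigma> (coord e (F j))" by (rule lat_ball_mono) (rule \<delta>(3))
  qed
  \<comment> \<open>Pairing \<open>F j\<close> with \<open>g j\<close> gives the square of the norm
    of \<open>y j\<close>, while the dual bound of \<open>g j\<close> is that norm itself.\<close>
  have lowF: "\<delta> \<le> K * norm (F j)" for j
  proof -
    let ?s = "ell2_norm (y j)"
    have s: "0 < ?s" using \<delta>(1) \<delta>(2)[of j] by linarith
    have "(\<Sum>i<m (Suc j). cmod (coord e (F j) i) * cmod (of_real (g j i))) \<le> K * norm (F j) * ?s"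
      by (rule dual_ballD[OF _ K(2)]) (use fac[of j] in \<open>simp add: factorization_def\<close>)
    moreover have "(\<Sum>i<m (Suc j). cmod (coord e (F j) i) * cmod (of_real (g j i))) = (\<Sum>i<m (Suc j). (cmod (y j i))\<^sup>2)"
    proof (rule sum.cong[OF refl])
      fix i
      have "f j i * g j i = (cmod (y j i))\<^sup>2"
        using fac[of j] by (cases "y j i = 0") (auto simp: factorization_def)
      then show "cmod (coord e (F j) i) * cmod (of_real (g j i)) = (cmod (y j i))\<^sup>2"
        by (simp add: cF fn)
    qed
    moreover have "(ell2_norm (y j))\<^sup>2 = (\<Sum>i<m (Suc j). (cmod (y j i))\<^sup>2)"
      by (rule ell2_norm_finite) (use m(2)[of j] in auto)
    ultimately have "?s * ?s \<le> K * norm (F j) * ?s" by (simp add: power2_eq_square)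
    then have "?s \<le> K * norm (F j)" using s by simp
    then show ?thesis using \<delta>(2)[of j] by linarith
  qed
  have sep: "norm (F j) \<le> K * norm (F j - F k)" if "j \<noteq> k" for j k
  proof (rule lat_ball_coord_norm_le[OF unc lat_ball_dominated[OF K(2)]])
    fix t show "cmod (coord e (F j) t) \<le> cmod (coord e (F j - F k) t)"
      using disjF[OF that, of t] by (cases "coord e (F j) t = 0") (auto simp: coord_diff[OF unc])
  qed
  have block: "block_family e UNIV F"
    unfolding block_family_def
  proof (intro conjI ballI impI)
    fix j k
    have bs: "basis_supp e (F j) = {i. y j i \<noteq> 0}" for j by (simp add: basis_supp_def cF fy)
    show fin: "finite (basis_supp e (F j))" for j using c00y[of j] by (simp add: bs c00_def)
    have ne: "basis_supp e (F j) \<noteq> {}" for j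
    proof
      assume "basis_supp e (F j) = {}"
      then have "y j = 0" by (auto simp: bs fun_eq_iff)
      then have "ell2_norm (y j) = 0" by (simp only: ell2_0)
      then show False using \<delta>(1) \<delta>(2)[of j] by simp
    qed
    show "F j \<noteq> 0" using lowF[of j] \<delta>(1) by auto
    assume "j < k"
    have "Max (basis_supp e (F j)) \<in> {m j..<m (Suc j)}"
      by (rule subsetD[OF m(2)]) (use Max_in[OF fin ne] in \<open>simp add: bs\<close>)
    moreover have "Min (basis_supp e (F k)) \<in> {m k..<m (Suc k)}"
      by (rule subsetD[OF m(2)]) (use Min_in[OF fin ne] in \<open>simp add: bs\<close>)
    ultimately show "Max (basis_supp e (F j)) < Min (basis_supp e (F k))" using mmono[OF \<open>j < k\<close>] by simp
  qed
  interpret X: normed_subspace "UNIV :: 'a set" norm by standard (rule norm_on_UNIV)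
  obtain r L where r: "strict_mono (r :: nat \<Rightarrow> nat)" and L: "spreading_limit norm (\<lambda>j. F (r j)) L"
    using X.brunel_sucheston[of F \<sigma>] bF by auto
  \<comment> \<open>Disjoint vectors of norm bounded below are uniformly separated by
    unconditionality, so the sequence really generates a spreading model.\<close>
  have noconv: "\<not> (\<exists>s::nat \<Rightarrow> nat. \<exists>l\<in>UNIV. strict_mono s \<and> (\<lambda>j. norm (F (s j) - l)) \<longlonglongrightarrow> 0)"
  proof
    assume "\<exists>s::nat \<Rightarrow> nat. \<exists>l\<in>UNIV. strict_mono s \<and> (\<lambda>j. norm (F (s j) - l)) \<longlonglongrightarrow> 0"
    then obtain s l where s: "strict_mono (s :: nat \<Rightarrow> nat)" and l: "(\<lambda>j. norm (F (s j) - l)) \<longlonglongrightarrow> 0" by blast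
    have "0 < \<delta> / (K * K) / 2" using \<delta>(1) K(1) by simp
    from order_tendstoD(2)[OF l this] obtain J where J: "\<And>j. j \<ge> J \<Longrightarrow> norm (F (s j) - l) < \<delta> / (K * K) / 2"
      by (auto simp: eventually_sequentially)
    have "norm (F (s J) - F (s (Suc J))) \<le> norm (F (s J) - l) + norm (F (s (Suc J)) - l)"
      using norm_triangle_ineq4[of "F (s J) - l" "F (s (Suc J)) - l"] by simp
    also have "\<dots> < \<delta> / (K * K)" using J[of J] J[of "Suc J"] by simp
    finally have "K * K * norm (F (s J) - F (s (Suc J))) < \<delta>" using K(1) by (simp add: field_simps)
    moreover have "s J \<noteq> s (Suc J)" using s by (simp add: strict_mono_eq)
    then have "K * norm (F (s J)) \<le> K * (K * norm (F (s J) - F (s (Suc J))))"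
      using K(1) by (intro mult_left_mono sep) auto
    then have "\<delta> \<le> K * K * norm (F (s J) - F (s (Suc J)))" using lowF[of "s J"] by (simp add: mult.assoc)
    ultimately show False by simp
  qed
  have "generates_spreading_norm UNIV norm F L"
    unfolding generates_spreading_norm_def
    by (intro conjI exI[of _ r] exI[of _ \<sigma>] r noconv L[unfolded spreading_limit_def] allI bF) simp
  then have iso: "completion_isomorphic_to c00 L c0 sup_norm"
    using bs block unfolding block_spreading_models_c0_def by blast
  define x where "x j = F (r j)" for j
  have Lx: "spreading_limit norm x L" using L by (simp add: x_def[abs_def])
  have disjx: "coord e (x k) t = 0" if "j \<noteq> k" "coord e (x j) t \<noteq> 0" for j k t
    unfolding x_def by (rule disjF[of "r j"]) (use that r in \<open>auto simp: x_def strict_mono_eq\<close>)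
  have "L (unit_seq j) \<le> \<sigma>" for j
  proof (rule spreading_limit_le[OF Lx, of _ "Suc j" 0])
    show "{i. unit_seq j i \<noteq> 0} \<subseteq> {..<Suc j}" by (auto simp: unit_seq_def)
    fix k :: "nat \<Rightarrow> nat"
    have "(\<Sum>i<Suc j. unit_seq j i *\<^sub>C x (k i)) = (\<Sum>i\<in>{j}. unit_seq j i *\<^sub>C x (k i))"
      by (intro sum.mono_neutral_right) (auto simp: unit_seq_def)
    then show "norm (\<Sum>i<Suc j. unit_seq j i *\<^sub>C x (k i)) \<le> \<sigma>"
      using bF by (simp add: unit_seq_def x_def scaleC_one)
  qed
  from c0_model_differences[OF iso this] obtain C where
    C: "\<forall>n. \<exists>A B. finite A \<and> finite B \<and> A \<inter> B = {} \<and> card A = n \<and> L (indic A - indic B) \<le> C" by (elim exE)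
  \<comment> \<open>The value of \<open>L\<close> at the signed sum is transferred to actual blocks
    far out; there the negative part is dropped, and the remaining \<open>n\<close> vectors are read
    as an increasing selection that approximates \<open>L (indic {..<n})\<close>. Each passage
    between \<open>L\<close> and blocks costs 1.\<close>
  have Lind: "L (indic {..<n}) \<le> K * (C + 1) + 1" for n
  proof -
    obtain A B where AB: "finite A" "finite B" "A \<inter> B = {}" "card A = n" "L (indic A - indic B) \<le> C"
      using C[THEN spec, of n] by (elim exE conjE)
    obtain n' where n': "A \<union> B \<subseteq> {..<n'}" using AB finite_nat_iff_bounded by blast
    have s1: "{j. (indic A - indic B) j \<noteq> 0} \<subseteq> {..<n'}" using n' by (auto simp: indic_def split: if_splits)
    have s2: "{j. indic {..<n} j \<noteq> 0} \<subseteq> {..<n}" by (auto simp: indic_def)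
    obtain q1 where q1: "0 \<le> q1" "\<And>k::nat \<Rightarrow> nat. strict_mono_on {..<n'} k \<Longrightarrow> (\<And>i. i < n' \<Longrightarrow> q1 \<le> k i) \<Longrightarrow>
        \<bar>norm (\<Sum>i<n'. (indic A - indic B) i *\<^sub>C x (k i)) - L (indic A - indic B)\<bar> < 1"
      using spreading_limit_approx[OF Lx s1 zero_less_one, of 0] by blast
    obtain q where q: "q1 \<le> q" "\<And>k::nat \<Rightarrow> nat. strict_mono_on {..<n} k \<Longrightarrow> (\<And>i. i < n \<Longrightarrow> q \<le> k i) \<Longrightarrow>
        \<bar>norm (\<Sum>i<n. indic {..<n} i *\<^sub>C x (k i)) - L (indic {..<n})\<bar> < 1"
      using spreading_limit_approx[OF Lx s2 zero_less_one, of q1] by blast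
    have 1: "norm (\<Sum>i<n'. (indic A - indic B) i *\<^sub>C x (q + i)) \<le> C + 1"
      using q1(2)[OF strict_mono_on_shift, of q] q(1) AB(5) by fastforce
    have "norm (\<Sum>i<n'. indic A i *\<^sub>C x (q + i)) \<le> K * norm (\<Sum>i<n'. (indic A - indic B) i *\<^sub>C x (q + i))"
    proof (rule disjoint_domination[OF unc K(2)])
      show "coord e (x (q + i')) t = 0" if "i \<noteq> i'" "coord e (x (q + i)) t \<noteq> 0" for i i' t
        by (rule disjx[OF _ that(2)]) (use that(1) in simp)
      show "cmod (indic A i) \<le> cmod ((indic A - indic B) i)" for i
        using AB(3) by (auto simp: indic_def)
    qed
    also have "\<dots> \<le> K * (C + 1)" using 1 K(1) by (intro mult_left_mono) auto
    finally have 2: "norm (\<Sum>i<n'. indic A i *\<^sub>C x (q + i)) \<le> K * (C + 1)" .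
    obtain h where h: "bij_betw h {..<n} A" "strict_mono_on {..<n} h"
      using ex_bij_betw_strict_mono_card[OF AB(1)] AB(4) by metis
    have "(\<Sum>i<n'. indic A i *\<^sub>C x (q + i)) = (\<Sum>i\<in>A. x (q + i))"
      using n' by (intro sum.mono_neutral_cong_right) (auto simp: indic_def scaleC_one)
    also have "\<dots> = (\<Sum>i<n. x (q + h i))"
      by (rule sum.reindex_bij_betw[OF h(1), symmetric])
    also have "\<dots> = (\<Sum>i<n. indic {..<n} i *\<^sub>C x (q + h i))"
      by (intro sum.cong) (auto simp: indic_def scaleC_one)
    finally have "norm (\<Sum>i<n. indic {..<n} i *\<^sub>C x (q + h i)) \<le> K * (C + 1)" using 2 by simp
    moreover have "\<bar>norm (\<Sum>i<n. indic {..<n} i *\<^sub>C x (q + h i)) - L (indic {..<n})\<bar> < 1"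
      by (rule q(2)) (use h(2) in \<open>auto simp: strict_mono_on_def\<close>)
    ultimately show ?thesis by linarith
  qed
  \<comment> \<open>One more than \<open>Lind\<close>, for the passage back from \<open>L\<close> to
    the blocks selected by \<open>k\<close>.\<close>
  define C1 where "C1 = K * (C + 1) + 2"
  have s0: "0 \<le> \<sigma>" using \<delta>(1) \<delta>(2,3)[of 0] by linarith
  show thesis
  proof (rule that[OF r, of "max (K * C1) \<sigma>"])
    fix n
    have s2: "{j. indic {..<n} j \<noteq> 0} \<subseteq> {..<n}" by (auto simp: indic_def)
    obtain q where q: "0 \<le> q" "\<And>k::nat \<Rightarrow> nat. strict_mono_on {..<n} k \<Longrightarrow> (\<And>i. i < n \<Longrightarrow> q \<le> k i) \<Longrightarrow>
        \<bar>norm (\<Sum>i<n. indic {..<n} i *\<^sub>C x (k i)) - L (indic {..<n})\<bar> < 1"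
      using spreading_limit_approx[OF Lx s2 zero_less_one, of 0] by blast
    have "upper_estimates e 0 (max (K * C1) \<sigma>) n (\<lambda>i. f (r (k i))) (\<lambda>i. g (r (k i)))"
      if k: "strict_mono_on {..<n} k" "\<forall>i<n. q \<le> k i" for k
      unfolding upper_estimates_def
    proof (intro allI impI conjI)
      fix c :: "nat \<Rightarrow> real" assume "(\<forall>i. 0 \<le> c i) \<and> (\<Sum>i<n. (c i)\<^sup>2) \<le> 1"
      then have c: "\<And>i. 0 \<le> c i" "(\<Sum>i<n. (c i)\<^sup>2) \<le> 1" by auto
      have "(\<Sum>i<n. indic {..<n} i *\<^sub>C x (k i)) = (\<Sum>i<n. 1 *\<^sub>C x (k i))"
        by (intro sum.cong) (auto simp: indic_def)
      then have nx: "norm (\<Sum>i<n. 1 *\<^sub>C x (k i)) \<le> C1"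
        using q(2)[OF k(1)] k(2) Lind[of n] by (force simp: C1_def)
      have le: "(\<Sum>i<n. c i powr (2 * 0) * f (r (k i)) t) \<le> (\<Sum>i<n. f (r (k i)) t)"
        "0 \<le> (\<Sum>i<n. c i powr (2 * 0) * f (r (k i)) t)" for t
        using fn by (auto intro!: sum_mono sum_nonneg)
      show "lat_ball e (max (K * C1) \<sigma>) (\<lambda>j. of_real (\<Sum>i<n. c i powr (2 * 0) * f (r (k i)) j))"
      proof (rule lat_ball_mono[OF lat_ball_dominated[OF K(2)]])
        fix t
        have "coord e (\<Sum>i<n. 1 *\<^sub>C x (k i)) t = of_real (\<Sum>i<n. f (r (k i)) t)"
          unfolding coord_sum[OF unc] by (simp add: sum_fun_apply x_def cF scaleC_one)
        then show "cmod (of_real (\<Sum>i<n. c i powr (2 * 0) * f (r (k i)) t)) \<le> cmod (coord e (\<Sum>i<n. 1 *\<^sub>C x (k i)) t)"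
          using le[of t] by (simp only: norm_of_real)
      next
        show "K * norm (\<Sum>i<n. 1 *\<^sub>C x (k i)) \<le> max (K * C1) \<sigma>"
          using mult_left_mono[OF nx, of K] K(1) by linarith
      qed
      \<comment> \<open>For exponent 0 the dual coefficients are the squares of \<open>c\<close>,
        whose sum is at most 1, so the triangle inequality suffices.\<close>
      show "dual_ball e (max (K * C1) \<sigma>) (\<lambda>j. of_real (\<Sum>i<n. c i powr (2 * (1 - 0)) * g (r (k i)) j))"
      proof (rule dual_ball_mono)
        have db: "dual_ball e (cmod (of_real ((c i)\<^sup>2)) * \<sigma>) (of_real ((c i)\<^sup>2) *\<^sub>C (\<lambda>j. of_real (g (r (k i)) j)))" for i
          using fac[of "r (k i)"] \<delta>(3)
          by (intro dual_ball_scaleC) (auto simp: factorization_def intro: dual_ball_mono)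
        have cp: "c i powr 2 = (c i)\<^sup>2" for i using c(1)[of i] by simp
        have "(\<lambda>j. of_real (\<Sum>i<n. c i powr (2 * (1 - 0)) * g (r (k i)) j)) =
            (\<Sum>i<n. of_real ((c i)\<^sup>2) *\<^sub>C (\<lambda>j. of_real (g (r (k i)) j) :: complex))"
          by (rule ext) (simp add: sum_fun_apply cp)
        with dual_ball_sum[of "{..<n}" e "\<lambda>i. cmod (of_real ((c i)\<^sup>2)) * \<sigma>", OF db]
        show "dual_ball e (\<Sum>i<n. cmod (of_real ((c i)\<^sup>2)) * \<sigma>) (\<lambda>j. of_real (\<Sum>i<n. c i powr (2 * (1 - 0)) * g (r (k i)) j))"
          by (simp only:)
        have "(\<Sum>i<n. cmod (of_real ((c i)\<^sup>2)) * \<sigma>) = (\<Sum>i<n. (c i)\<^sup>2) * \<sigma>"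
          unfolding norm_of_real by (simp add: sum_distrib_right)
        also have "\<dots> \<le> 1 * \<sigma>" using c(2) s0 by (intro mult_right_mono)
        finally show "(\<Sum>i<n. cmod (of_real ((c i)\<^sup>2)) * \<sigma>) \<le> max (K * C1) \<sigma>" by simp
      qed
    qed
    then show "\<exists>\<nu>. \<forall>k. strict_mono_on {..<n} k \<and> (\<forall>i<n. \<nu> \<le> k i) \<longrightarrow>
       upper_estimates e 0 (max (K * C1) \<sigma>) n (\<lambda>i. f (r (k i))) (\<lambda>i. g (r (k i)))" by blast
  qed
qed

text \<open>Both hypotheses are brought to one form, with \<open>\<alpha> = 1 / p\<close> or
  \<open>\<alpha> = 0\<close>; neither equals 1/2. In the asymptotic case no passage to a
  subsequence occurs and the threshold is \<open>n\<close>, because the block with index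
  \<open>k i\<close> lies beyond coordinate \<open>k i\<close>.\<close>

lemma block_upper_estimates:
  fixes e :: "nat \<Rightarrow> 'a::complex_banach" and y :: "nat \<Rightarrow> omega"
  assumes unc: "unconditional_basis e"
    and hyp: "(\<exists>p. 1 \<le> p \<and> p \<noteq> 2 \<and> asymptotic_lp e p) \<or> block_spreading_models_c0 e"
    and m: "strict_mono m" "\<And>j. {i. y j i \<noteq> 0} \<subseteq> {m j..<m (Suc j)}"
    and \<delta>: "0 < \<delta>" "\<And>j. \<delta> \<le> ell2_norm (y j)" "\<And>j. ell2_norm (y j) \<le> \<sigma>"
    and fac: "\<And>j. factorization e (y j) (f j) (g j)"
  obtains \<alpha> r C where "\<alpha> \<noteq> 1 / 2" "strict_mono (r :: nat \<Rightarrow> nat)"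
    "\<And>n. \<exists>\<nu>. \<forall>k. strict_mono_on {..<n} k \<and> (\<forall>i<n. \<nu> \<le> k i) \<longrightarrow>
       upper_estimates e \<alpha> C n (\<lambda>i. f (r (k i))) (\<lambda>i. g (r (k i)))"
  using hyp
proof
  assume "block_spreading_models_c0 e"
  from c0_upper_estimates[OF unc this m \<delta> fac] that[of 0] show thesis by (metis zero_neq_one divide_eq_0_iff zero_neq_numeral)
next
  assume "\<exists>p. 1 \<le> p \<and> p \<noteq> 2 \<and> asymptotic_lp e p"
  then obtain p where p: "1 \<le> p" "p \<noteq> 2" "asymptotic_lp e p" by blast
  have \<sigma>: "0 < \<sigma>" using \<delta>(1) \<delta>(2,3)[of 0] by linarith
  show thesis
  proof (rule asymptotic_lp_upper_estimates[OF unc p(1,3) \<sigma>])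
    fix C assume C: "\<And>n y f g (I :: nat \<Rightarrow> nat set). (\<And>i. i < n \<Longrightarrow> finite (I i) \<and> I i \<noteq> {}) \<Longrightarrow>
      (\<And>i. i < n \<Longrightarrow> {j. y i j \<noteq> 0} \<subseteq> I i) \<Longrightarrow> (\<And>i j. i < n \<Longrightarrow> j \<in> I i \<Longrightarrow> n \<le> j) \<Longrightarrow>
      (\<And>i. i < n \<Longrightarrow> factorization e (y i) (f i) (g i)) \<Longrightarrow> (\<And>i. i < n \<Longrightarrow> ell2_norm (y i) \<le> \<sigma>) \<Longrightarrow>
      (\<And>i i' j j'. i < i' \<Longrightarrow> i' < n \<Longrightarrow> j \<in> I i \<Longrightarrow> j' \<in> I i' \<Longrightarrow> j < j') \<Longrightarrow>
      upper_estimates e (1 / p) C n f g"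
  show thesis
  proof (rule that[of "1 / p" "\<lambda>j. j"])
    show "1 / p \<noteq> 1 / 2" using p by simp
    show "strict_mono (\<lambda>j::nat. j)" by (simp add: strict_mono_def)
    fix n
    have "upper_estimates e (1 / p) C n (\<lambda>i. f (k i)) (\<lambda>i. g (k i))"
      if k: "strict_mono_on {..<n} k" "\<forall>i<n. n \<le> k i" for k
    proof (rule C[of n "\<lambda>i. {m (k i)..<m (Suc (k i))}" "\<lambda>i. y (k i)"])
      fix i assume i: "i < n"
      show "finite {m (k i)..<m (Suc (k i))} \<and> {m (k i)..<m (Suc (k i))} \<noteq> {}"
        using m(1) by (simp add: strict_mono_def)
      show "{j. y (k i) j \<noteq> 0} \<subseteq> {m (k i)..<m (Suc (k i))}" by (rule m(2))
      show "n \<le> j" if "j \<in> {m (k i)..<m (Suc (k i))}" for j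
        using that k(2) i seq_suble[OF m(1), of "k i"] by fastforce
    next
      fix i i' j j' assume i: "i < i'" "i' < n" "j \<in> {m (k i)..<m (Suc (k i))}" "j' \<in> {m (k i')..<m (Suc (k i'))}"
      have "k i < k i'" using k(1) i by (auto simp: strict_mono_on_def)
      then have "m (Suc (k i)) \<le> m (k i')" using m(1) by (simp add: strict_mono_less_eq Suc_leI)
      then show "j < j'" using i by simp
    qed (rule fac \<delta>(3))+
    then show "\<exists>\<nu>. \<forall>k. strict_mono_on {..<n} k \<and> (\<forall>i<n. \<nu> \<le> k i) \<longrightarrow>
       upper_estimates e (1 / p) C n (\<lambda>i. f (k i)) (\<lambda>i. g (k i))" by blast
  qed
  qed
qed


subsection \<open>Bounded sequences in the twisted Hilbert space\<close>

lemma pnorm_restr_le: "pnorm m (restr {..<n} a) \<le> pnorm n a"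
proof -
  have "(\<Sum>j<m. (cmod (restr {..<n} a j))\<^sup>2) = (\<Sum>j\<in>{..<m} \<inter> {..<n}. (cmod (a j))\<^sup>2)"
    by (intro sum.mono_neutral_cong_right) (auto simp: restr_def)
  also have "\<dots> \<le> (\<Sum>j<n. (cmod (a j))\<^sup>2)" by (intro sum_mono2) auto
  finally show ?thesis by (simp add: L2_set_def)
qed

lemma restr_lessThan_ell2: "restr {..<n} a \<in> ell2" "ell2_norm (restr {..<n} a) \<le> pnorm n a"
  using ell2_boundD[OF pnorm_restr_le] by auto

lemma pnorm_le_restr: "pnorm n a \<le> ell2_norm (restr {..<n} a)"
proof -
  have "pnorm n a = pnorm n (restr {..<n} a)" by (intro L2_set_cong) (auto simp: restr_def)
  then show ?thesis using pnorm_le_ell2_norm[OF restr_lessThan_ell2(1)] by simp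
qed

lemma disjoint_blocks_norm:
  fixes h :: "nat \<Rightarrow> omega"
  assumes supp: "{j. a j \<noteq> 0} \<subseteq> {..<n}"
    and h: "\<And>i. i < n \<Longrightarrow> h i \<in> ell2"
    and disj: "\<And>i i' j. i < n \<Longrightarrow> i' < n \<Longrightarrow> i \<noteq> i' \<Longrightarrow> h i j \<noteq> 0 \<Longrightarrow> h i' j = 0"
  shows "(\<Sum>i<n. a i *\<^sub>C h i) \<in> ell2"
    "0 \<le> \<delta> \<Longrightarrow> (\<And>i. i < n \<Longrightarrow> \<delta> \<le> ell2_norm (h i)) \<Longrightarrow> \<delta> * ell2_norm a \<le> ell2_norm (\<Sum>i<n. a i *\<^sub>C h i)"
    "0 \<le> \<sigma> \<Longrightarrow> (\<And>i. i < n \<Longrightarrow> ell2_norm (h i) \<le> \<sigma>) \<Longrightarrow> ell2_norm (\<Sum>i<n. a i *\<^sub>C h i) \<le> \<sigma> * ell2_norm a"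
proof -
  have a: "a \<in> ell2" "0 \<le> ell2_norm a" using supp_c00[OF supp] c00_ell2 ell2_norm_nonneg by auto
  have an: "(ell2_norm a)\<^sup>2 = (\<Sum>i<n. (cmod (a i))\<^sup>2)" by (rule ell2_norm_finite[OF supp])
  have D: "(\<Sum>i<n. a i *\<^sub>C h i) \<in> ell2"
    "(ell2_norm (\<Sum>i<n. a i *\<^sub>C h i))\<^sup>2 = (\<Sum>i<n. (ell2_norm (a i *\<^sub>C h i))\<^sup>2)"
    by (rule ell2_norm_disjoint; use h disj in \<open>auto intro: ell2_scaleC\<close>)+
  show "(\<Sum>i<n. a i *\<^sub>C h i) \<in> ell2" by (rule D(1))
  have sq: "(ell2_norm (\<Sum>i<n. a i *\<^sub>C h i))\<^sup>2 = (\<Sum>i<n. (cmod (a i))\<^sup>2 * (ell2_norm (h i))\<^sup>2)"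
    unfolding D(2) using h by (intro sum.cong) (auto simp: ell2_norm_scaleC power_mult_distrib)
  have hn: "0 \<le> ell2_norm (h i)" if "i < n" for i using h[OF that] by (rule ell2_norm_nonneg)
  show "\<delta> * ell2_norm a \<le> ell2_norm (\<Sum>i<n. a i *\<^sub>C h i)" if "0 \<le> \<delta>" "\<And>i. i < n \<Longrightarrow> \<delta> \<le> ell2_norm (h i)"
  proof (rule power2_le_imp_le)
    have "(\<delta> * ell2_norm a)\<^sup>2 = (\<Sum>i<n. (cmod (a i))\<^sup>2) * \<delta>\<^sup>2"
      by (simp add: power_mult_distrib an mult.commute)
    also have "\<dots> = (\<Sum>i<n. (cmod (a i))\<^sup>2 * \<delta>\<^sup>2)" by (rule sum_distrib_right)
    also have "\<dots> \<le> (\<Sum>i<n. (cmod (a i))\<^sup>2 * (ell2_norm (h i))\<^sup>2)"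
      using that by (intro sum_mono mult_left_mono power_mono) auto
    finally show "(\<delta> * ell2_norm a)\<^sup>2 \<le> (ell2_norm (\<Sum>i<n. a i *\<^sub>C h i))\<^sup>2" by (simp only: sq)
  qed (rule ell2_norm_nonneg[OF D(1)])
  show "ell2_norm (\<Sum>i<n. a i *\<^sub>C h i) \<le> \<sigma> * ell2_norm a" if "0 \<le> \<sigma>" "\<And>i. i < n \<Longrightarrow> ell2_norm (h i) \<le> \<sigma>"
  proof (rule power2_le_imp_le)
    have "(\<Sum>i<n. (cmod (a i))\<^sup>2 * (ell2_norm (h i))\<^sup>2) \<le> (\<Sum>i<n. (cmod (a i))\<^sup>2 * \<sigma>\<^sup>2)"
      using that hn by (intro sum_mono mult_left_mono power_mono) auto
    also have "\<dots> = (\<Sum>i<n. (cmod (a i))\<^sup>2) * \<sigma>\<^sup>2" by (rule sum_distrib_right[symmetric])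
    also have "\<dots> = (\<sigma> * ell2_norm a)\<^sup>2"
      by (simp add: power_mult_distrib an mult.commute)
    finally show "(ell2_norm (\<Sum>i<n. a i *\<^sub>C h i))\<^sup>2 \<le> (\<sigma> * ell2_norm a)\<^sup>2" by (simp only: sq)
  qed (use that a in simp)
qed

lemma small_subseq:
  fixes t :: "nat \<Rightarrow> real"
  assumes "\<And>\<delta> J. 0 < \<delta> \<Longrightarrow> \<exists>j\<ge>J. t j < \<delta>"
  obtains s where "strict_mono (s :: nat \<Rightarrow> nat)" "\<And>j. t (s j) < 1 / real (Suc j)"
proof -
  have "\<exists>s. \<forall>n. t (s n) < 1 / real (Suc n) \<and> s n < s (Suc n)"
  proof (rule dependent_nat_choice)
    show "\<exists>x. t x < 1 / real (Suc 0)" using assms[of 1 0] by auto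
    fix x n
    obtain j where "j \<ge> Suc x" "t j < 1 / real (Suc (Suc n))"
      using assms[of "1 / real (Suc (Suc n))" "Suc x"] by auto
    then show "\<exists>y. t y < 1 / real (Suc (Suc n)) \<and> x < y" by (intro exI[of _ j]) auto
  qed
  then show thesis using that by (auto simp: strict_mono_Suc_iff)
qed

section \<open>Restrictions of pairs and the twisted norm\<close>

definition restrZ :: "nat set \<Rightarrow> omega \<times> omega \<Rightarrow> omega \<times> omega" where
  "restrZ I z = (restr I (fst z), restr I (snd z))"

lemma restrZ_add: "restrZ I (z + w) = restrZ I z + restrZ I w"
  and restrZ_diff: "restrZ I (z - w) = restrZ I z - restrZ I w"
  and restrZ_scaleC: "restrZ I (c *\<^sub>C z) = c *\<^sub>C restrZ I z"
  by (simp_all add: restrZ_def restr_add restr_diff restr_scaleC prod_eq_iff)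

lemma restrZ_0: "restrZ I 0 = 0"
  by (simp add: restrZ_def prod_eq_iff fun_eq_iff restr_def)

lemma restrZ_sum: "restrZ I (sum f A) = (\<Sum>i\<in>A. restrZ I (f i))"
  by (induction A rule: infinite_finite_induct)
     (simp_all only: sum.infinite sum.empty sum.insert restrZ_0 restrZ_add simp_thms)

definition suppZ :: "omega \<times> omega \<Rightarrow> nat set" where
  "suppZ z = {j. fst z j \<noteq> 0 \<or> snd z j \<noteq> 0}"

lemma restrZ_supp: "suppZ z \<subseteq> I \<Longrightarrow> restrZ I z = z"
  by (auto simp: suppZ_def restrZ_def restr_def prod_eq_iff fun_eq_iff)

lemma restrZ_disjoint: "suppZ z \<inter> I = {} \<Longrightarrow> restrZ I z = 0"
  by (auto simp: suppZ_def restrZ_def restr_def prod_eq_iff fun_eq_iff)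

lemma suppZ_restrZ: "suppZ (restrZ I z) \<subseteq> I"
  by (auto simp: suppZ_def restrZ_def restr_def)

text \<open>The selection is abstracted to \<open>der\<close>: \<open>\<Omega> y\<close> is the
  derivative at 1/2 of some function with value \<open>y\<close> and norm proportional to that of
  \<open>y\<close>. The norm \<open>N\<close> is any norm equivalent to the quasi-norm.\<close>

locale twisted_hilbert = normed_subspace "twisted_space \<Omega>" N
  for \<Omega> :: "omega \<Rightarrow> omega" and N :: "omega \<times> omega \<Rightarrow> real" +
  fixes e :: "nat \<Rightarrow> 'a::complex_banach" and C0 c1 c2 :: real
  assumes unc: "unconditional_basis e"
    and hyp: "(\<exists>p. 1 \<le> p \<and> p \<noteq> 2 \<and> asymptotic_lp e p) \<or> block_spreading_models_c0 e"
    and C0: "0 < C0" and der: "\<And>y. y \<in> ell2 \<Longrightarrow> der_at e (C0 * ell2_norm y) y (\<Omega> y)"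
    and c12: "0 < c1" "0 < c2"
    and N_ge: "\<And>z. z \<in> twisted_space \<Omega> \<Longrightarrow> c1 * twisted_norm \<Omega> z \<le> N z"
    and N_le: "\<And>z. z \<in> twisted_space \<Omega> \<Longrightarrow> N z \<le> c2 * twisted_norm \<Omega> z"
begin

abbreviation Z :: "(omega \<times> omega) set" where "Z \<equiv> twisted_space \<Omega>"
abbreviation q :: "omega \<times> omega \<Rightarrow> real" where "q \<equiv> twisted_norm \<Omega>"

text \<open>1 for \<open>ell2_norm y \<le> R\<close>, plus \<open>2 * (1 + C0)\<close> for
  exchanging \<open>\<Omega> y\<close> with another derivative of a function of norm at most
  \<open>R\<close>.\<close>

definition C1 :: real where "C1 = 3 + 2 * C0"

lemma C1_pos: "0 < C1" using C0 by (simp add: C1_def)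

lemma Z_D: "(x, y) \<in> Z \<Longrightarrow> y \<in> ell2" "(x, y) \<in> Z \<Longrightarrow> x - \<Omega> y \<in> ell2"
  by (auto simp: twisted_space_def)

lemma q_Pair: "q (x, y) = ell2_norm (x - \<Omega> y) + ell2_norm y"
  by (simp add: twisted_norm_def)

lemma q_ge: assumes "(x, y) \<in> Z" shows "ell2_norm y \<le> q (x, y)" "ell2_norm (x - \<Omega> y) \<le> q (x, y)" "0 \<le> q (x, y)"
  using ell2_norm_nonneg[OF Z_D(1)[OF assms]] ell2_norm_nonneg[OF Z_D(2)[OF assms]] by (auto simp: q_Pair)

lemma q_nonneg: "z \<in> Z \<Longrightarrow> 0 \<le> q z"
  using q_ge(3)[of "fst z" "snd z"] by simp

lemma q_le_N: "z \<in> Z \<Longrightarrow> q z \<le> N z / c1"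
  using N_ge c12 by (simp add: field_simps)

lemma der_diff:
  assumes "der_at e R y d"
  shows "d - \<Omega> y \<in> ell2" "ell2_norm (d - \<Omega> y) \<le> 2 * (1 + C0) * R"
proof -
  note y = der_at_ell2[OF assms]
  note u = der_at_unique[OF assms der[OF y(1)]]
  show "d - \<Omega> y \<in> ell2" by (rule u(1))
  have "C0 * ell2_norm y \<le> C0 * R" using y(2) C0 by (intro mult_left_mono) auto
  then show "ell2_norm (d - \<Omega> y) \<le> 2 * (1 + C0) * R" using u(2) by (simp add: algebra_simps)
qed

text \<open>Together with \<open>Z_lower\<close>, this allows any derivative \<open>d\<close> to
  replace \<open>\<Omega> y\<close> in the quasi-norm at a cost of \<open>C1 * R\<close>; the
  quasi-norms of blocks are computed in this way.\<close>

lemma Z_upper: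
  assumes d: "der_at e R y d" and x: "x - d \<in> ell2"
  shows "(x, y) \<in> Z" "q (x, y) \<le> ell2_norm (x - d) + C1 * R"
proof -
  note y = der_at_ell2[OF d]
  note dd = der_diff[OF d]
  have eq: "x - \<Omega> y = (x - d) + (d - \<Omega> y)" by simp
  note a = ell2_add[OF x dd(1), folded eq]
  show "(x, y) \<in> Z" using y a by (simp add: twisted_space_def)
  show "q (x, y) \<le> ell2_norm (x - d) + C1 * R"
    using a(2) dd(2) y(2) by (simp add: q_Pair C1_def algebra_simps)
qed

lemma Z_lower:
  assumes z: "(x, y) \<in> Z" and d: "der_at e R y d"
  shows "x - d \<in> ell2" "ell2_norm (x - d) \<le> q (x, y) + C1 * R"
proof -
  note dd = der_diff[OF d]
  have eq: "x - d = (x - \<Omega> y) - (d - \<Omega> y)" by simp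
  note a = ell2_diff[OF Z_D(2)[OF z] dd(1), folded eq]
  show "x - d \<in> ell2" by (rule a(1))
  have "2 * (1 + C0) * R \<le> C1 * R"
    using der_at_nonneg[OF d] by (intro mult_right_mono) (auto simp: C1_def)
  then show "ell2_norm (x - d) \<le> q (x, y) + C1 * R"
    using a(2) dd(2) q_ge(2)[OF z] by linarith
qed

text \<open>The map \<open>\<Omega>\<close> does not commute with restrictions, but the restriction
  of \<open>\<Omega> y\<close> is a derivative belonging to the restriction of
  \<open>y\<close>.\<close>

lemma restrZ_Z:
  assumes z: "z \<in> Z" shows "restrZ I z \<in> Z" "q (restrZ I z) \<le> (1 + C1 * C0) * q z"
proof -
  obtain x y where xy: "z = (x, y)" by (cases z)
  note zz = z[unfolded xy]
  have d: "der_at e (C0 * ell2_norm y) (restr I y) (restr I (\<Omega> y))"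
    by (intro der_at_restr der Z_D[OF zz])
  have eq: "restr I x - restr I (\<Omega> y) = restr I (x - \<Omega> y)" by (simp add: restr_diff)
  note r = restr_ell2[OF Z_D(2)[OF zz], of I, folded eq]
  note u = Z_upper[OF d r(1)]
  show "restrZ I z \<in> Z" using u(1) by (simp add: restrZ_def xy)
  have "C1 * (C0 * ell2_norm y) \<le> C1 * (C0 * q (x, y))"
    using C1_pos C0 q_ge(1)[OF zz] by (intro mult_left_mono) auto
  then show "q (restrZ I z) \<le> (1 + C1 * C0) * q z"
    using u(2) r(2) q_ge(2)[OF zz] by (simp add: restrZ_def xy algebra_simps)
qed

definition P :: real where "P = c2 * (1 + C1 * C0) / c1"

lemma P_pos: "0 < P" using c12 C1_pos C0 by (auto simp: P_def intro!: divide_pos_pos mult_pos_pos add_pos_pos)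

lemma N_restrZ: assumes z: "z \<in> Z" shows "N (restrZ I z) \<le> P * N z"
proof -
  have "N (restrZ I z) \<le> c2 * q (restrZ I z)" by (rule N_le[OF restrZ_Z(1)[OF z]])
  also have "\<dots> \<le> c2 * ((1 + C1 * C0) * (N z / c1))"
    using c12 C1_pos C0 q_le_N[OF z] restrZ_Z(2)[OF z, of I]
    by (intro mult_left_mono order_trans[OF restrZ_Z(2)[OF z, of I] mult_left_mono]) (auto intro: add_nonneg_nonneg)
  finally show ?thesis by (simp add: P_def)
qed

lemma N_tendsto_0:
  assumes "\<And>j. z j \<in> Z" "(\<lambda>j. q (z j)) \<longlonglongrightarrow> 0" shows "(\<lambda>j. N (z j)) \<longlonglongrightarrow> 0"
proof (rule Lim_null_comparison)
  show "\<forall>\<^sub>F j in sequentially. norm (N (z j)) \<le> c2 * q (z j)"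
    using N_le[OF assms(1)] N_nonneg[OF assms(1)] by simp
  show "(\<lambda>j. c2 * q (z j)) \<longlonglongrightarrow> 0" by (rule tendsto_mult_right_zero[OF assms(2)])
qed

text \<open>The cost of exchanging derivatives is first made small by cutting \<open>y\<close> down
  to a tail \<open>y'\<close> of small norm. With \<open>\<Omega> y'\<close> fixed, the corrected
  first component beyond \<open>m\<close> is a single element \<open>h\<close> of
  \<open>ell2\<close>, whose tails tend to zero.\<close>

lemma tail_tendsto:
  assumes z: "z \<in> Z" shows "(\<lambda>n. N (restrZ {n..} z)) \<longlonglongrightarrow> 0"
proof (rule N_tendsto_0)
  show "restrZ {n..} z \<in> Z" for n by (rule restrZ_Z(1)[OF z])
  obtain x y where xy: "z = (x, y)" by (cases z)
  note zz = z[unfolded xy] and y = Z_D(1)[OF z[unfolded xy]]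
  show "(\<lambda>n. q (restrZ {n..} z)) \<longlonglongrightarrow> 0"
  proof (rule LIMSEQ_I)
    fix \<epsilon> :: real assume \<epsilon>: "0 < \<epsilon>"
    have "(\<lambda>n. C1 * (C0 * ell2_norm (restr {n..} y))) \<longlonglongrightarrow> C1 * (C0 * 0)"
      by (intro tendsto_intros ell2_tail_tendsto y)
    then have "\<forall>\<^sub>F n in sequentially. C1 * (C0 * ell2_norm (restr {n..} y)) < \<epsilon> / 2"
      using \<epsilon> by (intro order_tendstoD(2)) auto
    then obtain m where m: "C1 * (C0 * ell2_norm (restr {m..} y)) < \<epsilon> / 2" by (auto simp: eventually_sequentially)
    define y' where "y' = restr {m..} y"
    have y': "y' \<in> ell2" unfolding y'_def by (rule restr_ell2(1)[OF y])
    have dz: "der_at e (C0 * ell2_norm y) y' (restr {m..} (\<Omega> y))"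
      unfolding y'_def by (intro der_at_restr der y)
    have dy': "der_at e (C0 * ell2_norm y') y' (restr {m..} (\<Omega> y'))"
    proof -
      have "restr {m..} y' = y'" by (simp add: y'_def restr_restr)
      then show ?thesis using der_at_restr[OF der[OF y'], of "{m..}"] by simp
    qed
    define h where "h = restr {m..} (x - \<Omega> y')"
    have "h = restr {m..} (x - \<Omega> y) + (restr {m..} (\<Omega> y) - restr {m..} (\<Omega> y'))"
      by (simp add: h_def restr_diff)
    then have h: "h \<in> ell2"
      using ell2_add(1)[OF restr_ell2(1)[OF Z_D(2)[OF zz]] der_at_unique(1)[OF dz dy']] by simp
    have "\<forall>\<^sub>F n in sequentially. ell2_norm (restr {n..} h) < \<epsilon> / 2"
      using ell2_tail_tendsto[OF h] \<epsilon> by (intro order_tendstoD(2)) auto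
    then obtain M where M: "\<And>n. n \<ge> M \<Longrightarrow> ell2_norm (restr {n..} h) < \<epsilon> / 2" by (auto simp: eventually_sequentially)
    have "q (restrZ {n..} z) < \<epsilon>" if n: "n \<ge> max m M" for n
    proof -
      have ry: "restr {n..} y' = restr {n..} y" using n by (auto simp: y'_def restr_def fun_eq_iff)
      have d: "der_at e (C0 * ell2_norm y') (restr {n..} y) (restr {n..} (\<Omega> y'))"
        using der_at_restr[OF der[OF y'], of "{n..}"] by (simp add: ry)
      have eq: "restr {n..} x - restr {n..} (\<Omega> y') = restr {n..} h"
        using n by (auto simp: h_def restr_def fun_eq_iff)
      have "q (restr {n..} x, restr {n..} y) \<le> ell2_norm (restr {n..} h) + C1 * (C0 * ell2_norm y')"
        using Z_upper(2)[OF d, of "restr {n..} x"] restr_ell2(1)[OF h, of "{n..}"] by (simp add: eq)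
      also have "\<dots> < \<epsilon>" using M[of n] m n by (simp add: y'_def)
      finally show ?thesis by (simp add: restrZ_def xy)
    qed
    moreover have "0 \<le> q (restrZ {n..} z)" for n by (rule q_nonneg[OF restrZ_Z(1)[OF z]])
    ultimately show "\<exists>M. \<forall>n\<ge>M. norm (q (restrZ {n..} z) - 0) < \<epsilon>"
      by (intro exI[of _ "max m M"]) simp
  qed
qed

section \<open>Coordinates and coordinatewise limits\<close>

lemma unit_der: "\<exists>l. \<forall>i. der_at e 1 (unit_seq i) (l i)"
proof -
  have "\<exists>d. der_at e 1 (unit_seq i) d" for i
  proof -
    obtain f g where "factorization e (unit_seq i) f g" using factorization_exists[OF unc unit_seq_c00] by blast
    from factorization_der_at[OF this] show ?thesis by auto
  qed
  then show ?thesis by metis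
qed

definition unit_derivative :: "nat \<Rightarrow> omega" where
  "unit_derivative = (SOME l. \<forall>i. der_at e 1 (unit_seq i) (l i))"

lemma unit_derivative: "der_at e 1 (unit_seq i) (unit_derivative i)"
  using someI_ex[OF unit_der] unfolding unit_derivative_def by blast

text \<open>Restricted to one coordinate, \<open>\<Omega> y\<close> is a derivative for a multiple
  of \<open>unit_seq i\<close> and can be compared with the same multiple of the fixed
  \<open>unit_derivative i\<close>.\<close>

lemma coordinate_bounds:
  assumes z: "z \<in> Z"
  shows "cmod (snd z i) \<le> q z" "cmod (fst z i) \<le> (1 + 2 * (C0 + 1) + cmod (unit_derivative i i)) * q z"
proof -
  obtain x y where xy: "z = (x, y)" by (cases z)
  note zz = z[unfolded xy] and y = Z_D(1)[OF z[unfolded xy]]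
  have yi: "cmod (y i) \<le> q z"
    using norm_component_le_ell2_norm[OF y, of i] q_ge(1)[OF zz] xy by simp
  then show "cmod (snd z i) \<le> q z" by (simp add: xy)
  have r: "restr {i} y = y i *\<^sub>C unit_seq i" by (auto simp: restr_def unit_seq_def fun_eq_iff)
  have d1: "der_at e (C0 * ell2_norm y) (y i *\<^sub>C unit_seq i) (restr {i} (\<Omega> y))"
    using der_at_restr[OF der[OF y], of "{i}"] by (simp only: r)
  have d2: "der_at e (cmod (y i) * 1) (y i *\<^sub>C unit_seq i) (y i *\<^sub>C unit_derivative i)"
    by (rule der_at_scaleC[OF unit_derivative])
  note u = der_at_unique[OF d1 d2]
  have "cmod ((restr {i} (\<Omega> y) - y i *\<^sub>C unit_derivative i) i) \<le> 2 * (C0 * ell2_norm y + cmod (y i) * 1)"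
    by (rule order_trans[OF norm_component_le_ell2_norm[OF u(1)] u(2)])
  then have 1: "cmod (\<Omega> y i - y i * unit_derivative i i) \<le> 2 * (C0 * ell2_norm y + cmod (y i))"
    by (simp add: restr_def)
  have 2: "cmod (x i - \<Omega> y i) \<le> q z"
    using norm_component_le_ell2_norm[OF Z_D(2)[OF zz], of i] q_ge(2)[OF zz] xy by simp
  have 3: "C0 * ell2_norm y \<le> C0 * q z" using q_ge(1)[OF zz] C0 xy by (intro mult_left_mono) auto
  have 4: "cmod (y i * unit_derivative i i) \<le> cmod (unit_derivative i i) * q z"
    using mult_left_mono[OF yi, of "cmod (unit_derivative i i)"] by (simp add: norm_mult mult.commute)
  have "cmod ((x i - \<Omega> y i) + (\<Omega> y i - y i * unit_derivative i i) + y i * unit_derivative i i)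
      \<le> cmod (x i - \<Omega> y i) + cmod (\<Omega> y i - y i * unit_derivative i i) + cmod (y i * unit_derivative i i)"
    by (rule order_trans[OF norm_triangle_ineq add_right_mono[OF norm_triangle_ineq]])
  then have "cmod (x i) \<le> cmod (x i - \<Omega> y i) + cmod (\<Omega> y i - y i * unit_derivative i i) + cmod (y i * unit_derivative i i)"
    by simp
  also have "\<dots> \<le> q z + 2 * (C0 * q z + q z) + cmod (unit_derivative i i) * q z"
    using order_trans[OF 1 mult_left_mono[OF add_mono[OF 3 yi], of 2]] by (intro add_mono 2 4) simp
  finally have "cmod (x i) \<le> q z + 2 * (C0 * q z + q z) + cmod (unit_derivative i i) * q z" .
  then show "cmod (fst z i) \<le> (1 + 2 * (C0 + 1) + cmod (unit_derivative i i)) * q z"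
    by (simp add: xy algebra_simps)
qed

text \<open>On finitely many coordinates there is a derivative that depends linearly on
  \<open>snd z\<close>, namely the combination of the \<open>unit_derivative i\<close>. The
  resulting bound is continuous in the coordinates, so coordinatewise convergence controls initial
  sections in norm.\<close>

lemma finite_part_in_Z: "restrZ {..<n} z \<in> Z"
  and finite_part_le: "q (restrZ {..<n} z) \<le>
    pnorm n (fst z - (\<Sum>i<n. snd z i *\<^sub>C unit_derivative i)) + C1 * (\<Sum>i<n. cmod (snd z i))"
proof -
  let ?d = "\<Sum>i<n. snd z i *\<^sub>C unit_derivative i"
  have r: "restr {..<n} (\<Sum>i<n. snd z i *\<^sub>C unit_seq i) = restr {..<n} (snd z)"
  proof
    fix j
    have "(\<Sum>i<n. snd z i * (if j = i then 1 else 0)) = (if j < n then snd z j else 0)"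
      by (simp add: if_distrib cong: if_cong)
    then show "restr {..<n} (\<Sum>i<n. snd z i *\<^sub>C unit_seq i) j = restr {..<n} (snd z) j"
      by (auto simp: restr_def sum_fun_apply unit_seq_def)
  qed
  have "der_at e (\<Sum>i<n. cmod (snd z i) * 1) (\<Sum>i<n. snd z i *\<^sub>C unit_seq i) ?d"
    by (intro der_at_sum der_at_scaleC unit_derivative)
  from der_at_restr[OF this, of "{..<n}", unfolded r]
  have d: "der_at e (\<Sum>i<n. cmod (snd z i) * 1) (restr {..<n} (snd z)) (restr {..<n} ?d)" .
  have eq: "restr {..<n} (fst z) - restr {..<n} ?d = restr {..<n} (fst z - ?d)" by (simp only: restr_diff)
  note h = restr_lessThan_ell2[of n "fst z - ?d", folded eq]
  note u = Z_upper[OF d h(1)]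
  show "restrZ {..<n} z \<in> Z" using u(1) by (simp add: restrZ_def)
  show "q (restrZ {..<n} z) \<le> pnorm n (fst z - ?d) + C1 * (\<Sum>i<n. cmod (snd z i))"
    using u(2) h(2) by (simp add: restrZ_def)
qed

lemma finite_part_tendsto:
  assumes "\<And>i. (\<lambda>j. fst (z j) i) \<longlonglongrightarrow> 0" "\<And>i. (\<lambda>j. snd (z j) i) \<longlonglongrightarrow> 0"
  shows "(\<lambda>j. N (restrZ {..<n} (z j))) \<longlonglongrightarrow> 0"
proof (rule N_tendsto_0)
  show "restrZ {..<n} (z j) \<in> Z" for j by (rule finite_part_in_Z)
  let ?b = "\<lambda>j. pnorm n (fst (z j) - (\<Sum>i<n. snd (z j) i *\<^sub>C unit_derivative i)) + C1 * (\<Sum>i<n. cmod (snd (z j) i))"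
  show "(\<lambda>j. q (restrZ {..<n} (z j))) \<longlonglongrightarrow> 0"
  proof (rule Lim_null_comparison)
    show "\<forall>\<^sub>F j in sequentially. norm (q (restrZ {..<n} (z j))) \<le> ?b j"
      using finite_part_le[of n] q_nonneg[OF finite_part_in_Z] by simp
    have "(\<lambda>j. pnorm n (fst (z j) - (\<Sum>i<n. snd (z j) i *\<^sub>C unit_derivative i))) \<longlonglongrightarrow> pnorm n 0"
    proof (rule pnorm_tendsto)
      fix t
      have "(\<lambda>j. fst (z j) t - (\<Sum>i<n. snd (z j) i * unit_derivative i t)) \<longlonglongrightarrow> 0 - (\<Sum>i<n. 0 * unit_derivative i t)"
        by (intro tendsto_intros assms)
      then show "(\<lambda>j. (fst (z j) - (\<Sum>i<n. snd (z j) i *\<^sub>C unit_derivative i)) t) \<longlonglongrightarrow> 0 t"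
        by (simp add: sum_fun_apply)
    qed
    moreover have "(\<lambda>j. C1 * (\<Sum>i<n. cmod (snd (z j) i))) \<longlonglongrightarrow> C1 * (\<Sum>i<n. cmod 0)"
      by (intro tendsto_intros assms)
    ultimately have "?b \<longlonglongrightarrow> pnorm n 0 + C1 * (\<Sum>i<n. cmod 0)" by (rule tendsto_add)
    then show "?b \<longlonglongrightarrow> 0" by (simp add: L2_set_def)
  qed
qed

text \<open>The initial sections of the limit are norm limits of sections of the \<open>z j\<close>
  and hence bounded by \<open>P * b\<close>. These bounds pass to the sections of
  \<open>x - \<Omega> y\<close>, whose membership in \<open>ell2\<close> depends only on
  them.\<close>

lemma coordinatewise_limit_in_Z:
  assumes z: "\<And>j. z j \<in> Z" "\<And>j. N (z j) \<le> b"
    and lim: "\<And>i. (\<lambda>j. fst (z j) i) \<longlonglongrightarrow> fst \<zeta> i" "\<And>i. (\<lambda>j. snd (z j) i) \<longlonglongrightarrow> snd \<zeta> i"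
  shows "\<zeta> \<in> Z"
proof -
  obtain x y where xy: "\<zeta> = (x, y)" by (cases \<zeta>)
  have qz: "q (z j) \<le> b / c1" for j
    using order_trans[OF q_le_N[OF z(1)] divide_right_mono[OF z(2)]] c12 by simp
  have yb: "snd (z j) \<in> ell2 \<and> ell2_norm (snd (z j)) \<le> b / c1" for j
    using z(1)[of j] qz[of j] q_ge(1)[of "fst (z j)" "snd (z j)"] Z_D(1)[of "fst (z j)" "snd (z j)"] by simp
  have y: "y \<in> ell2"
    by (rule ell2_lower_semicont(1)[where x = "\<lambda>j. snd (z j)" and R = "b / c1"])
       (use lim(2) yb xy in auto)
  have Nn: "N (restrZ {..<n} \<zeta>) \<le> P * b" for n
  proof -
    have l0: "(\<lambda>j. N (restrZ {..<n} (\<zeta> - z j))) \<longlonglongrightarrow> 0"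
    proof (rule finite_part_tendsto)
      show "(\<lambda>j. fst (\<zeta> - z j) i) \<longlonglongrightarrow> 0" for i
        using tendsto_diff[OF tendsto_const lim(1), of "fst \<zeta> i" i] by simp
      show "(\<lambda>j. snd (\<zeta> - z j) i) \<longlonglongrightarrow> 0" for i
        using tendsto_diff[OF tendsto_const lim(2), of "snd \<zeta> i" i] by simp
    qed
    have "N (restrZ {..<n} \<zeta>) \<le> N (restrZ {..<n} (\<zeta> - z j)) + P * b" for j
    proof -
      have "restrZ {..<n} \<zeta> = restrZ {..<n} (\<zeta> - z j) + restrZ {..<n} (z j)" by (simp add: restrZ_diff)
      then have "N (restrZ {..<n} \<zeta>) \<le> N (restrZ {..<n} (\<zeta> - z j)) + N (restrZ {..<n} (z j))"
        using N_add[OF finite_part_in_Z finite_part_in_Z] by metis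
      also have "N (restrZ {..<n} (z j)) \<le> P * b"
        by (rule order_trans[OF N_restrZ[OF z(1)] mult_left_mono[OF z(2) less_imp_le[OF P_pos]]])
      finally show ?thesis by simp
    qed
    moreover have "(\<lambda>j. N (restrZ {..<n} (\<zeta> - z j)) + P * b) \<longlonglongrightarrow> 0 + P * b" by (intro tendsto_intros l0)
    ultimately show ?thesis using LIMSEQ_le_const[of _ "0 + P * b"] by fastforce
  qed
  have "pnorm n (x - \<Omega> y) \<le> P * b / c1 + C1 * (C0 * ell2_norm y)" for n
  proof -
    have d: "der_at e (C0 * ell2_norm y) (restr {..<n} y) (restr {..<n} (\<Omega> y))"
      by (intro der_at_restr der y)
    have m: "(restr {..<n} x, restr {..<n} y) \<in> Z" using finite_part_in_Z[of n \<zeta>] by (simp add: restrZ_def xy)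
    have "q (restr {..<n} x, restr {..<n} y) \<le> P * b / c1"
      using order_trans[OF q_le_N[OF m] divide_right_mono] Nn[of n] c12 by (simp add: restrZ_def xy)
    moreover have "pnorm n (x - \<Omega> y) \<le> ell2_norm (restr {..<n} x - restr {..<n} (\<Omega> y))"
      using pnorm_le_restr[of "x - \<Omega> y" n] by (simp add: restr_diff)
    ultimately show ?thesis using Z_lower(2)[OF m d] by linarith
  qed
  then have "x - \<Omega> y \<in> ell2" by (rule ell2_boundD(1))
  then show ?thesis using y by (simp add: twisted_space_def xy)
qed

text \<open>A gliding hump: after subtraction of the coordinatewise limit the initial parts of the
  vectors tend to zero along the sequence, while for each vector the tails tend to zero. Vectors and
  intervals are chosen alternately.\<close>

lemma block_decomposition:
  assumes z: "\<And>j. z j \<in> Z" "\<And>j. N (z j) \<le> b"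
  obtains r \<zeta> m w where "strict_mono (r :: nat \<Rightarrow> nat)" "\<zeta> \<in> Z" "strict_mono (m :: nat \<Rightarrow> nat)"
    "\<And>j. w j \<in> Z" "\<And>j. suppZ (w j) \<subseteq> {m j..<m (Suc j)}" "(\<lambda>j. N (z (r j) - \<zeta> - w j)) \<longlonglongrightarrow> 0"
proof -
  have qz: "q (z j) \<le> b / c1" for j
    using order_trans[OF q_le_N[OF z(1)] divide_right_mono[OF z(2)]] c12 by simp
  have "cmod (fst (z j) i) \<le> (1 + 2 * (C0 + 1) + cmod (unit_derivative i i)) * (b / c1)" for i j
    using order_trans[OF coordinate_bounds(2)[OF z(1)] mult_left_mono[OF qz]] C0 by simp
  then obtain r1 x where r1: "strict_mono (r1 :: nat \<Rightarrow> nat)" "\<And>i. (\<lambda>j. fst (z (r1 j)) i) \<longlonglongrightarrow> x i"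
    using coordinatewise_convergent_subseq[of "\<lambda>j. fst (z j)" "\<lambda>i. (1 + 2 * (C0 + 1) + cmod (unit_derivative i i)) * (b / c1)"]
    by metis
  have "cmod (snd (z (r1 j)) i) \<le> b / c1" for i j
    by (rule order_trans[OF coordinate_bounds(1)[OF z(1)] qz])
  then obtain r2 y where r2: "strict_mono (r2 :: nat \<Rightarrow> nat)" "\<And>i. (\<lambda>j. snd (z (r1 (r2 j))) i) \<longlonglongrightarrow> y i"
    using coordinatewise_convergent_subseq[of "\<lambda>j. snd (z (r1 j))" "\<lambda>i. b / c1"] by metis
  define \<zeta> where "\<zeta> = (x, y)"
  define r0 where "r0 j = r1 (r2 j)" for j
  have r0: "strict_mono r0" using strict_mono_o[OF r1(1) r2(1)] by (simp add: r0_def[abs_def] o_def)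
  have lim1: "(\<lambda>j. fst (z (r0 j)) i) \<longlonglongrightarrow> fst \<zeta> i" for i
    using LIMSEQ_subseq_LIMSEQ[OF r1(2) r2(1), of i] by (simp add: r0_def o_def \<zeta>_def)
  have lim2: "(\<lambda>j. snd (z (r0 j)) i) \<longlonglongrightarrow> snd \<zeta> i" for i
    using r2(2)[of i] by (simp add: r0_def \<zeta>_def)
  have \<zeta>: "\<zeta> \<in> Z" by (rule coordinatewise_limit_in_Z[of "\<lambda>j. z (r0 j)", OF z lim1 lim2])
  define u where "u j = z (r0 j) - \<zeta>" for j
  have u: "u j \<in> Z" for j unfolding u_def by (intro V_diff z \<zeta>)
  have u0: "(\<lambda>j. N (restrZ {..<n} (u j))) \<longlonglongrightarrow> 0" for n
  proof (rule finite_part_tendsto)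
    show "(\<lambda>j. fst (u j) i) \<longlonglongrightarrow> 0" for i
      using tendsto_diff[OF lim1 tendsto_const, of i "fst \<zeta> i"] by (simp add: u_def)
    show "(\<lambda>j. snd (u j) i) \<longlonglongrightarrow> 0" for i
      using tendsto_diff[OF lim2 tendsto_const, of i "snd \<zeta> i"] by (simp add: u_def)
  qed
  have pick: "\<exists>\<rho>>a. N (restrZ {..<n} (u \<rho>)) < \<epsilon>" if "0 < \<epsilon>" for a n \<epsilon>
  proof -
    have "\<forall>\<^sub>F j in sequentially. N (restrZ {..<n} (u j)) < \<epsilon>" by (rule order_tendstoD(2)[OF u0 that])
    then have "\<forall>\<^sub>F j in sequentially. N (restrZ {..<n} (u j)) < \<epsilon> \<and> a < j"
      using eventually_gt_at_top[of a] by eventually_elim auto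
    then show ?thesis by (auto simp: eventually_sequentially)
  qed
  have pick': "\<exists>\<mu>>a. N (restrZ {\<mu>..} (u \<rho>)) < \<epsilon>" if "0 < \<epsilon>" for a \<rho> \<epsilon>
  proof -
    have "\<forall>\<^sub>F j in sequentially. N (restrZ {j..} (u \<rho>)) < \<epsilon>" by (rule order_tendstoD(2)[OF tail_tendsto[OF u] that])
    then have "\<forall>\<^sub>F j in sequentially. N (restrZ {j..} (u \<rho>)) < \<epsilon> \<and> a < j"
      using eventually_gt_at_top[of a] by eventually_elim auto
    then show ?thesis by (auto simp: eventually_sequentially)
  qed
  \<comment> \<open>The state consists of the index of a vector and of the start and end of its
    interval; the next interval starts where this one ends.\<close>
  define Q where "Q n s \<longleftrightarrow> (case s of (\<rho>, \<mu>, \<mu>') \<Rightarrow> \<mu> < \<mu>' \<and>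
      N (restrZ {..<\<mu>} (u \<rho>)) < 1 / real (Suc n) \<and> N (restrZ {\<mu>'..} (u \<rho>)) < 1 / real (Suc n))"
    for n and s :: "nat \<times> nat \<times> nat"
  have "\<exists>s. \<forall>n. Q n (s n) \<and> (fst (s n) < fst (s (Suc n)) \<and> fst (snd (s (Suc n))) = snd (snd (s n)))"
  proof (rule dependent_nat_choice)
    obtain \<rho> where "N (restrZ {..<0} (u \<rho>)) < 1 / real (Suc 0)" using pick[of 1 0 0] by auto
    moreover obtain \<mu>' where "0 < \<mu>'" "N (restrZ {\<mu>'..} (u \<rho>)) < 1 / real (Suc 0)" using pick'[of 1 0 \<rho>] by auto
    ultimately show "\<exists>s. Q 0 s" by (intro exI[of _ "(\<rho>, 0, \<mu>')"]) (simp add: Q_def)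
    fix s n
    obtain \<rho> where "fst s < \<rho>" "N (restrZ {..<snd (snd s)} (u \<rho>)) < 1 / real (Suc (Suc n))"
      using pick[of "1 / real (Suc (Suc n))" "fst s" "snd (snd s)"] by auto
    moreover obtain \<mu>' where "snd (snd s) < \<mu>'" "N (restrZ {\<mu>'..} (u \<rho>)) < 1 / real (Suc (Suc n))"
      using pick'[of "1 / real (Suc (Suc n))" "snd (snd s)" \<rho>] by auto
    ultimately show "\<exists>t. Q (Suc n) t \<and> fst s < fst t \<and> fst (snd t) = snd (snd s)"
      by (intro exI[of _ "(\<rho>, snd (snd s), \<mu>')"]) (simp add: Q_def)
  qed
  then obtain s where s: "\<And>n. Q n (s n)" "\<And>n. fst (s n) < fst (s (Suc n))" "\<And>n. fst (snd (s (Suc n))) = snd (snd (s n))"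
    by blast
  define \<rho> where "\<rho> n = fst (s n)" for n
  define m where "m n = fst (snd (s n))" for n
  have Q: "m n < m (Suc n)" "N (restrZ {..<m n} (u (\<rho> n))) < 1 / real (Suc n)"
    "N (restrZ {m (Suc n)..} (u (\<rho> n))) < 1 / real (Suc n)" for n
    using s(1)[of n] s(3)[of n] by (auto simp: Q_def \<rho>_def m_def split: prod.splits)
  define w where "w n = restrZ {m n..<m (Suc n)} (u (\<rho> n))" for n
  have \<rho>: "strict_mono \<rho>" using s(2) by (simp add: strict_mono_Suc_iff \<rho>_def)
  show thesis
  proof (rule that)
    show "strict_mono (\<lambda>j. r0 (\<rho> j))" using strict_mono_o[OF r0 \<rho>] by (simp add: o_def)
    show "\<zeta> \<in> Z" by (rule \<zeta>)
    show "strict_mono m" using Q(1) by (simp add: strict_mono_Suc_iff)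
    show "w j \<in> Z" for j unfolding w_def by (rule restrZ_Z(1)[OF u])
    show "suppZ (w j) \<subseteq> {m j..<m (Suc j)}" for j unfolding w_def by (rule suppZ_restrZ)
    have le: "N (z (r0 (\<rho> j)) - \<zeta> - w j) \<le> 2 * inverse (real (Suc j))" "0 \<le> N (z (r0 (\<rho> j)) - \<zeta> - w j)" for j
    proof -
      have "z (r0 (\<rho> j)) - \<zeta> - w j = restrZ {..<m j} (u (\<rho> j)) + restrZ {m (Suc j)..} (u (\<rho> j))"
        using Q(1)[of j] by (auto simp: u_def[symmetric] w_def restrZ_def restr_def prod_eq_iff fun_eq_iff)
      then show "N (z (r0 (\<rho> j)) - \<zeta> - w j) \<le> 2 * inverse (real (Suc j))"
        using N_add[OF restrZ_Z(1)[OF u] restrZ_Z(1)[OF u], of "{..<m j}" "\<rho> j" "{m (Suc j)..}" "\<rho> j"] Q(2,3)[of j]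
        by (simp add: inverse_eq_divide)
      show "0 \<le> N (z (r0 (\<rho> j)) - \<zeta> - w j)"
        by (intro N_nonneg V_diff z \<zeta>) (simp add: w_def restrZ_Z(1)[OF u])
    qed
    have "(\<lambda>j. 2 * inverse (real (Suc j))) \<longlonglongrightarrow> 2 * 0"
      by (intro tendsto_intros LIMSEQ_inverse_real_of_nat)
    then show "(\<lambda>j. N (z (r0 (\<rho> j)) - \<zeta> - w j)) \<longlonglongrightarrow> 0"
      using le by (rule_tac Lim_null_comparison[of _ "\<lambda>j. 2 * inverse (real (Suc j))"]) simp_all
  qed
qed

end


section \<open>Spreading models generated by blocks\<close>

lemma sum_scaleC_Pair: "(\<Sum>i\<in>A. a i *\<^sub>C (x i, y i)) = (\<Sum>i\<in>A. a i *\<^sub>C x i, \<Sum>i\<in>A. a i *\<^sub>C y i)"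
  by (simp add: prod_eq_iff fst_sum snd_sum)

lemma interval_disjoint:
  assumes "strict_mono (m :: nat \<Rightarrow> nat)" "j \<noteq> j'" "t \<in> {m j..<m (Suc j)}" shows "t \<notin> {m j'..<m (Suc j')}"
proof -
  have "m (Suc j) \<le> m k" if "j < k" for j k
    using assms(1) that by (simp add: strict_mono_less_eq Suc_leI)
  then show ?thesis using assms(2,3) by (cases j j' rule: linorder_cases) fastforce+
qed

context twisted_hilbert
begin

lemma combination_in_Z: "(\<And>i. i < n \<Longrightarrow> w i \<in> Z) \<Longrightarrow> (\<Sum>i<n. a i *\<^sub>C w i) \<in> Z" for n :: nat
  by (intro V_sum V_scale) auto

text \<open>Far-out blocks leave the first \<open>\<mu>\<close> coordinates to
  \<open>\<zeta>\<close>, so the part \<open>S *\<^sub>C \<zeta>\<close> of the combination is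
  recovered by a restriction; subtracting it recovers the blocks. The upper estimate is the triangle
  inequality.\<close>

lemma spreading_estimates:
  assumes L: "spreading_limit N z L" and z: "\<And>j. z j \<in> Z" and \<zeta>: "\<zeta> \<in> Z"
    and w: "\<And>j. w j \<in> Z" "\<And>j. suppZ (w j) \<subseteq> {j..}" and lim: "(\<lambda>j. N (z j - \<zeta> - w j)) \<longlonglongrightarrow> 0"
    and cC: "0 < c" "0 < C"
    and est: "\<And>n. \<exists>\<nu>. \<forall>k a. strict_mono_on {..<n} k \<and> (\<forall>i<n. \<nu> \<le> k i) \<and> {j. a j \<noteq> 0} \<subseteq> {..<n} \<longrightarrow>
        c * G a \<le> N (\<Sum>i<n. a i *\<^sub>C w (k i)) \<and> N (\<Sum>i<n. a i *\<^sub>C w (k i)) \<le> C * G a"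
  shows "\<exists>c' C'. 0 < c' \<and> 0 < C' \<and> (\<forall>a\<in>c00. c' * (N \<zeta> * cmod (\<Sum>j. a j) + G a) \<le> L a \<and>
      L a \<le> C' * (N \<zeta> * cmod (\<Sum>j. a j) + G a))"
proof -
  \<comment> \<open>\<open>2 * P\<close> bounds the part from \<open>\<zeta>\<close>, of which at
    least half the norm sits before \<open>\<mu>\<close>; \<open>(1 + 2 * P) / c\<close> bounds
    \<open>G a\<close> after that part is subtracted.\<close>
  define D where "D = 2 * P + (1 + 2 * P) / c"
  have D: "0 < D" using P_pos cC by (simp add: D_def add_pos_pos)
  have \<zeta>0: "0 \<le> N \<zeta>" by (rule N_nonneg[OF \<zeta>])
  obtain \<mu> where \<mu>: "N (restrZ {\<mu>..} \<zeta>) \<le> N \<zeta> / 2"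
  proof (cases "N \<zeta> = 0")
    case True
    then have "\<zeta> = 0" using N_eq_0[OF \<zeta>] by simp
    then have "N (restrZ {0..} \<zeta>) \<le> N \<zeta> / 2" by (simp add: restrZ_0)
    then show thesis by (rule that)
  next
    case False
    then have "\<forall>\<^sub>F n in sequentially. N (restrZ {n..} \<zeta>) < N \<zeta> / 2"
      using \<zeta>0 by (intro order_tendstoD(2)[OF tail_tendsto[OF \<zeta>]]) simp
    then obtain n where "N (restrZ {n..} \<zeta>) < N \<zeta> / 2" by (auto simp: eventually_sequentially)
    then show thesis by (intro that[of n]) simp
  qed
  have head: "N \<zeta> / 2 \<le> N (restrZ {..<\<mu>} \<zeta>)"
  proof -
    have "\<zeta> = restrZ {..<\<mu>} \<zeta> + restrZ {\<mu>..} \<zeta>"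
      by (auto simp: restrZ_def restr_def prod_eq_iff fun_eq_iff)
    then have "N \<zeta> \<le> N (restrZ {..<\<mu>} \<zeta>) + N (restrZ {\<mu>..} \<zeta>)"
      using N_add[OF restrZ_Z(1)[OF \<zeta>] restrZ_Z(1)[OF \<zeta>]] by metis
    then show ?thesis using \<mu> by simp
  qed
  have "(1 / D) * (N \<zeta> * cmod (\<Sum>j. a j) + G a) \<le> L a \<and> L a \<le> max 1 C * (N \<zeta> * cmod (\<Sum>j. a j) + G a)"
    if a00: "a \<in> c00" for a
  proof -
    obtain n where n: "{j. a j \<noteq> 0} \<subseteq> {..<n}" using c00_bounded[OF a00] .
    define S where "S = (\<Sum>j. a j)"
    have S: "S = (\<Sum>i<n. a i)" unfolding S_def using n by (intro suminf_finite) auto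
    define T where "T = N \<zeta> * cmod S + G a"
    obtain \<nu> where \<nu>: "\<And>k. strict_mono_on {..<n} k \<Longrightarrow> (\<forall>i<n. \<nu> \<le> k i) \<Longrightarrow>
        c * G a \<le> N (\<Sum>i<n. a i *\<^sub>C w (k i)) \<and> N (\<Sum>i<n. a i *\<^sub>C w (k i)) \<le> C * G a"
      using est[of n] n by blast
    \<comment> \<open>The combination with every \<open>z j\<close> replaced by
      \<open>\<zeta> + w j\<close>. The error is small for large indices, with coefficients
      fixed.\<close>
    define v where "v k = S *\<^sub>C \<zeta> + (\<Sum>i<n. a i *\<^sub>C w (k i))" for k :: "nat \<Rightarrow> nat"
    have wZ: "(\<Sum>i<n. a i *\<^sub>C w (k i)) \<in> Z" for k by (intro combination_in_Z w)
    have vZ: "v k \<in> Z" for k unfolding v_def by (intro V_add V_scale \<zeta> wZ)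
    have Ga: "0 \<le> G a"
    proof -
      have "0 \<le> N (\<Sum>i<n. a i *\<^sub>C w (\<nu> + i))" by (rule N_nonneg[OF wZ])
      also have "\<dots> \<le> C * G a" using \<nu>[OF strict_mono_on_shift, of \<nu>] by simp
      finally show ?thesis using cC by (simp add: zero_le_mult_iff)
    qed
    have bounds: "N (v k) \<le> max 1 C * T" "(1 / D) * T \<le> N (v k)"
      if k: "strict_mono_on {..<n} k" "\<And>i. i < n \<Longrightarrow> max \<nu> \<mu> \<le> k i" for k
    proof -
      have e: "c * G a \<le> N (\<Sum>i<n. a i *\<^sub>C w (k i))" "N (\<Sum>i<n. a i *\<^sub>C w (k i)) \<le> C * G a"
        using \<nu>[OF k(1)] k(2) by auto
      have NS: "N (S *\<^sub>C \<zeta>) = N \<zeta> * cmod S" using N_scale[OF \<zeta>] by (simp add: mult.commute)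
      have "N (v k) \<le> N \<zeta> * cmod S + C * G a"
        using N_add[OF V_scale[OF \<zeta>] wZ, of S k] e(2) NS by (simp add: v_def)
      also have "\<dots> \<le> max 1 C * (N \<zeta> * cmod S) + max 1 C * G a"
        using \<zeta>0 Ga mult_right_mono[of 1 "max 1 C" "N \<zeta> * cmod S"] by (intro add_mono mult_right_mono) auto
      finally show "N (v k) \<le> max 1 C * T" by (simp add: T_def distrib_left)
      have "restrZ {..<\<mu>} (w (k i)) = 0" if "i < n" for i
        by (rule restrZ_disjoint) (use w(2)[of "k i"] k(2)[OF that] in force)
      then have "restrZ {..<\<mu>} (v k) = S *\<^sub>C restrZ {..<\<mu>} \<zeta>"
        unfolding v_def by (simp add: restrZ_add restrZ_sum restrZ_scaleC)
      then have "cmod S * N (restrZ {..<\<mu>} \<zeta>) \<le> P * N (v k)"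
        using N_restrZ[OF vZ, of "{..<\<mu>}" k] N_scale[OF restrZ_Z(1)[OF \<zeta>]] by simp
      moreover have "cmod S * (N \<zeta> / 2) \<le> cmod S * N (restrZ {..<\<mu>} \<zeta>)" using head by (intro mult_left_mono) auto
      ultimately have 1: "N \<zeta> * cmod S \<le> 2 * P * N (v k)" by (simp add: mult.commute)
      have "(\<Sum>i<n. a i *\<^sub>C w (k i)) = v k - S *\<^sub>C \<zeta>" by (simp add: v_def)
      then have "N (\<Sum>i<n. a i *\<^sub>C w (k i)) \<le> N (v k) + N \<zeta> * cmod S"
        using N_diff_le[OF vZ V_scale[OF \<zeta>], of k S] NS by simp
      then have "c * G a \<le> (1 + 2 * P) * N (v k)" using e(1) 1 by (simp add: distrib_right)
      then have "G a \<le> (1 + 2 * P) / c * N (v k)" using cC by (simp add: field_simps)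
      then have "T \<le> D * N (v k)" using 1 by (simp add: T_def D_def distrib_right)
      then show "(1 / D) * T \<le> N (v k)" using D by (simp add: field_simps)
    qed
    define A where "A = (\<Sum>i<n. cmod (a i)) + 1"
    have A: "0 < A" unfolding A_def by (intro add_nonneg_pos sum_nonneg) auto
    have close: "\<exists>J. \<forall>k. (\<forall>i<n. J \<le> k i) \<longrightarrow> \<bar>N (\<Sum>i<n. a i *\<^sub>C z (k i)) - N (v k)\<bar> \<le> \<epsilon>" if \<epsilon>: "0 < \<epsilon>" for \<epsilon>
    proof -
      have "\<forall>\<^sub>F j in sequentially. N (z j - \<zeta> - w j) < \<epsilon> / A" using \<epsilon> A by (intro order_tendstoD(2)[OF lim]) simp
      then obtain J where J: "\<And>j. j \<ge> J \<Longrightarrow> N (z j - \<zeta> - w j) < \<epsilon> / A" by (auto simp: eventually_sequentially)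
      have "\<bar>N (\<Sum>i<n. a i *\<^sub>C z (k i)) - N (v k)\<bar> \<le> \<epsilon>" if k: "\<forall>i<n. J \<le> k i" for k
      proof -
        have "S *\<^sub>C \<zeta> = (\<Sum>i<n. a i *\<^sub>C \<zeta>)" by (simp add: S complex_vector.scale_sum_left)
        then have eq: "(\<Sum>i<n. a i *\<^sub>C z (k i)) - v k = (\<Sum>i<n. a i *\<^sub>C (z (k i) - \<zeta> - w (k i)))"
          by (simp add: v_def complex_vector.scale_right_diff_distrib sum_subtractf sum.distrib algebra_simps)
        have "\<bar>N (\<Sum>i<n. a i *\<^sub>C z (k i)) - N (v k)\<bar> \<le> N ((\<Sum>i<n. a i *\<^sub>C z (k i)) - v k)"
          by (intro N_abs_diff combination_in_Z z vZ)
        also have "\<dots> \<le> (\<Sum>i<n. cmod (a i) * N (z (k i) - \<zeta> - w (k i)))"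
          unfolding eq by (intro N_combination V_diff z \<zeta> w)
        also have "\<dots> \<le> (\<Sum>i<n. cmod (a i) * (\<epsilon> / A))"
          using J k by (intro sum_mono mult_left_mono) (auto intro: less_imp_le)
        also have "\<dots> = (\<Sum>i<n. cmod (a i)) * (\<epsilon> / A)" by (simp only: sum_distrib_right)
        also have "\<dots> \<le> A * (\<epsilon> / A)" using \<epsilon> A by (intro mult_right_mono) (auto simp: A_def)
        finally show ?thesis using A by simp
      qed
      then show ?thesis by blast
    qed
    have "L a \<le> max 1 C * T"
    proof (rule field_le_epsilon)
      fix \<epsilon> :: real assume "0 < \<epsilon>"
      then obtain J where J: "\<And>k. (\<forall>i<n. J \<le> k i) \<Longrightarrow> \<bar>N (\<Sum>i<n. a i *\<^sub>C z (k i)) - N (v k)\<bar> \<le> \<epsilon>" using close by blast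
      show "L a \<le> max 1 C * T + \<epsilon>"
      proof (rule spreading_limit_le[OF L n, of "max J (max \<nu> \<mu>)"])
        fix k :: "nat \<Rightarrow> nat" assume k: "strict_mono_on {..<n} k" "\<And>i. i < n \<Longrightarrow> max J (max \<nu> \<mu>) \<le> k i"
        have "N (v k) \<le> max 1 C * T" by (rule bounds(1)[OF k(1)]) (use k(2) in auto)
        moreover have "\<bar>N (\<Sum>i<n. a i *\<^sub>C z (k i)) - N (v k)\<bar> \<le> \<epsilon>" by (rule J) (use k(2) in auto)
        ultimately show "N (\<Sum>i<n. a i *\<^sub>C z (k i)) \<le> max 1 C * T + \<epsilon>" by linarith
      qed
    qed
    moreover have "(1 / D) * T \<le> L a"
    proof (rule field_le_epsilon)
      fix \<epsilon> :: real assume "0 < \<epsilon>"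
      then obtain J where J: "\<And>k. (\<forall>i<n. J \<le> k i) \<Longrightarrow> \<bar>N (\<Sum>i<n. a i *\<^sub>C z (k i)) - N (v k)\<bar> \<le> \<epsilon>" using close by blast
      have "(1 / D) * T - \<epsilon> \<le> L a"
      proof (rule spreading_limit_ge[OF L n, of "max J (max \<nu> \<mu>)"])
        fix k :: "nat \<Rightarrow> nat" assume k: "strict_mono_on {..<n} k" "\<And>i. i < n \<Longrightarrow> max J (max \<nu> \<mu>) \<le> k i"
        have "(1 / D) * T \<le> N (v k)" by (rule bounds(2)[OF k(1)]) (use k(2) in auto)
        moreover have "\<bar>N (\<Sum>i<n. a i *\<^sub>C z (k i)) - N (v k)\<bar> \<le> \<epsilon>" by (rule J) (use k(2) in auto)
        ultimately show "(1 / D) * T - \<epsilon> \<le> N (\<Sum>i<n. a i *\<^sub>C z (k i))" by linarith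
      qed
      then show "(1 / D) * T \<le> L a + \<epsilon>" by simp
    qed
    ultimately show ?thesis by (simp only: T_def S_def)
  qed
  moreover have "0 < 1 / D" "0 < max 1 C" using D by auto
  ultimately show ?thesis by blast
qed

text \<open>For the value 0 the zero function is available with norm 0, so no correction terms
  appear and the first component carries an isometric copy of \<open>ell2\<close> for the
  quasi-norm.\<close>

lemma Z_left: assumes "h \<in> ell2" shows "(h, 0) \<in> Z" "q (h, 0) = ell2_norm h"
proof -
  have h: "h - 0 \<in> ell2" "ell2_norm (h - 0) = ell2_norm h" using assms by simp_all
  note u = Z_upper[OF der_at_0 h(1)]
  show z: "(h, 0) \<in> Z" by (rule u(1))
  have "ell2_norm (h - 0) \<le> q (h, 0) + C1 * 0" by (rule Z_lower(2)[OF z der_at_0])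
  then show "q (h, 0) = ell2_norm h" using u(2) h(2) by linarith
qed

lemma ell2_blocks:
  assumes m: "strict_mono m" and h: "\<And>j. h j \<in> ell2" "\<And>j. {t. h j t \<noteq> 0} \<subseteq> {m j..<m (Suc j)}"
    and b: "0 < \<delta>" "\<And>j. \<delta> \<le> ell2_norm (h j)" "\<And>j. ell2_norm (h j) \<le> \<beta>"
    and k: "strict_mono_on {..<n} k" "{j. a j \<noteq> 0} \<subseteq> {..<n}"
  shows "c1 * \<delta> * ell2_norm a \<le> N (\<Sum>i<n. a i *\<^sub>C (h (k i), 0))"
    "N (\<Sum>i<n. a i *\<^sub>C (h (k i), 0)) \<le> c2 * \<beta> * ell2_norm a"
proof -
  define H where "H = (\<Sum>i<n. a i *\<^sub>C h (k i))"
  have disj: "h (k i') t = 0" if "i < n" "i' < n" "i \<noteq> i'" "h (k i) t \<noteq> 0" for i i' t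
  proof -
    have "k i \<noteq> k i'" using k(1) that strict_mono_on_imp_inj_on[of "{..<n}" k] by (auto simp: inj_on_def)
    moreover have "t \<in> {m (k i)..<m (Suc (k i))}" using h(2) that(4) by blast
    ultimately have "t \<notin> {m (k i')..<m (Suc (k i'))}" using interval_disjoint[OF m] by blast
    then show ?thesis using h(2)[of "k i'"] by blast
  qed
  note D = disjoint_blocks_norm[OF k(2), of "\<lambda>i. h (k i)", OF h(1) disj]
  have eq: "(\<Sum>i<n. a i *\<^sub>C (h (k i), 0)) = (H, 0)"
    unfolding sum_scaleC_Pair H_def by (simp add: fun_eq_iff)
  have H: "H \<in> ell2" unfolding H_def by (rule D(1))
  note Z = Z_left[OF H]
  have "\<delta> * ell2_norm a \<le> ell2_norm H" unfolding H_def by (rule D(2)) (use b in auto)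
  then have "c1 * (\<delta> * ell2_norm a) \<le> c1 * q (H, 0)" unfolding Z(2) by (rule mult_left_mono[OF _ less_imp_le[OF c12(1)]])
  with N_ge[OF Z(1)] show "c1 * \<delta> * ell2_norm a \<le> N (\<Sum>i<n. a i *\<^sub>C (h (k i), 0))"
    unfolding eq mult.assoc by linarith
  have "0 \<le> \<beta>" using b(1) b(2,3)[of 0] by linarith
  have "ell2_norm H \<le> \<beta> * ell2_norm a" unfolding H_def by (rule D(3)) (use b(3) \<open>0 \<le> \<beta>\<close> in auto)
  then have "c2 * q (H, 0) \<le> c2 * (\<beta> * ell2_norm a)" unfolding Z(2) by (rule mult_left_mono[OF _ less_imp_le[OF c12(2)]])
  with N_le[OF Z(1)] show "N (\<Sum>i<n. a i *\<^sub>C (h (k i), 0)) \<le> c2 * \<beta> * ell2_norm a"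
    unfolding eq mult.assoc by linarith
qed

text \<open>Each first component is the explicit derivative of its block plus a bounded
  \<open>h j\<close>. For a combination \<open>(X, Y)\<close> with explicit derivative
  \<open>D\<close> this gives \<open>X - D = H - lam E\<close>, where \<open>E\<close> has the
  coefficients \<open>kalton_peck a\<close>. Disjointness makes \<open>H\<close>, \<open>E\<close>
  and \<open>Y\<close> comparable with their coefficients, and the nonzero \<open>lam\<close> lets
  \<open>E\<close> be recovered.\<close>

lemma ellM_blocks:
  assumes m: "strict_mono m" and w: "\<And>j. w j \<in> Z" "\<And>j. suppZ (w j) \<subseteq> {m j..<m (Suc j)}" "\<And>j. N (w j) \<le> b"
    and \<delta>: "0 < \<delta>" "\<And>j. \<delta> \<le> ell2_norm (snd (w j))"
  obtains r c C where "strict_mono (r :: nat \<Rightarrow> nat)" "0 < c" "0 < C"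
    "\<And>n. \<exists>\<nu>. \<forall>k a. strict_mono_on {..<n} k \<and> (\<forall>i<n. \<nu> \<le> k i) \<and> {j. a j \<noteq> 0} \<subseteq> {..<n} \<longrightarrow>
        c * ellM_seq_norm a \<le> N (\<Sum>i<n. a i *\<^sub>C w (r (k i))) \<and>
        N (\<Sum>i<n. a i *\<^sub>C w (r (k i))) \<le> C * ellM_seq_norm a"
proof -
  define x where "x j = fst (w j)" for j
  define y where "y j = snd (w j)" for j
  have wxy: "w j = (x j, y j)" for j by (simp add: x_def y_def)
  define \<sigma> where "\<sigma> = b / c1"
  have qw: "q (x j, y j) \<le> \<sigma>" for j
    using order_trans[OF q_le_N[OF w(1)] divide_right_mono[OF w(3)], of j] c12 by (simp add: wxy \<sigma>_def)
  have zw: "(x j, y j) \<in> Z" for j using w(1)[of j] by (simp add: wxy)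
  have y\<sigma>: "ell2_norm (y j) \<le> \<sigma>" for j using q_ge(1)[OF zw] qw order_trans by blast
  have y\<delta>: "\<delta> \<le> ell2_norm (y j)" for j using \<delta>(2) by (simp add: y_def)
  have \<sigma>: "0 < \<sigma>" using \<delta>(1) y\<delta>[of 0] y\<sigma>[of 0] by linarith
  have sx: "{t. x j t \<noteq> 0} \<subseteq> {m j..<m (Suc j)}" and sy: "{t. y j t \<noteq> 0} \<subseteq> {m j..<m (Suc j)}" for j
    using w(2)[of j] by (auto simp: suppZ_def x_def y_def)
  have yc: "y j \<in> c00" for j using sy[of j] by (auto simp: c00_def intro: finite_subset)
  have "\<forall>j. \<exists>f g. factorization e (y j) f g" using factorization_exists[OF unc yc] by blast
  then obtain f g where fac: "\<And>j. factorization e (y j) (f j) (g j)" by metis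
  show thesis
  proof (rule block_upper_estimates[OF unc hyp m sy \<delta>(1) y\<delta> y\<sigma> fac])
    fix \<alpha> r C'
    assume \<alpha>: "\<alpha> \<noteq> 1 / 2" and r: "strict_mono (r :: nat \<Rightarrow> nat)"
      and ue: "\<And>n. \<exists>\<nu>. \<forall>k. strict_mono_on {..<n} k \<and> (\<forall>i<n. \<nu> \<le> k i) \<longrightarrow>
         upper_estimates e \<alpha> C' n (\<lambda>i. f (r (k i))) (\<lambda>i. g (r (k i)))"
    define h where "h j = x j - log_derivation (f j) (g j) (y j)" for j
    define \<beta> where "\<beta> = \<sigma> + C1 * \<sigma>"
    define \<kappa> where "\<kappa> = C1 * \<bar>C'\<bar>"
    define lam where "lam = 2 * (1 - 2 * \<alpha>)"
    have lam: "0 < \<bar>lam\<bar>" using \<alpha> by (simp add: lam_def)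
    have \<beta>: "0 < \<beta>" using \<sigma> C1_pos by (simp add: \<beta>_def add_pos_pos)
    have \<kappa>: "0 \<le> \<kappa>" using C1_pos by (simp add: \<kappa>_def)
    have h: "h j \<in> ell2" "ell2_norm (h j) \<le> \<beta>" for j
    proof -
      note l = Z_lower[OF zw[of j] factorization_der_at[OF fac[of j]]]
      show "h j \<in> ell2" unfolding h_def by (rule l(1))
      have "C1 * ell2_norm (y j) \<le> C1 * \<sigma>" using C1_pos y\<sigma> by (intro mult_left_mono) auto
      then show "ell2_norm (h j) \<le> \<beta>" using l(2) qw[of j] by (simp add: h_def \<beta>_def)
    qed
    have sh: "{t. h j t \<noteq> 0} \<subseteq> {m j..<m (Suc j)}" for j
    proof
      fix t assume "t \<in> {t. h j t \<noteq> 0}"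
      then have "x j t \<noteq> 0 \<or> y j t \<noteq> 0" by (auto simp: h_def log_derivation_def)
      then show "t \<in> {m j..<m (Suc j)}" using sx[of j] sy[of j] by blast
    qed
    \<comment> \<open>\<open>Cu\<close> adds the bounds for \<open>H\<close>, for \<open>lam\<close>
      times \<open>E\<close>, and for exchanging derivatives. In \<open>Cl\<close> the first summand
      recovers the norm of \<open>kalton_peck a\<close> and the second the norm of
      \<open>a\<close>.\<close>
    define Cu where "Cu = \<beta> + \<bar>lam\<bar> * \<sigma> + \<kappa>"
    define Cl where "Cl = (1 + (\<kappa> + \<beta>) / \<delta>) / (\<bar>lam\<bar> * \<delta>) + 1 / \<delta>"
    have Cu: "0 < Cu" using \<beta> \<kappa> lam \<sigma> by (simp add: Cu_def add_pos_nonneg)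
    have Cl: "0 < Cl" using \<beta> \<kappa> lam \<delta>(1) unfolding Cl_def by (intro add_nonneg_pos) auto
    have main: "c1 / Cl * ellM_seq_norm a \<le> N (\<Sum>i<n. a i *\<^sub>C w (r (k i))) \<and>
        N (\<Sum>i<n. a i *\<^sub>C w (r (k i))) \<le> c2 * Cu * ellM_seq_norm a"
      if u: "upper_estimates e \<alpha> C' n (\<lambda>i. f (r (k i))) (\<lambda>i. g (r (k i)))"
        and k: "strict_mono_on {..<n} k" and a: "{j. a j \<noteq> 0} \<subseteq> {..<n}" for n k and a :: omega
    proof (cases "a = 0")
      case True
      have "(\<Sum>i<n. a i *\<^sub>C w (r (k i))) = 0" using True by simp
      moreover have "ellM_seq_norm 0 = 0" by (simp only: ellM_seq_norm_def kalton_peck_0 ell2_0)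
      ultimately show ?thesis using True by simp
    next
      case False
      have a2: "a \<in> ell2" using supp_c00[OF a] c00_ell2 by blast
      \<comment> \<open>This scale makes the squares of \<open>cmod (a i) / s\<close> sum to 1, as
        \<open>upper_estimates\<close> requires, and turns the logarithms into the coordinates of
        \<open>kalton_peck a\<close>.\<close>
      define s where "s = ell2_norm a"
      have s: "0 < s" using False ell2_norm_eq_0[OF a2] ell2_norm_nonneg[OF a2] by (simp add: s_def)
      have sqs: "s\<^sup>2 = (\<Sum>j<n. (cmod (a j))\<^sup>2)" unfolding s_def by (rule ell2_norm_finite[OF a])
      define K where "K = kalton_peck a"
      have Ka: "K i = a i * of_real (ln (cmod (a i) / s))" for i by (simp add: K_def kalton_peck_def s_def)
      have K: "{j. K j \<noteq> 0} \<subseteq> {..<n}" using a by (auto simp: Ka)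
      have ne: "r (k i) \<noteq> r (k i')" if "i < n" "i' < n" "i \<noteq> i'" for i i'
        using k r that strict_mono_on_imp_inj_on[of "{..<n}" k] by (auto simp: inj_on_def strict_mono_eq)
      have disj: "v (r (k i')) t = 0" if v: "\<And>j. {t. v j t \<noteq> 0} \<subseteq> {m j..<m (Suc j)}"
        and i: "i < n" "i' < n" "i \<noteq> i'" "v (r (k i)) t \<noteq> 0" for v :: "nat \<Rightarrow> omega" and i i' t
      proof -
        have "t \<in> {m (r (k i))..<m (Suc (r (k i)))}" using v i(4) by blast
        then have "t \<notin> {m (r (k i'))..<m (Suc (r (k i')))}" by (rule interval_disjoint[OF m ne[OF i(1-3)]])
        then show ?thesis using v[of "r (k i')"] by blast
      qed
      define Y where "Y = (\<Sum>i<n. a i *\<^sub>C y (r (k i)))"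
      define X where "X = (\<Sum>i<n. a i *\<^sub>C x (r (k i)))"
      define H where "H = (\<Sum>i<n. a i *\<^sub>C h (r (k i)))"
      define E where "E = (\<Sum>i<n. K i *\<^sub>C y (r (k i)))"
      have y2: "y j \<in> ell2" for j using Z_D(1)[OF zw] .
      note nY = disjoint_blocks_norm[OF a, of "\<lambda>i. y (r (k i))", OF y2 disj[OF sy]]
      note nH = disjoint_blocks_norm[OF a, of "\<lambda>i. h (r (k i))", OF h(1) disj[OF sh]]
      note nE = disjoint_blocks_norm[OF K, of "\<lambda>i. y (r (k i))", OF y2 disj[OF sy]]
      have H: "H \<in> ell2" "ell2_norm H \<le> \<beta> * s"
      proof -
        show "H \<in> ell2" unfolding H_def by (rule nH(1))
        show "ell2_norm H \<le> \<beta> * s" unfolding H_def s_def by (rule nH(3)) (use \<beta> h(2) in auto)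
      qed
      have E: "E \<in> ell2" "\<delta> * ell2_norm K \<le> ell2_norm E" "ell2_norm E \<le> \<sigma> * ell2_norm K"
      proof -
        show "E \<in> ell2" unfolding E_def by (rule nE(1))
        show "\<delta> * ell2_norm K \<le> ell2_norm E" unfolding E_def by (rule nE(2)) (use \<delta>(1) y\<delta> in auto)
        show "ell2_norm E \<le> \<sigma> * ell2_norm K" unfolding E_def by (rule nE(3)) (use \<sigma> y\<sigma> in auto)
      qed
      have Y: "\<delta> * s \<le> ell2_norm Y" unfolding Y_def s_def by (rule nY(2)) (use \<delta>(1) y\<delta> in auto)
      have sum: "(\<Sum>i<n. a i *\<^sub>C w (r (k i))) = (X, Y)" unfolding wxy sum_scaleC_Pair X_def Y_def ..
      have XY: "(X, Y) \<in> Z" unfolding sum[symmetric] by (intro combination_in_Z w(1))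
      have lat: "lat_ball e C' (\<lambda>j. of_real (\<Sum>i<n. (cmod (a i) / s) powr (2 * \<alpha>) * f (r (k i)) j))"
        and dual: "dual_ball e C' (\<lambda>j. of_real (\<Sum>i<n. (cmod (a i) / s) powr (2 * (1 - \<alpha>)) * g (r (k i)) j))"
      proof -
        have "(\<Sum>i<n. (cmod (a i) / s)\<^sup>2) = (\<Sum>i<n. (cmod (a i))\<^sup>2) / s\<^sup>2"
          by (simp add: power_divide sum_divide_distrib)
        then have "(\<forall>i. 0 \<le> cmod (a i) / s) \<and> (\<Sum>i<n. (cmod (a i) / s)\<^sup>2) \<le> 1"
          using s by (simp add: sqs[symmetric])
        from u[unfolded upper_estimates_def, rule_format, OF this]
        show "lat_ball e C' (\<lambda>j. of_real (\<Sum>i<n. (cmod (a i) / s) powr (2 * \<alpha>) * f (r (k i)) j))"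
          "dual_ball e C' (\<lambda>j. of_real (\<Sum>i<n. (cmod (a i) / s) powr (2 * (1 - \<alpha>)) * g (r (k i)) j))"
          by blast+
      qed
      \<comment> \<open>The derivative of the combined competitor; its function has norm at most
        \<open>s * C'\<close> whatever the number of blocks, which is the gain from the upper
        estimates.\<close>
      define D where "D = (\<Sum>i<n. a i *\<^sub>C log_derivation (f (r (k i))) (g (r (k i))) (y (r (k i)))) +
          of_real lam *\<^sub>C E"
      have d: "der_at e (s * C') Y D"
        using block_combination_der_at[of n "\<lambda>i. y (r (k i))" e "\<lambda>i. f (r (k i))" "\<lambda>i. g (r (k i))" s C' a \<alpha>,
            OF disj[OF sy] fac s lat dual]
        unfolding D_def E_def Y_def Ka lam_def .
      have XD: "X - D = H - of_real lam *\<^sub>C E"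
        by (simp add: X_def D_def H_def h_def complex_vector.scale_right_diff_distrib sum_subtractf)
      have lE: "of_real lam *\<^sub>C E \<in> ell2" "ell2_norm (of_real lam *\<^sub>C E) = \<bar>lam\<bar> * ell2_norm E"
        using ell2_scaleC[OF E(1)] ell2_norm_scaleC[OF E(1), of "of_real lam"] by simp_all
      have XD2: "X - D \<in> ell2" unfolding XD by (rule ell2_diff(1)[OF H(1) lE(1)])
      have C1s: "C1 * (s * C') \<le> \<kappa> * s"
        using s C1_pos by (simp add: \<kappa>_def mult.assoc mult.left_commute)
      have K0: "0 \<le> ell2_norm K" using supp_c00[OF K] c00_ell2 by (intro ell2_norm_nonneg) blast
      have nM: "ellM_seq_norm a = ell2_norm K + s" by (simp add: ellM_seq_norm_def K_def s_def)
      have "q (X, Y) \<le> ell2_norm (X - D) + C1 * (s * C')" by (rule Z_upper(2)[OF d XD2])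
      also have "ell2_norm (X - D) \<le> \<beta> * s + \<bar>lam\<bar> * (\<sigma> * ell2_norm K)"
        unfolding XD using ell2_diff(2)[OF H(1) lE(1)] H(2) lE(2) mult_left_mono[OF E(3), of "\<bar>lam\<bar>"] by linarith
      finally have "q (X, Y) \<le> (\<beta> + \<kappa>) * s + (\<bar>lam\<bar> * \<sigma>) * ell2_norm K" using C1s by (simp add: algebra_simps)
      also have "\<dots> \<le> Cu * s + Cu * ell2_norm K"
        using \<beta> \<kappa> \<sigma> s K0 by (intro add_mono mult_right_mono) (auto simp: Cu_def)
      finally have up: "q (X, Y) \<le> Cu * ellM_seq_norm a" by (simp add: nM algebra_simps)
      have qY: "s \<le> q (X, Y) / \<delta>"
        using Y q_ge(1)[OF XY] \<delta>(1) by (simp add: field_simps)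
      \<comment> \<open>For the lower estimate the Kalton-Peck term is isolated: \<open>H\<close> is
        bounded by a multiple of \<open>s\<close>, which \<open>Y\<close> controls, and
        \<open>X - D\<close> by the quasi-norm up to a multiple of \<open>s\<close>.\<close>
      have "of_real lam *\<^sub>C E = H - (X - D)" by (simp add: XD)
      then have "\<bar>lam\<bar> * ell2_norm E \<le> ell2_norm H + ell2_norm (X - D)"
        using ell2_diff(2)[OF H(1) XD2] lE(2) by simp
      moreover have "ell2_norm (X - D) \<le> q (X, Y) + C1 * (s * C')" by (rule Z_lower(2)[OF XY d])
      moreover have "\<bar>lam\<bar> * (\<delta> * ell2_norm K) \<le> \<bar>lam\<bar> * ell2_norm E" using E(2) by (intro mult_left_mono) auto
      ultimately have "\<bar>lam\<bar> * \<delta> * ell2_norm K \<le> q (X, Y) + (\<kappa> + \<beta>) * s"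
        using H(2) C1s by (simp add: algebra_simps)
      also have "\<dots> \<le> q (X, Y) + (\<kappa> + \<beta>) * (q (X, Y) / \<delta>)"
        using qY \<kappa> \<beta> by (intro add_left_mono mult_left_mono) auto
      also have "\<dots> = (1 + (\<kappa> + \<beta>) / \<delta>) * q (X, Y)" by (simp add: distrib_right)
      finally have "ell2_norm K \<le> (1 + (\<kappa> + \<beta>) / \<delta>) * q (X, Y) / (\<bar>lam\<bar> * \<delta>)"
        using lam \<delta>(1) by (subst pos_le_divide_eq) (auto simp: mult.commute)
      then have "ellM_seq_norm a \<le> Cl * q (X, Y)" using qY by (simp add: nM Cl_def distrib_right)
      then have "c1 / Cl * ellM_seq_norm a \<le> c1 / Cl * (Cl * q (X, Y))"
        using c12 Cl by (intro mult_left_mono) auto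
      also have "\<dots> \<le> N (X, Y)" using Cl N_ge[OF XY] by simp
      finally have 1: "c1 / Cl * ellM_seq_norm a \<le> N (X, Y)" .
      have "N (X, Y) \<le> c2 * (Cu * ellM_seq_norm a)"
        using N_le[OF XY] mult_left_mono[OF up, of c2] c12 by linarith
      with 1 show ?thesis unfolding sum by (simp add: mult.assoc)
    qed
    show thesis
    proof (rule that[OF r])
      show "0 < c1 / Cl" "0 < c2 * Cu" using c12 Cl Cu by auto
      fix n
      obtain \<nu> where "\<And>k. strict_mono_on {..<n} k \<Longrightarrow> (\<forall>i<n. \<nu> \<le> k i) \<Longrightarrow>
         upper_estimates e \<alpha> C' n (\<lambda>i. f (r (k i))) (\<lambda>i. g (r (k i)))" using ue[of n] by blast
      then have "c1 / Cl * ellM_seq_norm a \<le> N (\<Sum>i<n. a i *\<^sub>C w (r (k i))) \<and>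
        N (\<Sum>i<n. a i *\<^sub>C w (r (k i))) \<le> c2 * Cu * ellM_seq_norm a"
        if "strict_mono_on {..<n} k" "\<forall>i<n. \<nu> \<le> k i" "{j. a j \<noteq> 0} \<subseteq> {..<n}" for k and a :: omega
        using that by (intro main)
      then show "\<exists>\<nu>. \<forall>k a. strict_mono_on {..<n} k \<and> (\<forall>i<n. \<nu> \<le> k i) \<and> {j. a j \<noteq> 0} \<subseteq> {..<n} \<longrightarrow>
        c1 / Cl * ellM_seq_norm a \<le> N (\<Sum>i<n. a i *\<^sub>C w (r (k i))) \<and>
        N (\<Sum>i<n. a i *\<^sub>C w (r (k i))) \<le> c2 * Cu * ellM_seq_norm a" by blast
    qed
  qed
qed

text \<open>Restricting a difference of two terms to the support of one recovers that term, so the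
  terms stay apart.\<close>

lemma disjoint_no_convergent_subseq:
  assumes w: "\<And>j. w j \<in> Z" "\<And>j k. j \<noteq> k \<Longrightarrow> suppZ (w j) \<inter> suppZ (w k) = {}" and \<delta>: "0 < \<delta>" "\<And>j. \<delta> \<le> N (w j)"
  shows "\<not> (\<exists>s::nat \<Rightarrow> nat. \<exists>l\<in>Z. strict_mono s \<and> (\<lambda>j. N (w (s j) - l)) \<longlonglongrightarrow> 0)"
proof
  assume "\<exists>s::nat \<Rightarrow> nat. \<exists>l\<in>Z. strict_mono s \<and> (\<lambda>j. N (w (s j) - l)) \<longlonglongrightarrow> 0"
  then obtain s l where s: "strict_mono (s :: nat \<Rightarrow> nat)" and l: "l \<in> Z" "(\<lambda>j. N (w (s j) - l)) \<longlonglongrightarrow> 0" by blast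
  have "0 < \<delta> / P / 2" using \<delta>(1) P_pos by simp
  from order_tendstoD(2)[OF l(2) this] obtain J where J: "\<And>j. j \<ge> J \<Longrightarrow> N (w (s j) - l) < \<delta> / P / 2"
    by (auto simp: eventually_sequentially)
  let ?a = "w (s J)" and ?b = "w (s (Suc J))"
  have "?a - ?b = (?a - l) - (?b - l)" by simp
  then have "N (?a - ?b) \<le> N (?a - l) + N (?b - l)"
    using N_diff_le[OF V_diff[OF w(1) l(1)] V_diff[OF w(1) l(1)], of "s J" "s (Suc J)"] by (simp only:)
  also have "\<dots> < \<delta> / P" using J[of J] J[of "Suc J"] by simp
  finally have 1: "P * N (?a - ?b) < \<delta>" using P_pos by (simp add: field_simps)
  have "s J \<noteq> s (Suc J)" using s by (simp add: strict_mono_eq)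
  then have "restrZ (suppZ ?a) (?a - ?b) = ?a"
    using w(2)[of "s J" "s (Suc J)"] restrZ_supp[of ?a "suppZ ?a"] restrZ_disjoint[of ?b "suppZ ?a"]
    by (simp add: restrZ_diff Int_commute)
  then have "N ?a \<le> P * N (?a - ?b)" using N_restrZ[OF V_diff[OF w(1) w(1)], of "suppZ ?a"] by metis
  then show False using 1 \<delta>(2)[of "s J"] by linarith
qed

lemma generates_spreading_normI:
  assumes "\<And>j. z j \<in> Z" "\<And>j. N (z j) \<le> b"
    "\<not> (\<exists>s::nat \<Rightarrow> nat. \<exists>l\<in>Z. strict_mono s \<and> (\<lambda>j. N (z (s j) - l)) \<longlonglongrightarrow> 0)"
    "strict_mono (r :: nat \<Rightarrow> nat)" "spreading_limit N (\<lambda>j. z (r j)) L"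
  shows "spreading_norm Z N L"
  unfolding spreading_norm_def generates_spreading_norm_def
  by (intro exI[of _ z] conjI exI[of _ b] exI[of _ r] assms(3,4) allI assms(2) assms(5)[unfolded spreading_limit_def])
     (use assms(1) in auto)

lemma completion_from_estimates_ell2:
  assumes L: "spreading_limit N z L" and z: "\<And>j. z j \<in> Z" and \<zeta>: "\<zeta> \<in> Z"
    and w: "\<And>j. w j \<in> Z" "\<And>j. suppZ (w j) \<subseteq> {j..}" and lim: "(\<lambda>j. N (z j - \<zeta> - w j)) \<longlonglongrightarrow> 0"
    and cC: "0 < c" "0 < C"
    and est: "\<And>n. \<exists>\<nu>. \<forall>k a. strict_mono_on {..<n} k \<and> (\<forall>i<n. \<nu> \<le> k i) \<and> {j. a j \<noteq> 0} \<subseteq> {..<n} \<longrightarrow>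
        c * ell2_norm a \<le> N (\<Sum>i<n. a i *\<^sub>C w (k i)) \<and> N (\<Sum>i<n. a i *\<^sub>C w (k i)) \<le> C * ell2_norm a"
  shows "completion_isomorphic_to c00 L ell2 ell2_norm"
proof -
  obtain c' C' where *: "0 < c'" "0 < C'" "\<And>a. a \<in> c00 \<Longrightarrow> c' * (N \<zeta> * cmod (\<Sum>j. a j) + ell2_norm a) \<le> L a"
    "\<And>a. a \<in> c00 \<Longrightarrow> L a \<le> C' * (N \<zeta> * cmod (\<Sum>j. a j) + ell2_norm a)"
    using spreading_estimates[OF L z \<zeta> w lim cC est] by (elim exE conjE) blast
  have zr: "range z \<subseteq> Z" using z by blast
  show ?thesis
    by (rule completion_isomorphic_to_ell2[OF spreading_limit_triangle[OF L zr] spreading_limit_scale[OF L zr]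
          *(1,2) N_nonneg[OF \<zeta>] *(3,4)])
qed

lemma completion_from_estimates_ell_M:
  assumes L: "spreading_limit N z L" and z: "\<And>j. z j \<in> Z" and \<zeta>: "\<zeta> \<in> Z"
    and w: "\<And>j. w j \<in> Z" "\<And>j. suppZ (w j) \<subseteq> {j..}" and lim: "(\<lambda>j. N (z j - \<zeta> - w j)) \<longlonglongrightarrow> 0"
    and cC: "0 < c" "0 < C"
    and est: "\<And>n. \<exists>\<nu>. \<forall>k a. strict_mono_on {..<n} k \<and> (\<forall>i<n. \<nu> \<le> k i) \<and> {j. a j \<noteq> 0} \<subseteq> {..<n} \<longrightarrow>
        c * ellM_seq_norm a \<le> N (\<Sum>i<n. a i *\<^sub>C w (k i)) \<and> N (\<Sum>i<n. a i *\<^sub>C w (k i)) \<le> C * ellM_seq_norm a"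
  shows "completion_isomorphic_to c00 L ell_M ell_M_norm"
proof -
  obtain c' C' where *: "0 < c'" "0 < C'" "\<And>a. a \<in> c00 \<Longrightarrow> c' * (N \<zeta> * cmod (\<Sum>j. a j) + ellM_seq_norm a) \<le> L a"
    "\<And>a. a \<in> c00 \<Longrightarrow> L a \<le> C' * (N \<zeta> * cmod (\<Sum>j. a j) + ellM_seq_norm a)"
    using spreading_estimates[OF L z \<zeta> w lim cC est] by (elim exE conjE) blast
  have zr: "range z \<subseteq> Z" using z by blast
  show ?thesis
    by (rule completion_isomorphic_to_ell_M[OF spreading_limit_triangle[OF L zr] spreading_limit_scale[OF L zr]
          *(1,2) N_nonneg[OF \<zeta>] *(3,4)])
qed

lemma block_subseq:
  assumes "strict_mono m" "strict_mono (s :: nat \<Rightarrow> nat)" "\<And>j. A j \<subseteq> {m j..<m (Suc j)}"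
  shows "strict_mono (\<lambda>j. m (s j))" "A (s j) \<subseteq> {m (s j)..<m (s (Suc j))}" "A (s j) \<subseteq> {j..}"
proof -
  show ms: "strict_mono (\<lambda>j. m (s j))" using strict_mono_o[OF assms(1,2)] by (simp add: o_def)
  have "Suc (s j) \<le> s (Suc j)" using assms(2) by (simp add: strict_mono_def Suc_leI)
  then have "m (Suc (s j)) \<le> m (s (Suc j))" using assms(1) by (simp add: strict_mono_less_eq)
  then show "A (s j) \<subseteq> {m (s j)..<m (s (Suc j))}" using assms(3)[of "s j"] by auto
  show "A (s j) \<subseteq> {j..}" using assms(3)[of "s j"] seq_suble[OF ms, of j] by auto
qed

text \<open>After subtracting a coordinatewise limit the sequence consists of blocks. If the second
  components do not tend to zero in norm the blocks span the Orlicz space, otherwise they may be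
  replaced by disjoint vectors of the form \<open>(h, 0)\<close>.\<close>

lemma spreading_model_dichotomy:
  assumes "spreading_norm Z N L"
  shows "completion_isomorphic_to c00 L ell2 ell2_norm \<or> completion_isomorphic_to c00 L ell_M ell_M_norm"
proof -
  obtain x0 where gen: "generates_spreading_norm Z N x0 L" using assms unfolding spreading_norm_def by (elim exE)
  have x0: "range x0 \<subseteq> Z" using gen unfolding generates_spreading_norm_def by (elim conjE)
  obtain b where b: "\<forall>j. N (x0 j) \<le> b" using gen unfolding generates_spreading_norm_def by (elim conjE exE)
  have noconv: "\<not> (\<exists>s::nat \<Rightarrow> nat. \<exists>l\<in>Z. strict_mono s \<and> (\<lambda>j. N (x0 (s j) - l)) \<longlonglongrightarrow> 0)"
    using gen unfolding generates_spreading_norm_def by (elim conjE)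
  obtain r0 where r0: "strict_mono (r0 :: nat \<Rightarrow> nat)" and L0: "spreading_limit N (\<lambda>j. x0 (r0 j)) L"
    using gen unfolding generates_spreading_norm_def spreading_limit_def by (elim conjE exE)
  show ?thesis
  proof (rule block_decomposition[of "\<lambda>j. x0 (r0 j)" b])
    show "x0 (r0 j) \<in> Z" "N (x0 (r0 j)) \<le> b" for j using x0 b by auto
    fix r1 \<zeta> m w
    assume r1: "strict_mono (r1 :: nat \<Rightarrow> nat)" and \<zeta>: "\<zeta> \<in> Z" and m: "strict_mono (m :: nat \<Rightarrow> nat)"
      and w: "\<And>j. w j \<in> Z" "\<And>j. suppZ (w j) \<subseteq> {m j..<m (Suc j)}"
      and lim: "(\<lambda>j. N (x0 (r0 (r1 j)) - \<zeta> - w j)) \<longlonglongrightarrow> 0"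
    define z where "z j = x0 (r0 (r1 j))" for j
    have z: "z j \<in> Z" for j using x0 by (auto simp: z_def)
    have zb: "N (z j) \<le> b" for j using b by (simp add: z_def)
    have Lz: "spreading_limit N z L" using spreading_limit_subseq[OF L0 r1] by (simp add: z_def[abs_def])
    have limz: "(\<lambda>j. N (z j - \<zeta> - w j)) \<longlonglongrightarrow> 0" using lim by (simp add: z_def)
    obtain bw where bw: "\<And>j. N (w j) \<le> bw"
    proof -
      have "Bseq (\<lambda>j. N (z j - \<zeta> - w j))" using limz by (rule convergent_imp_Bseq[OF convergentI])
      then obtain M where M: "\<And>j. \<bar>N (z j - \<zeta> - w j)\<bar> \<le> M" by (auto simp: Bseq_def)
      have "N (w j) \<le> b + N \<zeta> + M" for j
      proof -
        have "w j = (z j - \<zeta>) - (z j - \<zeta> - w j)" by simp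
        then have "N (w j) \<le> N (z j - \<zeta>) + N (z j - \<zeta> - w j)"
          using N_diff_le[OF V_diff[OF z \<zeta>] V_diff[OF V_diff[OF z \<zeta>] w(1)], of j j j] by simp
        then show ?thesis using N_diff_le[OF z \<zeta>, of j] zb[of j] M[of j] by linarith
      qed
      then show thesis by (rule that)
    qed
    \<comment> \<open>Otherwise some blocks tend to zero and a subsequence of the given sequence
      converges to \<open>\<zeta>\<close>, which is excluded.\<close>
    have pos: "\<exists>\<delta>>0. \<exists>J. \<forall>j\<ge>J. \<delta> \<le> N (w j)"
    proof (rule ccontr)
      assume no: "\<not> ?thesis"
      have "\<exists>j\<ge>J. N (w j) < \<delta>" if "0 < \<delta>" for \<delta> J using no that by (meson not_less)
      then obtain s where s: "strict_mono (s :: nat \<Rightarrow> nat)" "\<And>j. N (w (s j)) < 1 / real (Suc j)"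
        using small_subseq[of "\<lambda>j. N (w j)"] by blast
      have "(\<lambda>j. N (z (s j) - \<zeta>)) \<longlonglongrightarrow> 0"
      proof (rule Lim_null_comparison)
        have "(\<lambda>j. N (z (s j) - \<zeta> - w (s j)) + inverse (real (Suc j))) \<longlonglongrightarrow> 0 + 0"
          using LIMSEQ_subseq_LIMSEQ[OF limz s(1)] by (intro tendsto_add LIMSEQ_inverse_real_of_nat) (simp add: o_def)
        then show "(\<lambda>j. N (z (s j) - \<zeta> - w (s j)) + inverse (real (Suc j))) \<longlonglongrightarrow> 0" by simp
        have "norm (N (z (s j) - \<zeta>)) \<le> N (z (s j) - \<zeta> - w (s j)) + inverse (real (Suc j))" for j
        proof -
          have "z (s j) - \<zeta> = (z (s j) - \<zeta> - w (s j)) + w (s j)" by simp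
          then have "N (z (s j) - \<zeta>) \<le> N (z (s j) - \<zeta> - w (s j)) + N (w (s j))"
            using N_add[OF V_diff[OF V_diff[OF z \<zeta>] w(1)] w(1), of "s j" "s j" "s j"] by simp
          then show ?thesis using s(2)[of j] N_nonneg[OF V_diff[OF z \<zeta>], of "s j"] by (simp add: inverse_eq_divide)
        qed
        then show "\<forall>\<^sub>F j in sequentially. norm (N (z (s j) - \<zeta>)) \<le> N (z (s j) - \<zeta> - w (s j)) + inverse (real (Suc j))"
          by simp
      qed
      moreover have "strict_mono (\<lambda>j. r0 (r1 (s j)))"
        using strict_mono_o[OF r0 strict_mono_o[OF r1 s(1)]] by (simp add: o_def)
      ultimately show False using noconv \<zeta> unfolding z_def by blast
    qed
    then obtain \<delta> J where \<delta>: "0 < \<delta>" "\<And>j. j \<ge> J \<Longrightarrow> \<delta> \<le> N (w j)" by blast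
    have limsub: "(\<lambda>j. N (z (s j) - \<zeta> - w (s j))) \<longlonglongrightarrow> 0" if "strict_mono (s :: nat \<Rightarrow> nat)" for s
      using LIMSEQ_subseq_LIMSEQ[OF limz that] by (simp add: o_def)
    show ?thesis
    proof (cases "\<exists>\<tau>>0. \<exists>J. \<forall>j\<ge>J. \<tau> \<le> ell2_norm (snd (w j))")
      case True
      then obtain \<tau> J' where \<tau>: "0 < \<tau>" "\<And>j. j \<ge> J' \<Longrightarrow> \<tau> \<le> ell2_norm (snd (w j))" by blast
      \<comment> \<open>The lower bound holds only from \<open>J'\<close> on; the earlier blocks are
        dropped by a shift.\<close>
      have sh: "strict_mono ((+) J')" by (simp add: strict_mono_def)
      note bs = block_subseq[where A = "\<lambda>j. suppZ (w j)", OF m sh w(2)]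
      show ?thesis
      proof (rule ellM_blocks[of "\<lambda>j. m (J' + j)" "\<lambda>j. w (J' + j)" bw \<tau>, OF bs(1) w(1) bs(2) bw \<tau>(1)])
        show "\<tau> \<le> ell2_norm (snd (w (J' + j)))" for j by (rule \<tau>(2)) simp
        fix r2 c C
        assume r2: "strict_mono (r2 :: nat \<Rightarrow> nat)" and cC: "0 < c" "0 < C"
          and est: "\<And>n. \<exists>\<nu>. \<forall>k a. strict_mono_on {..<n} k \<and> (\<forall>i<n. \<nu> \<le> k i) \<and> {j. a j \<noteq> 0} \<subseteq> {..<n} \<longrightarrow>
            c * ellM_seq_norm a \<le> N (\<Sum>i<n. a i *\<^sub>C w (J' + r2 (k i))) \<and>
            N (\<Sum>i<n. a i *\<^sub>C w (J' + r2 (k i))) \<le> C * ellM_seq_norm a"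
        have sm: "strict_mono (\<lambda>j. J' + r2 j)" using r2 by (simp add: strict_mono_def)
        note bs' = block_subseq[where A = "\<lambda>j. suppZ (w j)", OF m sm w(2)]
        have "completion_isomorphic_to c00 L ell_M ell_M_norm"
          by (rule completion_from_estimates_ell_M[OF spreading_limit_subseq[OF Lz sm] z \<zeta> w(1) bs'(3) limsub[OF sm] cC est])
        then show ?thesis ..
      qed
    next
      case False
      have "\<exists>j\<ge>J'. ell2_norm (snd (w j)) < \<tau>" if "0 < \<tau>" for \<tau> J' using False that by (meson not_less)
      then obtain s where s: "strict_mono (s :: nat \<Rightarrow> nat)" "\<And>j. ell2_norm (snd (w (s j))) < 1 / real (Suc j)"
        using small_subseq[of "\<lambda>j. ell2_norm (snd (w j))"] by blast
      define x where "x j = fst (w j)" for j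
      define y where "y j = snd (w j)" for j
      have wxy: "w j = (x j, y j)" for j by (simp add: x_def y_def)
      have zw: "(x j, y j) \<in> Z" for j using w(1)[of j] by (simp add: wxy)
      \<comment> \<open>The second component is small, so the block is nearly its corrected first
        component. Restricting \<open>x j - \<Omega> (y j)\<close> to the interval keeps the
        supports disjoint, and the discarded pair consists of \<open>y j\<close> and the restriction
        of \<open>\<Omega> (y j)\<close>, of quasi-norm at most a multiple of the norm of
        \<open>y j\<close>.\<close>
      define h where "h j = restr {m j..<m (Suc j)} (x j - \<Omega> (y j))" for j
      have rx: "restr {m j..<m (Suc j)} (x j) = x j" and ry: "restr {m j..<m (Suc j)} (y j) = y j" for j
        using restrZ_supp[OF w(2), of j] by (auto simp: restrZ_def wxy)
      have h: "h j \<in> ell2" "ell2_norm (h j) \<le> bw / c1" for j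
      proof -
        show "h j \<in> ell2" unfolding h_def by (rule restr_ell2(1)[OF Z_D(2)[OF zw]])
        have "ell2_norm (h j) \<le> q (x j, y j)"
          unfolding h_def by (rule order_trans[OF restr_ell2(2)[OF Z_D(2)[OF zw]] q_ge(2)[OF zw]])
        also have "\<dots> \<le> bw / c1"
          using order_trans[OF q_le_N[OF w(1)] divide_right_mono[OF bw], of j] c12 by (simp add: wxy)
        finally show "ell2_norm (h j) \<le> bw / c1" .
      qed
      have diff: "N (w j - (h j, 0)) \<le> c2 * (C1 * (C0 * ell2_norm (y j)))" "w j - (h j, 0) \<in> Z" for j
      proof -
        have d: "der_at e (C0 * ell2_norm (y j)) (y j) (restr {m j..<m (Suc j)} (\<Omega> (y j)))"
        proof -
          have "der_at e (C0 * ell2_norm (y j)) (restr {m j..<m (Suc j)} (y j)) (restr {m j..<m (Suc j)} (\<Omega> (y j)))"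
            by (intro der_at_restr der Z_D(1)[OF zw])
          then show ?thesis by (simp only: ry)
        qed
        have e1: "x j - h j = restr {m j..<m (Suc j)} (\<Omega> (y j))" unfolding h_def restr_diff rx by simp
        have e2: "w j - (h j, 0) = (x j - h j, y j)" by (simp add: wxy fun_eq_iff)
        have "(x j - h j) - restr {m j..<m (Suc j)} (\<Omega> (y j)) \<in> ell2"
          "ell2_norm ((x j - h j) - restr {m j..<m (Suc j)} (\<Omega> (y j))) = 0"
          unfolding e1 diff_self by (rule ell2_0)+
        note u = Z_upper[OF d this(1)] and this(2)
        then have "q (x j - h j, y j) \<le> C1 * (C0 * ell2_norm (y j))" by simp
        then show "N (w j - (h j, 0)) \<le> c2 * (C1 * (C0 * ell2_norm (y j)))"
          unfolding e2 using N_le[OF u(1)] c12(2) by (intro order_trans[OF N_le[OF u(1)] mult_left_mono]) auto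
        show "w j - (h j, 0) \<in> Z" unfolding e2 by (rule u(1))
      qed
      have small: "(\<lambda>j. N (w (s j) - (h (s j), 0))) \<longlonglongrightarrow> 0"
      proof (rule Lim_null_comparison)
        have "(\<lambda>j. c2 * (C1 * (C0 * inverse (real (Suc j))))) \<longlonglongrightarrow> c2 * (C1 * (C0 * 0))"
          by (intro tendsto_intros LIMSEQ_inverse_real_of_nat)
        then show "(\<lambda>j. c2 * (C1 * (C0 * inverse (real (Suc j))))) \<longlonglongrightarrow> 0" by simp
        have "norm (N (w (s j) - (h (s j), 0))) \<le> c2 * (C1 * (C0 * inverse (real (Suc j))))" for j
        proof -
          have "c2 * (C1 * (C0 * ell2_norm (y (s j)))) \<le> c2 * (C1 * (C0 * inverse (real (Suc j))))"
            using s(2)[of j] c12 C1_pos C0 by (intro mult_left_mono) (auto simp: y_def inverse_eq_divide)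
          then show ?thesis using diff(1)[of "s j"] N_nonneg[OF diff(2)[of "s j"]] by simp
        qed
        then show "\<forall>\<^sub>F j in sequentially. norm (N (w (s j) - (h (s j), 0))) \<le> c2 * (C1 * (C0 * inverse (real (Suc j))))"
          by simp
      qed
      have "0 < \<delta> / 2" using \<delta>(1) by simp
      from order_tendstoD(2)[OF small this] obtain J2 where J2: "\<And>j. j \<ge> J2 \<Longrightarrow> N (w (s j) - (h (s j), 0)) < \<delta> / 2"
        by (auto simp: eventually_sequentially)
      \<comment> \<open>Beyond \<open>J\<close> the blocks are bounded below by
        \<open>\<delta>\<close> and beyond \<open>J2\<close> the replacement error is below
        \<open>\<delta> / 2\<close>, which leaves \<open>h\<close> bounded below.\<close>
      define t where "t j = s (J + J2 + j)" for j
      have t: "strict_mono t" using s(1) by (simp add: t_def strict_mono_def)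
      define v where "v j = (h (t j), 0::omega)" for j
      have v: "v j \<in> Z" for j unfolding v_def by (rule Z_left(1)[OF h(1)])
      have hlow: "\<delta> / (2 * c2) \<le> ell2_norm (h (t j))" for j
      proof -
        have "J \<le> t j" using seq_suble[OF s(1), of "J + J2 + j"] by (simp add: t_def)
        then have "\<delta> \<le> N (w (t j))" by (rule \<delta>(2))
        also have "N (w (t j)) \<le> N (w (t j) - v j) + N (v j)"
          using N_add[OF V_diff[OF w(1) v] v, of "t j" j j] by simp
        also have "N (w (t j) - v j) < \<delta> / 2" unfolding v_def t_def by (rule J2) simp
        finally have "\<delta> / 2 \<le> N (v j)" by simp
        also have "\<dots> \<le> c2 * ell2_norm (h (t j))"
          using N_le[OF v, of j] Z_left(2)[OF h(1)] by (simp add: v_def)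
        finally show ?thesis using c12 by (simp add: field_simps)
      qed
      have sh: "{i. h j i \<noteq> 0} \<subseteq> {m j..<m (Suc j)}" for j by (auto simp: h_def restr_def)
      note bs = block_subseq[where A = "\<lambda>j. {i. h j i \<noteq> 0}", OF m t sh]
      have lim': "(\<lambda>j. N (z (t j) - \<zeta> - v j)) \<longlonglongrightarrow> 0"
      proof (rule Lim_null_comparison)
        have "(\<lambda>j. N (w (t j) - v j)) \<longlonglongrightarrow> 0"
          using LIMSEQ_ignore_initial_segment[OF small, of "J + J2"] by (simp add: t_def v_def add.commute)
        then have "(\<lambda>j. N (z (t j) - \<zeta> - w (t j)) + N (w (t j) - v j)) \<longlonglongrightarrow> 0 + 0"
          by (intro tendsto_add limsub[OF t])
        then show "(\<lambda>j. N (z (t j) - \<zeta> - w (t j)) + N (w (t j) - v j)) \<longlonglongrightarrow> 0" by simp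
        have "norm (N (z (t j) - \<zeta> - v j)) \<le> N (z (t j) - \<zeta> - w (t j)) + N (w (t j) - v j)" for j
        proof -
          have "z (t j) - \<zeta> - v j = (z (t j) - \<zeta> - w (t j)) + (w (t j) - v j)" by simp
          then have "N (z (t j) - \<zeta> - v j) \<le> N (z (t j) - \<zeta> - w (t j)) + N (w (t j) - v j)"
            using N_add[OF V_diff[OF V_diff[OF z \<zeta>] w(1)] V_diff[OF w(1) v], of "t j" "t j" "t j" j] by simp
          moreover have "0 \<le> N (z (t j) - \<zeta> - v j)" by (intro N_nonneg V_diff z \<zeta> v)
          ultimately show ?thesis by simp
        qed
        then show "\<forall>\<^sub>F j in sequentially. norm (N (z (t j) - \<zeta> - v j)) \<le> N (z (t j) - \<zeta> - w (t j)) + N (w (t j) - v j)"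
          by simp
      qed
      have \<delta>2: "0 < \<delta> / (2 * c2)" using \<delta>(1) c12 by simp
      have bpos: "0 < bw / c1" using \<delta>2 hlow[of 0] h(2)[of "t 0"] by linarith
      have "completion_isomorphic_to c00 L ell2 ell2_norm"
      proof (rule completion_from_estimates_ell2[OF spreading_limit_subseq[OF Lz t] z \<zeta> v _ lim'])
        show "suppZ (v j) \<subseteq> {j..}" for j using bs(3)[of j] by (auto simp: suppZ_def v_def)
        show "0 < c1 * (\<delta> / (2 * c2))" by (rule mult_pos_pos[OF c12(1) \<delta>2])
        show "0 < c2 * (bw / c1)" by (rule mult_pos_pos[OF c12(2) bpos])
        fix n
        have "c1 * (\<delta> / (2 * c2)) * ell2_norm a \<le> N (\<Sum>i<n. a i *\<^sub>C v (k i)) \<and>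
            N (\<Sum>i<n. a i *\<^sub>C v (k i)) \<le> c2 * (bw / c1) * ell2_norm a"
          if "strict_mono_on {..<n} k" "{j. a j \<noteq> 0} \<subseteq> {..<n}" for k and a :: omega
          unfolding v_def using ell2_blocks[of "\<lambda>j. m (t j)" "\<lambda>j. h (t j)", OF bs(1) h(1) bs(2) \<delta>2 hlow h(2) that] ..
        then show "\<exists>\<nu>. \<forall>k a. strict_mono_on {..<n} k \<and> (\<forall>i<n. \<nu> \<le> k i) \<and> {j. a j \<noteq> 0} \<subseteq> {..<n} \<longrightarrow>
            c1 * (\<delta> / (2 * c2)) * ell2_norm a \<le> N (\<Sum>i<n. a i *\<^sub>C v (k i)) \<and>
            N (\<Sum>i<n. a i *\<^sub>C v (k i)) \<le> c2 * (bw / c1) * ell2_norm a" by blast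
      qed
      then show ?thesis ..
    qed
  qed
qed

text \<open>The unit vectors of the first component generate it; being disjoint and of quasi-norm 1
  they satisfy the estimates exactly, with limit vector 0.\<close>

lemma ell2_spreading_model: "\<exists>L. spreading_norm Z N L \<and> completion_isomorphic_to c00 L ell2 ell2_norm"
proof -
  define z where "z j = (unit_seq j, 0::omega)" for j
  have u: "unit_seq j \<in> ell2" for j using unit_seq_c00 c00_ell2 by blast
  have z: "z j \<in> Z" and qz: "q (z j) = 1" for j unfolding z_def using Z_left[OF u] by auto
  have zb: "N (z j) \<le> c2" "c1 \<le> N (z j)" for j using N_le[OF z] N_ge[OF z] qz by auto
  have supp: "suppZ (z j) = {j}" for j by (auto simp: suppZ_def z_def unit_seq_def)
  have rz: "range z \<subseteq> Z" using z by blast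
  obtain r L where r: "strict_mono (r :: nat \<Rightarrow> nat)" and L: "spreading_limit N (\<lambda>j. z (r j)) L"
    using brunel_sucheston[OF rz zb(1)] by blast
  have "spreading_norm Z N L"
    by (rule generates_spreading_normI[OF z zb(1) disjoint_no_convergent_subseq[OF z _ c12(1) zb(2)] r L])
       (simp add: supp)
  moreover have "completion_isomorphic_to c00 L ell2 ell2_norm"
  proof (rule completion_from_estimates_ell2[OF L z V_0 z])
    show "suppZ (z (r j)) \<subseteq> {j..}" for j using seq_suble[OF r, of j] by (simp add: supp)
    show "(\<lambda>j. N (z (r j) - 0 - z (r j))) \<longlonglongrightarrow> 0" by simp
    show "0 < c1 * 1" "0 < c2 * 1" using c12 by auto
    fix n
    have idm: "strict_mono (\<lambda>j::nat. j)" by (simp add: strict_mono_def)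
    have sk: "{i. unit_seq j i \<noteq> 0} \<subseteq> {j..<Suc j}" for j by (auto simp: unit_seq_def)
    have "c1 * 1 * ell2_norm a \<le> N (\<Sum>i<n. a i *\<^sub>C z (r (k i))) \<and>
        N (\<Sum>i<n. a i *\<^sub>C z (r (k i))) \<le> c2 * 1 * ell2_norm a"
      if k: "strict_mono_on {..<n} k" "{j. a j \<noteq> 0} \<subseteq> {..<n}" for k and a :: omega
    proof -
      have k': "strict_mono_on {..<n} (\<lambda>i. r (k i))"
        using k(1) r by (auto simp: strict_mono_on_def strict_mono_def)
      show ?thesis unfolding z_def
        using ell2_blocks[of "\<lambda>j. j" unit_seq 1 1, OF idm u sk _ _ _ k' k(2)] by simp
    qed
    then show "\<exists>\<nu>. \<forall>k a. strict_mono_on {..<n} k \<and> (\<forall>i<n. \<nu> \<le> k i) \<and> {j. a j \<noteq> 0} \<subseteq> {..<n} \<longrightarrow>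
        c1 * 1 * ell2_norm a \<le> N (\<Sum>i<n. a i *\<^sub>C z (r (k i))) \<and>
        N (\<Sum>i<n. a i *\<^sub>C z (r (k i))) \<le> c2 * 1 * ell2_norm a" by blast
  qed
  ultimately show ?thesis by blast
qed

lemma ell_M_spreading_model: "\<exists>L. spreading_norm Z N L \<and> completion_isomorphic_to c00 L ell_M ell_M_norm"
proof -
  \<comment> \<open>A unit vector in the second component needs a first component close to its
    derivative. Restricting the derivative to one coordinate keeps it a derivative of
    \<open>unit_seq j\<close> and gives the pairs disjoint supports.\<close>
  define z where "z j = (restr {j} (unit_derivative j), unit_seq j)" for j
  have zq: "z j \<in> Z \<and> q (z j) \<le> C1" for j
  proof -
    have "restr {j} (unit_seq j) = unit_seq j" by (auto simp: restr_def unit_seq_def fun_eq_iff)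
    moreover have "der_at e 1 (restr {j} (unit_seq j)) (restr {j} (unit_derivative j))"
      by (intro der_at_restr unit_derivative)
    ultimately have d: "der_at e 1 (unit_seq j) (restr {j} (unit_derivative j))" by (simp only:)
    have "restr {j} (unit_derivative j) - restr {j} (unit_derivative j) \<in> ell2"
      "ell2_norm (restr {j} (unit_derivative j) - restr {j} (unit_derivative j)) = 0"
      unfolding diff_self by (rule ell2_0)+
    with Z_upper[OF d this(1)] show ?thesis by (simp add: z_def)
  qed
  then have z: "z j \<in> Z" for j by blast
  have zb: "N (z j) \<le> c2 * C1" "c1 \<le> N (z j)" for j
  proof -
    show "N (z j) \<le> c2 * C1" using order_trans[OF N_le[OF z] mult_left_mono] zq c12 by simp
    have "1 \<le> q (z j)" using q_ge(1)[of "fst (z j)" "snd (z j)"] z[of j] by (simp add: z_def)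
    from mult_left_mono[OF this less_imp_le[OF c12(1)]] show "c1 \<le> N (z j)" using N_ge[OF z, of j] by simp
  qed
  have supp: "suppZ (z j) = {j}" for j by (auto simp: suppZ_def z_def unit_seq_def restr_def split: if_splits)
  have rz: "range z \<subseteq> Z" using z by blast
  obtain r L where r: "strict_mono (r :: nat \<Rightarrow> nat)" and L: "spreading_limit N (\<lambda>j. z (r j)) L"
    using brunel_sucheston[OF rz zb(1)] by blast
  have "spreading_norm Z N L"
    by (rule generates_spreading_normI[OF z zb(1) disjoint_no_convergent_subseq[OF z _ c12(1) zb(2)] r L])
       (simp add: supp)
  moreover have "completion_isomorphic_to c00 L ell_M ell_M_norm"
  proof (rule ellM_blocks[of r "\<lambda>j. z (r j)" "c2 * C1" 1, OF r z])
    show "suppZ (z (r j)) \<subseteq> {r j..<r (Suc j)}" for j using r by (simp add: supp strict_mono_def)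
    show "N (z (r j)) \<le> c2 * C1" for j by (rule zb)
    show "(0::real) < 1" by simp
    show "1 \<le> ell2_norm (snd (z (r j)))" for j by (simp add: z_def)
    fix r2 c C
    assume r2: "strict_mono (r2 :: nat \<Rightarrow> nat)" and cC: "0 < c" "0 < C"
      and est: "\<And>n. \<exists>\<nu>. \<forall>k a. strict_mono_on {..<n} k \<and> (\<forall>i<n. \<nu> \<le> k i) \<and> {j. a j \<noteq> 0} \<subseteq> {..<n} \<longrightarrow>
        c * ellM_seq_norm a \<le> N (\<Sum>i<n. a i *\<^sub>C z (r (r2 (k i)))) \<and>
        N (\<Sum>i<n. a i *\<^sub>C z (r (r2 (k i)))) \<le> C * ellM_seq_norm a"
    show ?thesis
    proof (rule completion_from_estimates_ell_M[OF spreading_limit_subseq[OF L r2] z V_0 z _ _ cC est])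
      show "suppZ (z (r (r2 j))) \<subseteq> {j..}" for j
        using order_trans[OF seq_suble[OF r2, of j] seq_suble[OF r, of "r2 j"]] by (simp add: supp)
      show "(\<lambda>j. N (z (r (r2 j)) - 0 - z (r (r2 j)))) \<longlonglongrightarrow> 0" by simp
    qed
  qed
  ultimately show ?thesis by blast
qed

end

theorem corollary6:
  fixes e :: "nat \<Rightarrow> 'a::complex_banach"
    and B :: "omega \<Rightarrow> complex \<Rightarrow> omega"
    and N :: "omega \<times> omega \<Rightarrow> real"
  assumes "unconditional_basis e"
    and "shrinking e"
    and "(\<exists>p. 1 \<le> p \<and> p \<noteq> 2 \<and> asymptotic_lp e p) \<or> block_spreading_models_c0 e"
    and "homogeneous_selection e B"
    and "norm_on (Z_space B) N"
    and "equivalent_on (Z_space B) N (Z_quasinorm B)"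
  shows "(\<forall>L. spreading_norm (Z_space B) N L \<longrightarrow>
            completion_isomorphic_to c00 L ell2 ell2_norm \<or>
            completion_isomorphic_to c00 L ell_M ell_M_norm) \<and>
         (\<exists>L. spreading_norm (Z_space B) N L \<and> completion_isomorphic_to c00 L ell2 ell2_norm) \<and>
         (\<exists>L. spreading_norm (Z_space B) N L \<and> completion_isomorphic_to c00 L ell_M ell_M_norm)"
proof -
  obtain C0 where C0: "0 < C0" "\<And>y. y \<in> ell2 \<Longrightarrow> der_at e (C0 * ell2_norm y) y (selection_derivation B y)"
    using selection_der_at[OF assms(1,4)] by blast
  obtain c1 c2 where c: "0 < c1" "0 < c2"
    "\<And>z. z \<in> Z_space B \<Longrightarrow> c1 * Z_quasinorm B z \<le> N z" "\<And>z. z \<in> Z_space B \<Longrightarrow> N z \<le> c2 * Z_quasinorm B z"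
    using assms(6) unfolding equivalent_on_def by blast
  interpret twisted_hilbert "selection_derivation B" N e C0 c1 c2
    by unfold_locales (use assms C0 c in auto)
  show ?thesis
    using spreading_model_dichotomy ell2_spreading_model ell_M_spreading_model by blast
qed

end
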